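(* Let $s=1$, $\lambda_n>0$, and let $\hat F_n\in\mathcal H^1(I,M)$ be a minimizer of $R_n+\lambda_nJ_1$ over $\mathcal H^1(I,M)$. Suppose that $$d_M\big(\hat F_n(t_i),Y_i\big)<\mathrm{inj}(M)\qquad\text{for all }i=1,\dots,n.$$ Then $\hat F_n$ satisfies, in the sense of distributions on $I$, $$\hat F_n''(t)+A\big(\hat F_n(t)\big)\big(\hat F_n'(t),\hat F_n'(t)\big)=-\frac1{n\lambda_n}\sum_{i=1}^n\delta_{t_i}(t)\,\log_{\hat F_n(t_i)}(Y_i).$$
   Context: $I=[0,1]$. $(M,g)$ is a smooth compact connected Riemannian manifold without boundary, isometrically and smoothly embedded in $\mathbb R^D$, with geodesic distance $d_M$ and injectivity radius $\mathrm{inj}(M)$. $\mathcal H^1(I,M)=\{F\in H^1(I,\mathbb R^D):F(t)\in M\ \forall t\in I\}$, $J_1(F)=\int_0^1|F'(t)|^2dt$. Given observations $(t_i,Y_i)_{i=1}^n$ with $t_i\in I$, $Y_i\in M$, $R_n(F)=n^{-1}\sum_{i=1}^nd_M^2(Y_i,F(t_i))$. $A(y):T_yM\times T_yM\to(T_yM)^\perp$ is the second fundamental form of $M\subset\mathbb R^D$ at $y$, with the sign convention under which the tension field is $\tau(F)=F''+A(F)(F',F')$ and $\tau(F)=0$ exactly when $F$ is a geodesic of $M$ (i.e. geodesics satisfy $\gamma''=-A(\gamma)(\gamma',\gamma')$). For $d_M(y,q)<\mathrm{inj}(M)$, $\log_y(q)\in T_yM\subset\mathbb R^D$ is the initial velocity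 of the unique minimizing unit-time geodesic from $y$ to $q$. $\delta_{t_i}$ is the Dirac mass at $t_i$. *)

theory Defs
  imports "HOL-Analysis.Analysis"
begin

section \<open>Smooth maps and submanifolds of Euclidean space\<close>

text \<open>\<open>Ck_on k U f\<close>: all iterated directional derivatives of order at most \<open>k\<close> exist and are
  continuous on \<open>U\<close>. On open subsets of a Euclidean space this is the usual class \<open>C\<^sup>k\<close>.\<close>

fun Ck_on :: "nat \<Rightarrow> 'a::euclidean_space set \<Rightarrow> ('a \<Rightarrow> 'b::euclidean_space) \<Rightarrow> bool" where
  "Ck_on 0 U f \<longleftrightarrow> continuous_on U f"
| "Ck_on (Suc k) U f \<longleftrightarrow>
     (\<forall>x\<in>U. f differentiable (at x)) \<and>
     (\<forall>v. Ck_on k U (\<lambda>x. frechet_derivative f (at x) v))"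

text \<open>Smoothness on an arbitrary subset: locally the restriction of a \<open>C\<^sup>\<infinity>\<close> map defined on an open
  subset of the ambient space.\<close>

definition smooth_on :: "'a::euclidean_space set \<Rightarrow> ('a \<Rightarrow> 'b::euclidean_space) \<Rightarrow> bool" where
  "smooth_on S f \<longleftrightarrow>
     (\<forall>x\<in>S. \<exists>U g. open U \<and> x \<in> U \<and> (\<forall>k. Ck_on k U g) \<and> (\<forall>y\<in>S \<inter> U. g y = f y))"

definition diffeomorphism_on ::
    "'a::euclidean_space set \<Rightarrow> 'b::euclidean_space set \<Rightarrow> ('a \<Rightarrow> 'b) \<Rightarrow> bool" where
  "diffeomorphism_on S T f \<longleftrightarrow>
     bij_betw f S T \<and> smooth_on S f \<and> smooth_on T (the_inv_into S f)"

text \<open>An \<open>m\<close>-dimensional smooth submanifold without boundary. An \<open>m\<close>-dimensional linear subspace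
  \<open>E\<close> of the ambient space plays the role of \<open>\<real>\<^sup>m\<close>. A submanifold always carries the Riemannian
  metric induced by the inner product of the ambient space.\<close>

definition smooth_submanifold :: "nat \<Rightarrow> 'a::euclidean_space set \<Rightarrow> bool" where
  "smooth_submanifold m M \<longleftrightarrow>
     (\<forall>p\<in>M. \<exists>W (E :: 'a set) V f. p \<in> W \<and> openin (top_of_set M) W \<and>
        subspace E \<and> dim E = m \<and> openin (top_of_set E) V \<and> diffeomorphism_on V W f)"

definition tangent_space :: "'a::euclidean_space set \<Rightarrow> 'a \<Rightarrow> 'a set" where
  "tangent_space M p =
     {v. \<exists>c e. 0 < e \<and> smooth_on {-e<..<e} c \<and> c ` {-e<..<e} \<subseteq> M \<and> c 0 = p \<and>
               (c has_vector_derivative v) (at (0::real))}"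

text \<open>The negative of the normal component of the ambient derivative \<open>D\<^sub>u V\<close>, where \<open>V\<close> is any
  local extension of \<open>v\<close> that is tangent along \<open>M\<close>. The sign is the one for which geodesics
  satisfy \<open>\<gamma>'' = - A(\<gamma>)(\<gamma>', \<gamma>')\<close>; the opposite sign is also common. Only meaningful
  for \<open>u, v \<in> tangent_space M p\<close>.\<close>

definition second_fundamental_form :: "'a::euclidean_space set \<Rightarrow> 'a \<Rightarrow> 'a \<Rightarrow> 'a \<Rightarrow> 'a" where
  "second_fundamental_form M p u v =
     (THE w. \<exists>U V. open U \<and> p \<in> U \<and> smooth_on U V \<and>
        (\<forall>q\<in>M \<inter> U. V q \<in> tangent_space M q) \<and> V p = v \<and>
        w = - closest_point ((tangent_space M p)\<^sup>\<bottom>) (frechet_derivative V (at p) u))"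


section \<open>Geodesics, distance, injectivity radius and logarithm\<close>

definition piecewise_smooth_path :: "(real \<Rightarrow> 'a::euclidean_space) \<Rightarrow> bool" where
  "piecewise_smooth_path c \<longleftrightarrow>
     continuous_on {0..1} c \<and>
     (\<exists>S. finite S \<and>
        (\<forall>a b. 0 \<le> a \<and> a < b \<and> b \<le> 1 \<and> {a<..<b} \<inter> S = {} \<longrightarrow> smooth_on {a..b} c))"

definition curve_length :: "(real \<Rightarrow> 'a::euclidean_space) \<Rightarrow> real" where
  "curve_length c = integral {0..1} (\<lambda>t. norm (vector_derivative c (at t)))"

definition geodesic_dist :: "'a::euclidean_space set \<Rightarrow> 'a \<Rightarrow> 'a \<Rightarrow> real" where
  "geodesic_dist M p q =
     Inf {curve_length c | c.
            piecewise_smooth_path c \<and> c ` {0..1} \<subseteq> M \<and> c 0 = p \<and> c 1 = q}"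

text \<open>The Levi-Civita connection of the induced metric is the tangential part of the ambient
  derivative, so a geodesic is a curve in \<open>M\<close> whose acceleration is normal to \<open>M\<close>.\<close>

definition unit_time_geodesic :: "'a::euclidean_space set \<Rightarrow> (real \<Rightarrow> 'a) \<Rightarrow> bool" where
  "unit_time_geodesic M c \<longleftrightarrow>
     smooth_on {0..1} c \<and> c ` {0..1} \<subseteq> M \<and>
     (\<forall>t\<in>{0..1}.
        vector_derivative (\<lambda>s. vector_derivative c (at s within {0..1})) (at t within {0..1})
          \<in> (tangent_space M (c t))\<^sup>\<bottom>)"

definition initial_velocity :: "(real \<Rightarrow> 'a::euclidean_space) \<Rightarrow> 'a" where
  "initial_velocity c = vector_derivative c (at 0 within {0..1})"

definition exp_map :: "'a::euclidean_space set \<Rightarrow> 'a \<Rightarrow> 'a \<Rightarrow> 'a" where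
  "exp_map M p v =
     (THE q. \<exists>c. unit_time_geodesic M c \<and> c 0 = p \<and> initial_velocity c = v \<and> c 1 = q)"

text \<open>Extended-real valued: the injectivity radius of a one-point manifold is \<open>\<infinity>\<close>.\<close>

definition injectivity_radius :: "'a::euclidean_space set \<Rightarrow> ereal" where
  "injectivity_radius M =
     (INF p\<in>M. SUP r\<in>{r. 0 < r \<and>
        diffeomorphism_on (tangent_space M p \<inter> ball 0 r)
          (exp_map M p ` (tangent_space M p \<inter> ball 0 r)) (exp_map M p)}. ereal r)"

definition log_map :: "'a::euclidean_space set \<Rightarrow> 'a \<Rightarrow> 'a \<Rightarrow> 'a" where
  "log_map M y q =
     (THE v. \<exists>c. unit_time_geodesic M c \<and> c 0 = y \<and> c 1 = q \<and>
        curve_length c = geodesic_dist M y q \<and> initial_velocity c = v)"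


section \<open>Distributions on the unit interval and the Sobolev space\<close>

definition test_functions :: "real set \<Rightarrow> (real \<Rightarrow> real) set" where
  "test_functions U =
     {\<phi>. smooth_on UNIV \<phi> \<and> (\<exists>K. compact K \<and> K \<subseteq> U \<and> (\<forall>x. x \<notin> K \<longrightarrow> \<phi> x = 0))}"

text \<open>A vector-valued distribution is represented by its action on scalar test functions.\<close>

type_synonym 'a distribution = "(real \<Rightarrow> real) \<Rightarrow> 'a"

definition regular_distr :: "(real \<Rightarrow> 'a::euclidean_space) \<Rightarrow> 'a distribution" where
  "regular_distr f \<phi> = (LINT t|lebesgue_on {0..1}. \<phi> t *\<^sub>R f t)"

definition distr_deriv :: "'a::euclidean_space distribution \<Rightarrow> 'a distribution" where
  "distr_deriv T \<phi> = - T (deriv \<phi>)"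

definition dirac :: "real \<Rightarrow> real distribution" where
  "dirac t \<phi> = \<phi> t"

text \<open>As usual, distributions on \<open>I = [0,1]\<close> are tested against functions with compact support in
  the open interval.\<close>

definition distr_eq_on_I ::
    "'a::euclidean_space distribution \<Rightarrow> 'a distribution \<Rightarrow> bool" where
  "distr_eq_on_I S T \<longleftrightarrow> (\<forall>\<phi>\<in>test_functions {0<..<1}. S \<phi> = T \<phi>)"

definition L2_I :: "(real \<Rightarrow> 'a::euclidean_space) set" where
  "L2_I = {f. f \<in> borel_measurable (lebesgue_on {0..1}) \<and>
              integrable (lebesgue_on {0..1}) (\<lambda>t. (norm (f t))\<^sup>2)}"

definition has_weak_deriv :: "(real \<Rightarrow> 'a::euclidean_space) \<Rightarrow> (real \<Rightarrow> 'a) \<Rightarrow> bool" where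
  "has_weak_deriv f g \<longleftrightarrow> g \<in> L2_I \<and> distr_eq_on_I (distr_deriv (regular_distr f)) (regular_distr g)"

text \<open>Unique almost everywhere on \<open>[0,1]\<close>; only used under integrals.\<close>

definition weak_deriv :: "(real \<Rightarrow> 'a::euclidean_space) \<Rightarrow> real \<Rightarrow> 'a" where
  "weak_deriv f = (SOME g. has_weak_deriv f g)"

text \<open>Elements of \<open>H\<^sup>1(I)\<close> are identified with their continuous representatives, so that point values
  make sense; continuity on \<open>[0,1]\<close> includes membership in \<open>L\<^sup>2(I)\<close>.\<close>

definition H1_I :: "(real \<Rightarrow> 'a::euclidean_space) set" where
  "H1_I = {f. continuous_on {0..1} f \<and> (\<exists>g. has_weak_deriv f g)}"

definition H1_maps :: "'a::euclidean_space set \<Rightarrow> (real \<Rightarrow> 'a) set" where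
  "H1_maps M = {f \<in> H1_I. \<forall>t\<in>{0..1}. f t \<in> M}"

definition J1 :: "(real \<Rightarrow> 'a::euclidean_space) \<Rightarrow> real" where
  "J1 f = (LINT t|lebesgue_on {0..1}. (norm (weak_deriv f t))\<^sup>2)"

definition empirical_risk ::
    "'a::euclidean_space set \<Rightarrow> nat \<Rightarrow> (nat \<Rightarrow> real) \<Rightarrow> (nat \<Rightarrow> 'a) \<Rightarrow> (real \<Rightarrow> 'a) \<Rightarrow> real" where
  "empirical_risk M n t Y f = (1 / real n) * (\<Sum>i=1..n. (geodesic_dist M (Y i) (f (t i)))\<^sup>2)"

end

theory Submission
  imports Defs
begin

text \<open>Vary \<open>F\<close> by \<open>F\<^sub>\<epsilon> = r (F + \<epsilon> \<phi> P(F) e)\<close>, where \<open>r\<close> is a smooth local retraction onto \<open>M\<close>,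
  \<open>P(x)\<close> the orthogonal projection onto the tangent space and \<open>e\<close> a fixed vector; since \<open>r\<close> is only
  local, \<open>\<phi>\<close> is first split by a partition of unity of \<open>[0,1]\<close>. The energy of \<open>F\<^sub>\<epsilon>\<close> has an explicit
  first order term. For the data term an upper bound suffices: bending the initial piece of the
  minimizing geodesic from \<open>F(t\<^sub>i)\<close> to \<open>Y\<^sub>i\<close> yields a competitor path starting at \<open>F\<^sub>\<epsilon>(t\<^sub>i)\<close>, whence
  \<open>d(F\<^sub>\<epsilon>(t\<^sub>i), Y\<^sub>i)\<^sup>2 \<le> d(F(t\<^sub>i), Y\<^sub>i)\<^sup>2 - 2 \<epsilon> \<langle>log, \<phi> P e\<rangle> + O(\<epsilon>\<^sup>2)\<close>. Minimality for both signs of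
  \<open>\<epsilon>\<close> forces the coefficient of \<open>\<epsilon>\<close> to vanish, which is the equation tested against \<open>\<phi> e\<close>, because
  \<open>\<langle>F', DP(F)(F') e\<rangle> = - \<langle>A(F)(F',F'), e\<rangle>\<close>.\<close>

text \<open>The obstacle is regularity: \<open>F\<close> is only an H^1 curve, so
  \<open>A(F)(F',F')\<close> is merely integrable and \<open>F'\<close> exists only up to negligible
  sets. A curve is therefore carried together with an integrable density (\<open>ac_on\<close>), and
  identities between derivatives follow from uniqueness of the density. The field
  \<open>\<phi> P(F) e\<close> is taken tangent because differentiating \<open>r(F) = F\<close> and
  \<open>Dr(F)\<psi> = \<psi>\<close> then makes the velocity of the competitor equal to
  \<open>F' + \<epsilon> \<psi>'\<close> up to an error of order \<open>\<epsilon>^2\<close> that is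
  linear in \<open>|F'|\<close> and \<open>|\<psi>'|\<close>, hence square integrable. Two objects
  are definite descriptions and must be identified. \<open>A\<close> becomes minus the derivative of
  the orthogonal projection onto the tangent spaces, which is how it arises from the energy.
  \<open>log_map\<close> becomes the initial velocity of a radial geodesic: this is where the
  injectivity radius enters, and the Gauss lemma shows that radial geodesics of a ball on which the
  exponential map is a diffeomorphism minimize length.\<close>

section \<open>Calculus of C^k maps given by iterated directional derivatives\<close>

lemma Ck_on_cong:
  assumes "open U" "\<And>x. x \<in> U \<Longrightarrow> f x = g x" "Ck_on k U f"
  shows "Ck_on k U g"
  using assms(2,3)
proof (induction k arbitrary: f g)
  case 0
  then show ?case using continuous_on_cong[of U U f g] by simp
next
  case (Suc k)
  have D: "(g has_derivative frechet_derivative f (at x)) (at x)" if "x \<in> U" for x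
    using Suc.prems that assms(1) frechet_derivative_works[of f "at x"]
    by (auto intro: has_derivative_transform_within_open)
  have eq: "frechet_derivative g (at x) = frechet_derivative f (at x)" if "x \<in> U" for x
    using D[OF that] frechet_derivative_at by metis
  have "Ck_on k U (\<lambda>x. frechet_derivative g (at x) v)" for v
    using Suc.IH[of "\<lambda>x. frechet_derivative f (at x) v" "\<lambda>x. frechet_derivative g (at x) v"] eq Suc.prems(2)
    by simp
  then show ?case using D by (auto simp: differentiable_def)
qed

text \<open>The definition refers to the chosen \<open>frechet_derivative\<close>; uniqueness of
  derivatives allows any explicitly computed derivative in its place. The closure properties below
  rest on this rule.\<close>

lemma Ck_on_SucI:
  assumes "open U" "\<And>x. x \<in> U \<Longrightarrow> (f has_derivative f' x) (at x)"
    and "\<And>v. Ck_on k U (\<lambda>x. f' x v)"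
  shows "Ck_on (Suc k) U f"
proof -
  have "frechet_derivative f (at x) = f' x" if "x \<in> U" for x
    using assms(2)[OF that] frechet_derivative_at by metis
  then have "Ck_on k U (\<lambda>x. frechet_derivative f (at x) v)" for v
    using Ck_on_cong[OF assms(1) _ assms(3)[of v]] by simp
  then show ?thesis using assms(2) by (auto simp: differentiable_def)
qed

lemma Ck_on_has_derivative:
  assumes "Ck_on (Suc k) U f" "x \<in> U"
  shows "(f has_derivative frechet_derivative f (at x)) (at x)"
  using assms frechet_derivative_works by auto

lemma Ck_on_continuous:
  "Ck_on k U f \<Longrightarrow> continuous_on U f"
  by (cases k) (auto intro!: continuous_at_imp_continuous_on differentiable_imp_continuous_within)

lemma Ck_on_SucD: "Ck_on (Suc k) U f \<Longrightarrow> Ck_on k U f"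
proof (induction k arbitrary: f)
  case 0
  then show ?case using Ck_on_continuous Ck_on.simps(1) by blast
next
  case (Suc k)
  then show ?case by simp
qed

lemma Ck_on_subset: "Ck_on k U f \<Longrightarrow> V \<subseteq> U \<Longrightarrow> Ck_on k V f"
  by (induction k arbitrary: f) (auto intro: continuous_on_subset)

lemma Ck_on_const [intro]: "Ck_on k U (\<lambda>x. c)"
proof (induction k arbitrary: c)
  case (Suc k)
  show ?case using Suc[of 0] by (simp add: frechet_derivative_const)
qed simp

lemma Ck_on_linear:
  assumes "open U" "bounded_linear f" shows "Ck_on k U f"
proof (cases k)
  case 0 then show ?thesis using assms(2) by (simp add: linear_continuous_on)
next
  case (Suc j)
  show ?thesis unfolding Suc
    by (rule Ck_on_SucI[where f'="\<lambda>_. f"]) (use assms bounded_linear_imp_has_derivative in auto)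
qed

lemma Ck_on_add:
  assumes "open U" "Ck_on k U f" "Ck_on k U g"
  shows "Ck_on k U (\<lambda>x. f x + g x)"
  using assms(2,3)
proof (induction k arbitrary: f g)
  case 0 then show ?case by (simp add: continuous_on_add)
next
  case (Suc k)
  show ?case
    by (rule Ck_on_SucI[OF assms(1) has_derivative_add[OF Ck_on_has_derivative[OF Suc.prems(1)] Ck_on_has_derivative[OF Suc.prems(2)]]])
       (use Suc.prems in \<open>auto intro: Suc.IH\<close>)
qed

lemma Ck_on_sum:
  assumes "open U" "\<And>i. i \<in> I \<Longrightarrow> Ck_on k U (f i)"
  shows "Ck_on k U (\<lambda>x. \<Sum>i\<in>I. f i x)"
  using assms(2)
  by (induction I rule: infinite_finite_induct) (auto intro: Ck_on_add[OF assms(1)])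

lemma Ck_on_bilinear:
  assumes "open U" "bounded_bilinear B" "Ck_on k U f" "Ck_on k U g"
  shows "Ck_on k U (\<lambda>x. B (f x) (g x))"
  using assms(3,4)
proof (induction k arbitrary: f g)
  case 0 then show ?case using bounded_bilinear.continuous_on[OF assms(2)] by auto
next
  case (Suc k)
  have f: "Ck_on k U f" and g: "Ck_on k U g" using Suc.prems Ck_on_SucD by blast+
  show ?case
  proof (rule Ck_on_SucI[OF assms(1)])
    show "((\<lambda>x. B (f x) (g x)) has_derivative
        (\<lambda>h. B (f x) (frechet_derivative g (at x) h) + B (frechet_derivative f (at x) h) (g x))) (at x)"
      if "x \<in> U" for x
      by (rule bounded_bilinear.FDERIV[OF assms(2) Ck_on_has_derivative[OF Suc.prems(1) that] Ck_on_has_derivative[OF Suc.prems(2) that]])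
    show "Ck_on k U (\<lambda>x. B (f x) (frechet_derivative g (at x) v) + B (frechet_derivative f (at x) v) (g x))" for v
      using Suc.prems f g by (intro Ck_on_add[OF assms(1)] Suc.IH) auto
  qed
qed

lemmas Ck_on_scaleR = Ck_on_bilinear[OF _ bounded_bilinear_scaleR]
  and Ck_on_inner = Ck_on_bilinear[OF _ bounded_bilinear_inner]
  and Ck_on_mult = Ck_on_bilinear[OF _ bounded_bilinear_mult]

lemma Ck_on_bounded_linear:
  assumes "open U" "bounded_linear L" "Ck_on k U f"
  shows "Ck_on k U (\<lambda>x. L (f x))"
  using assms(3)
proof (induction k arbitrary: f)
  case 0 then show ?case using bounded_linear.continuous_on[OF assms(2)] by auto
next
  case (Suc k)
  show ?case
    by (rule Ck_on_SucI[OF assms(1) bounded_linear.has_derivative[OF assms(2) Ck_on_has_derivative[OF Suc.prems]]])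
       (use Suc.prems in \<open>auto intro: Suc.IH\<close>)
qed

lemma Ck_on_minus: "open U \<Longrightarrow> Ck_on k U f \<Longrightarrow> Ck_on k U (\<lambda>x. - f x)"
  by (rule Ck_on_bounded_linear[where L=uminus]) (auto intro: bounded_linear_minus[OF bounded_linear_ident])

lemma Ck_on_diff: "open U \<Longrightarrow> Ck_on k U f \<Longrightarrow> Ck_on k U g \<Longrightarrow> Ck_on k U (\<lambda>x. f x - g x)"
  using Ck_on_add[of U k f "\<lambda>x. - g x"] Ck_on_minus by fastforce

lemma linear_basis_expand:
  fixes L :: "'a::euclidean_space \<Rightarrow> 'b::real_vector"
  assumes "linear L" shows "L v = (\<Sum>b\<in>Basis. (v \<bullet> b) *\<^sub>R L b)"
proof -
  have "L v = L (\<Sum>b\<in>Basis. (v \<bullet> b) *\<^sub>R b)" by (simp add: euclidean_representation)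
  also have "\<dots> = (\<Sum>b\<in>Basis. L ((v \<bullet> b) *\<^sub>R b))" by (rule linear_sum[OF assms])
  finally show ?thesis by (simp add: linear_scale[OF assms])
qed

text \<open>By the chain rule the derivative applies \<open>Dg(f x)\<close> to the moving vector
  \<open>Df(x) v\<close>, whereas \<open>Ck_on\<close> speaks of fixed directions. Expanding that
  vector in the basis leaves products of coordinates with \<open>Dg(f x) b\<close> for fixed
  \<open>b\<close>, to which the induction hypothesis applies.\<close>

lemma Ck_on_compose:
  fixes f :: "'a::euclidean_space \<Rightarrow> 'b::euclidean_space" and g :: "'b \<Rightarrow> 'c::euclidean_space"
  assumes "open U" "open V" "f ` U \<subseteq> V" "Ck_on k U f" "Ck_on k V g"
  shows "Ck_on k U (\<lambda>x. g (f x))"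
  using assms(4,5)
proof (induction k arbitrary: g)
  case 0 then show ?case using continuous_on_compose2 assms(3) by (metis Ck_on.simps(1))
next
  case (Suc k)
  have fU: "f x \<in> V" if "x \<in> U" for x using that assms(3) by auto
  have lin: "linear (frechet_derivative g (at y))" if "y \<in> V" for y
    using Suc.prems(2) that linear_frechet_derivative by auto
  show ?case
  proof (rule Ck_on_SucI[OF assms(1)])
    show "((\<lambda>x. g (f x)) has_derivative
       (\<lambda>h. \<Sum>b\<in>Basis. (frechet_derivative f (at x) h \<bullet> b) *\<^sub>R frechet_derivative g (at (f x)) b)) (at x)" if "x \<in> U" for x
    proof -
      have "((\<lambda>x. g (f x)) has_derivative (\<lambda>h. frechet_derivative g (at (f x)) (frechet_derivative f (at x) h))) (at x)"
        using diff_chain_at[OF Ck_on_has_derivative[OF Suc.prems(1) that] Ck_on_has_derivative[OF Suc.prems(2) fU[OF that]]]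
        by (simp add: o_def)
      moreover have "(\<lambda>h. frechet_derivative g (at (f x)) (frechet_derivative f (at x) h)) =
        (\<lambda>h. \<Sum>b\<in>Basis. (frechet_derivative f (at x) h \<bullet> b) *\<^sub>R frechet_derivative g (at (f x)) b)"
        by (rule ext) (rule linear_basis_expand[OF lin[OF fU[OF that]]])
      ultimately show ?thesis by simp
    qed
    show "Ck_on k U (\<lambda>x. \<Sum>b\<in>Basis. (frechet_derivative f (at x) v \<bullet> b) *\<^sub>R frechet_derivative g (at (f x)) b)" for v
    proof (intro Ck_on_sum Ck_on_scaleR Ck_on_inner assms(1))
      show "Ck_on k U (\<lambda>x. frechet_derivative g (at (f x)) b)" for b
        using Suc.IH[OF Ck_on_SucD[OF Suc.prems(1)], of "\<lambda>y. frechet_derivative g (at y) b"] Suc.prems(2) by simp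
    qed (use Suc.prems in auto)
  qed
qed

lemma frechet_derivative_eq: "(f has_derivative f') (at x) \<Longrightarrow> frechet_derivative f (at x) = f'"
  using frechet_derivative_at by metis

lemma injective_linear_bounded_below:
  fixes L :: "'a::euclidean_space \<Rightarrow> 'b::euclidean_space"
  assumes "linear L" "inj L"
  obtains B where "B > 0" "\<And>x. B * norm x \<le> norm (L x)"
  using linear_inj_bounded_below_pos[OF assms] by blast

text \<open>Differentiating \<open>Q(x) w(x) = y(x)\<close> gives \<open>Q(x) Dw(x)v = Dy(x)v - (DQ(x)v) w(x)\<close>, which is again
  an equation of the same type; so the regularity of \<open>w\<close> follows by induction.\<close>

lemma Ck_on_inv_linear:
  fixes Q :: "'a::euclidean_space \<Rightarrow> 'b::euclidean_space \<Rightarrow> 'b" and y w :: "'a \<Rightarrow> 'b"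
  assumes U: "open U" and lin: "\<And>x. x \<in> U \<Longrightarrow> linear (Q x)" and inj: "\<And>x. x \<in> U \<Longrightarrow> inj (Q x)"
    and Q: "\<And>e. Ck_on k U (\<lambda>x. Q x e)" and "Ck_on k U y" and "\<And>x. x \<in> U \<Longrightarrow> Q x (w x) = y x"
  shows "Ck_on k U w"
proof -
  have expand: "Q x v = (\<Sum>b\<in>Basis. (v \<bullet> b) *\<^sub>R Q x b)" if "x \<in> U" for x v
    by (rule linear_basis_expand[OF lin[OF that]])
  \<comment> \<open>Continuity by perturbation: near \<open>x\<close> the operator
    \<open>Q z\<close> is close to \<open>Q x\<close>, which is bounded below.\<close>
  have cont: "continuous_on U w" if Qc: "\<And>e. continuous_on U (\<lambda>x. Q x e)" and y: "continuous_on U y"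
      and w: "\<And>x. x \<in> U \<Longrightarrow> Q x (w x) = y x" for y w
  proof (subst continuous_on_eq_continuous_at[OF U], rule ballI)
    fix x assume x: "x \<in> U"
    obtain B where B: "B > 0" "\<And>v. B * norm v \<le> norm (Q x v)"
      using injective_linear_bounded_below[OF lin[OF x] inj[OF x]] by blast
    define E where "E z = (\<Sum>b\<in>Basis. norm (Q z b - Q x b))" for z
    have E: "(E \<longlongrightarrow> 0) (at x)"
    proof -
      have "((\<lambda>z. norm (Q z b - Q x b)) \<longlongrightarrow> 0) (at x)" for b
        using Qc[of b] U x by (simp add: continuous_on_eq_continuous_at isCont_def tendsto_norm_zero LIM_zero)
      then show ?thesis unfolding E_def by (intro tendsto_null_sum)
    qed
    have yl: "((\<lambda>z. norm (y z - y x)) \<longlongrightarrow> 0) (at x)"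
      using y U x by (simp add: continuous_on_eq_continuous_at isCont_def tendsto_norm_zero LIM_zero)
    have diff: "norm (Q z v - Q x v) \<le> E z * norm v" if "z \<in> U" for z v
    proof -
      have "Q z v - Q x v = (\<Sum>b\<in>Basis. (v \<bullet> b) *\<^sub>R (Q z b - Q x b))"
        using expand[OF that, of v] expand[OF x, of v] by (simp only: sum_subtractf scaleR_diff_right)
      also have "norm \<dots> \<le> (\<Sum>b\<in>Basis. norm v * norm (Q z b - Q x b))"
        by (rule order_trans[OF norm_sum sum_mono]) (simp add: mult_right_mono Basis_le_norm)
      finally show ?thesis by (simp add: E_def sum_distrib_left mult.commute)
    qed
    \<comment> \<open>The last summand is absorbed into the left side as soon as
      \<open>E z < B/2\<close>, which leaves the factor \<open>2/B\<close> below.\<close>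
    have main: "B * norm (w z - w x) \<le> norm (y z - y x) + E z * norm (w x) + E z * norm (w z - w x)" if z: "z \<in> U" for z
    proof -
      have "Q x (w z - w x) = (y z - y x) - (Q z (w x) - Q x (w x)) - (Q z (w z - w x) - Q x (w z - w x))"
        using w[OF z] w[OF x] lin[OF z] lin[OF x] by (simp add: linear_diff)
      then have "norm (Q x (w z - w x)) \<le> norm (y z - y x) + norm (Q z (w x) - Q x (w x)) + norm (Q z (w z - w x) - Q x (w z - w x))"
        by (metis (no_types, lifting) norm_triangle_ineq4 order_trans add_mono_thms_linordered_semiring(3))
      also have "\<dots> \<le> norm (y z - y x) + E z * norm (w x) + E z * norm (w z - w x)"
        using diff[OF z, of "w x"] diff[OF z, of "w z - w x"] by linarith
      finally show ?thesis using B(2)[of "w z - w x"] by linarith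
    qed
    have ev: "eventually (\<lambda>z. norm (w z - w x) \<le> (2/B) * (norm (y z - y x) + E z * norm (w x))) (at x)"
    proof -
      have "eventually (\<lambda>z. E z < B/2) (at x)" by (rule order_tendstoD(2)[OF E]) (use B(1) in simp)
      moreover have "eventually (\<lambda>z. z \<in> U) (at x)" using U x by (auto simp: eventually_at_topological)
      ultimately show ?thesis
      proof eventually_elim
        case (elim z)
        have "E z * norm (w z - w x) \<le> B/2 * norm (w z - w x)" using elim by (intro mult_right_mono) auto
        then have "B/2 * norm (w z - w x) \<le> norm (y z - y x) + E z * norm (w x)" using main[OF elim(2)] by (simp add: field_simps)
        then show ?case using B(1) by (simp add: field_simps)
      qed
    qed
    have "((\<lambda>z. (2/B) * (norm (y z - y x) + E z * norm (w x))) \<longlongrightarrow> (2/B) * (0 + 0 * norm (w x))) (at x)"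
      by (intro tendsto_intros yl E)
    then have "((\<lambda>z. w z - w x) \<longlongrightarrow> 0) (at x)"
      by (intro Lim_null_comparison[OF ev]) simp
    then show "isCont w x" by (simp add: isCont_def LIM_zero_iff)
  qed
  show ?thesis using assms(4-6)
  proof (induction k arbitrary: y w)
    case 0 then show ?case using cont[of y w] by simp
  next
    case (Suc k)
    have Qk: "\<And>e. Ck_on k U (\<lambda>x. Q x e)" and yk: "Ck_on k U y" using Suc.prems Ck_on_SucD by blast+
    have wk: "Ck_on k U w" by (rule Suc.IH[OF Qk yk Suc.prems(3)])
    define dQ where "dQ x v = (\<Sum>b\<in>Basis. (w x \<bullet> b) *\<^sub>R frechet_derivative (\<lambda>x. Q x b) (at x) v)" for x v
    define dy where "dy x v = frechet_derivative y (at x) v - dQ x v" for x v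
    have R: "\<exists>R. bounded_linear R \<and> (\<forall>v. R (Q x v) = v) \<and> (\<forall>v. Q x (R v) = v)" if x: "x \<in> U" for x
    proof -
      obtain R where "linear R" "R \<circ> Q x = id" using linear_injective_left_inverse[OF lin[OF x] inj[OF x]] by blast
      moreover have "surj (Q x)" using linear_inj_imp_surj lin[OF x] inj[OF x] by blast
      ultimately show ?thesis
        by (intro exI[of _ R]) (metis comp_apply id_apply linear_conv_bounded_linear surjD)
    qed
    define R where "R x = (SOME R. bounded_linear R \<and> (\<forall>v. R (Q x v) = v) \<and> (\<forall>v. Q x (R v) = v))" for x
    have R: "bounded_linear (R x)" "R x (Q x v) = v" "Q x (R x v) = v" if x: "x \<in> U" for x v
      using someI_ex[OF R[OF x]] unfolding R_def by blast+
    show ?case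
    proof (rule Ck_on_SucI[OF U])
      fix x assume x: "x \<in> U"
      define G where "G z = y z - (\<Sum>b\<in>Basis. (w x \<bullet> b) *\<^sub>R (Q z b - Q x b))" for z
      have wz: "w z - w x = R x (y z - y x) - R x (\<Sum>b\<in>Basis. (w z \<bullet> b) *\<^sub>R (Q z b - Q x b))" if z: "z \<in> U" for z
      proof -
        have "(\<Sum>b\<in>Basis. (w z \<bullet> b) *\<^sub>R (Q z b - Q x b)) = Q z (w z) - Q x (w z)"
          using expand[OF z, of "w z"] expand[OF x, of "w z"] by (simp only: sum_subtractf scaleR_diff_right)
        then have eq: "Q x (w z - w x) = (y z - y x) - (\<Sum>b\<in>Basis. (w z \<bullet> b) *\<^sub>R (Q z b - Q x b))"
          using Suc.prems(3)[OF z] Suc.prems(3)[OF x] lin[OF x] by (simp add: linear_diff)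
        have "w z - w x = R x (Q x (w z - w x))" by (simp only: R(2)[OF x])
        also have "\<dots> = R x (y z - y x) - R x (\<Sum>b\<in>Basis. (w z \<bullet> b) *\<^sub>R (Q z b - Q x b))"
          unfolding eq by (rule linear_diff[OF bounded_linear.linear[OF R(1)[OF x]]])
        finally show ?thesis .
      qed
      \<comment> \<open>No derivative of \<open>w\<close> is available yet. Since the other factor
        vanishes at \<open>x\<close>, continuity of \<open>w\<close> suffices for this product
        rule.\<close>
      have prod: "((\<lambda>z. (w z \<bullet> b) *\<^sub>R (Q z b - Q x b)) has_derivative (\<lambda>v. (w x \<bullet> b) *\<^sub>R frechet_derivative (\<lambda>x. Q x b) (at x) v)) (at x)" for b
      proof -
        define q where "q = frechet_derivative (\<lambda>x. Q x b) (at x)"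
        have q: "((\<lambda>z. Q z b) has_derivative q) (at x)"
          unfolding q_def by (rule Ck_on_has_derivative[OF Suc.prems(1) x])
        have qb: "bounded_linear q" using q has_derivative_bounded_linear by blast
        have wc: "((\<lambda>z. w z \<bullet> b) \<longlongrightarrow> w x \<bullet> b) (at x)"
          using Ck_on_continuous[OF wk] U x by (auto simp: continuous_on_eq_continuous_at isCont_def intro!: tendsto_intros)
        have 1: "((\<lambda>z. (norm (Q z b - Q x b - q (z - x))) / norm (z - x)) \<longlongrightarrow> 0) (at x)"
          using q unfolding has_derivative_iff_norm by blast
        obtain K where K: "\<And>v. norm (q v) \<le> norm v * K" "K > 0" using bounded_linear.pos_bounded[OF qb] by blast
        have 2: "((\<lambda>z. \<bar>w z \<bullet> b\<bar> * (norm (Q z b - Q x b - q (z - x)) / norm (z - x)) + \<bar>w z \<bullet> b - w x \<bullet> b\<bar> * K) \<longlongrightarrow> \<bar>w x \<bullet> b\<bar> * 0 + \<bar>w x \<bullet> b - w x \<bullet> b\<bar> * K) (at x)"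
          by (intro tendsto_intros wc 1)
        have 3: "norm (norm ((w z \<bullet> b) *\<^sub>R (Q z b - Q x b) - (w x \<bullet> b) *\<^sub>R (Q x b - Q x b) - (w x \<bullet> b) *\<^sub>R q (z - x)) / norm (z - x))
            \<le> \<bar>w z \<bullet> b\<bar> * (norm (Q z b - Q x b - q (z - x)) / norm (z - x)) + \<bar>w z \<bullet> b - w x \<bullet> b\<bar> * K" if "z \<noteq> x" for z
        proof -
          have "norm ((w z \<bullet> b) *\<^sub>R (Q z b - Q x b) - (w x \<bullet> b) *\<^sub>R q (z - x)) = norm ((w z \<bullet> b) *\<^sub>R (Q z b - Q x b - q (z - x)) + (w z \<bullet> b - w x \<bullet> b) *\<^sub>R q (z - x))"
            by (simp add: algebra_simps)
          also have "\<dots> \<le> \<bar>w z \<bullet> b\<bar> * norm (Q z b - Q x b - q (z - x)) + \<bar>w z \<bullet> b - w x \<bullet> b\<bar> * (norm (z - x) * K)"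
            by (rule order_trans[OF norm_triangle_ineq]) (auto intro!: add_mono mult_left_mono K(1))
          finally show ?thesis using that by (simp add: field_simps)
        qed
        have "((\<lambda>z. norm ((w z \<bullet> b) *\<^sub>R (Q z b - Q x b) - (w x \<bullet> b) *\<^sub>R (Q x b - Q x b) - (w x \<bullet> b) *\<^sub>R q (z - x)) / norm (z - x)) \<longlongrightarrow> 0) (at x)"
          by (rule Lim_null_comparison[OF eventually_mono[OF eventually_neq_at_within[of x] 3]]) (use 2 in simp_all)
        then show ?thesis unfolding has_derivative_iff_norm q_def[symmetric]
          using bounded_linear_compose[OF bounded_linear_scaleR_right[of "w x \<bullet> b"] qb] by simp
      qed
      have "((\<lambda>z. w x + (R x (y z - y x) - R x (\<Sum>b\<in>Basis. (w z \<bullet> b) *\<^sub>R (Q z b - Q x b)))) has_derivative (\<lambda>v. R x (dy x v))) (at x)"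
      proof -
        have "((\<lambda>z. w x + (R x (y z - y x) - R x (\<Sum>b\<in>Basis. (w z \<bullet> b) *\<^sub>R (Q z b - Q x b)))) has_derivative
            (\<lambda>v. 0 + (R x (frechet_derivative y (at x) v - 0) - R x (dQ x v)))) (at x)"
          unfolding dQ_def
          by (intro has_derivative_add has_derivative_diff has_derivative_const has_derivative_sum prod
            bounded_linear.has_derivative[OF R(1)[OF x]] Ck_on_has_derivative[OF Suc.prems(2) x])
        moreover have "(\<lambda>v. 0 + (R x (frechet_derivative y (at x) v - 0) - R x (dQ x v))) = (\<lambda>v. R x (dy x v))"
          unfolding dy_def by (simp add: linear_diff[OF bounded_linear.linear[OF R(1)[OF x]]])
        ultimately show ?thesis by simp
      qed
      then show "(w has_derivative (\<lambda>v. R x (dy x v))) (at x)"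
        by (rule has_derivative_transform_within_open[OF _ U x]) (simp add: wz[symmetric])
    next
      fix v
      have "Ck_on k U (\<lambda>x. dy x v)" unfolding dy_def dQ_def
        using Suc.prems(1,2) by (intro Ck_on_diff Ck_on_sum Ck_on_scaleR Ck_on_inner wk U) (auto intro: Ck_on_const)
      then show "Ck_on k U (\<lambda>x. R x (dy x v))"
        by (rule Suc.IH[OF Qk]) (simp add: R)
    qed
  qed
qed

lemma vector_derivative_norm_bound:
  fixes f :: "real \<Rightarrow> 'a::euclidean_space"
  assumes "a \<le> b" "\<And>s. s \<in> {a..b} \<Longrightarrow> (f has_vector_derivative f' s) (at s within {a..b})"
    and "\<And>s. s \<in> {a..b} \<Longrightarrow> norm (f' s) \<le> B"
  shows "norm (f b - f a) \<le> B * (b - a)"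
proof -
  have "norm (f b - f a) \<le> B * norm (b - a)"
  proof (rule differentiable_bound[where S="{a..b}" and f'="\<lambda>s h. h *\<^sub>R f' s"])
    show "(f has_derivative (\<lambda>h. h *\<^sub>R f' s)) (at s within {a..b})" if "s \<in> {a..b}" for s
      using assms(2)[OF that] by (simp add: has_vector_derivative_def)
    show "onorm (\<lambda>h. h *\<^sub>R f' s) \<le> B" if "s \<in> {a..b}" for s
      by (rule onorm_le) (use mult_right_mono[OF assms(3)[OF that] abs_ge_zero] in \<open>simp add: mult.commute\<close>)
  qed (use assms(1) in auto)
  then show ?thesis using assms(1) by simp
qed

lemma has_derivative_along_line:
  assumes "(f has_derivative f') (at (x + s *\<^sub>R v))"
  shows "((\<lambda>s. f (x + s *\<^sub>R v)) has_vector_derivative f' v) (at s within S)"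
proof -
  have "((\<lambda>s. x + s *\<^sub>R v) has_derivative (\<lambda>h. h *\<^sub>R v)) (at s within S)"
    by (auto intro!: derivative_eq_intros)
  from diff_chain_within[OF this has_derivative_at_withinI[OF assms, of "range (\<lambda>s. x + s *\<^sub>R v)", THEN has_derivative_subset]]
  have "((\<lambda>s. f (x + s *\<^sub>R v)) has_derivative (\<lambda>h. f' (h *\<^sub>R v))) (at s within S)"
    by (auto simp: o_def)
  then show ?thesis
    using has_derivative_linear[OF assms] by (simp add: has_vector_derivative_def linear_scale)
qed

section \<open>Symmetry of second derivatives and Taylor estimates\<close>

definition second_difference :: "('a::real_vector \<Rightarrow> 'b::real_vector) \<Rightarrow> 'a \<Rightarrow> 'a \<Rightarrow> 'a \<Rightarrow> 'b" where
  "second_difference f x u v = f (x + u + v) - f (x + u) - f (x + v) + f x"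

lemma second_difference_commute: "second_difference f x u v = second_difference f x v u"
  by (simp add: second_difference_def algebra_simps)

text \<open>Mean value inequality in the direction \<open>u\<close>: the map
  \<open>s \<mapsto> f(x + s u + h v) - f(x + s u)\<close> has derivative close to
  \<open>h L v\<close>, because \<open>y \<mapsto> f' y u\<close> is differentiable at
  \<open>x\<close>. Exchanging \<open>u\<close> and \<open>v\<close> gives a second estimate for the
  same quantity.\<close>

lemma second_difference_estimate:
  fixes f :: "'a::euclidean_space \<Rightarrow> 'b::euclidean_space"
  assumes "open U" "x \<in> U" and f: "\<And>y. y \<in> U \<Longrightarrow> (f has_derivative f' y) (at y)"
    and L: "((\<lambda>y. f' y u) has_derivative L) (at x)" and "e > 0"
  shows "\<forall>\<^sub>F h in at_right 0. norm (second_difference f x (h *\<^sub>R u) (h *\<^sub>R v) - (h * h) *\<^sub>R L v) \<le> e * (h * h)"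
proof -
  \<comment> \<open>\<open>K\<close> makes \<open>norm (s u + t v) \<le> h K\<close> for
    \<open>s\<close> and \<open>t\<close> in \<open>[0,h]\<close>; two errors \<open>e' h K\<close>
    then add up to \<open>e h\<close>.\<close>
  define K where "K = norm u + norm v + 1"
  have K: "K > 0" by (simp add: K_def add_nonneg_pos)
  define e' where "e' = e / (2 * K)"
  have e': "e' > 0" using K \<open>e > 0\<close> by (simp add: e'_def)
  obtain d1 where d1: "d1 > 0" "\<And>y. norm (y - x) < d1 \<Longrightarrow> norm (f' y u - f' x u - L (y - x)) \<le> e' * norm (y - x)"
    using L e' unfolding has_derivative_at_alt by blast
  obtain d2 where d2: "d2 > 0" "ball x d2 \<subseteq> U" using assms(1,2) open_contains_ball by blast
  have linL: "linear L" using has_derivative_linear[OF L] .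
  show ?thesis unfolding eventually_at_right_field
  proof (intro exI[of _ "min d1 d2 / K"] conjI allI impI)
    show "0 < min d1 d2 / K" using d1 d2 K by simp
    fix h :: real assume h: "0 < h" "h < min d1 d2 / K"
    have hK: "h * K < d1" "h * K < d2" using h K by (auto simp: pos_less_divide_eq)
    have nb: "norm (s *\<^sub>R u + t *\<^sub>R v) \<le> h * K" if "s \<in> {0..h}" "t \<in> {0..h}" for s t
    proof -
      have "norm (s *\<^sub>R u + t *\<^sub>R v) \<le> s * norm u + t * norm v"
        using norm_triangle_ineq[of "s *\<^sub>R u" "t *\<^sub>R v"] that by simp
      also have "\<dots> \<le> h * norm u + h * norm v" using that by (intro add_mono mult_right_mono) auto
      also have "\<dots> \<le> h * K" using h(1) by (simp add: K_def algebra_simps)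
      finally show ?thesis .
    qed
    have inU: "x + s *\<^sub>R u + t *\<^sub>R v \<in> U" if "s \<in> {0..h}" "t \<in> {0..h}" for s t
      proof (rule subsetD[OF d2(2)])
      have "norm ((x + s *\<^sub>R u + t *\<^sub>R v) - x) < d2"
        using nb[OF that] hK(2) by (simp add: add.assoc)
      then show "x + s *\<^sub>R u + t *\<^sub>R v \<in> ball x d2" by (metis dist_commute dist_norm mem_ball)
    qed
    have est: "norm (f' (x + s *\<^sub>R u + t *\<^sub>R v) u - f' x u - L (s *\<^sub>R u + t *\<^sub>R v)) \<le> e' * (h * K)"
      if "s \<in> {0..h}" "t \<in> {0..h}" for s t
    proof -
      have "norm (f' (x + s *\<^sub>R u + t *\<^sub>R v) u - f' x u - L (s *\<^sub>R u + t *\<^sub>R v)) \<le> e' * norm (s *\<^sub>R u + t *\<^sub>R v)"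
        using d1(2)[of "x + s *\<^sub>R u + t *\<^sub>R v"] nb[OF that] hK(1) by (simp add: add.assoc)
      also have "\<dots> \<le> e' * (h * K)" using nb[OF that] e' by (intro mult_left_mono) auto
      finally show ?thesis .
    qed
    define \<phi> where "\<phi> s = f (x + s *\<^sub>R u + h *\<^sub>R v) - f (x + s *\<^sub>R u) - (s * h) *\<^sub>R L v" for s
    define \<phi>' where "\<phi>' s = f' (x + s *\<^sub>R u + h *\<^sub>R v) u - f' (x + s *\<^sub>R u) u - h *\<^sub>R L v" for s
    have "norm (\<phi> h - \<phi> 0) \<le> (e * h) * (h - 0)"
    proof (rule vector_derivative_norm_bound)
      show "(\<phi> has_vector_derivative \<phi>' s) (at s within {0..h})" if s: "s \<in> {0..h}" for s
      proof -
        have 1: "((\<lambda>s. f ((x + h *\<^sub>R v) + s *\<^sub>R u)) has_vector_derivative f' ((x + h *\<^sub>R v) + s *\<^sub>R u) u) (at s within {0..h})"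
          using inU[OF s, of h] h by (intro has_derivative_along_line f) (simp add: algebra_simps)
        have 2: "((\<lambda>s. f (x + s *\<^sub>R u)) has_vector_derivative f' (x + s *\<^sub>R u) u) (at s within {0..h})"
          using inU[OF s, of 0] h by (intro has_derivative_along_line f) simp
        have 3: "((\<lambda>s. (s * h) *\<^sub>R L v) has_vector_derivative h *\<^sub>R L v) (at s within {0..h})"
          by (auto intro!: derivative_eq_intros simp: has_vector_derivative_def)
        show ?thesis unfolding \<phi>_def \<phi>'_def
          using has_vector_derivative_diff[OF has_vector_derivative_diff[OF 1 2] 3] by (simp add: algebra_simps)
      qed
      show "norm (\<phi>' s) \<le> e * h" if s: "s \<in> {0..h}" for s
      proof -
        have "\<phi>' s = (f' (x + s *\<^sub>R u + h *\<^sub>R v) u - f' x u - L (s *\<^sub>R u + h *\<^sub>R v))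
            - (f' (x + s *\<^sub>R u + 0 *\<^sub>R v) u - f' x u - L (s *\<^sub>R u + 0 *\<^sub>R v))"
          unfolding \<phi>'_def using linL by (simp add: linear_add linear_scale)
        also have "norm \<dots> \<le> e' * (h * K) + e' * (h * K)"
          by (rule order_trans[OF norm_triangle_ineq4 add_mono[OF est[OF s, of h] est[OF s, of 0]]]) (use h(1) in auto)
        also have "\<dots> = e * h" using K by (simp add: e'_def)
        finally show ?thesis .
      qed
    qed (use h in simp)
    then show "norm (second_difference f x (h *\<^sub>R u) (h *\<^sub>R v) - (h * h) *\<^sub>R L v) \<le> e * (h * h)"
      by (simp add: \<phi>_def second_difference_def algebra_simps)
  qed
qed

text \<open>The second difference is symmetric in \<open>u\<close> and \<open>v\<close> and equals
  both \<open>h^2 Lu v\<close> and \<open>h^2 Lv u\<close> up to \<open>o(h^2)\<close>. With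
  \<open>e\<close> a third of the supposed gap, two errors \<open>e h^2\<close> cannot bridge
  \<open>3 e h^2\<close>.\<close>

lemma symmetric_second_derivative:
  fixes f :: "'a::euclidean_space \<Rightarrow> 'b::euclidean_space"
  assumes "open U" "x \<in> U" and f: "\<And>y. y \<in> U \<Longrightarrow> (f has_derivative f' y) (at y)"
    and Lu: "((\<lambda>y. f' y u) has_derivative Lu) (at x)" and Lv: "((\<lambda>y. f' y v) has_derivative Lv) (at x)"
  shows "Lu v = Lv u"
proof (rule ccontr)
  assume ne: "Lu v \<noteq> Lv u"
  define e where "e = norm (Lu v - Lv u) / 3"
  have e: "e > 0" using ne by (simp add: e_def)
  have ev: "\<forall>\<^sub>F h in at_right 0. norm (second_difference f x (h *\<^sub>R u) (h *\<^sub>R v) - (h * h) *\<^sub>R Lu v) \<le> e * (h * h)"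
    "\<forall>\<^sub>F h in at_right 0. norm (second_difference f x (h *\<^sub>R v) (h *\<^sub>R u) - (h * h) *\<^sub>R Lv u) \<le> e * (h * h)"
    by (rule second_difference_estimate[where f'=f' and U=U]; use assms e in auto)+
  have "\<forall>\<^sub>F h in at_right (0::real). False"
    using ev eventually_at_right_less[of 0]
  proof eventually_elim
    case (elim h)
    have "(h * h) *\<^sub>R Lu v - (h * h) *\<^sub>R Lv u =
      (second_difference f x (h *\<^sub>R v) (h *\<^sub>R u) - (h * h) *\<^sub>R Lv u)
      - (second_difference f x (h *\<^sub>R u) (h *\<^sub>R v) - (h * h) *\<^sub>R Lu v)"
      by (simp add: second_difference_commute[of f x "h *\<^sub>R v"])
    also have "norm \<dots> \<le> e * (h * h) + e * (h * h)"
      by (rule order_trans[OF norm_triangle_ineq4 add_mono[OF elim(2) elim(1)]])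
    finally have "norm ((h * h) *\<^sub>R Lu v - (h * h) *\<^sub>R Lv u) \<le> e * (h * h) + e * (h * h)" .
    moreover have "norm ((h * h) *\<^sub>R Lu v - (h * h) *\<^sub>R Lv u) = (h * h) * (3 * e)"
      by (simp add: e_def flip: scaleR_diff_right)
    moreover have "e * (h * h) > 0" using e elim(3) by simp
    ultimately show False by (simp add: algebra_simps)
  qed
  then show False by simp
qed

lemma Ck_on_second_derivative_commute:
  assumes "open U" "x \<in> U" "Ck_on 2 U f"
  shows "frechet_derivative (\<lambda>y. frechet_derivative f (at y) u) (at x) v
    = frechet_derivative (\<lambda>y. frechet_derivative f (at y) v) (at x) u"
proof -
  have C: "Ck_on (Suc (Suc 0)) U f" using assms(3) by (simp add: numeral_2_eq_2)
  have D: "((\<lambda>y. frechet_derivative f (at y) w) has_derivative frechet_derivative (\<lambda>y. frechet_derivative f (at y) w) (at x)) (at x)" for w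
    by (rule Ck_on_has_derivative[of 0 U]) (use C assms(2) in auto)
  show ?thesis
    by (rule symmetric_second_derivative[OF assms(1,2) Ck_on_has_derivative[OF C] D D])
qed

text \<open>\<open>Ck_on\<close> gives continuity of the derivative for each fixed direction;
  summing the bounds over the basis makes them uniform in \<open>v\<close>.\<close>

lemma Ck_on_derivative_bounded:
  fixes f :: "'a::euclidean_space \<Rightarrow> 'b::euclidean_space"
  assumes "Ck_on (Suc k) U f" "compact K" "K \<subseteq> U"
  obtains C where "C \<ge> 0" "\<And>x v. x \<in> K \<Longrightarrow> norm (frechet_derivative f (at x) v) \<le> C * norm v"
proof -
  have "\<forall>b. \<exists>C\<ge>0. \<forall>x\<in>K. norm (frechet_derivative f (at x) b) \<le> C"
  proof
    fix b
    have "continuous_on K (\<lambda>x. frechet_derivative f (at x) b)"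
      using assms(1,3) by (intro continuous_on_subset[OF Ck_on_continuous[of k U]]) auto
    then have "bounded ((\<lambda>x. frechet_derivative f (at x) b) ` K)"
      using assms(2) compact_continuous_image compact_imp_bounded by blast
    then show "\<exists>C\<ge>0. \<forall>x\<in>K. norm (frechet_derivative f (at x) b) \<le> C"
      unfolding bounded_pos by (auto intro: less_imp_le)
  qed
  then obtain C where C: "\<And>b. C b \<ge> 0" "\<And>b x. x \<in> K \<Longrightarrow> norm (frechet_derivative f (at x) b) \<le> C b" by metis
  show ?thesis
  proof (rule that[of "\<Sum>b\<in>Basis. C b"])
    show "0 \<le> (\<Sum>b\<in>Basis. C b)" by (intro sum_nonneg C)
    fix x v assume x: "x \<in> K"
    have "linear (frechet_derivative f (at x))" using assms x linear_frechet_derivative by auto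
    then have "norm (frechet_derivative f (at x) v) = norm (\<Sum>b\<in>Basis. (v \<bullet> b) *\<^sub>R frechet_derivative f (at x) b)"
      by (subst linear_basis_expand) auto
    also have "\<dots> \<le> (\<Sum>b\<in>Basis. norm v * C b)"
      by (rule order_trans[OF norm_sum sum_mono]) (use x in \<open>auto intro!: mult_mono C simp: Basis_le_norm\<close>)
    finally show "norm (frechet_derivative f (at x) v) \<le> (\<Sum>b\<in>Basis. C b) * norm v"
      by (simp add: sum_distrib_left mult.commute)
  qed
qed

text \<open>The hypothesis concerns the segment instead of convexity of \<open>K\<close>, because
  \<open>K\<close> will later be a closed tube around the image of a curve.\<close>

lemma Ck_on_lipschitz_segment:
  fixes f :: "'a::euclidean_space \<Rightarrow> 'b::euclidean_space"
  assumes "Ck_on (Suc k) U f" "compact K" "K \<subseteq> U"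
  obtains C where "C \<ge> 0" "\<And>x y. (\<And>s. s \<in> {0..1} \<Longrightarrow> x + s *\<^sub>R y \<in> K) \<Longrightarrow> norm (f (x + y) - f x) \<le> C * norm y"
proof -
  obtain C where C: "C \<ge> 0" "\<And>x v. x \<in> K \<Longrightarrow> norm (frechet_derivative f (at x) v) \<le> C * norm v"
    using Ck_on_derivative_bounded[OF assms] by blast
  show ?thesis
  proof (rule that[OF C(1)])
    fix x y assume seg: "\<And>s. s \<in> {0..1} \<Longrightarrow> x + s *\<^sub>R y \<in> K"
    have "norm (f (x + 1 *\<^sub>R y) - f (x + 0 *\<^sub>R y)) \<le> (C * norm y) * (1 - 0)"
    proof (rule vector_derivative_norm_bound[where f'="\<lambda>s. frechet_derivative f (at (x + s *\<^sub>R y)) y"])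
      show "((\<lambda>a. f (x + a *\<^sub>R y)) has_vector_derivative frechet_derivative f (at (x + s *\<^sub>R y)) y) (at s within {0..1})"
        if "s \<in> {0..1}" for s
        using seg[OF that] assms(3) by (intro has_derivative_along_line Ck_on_has_derivative[OF assms(1)]) auto
    qed (use C(2) seg in auto)
    then show "norm (f (x + y) - f x) \<le> C * norm y" by simp
  qed
qed

lemma Ck_on_derivative_lipschitz_segment:
  fixes f :: "'a::euclidean_space \<Rightarrow> 'b::euclidean_space"
  assumes "Ck_on (Suc (Suc k)) U f" "compact K" "K \<subseteq> U"
  obtains C where "C \<ge> 0" "\<And>x y v. (\<And>s. s \<in> {0..1} \<Longrightarrow> x + s *\<^sub>R y \<in> K) \<Longrightarrow>
    norm (frechet_derivative f (at (x + y)) v - frechet_derivative f (at x) v) \<le> C * norm v * norm y"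
proof -
  have "\<exists>C\<ge>0. \<forall>x y. (\<forall>s\<in>{0..1}. x + s *\<^sub>R y \<in> K) \<longrightarrow>
    norm (frechet_derivative f (at (x + y)) b - frechet_derivative f (at x) b) \<le> C * norm y" for b
    by (rule Ck_on_lipschitz_segment[of k U "\<lambda>x. frechet_derivative f (at x) b" K])
       (use assms in \<open>auto simp del: Ck_on.simps(2) simp: Ck_on.simps(2)[of "Suc k"]\<close>)
  then obtain C where C: "\<And>b. C b \<ge> 0" "\<And>b x y. (\<And>s. s\<in>{0..1} \<Longrightarrow> x + s *\<^sub>R y \<in> K) \<Longrightarrow>
    norm (frechet_derivative f (at (x + y)) b - frechet_derivative f (at x) b) \<le> C b * norm y" by metis
  show ?thesis
  proof (rule that[of "\<Sum>b\<in>Basis. C b"])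
    show "0 \<le> (\<Sum>b\<in>Basis. C b)" by (intro sum_nonneg C)
    fix x y v assume seg: "\<And>s. s \<in> {0..1} \<Longrightarrow> x + s *\<^sub>R y \<in> K"
    have "x \<in> K" "x + y \<in> K" using seg[of 0] seg[of 1] by auto
    then have lin: "linear (frechet_derivative f (at x))" "linear (frechet_derivative f (at (x + y)))"
      using assms linear_frechet_derivative by auto
    have "frechet_derivative f (at (x + y)) v - frechet_derivative f (at x) v =
      (\<Sum>b\<in>Basis. (v \<bullet> b) *\<^sub>R (frechet_derivative f (at (x + y)) b - frechet_derivative f (at x) b))"
      using linear_basis_expand[OF lin(1), of v] linear_basis_expand[OF lin(2), of v] by (simp only: sum_subtractf scaleR_diff_right)
    also have "norm \<dots> \<le> (\<Sum>b\<in>Basis. norm v * (C b * norm y))"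
      by (rule order_trans[OF norm_sum sum_mono]) (use seg in \<open>auto intro!: mult_mono C simp: Basis_le_norm\<close>)
    finally show "norm (frechet_derivative f (at (x + y)) v - frechet_derivative f (at x) v) \<le> (\<Sum>b\<in>Basis. C b) * norm v * norm y"
      by (simp only: sum_distrib_left sum_distrib_right mult_ac)
  qed
qed

lemma Ck_on_taylor_segment:
  fixes f :: "'a::euclidean_space \<Rightarrow> 'b::euclidean_space"
  assumes "Ck_on (Suc (Suc k)) U f" "compact K" "K \<subseteq> U"
  obtains C where "C \<ge> 0" "\<And>x y. (\<And>s. s \<in> {0..1} \<Longrightarrow> x + s *\<^sub>R y \<in> K) \<Longrightarrow>
    norm (f (x + y) - f x - frechet_derivative f (at x) y) \<le> C * (norm y * norm y)"
proof -
  obtain C where C: "C \<ge> 0" "\<And>x y v. (\<And>s. s \<in> {0..1} \<Longrightarrow> x + s *\<^sub>R y \<in> K) \<Longrightarrow>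
    norm (frechet_derivative f (at (x + y)) v - frechet_derivative f (at x) v) \<le> C * norm v * norm y"
    using Ck_on_derivative_lipschitz_segment[OF assms] by blast
  show ?thesis
  proof (rule that[OF C(1)])
    fix x y assume seg: "\<And>s. s \<in> {0..1} \<Longrightarrow> x + s *\<^sub>R y \<in> K"
    define g where "g s = f (x + s *\<^sub>R y) - s *\<^sub>R frechet_derivative f (at x) y" for s
    have "norm (g 1 - g 0) \<le> (C * norm y * norm y) * (1 - 0)"
    proof (rule vector_derivative_norm_bound[where f'="\<lambda>s. frechet_derivative f (at (x + s *\<^sub>R y)) y - frechet_derivative f (at x) y"])
      fix s :: real assume s: "s \<in> {0..1}"
      have "((\<lambda>a. f (x + a *\<^sub>R y)) has_vector_derivative frechet_derivative f (at (x + s *\<^sub>R y)) y) (at s within {0..1})"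
        using seg[OF s] assms(3) by (intro has_derivative_along_line Ck_on_has_derivative[OF assms(1)]) auto
      moreover have "((\<lambda>a. a *\<^sub>R frechet_derivative f (at x) y) has_vector_derivative frechet_derivative f (at x) y) (at s within {0..1})"
        by (auto intro!: derivative_eq_intros simp: has_vector_derivative_def)
      ultimately show "(g has_vector_derivative (frechet_derivative f (at (x + s *\<^sub>R y)) y - frechet_derivative f (at x) y)) (at s within {0..1})"
        unfolding g_def by (rule has_vector_derivative_diff)
      have "norm (frechet_derivative f (at (x + s *\<^sub>R y)) y - frechet_derivative f (at x) y) \<le> C * norm y * norm (s *\<^sub>R y)"
      proof (rule C(2))
        fix r :: real assume "r \<in> {0..1}"
        then have "r * s \<in> {0..1}" using s by (auto intro: mult_le_one)
        from seg[OF this] show "x + r *\<^sub>R s *\<^sub>R y \<in> K" by simp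
      qed
      also have "\<dots> \<le> C * norm y * norm y" using s C(1) by (intro mult_left_mono) (auto simp: mult_left_le_one_le)
      finally show "norm (frechet_derivative f (at (x + s *\<^sub>R y)) y - frechet_derivative f (at x) y) \<le> C * norm y * norm y" .
    qed simp
    then show "norm (f (x + y) - f x - frechet_derivative f (at x) y) \<le> C * (norm y * norm y)"
      by (simp add: g_def algebra_simps)
  qed
qed

lemma second_derivative_basis_expand:
  fixes f :: "'a::euclidean_space \<Rightarrow> 'b::euclidean_space"
  assumes "open U" "x \<in> U" "Ck_on (Suc (Suc k)) U f"
  shows "frechet_derivative (\<lambda>z. frechet_derivative f (at z) v) (at x) y =
    (\<Sum>b\<in>Basis. (v \<bullet> b) *\<^sub>R frechet_derivative (\<lambda>z. frechet_derivative f (at z) b) (at x) y)"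
proof -
  have D: "((\<lambda>z. frechet_derivative f (at z) b) has_derivative frechet_derivative (\<lambda>z. frechet_derivative f (at z) b) (at x)) (at x)" for b
    by (rule Ck_on_has_derivative[of k U]) (use assms in auto)
  have lin: "linear (frechet_derivative f (at z))" if "z \<in> U" for z
    using assms(3) that linear_frechet_derivative by auto
  have "((\<lambda>z. \<Sum>b\<in>Basis. (v \<bullet> b) *\<^sub>R frechet_derivative f (at z) b) has_derivative
     (\<lambda>y. \<Sum>b\<in>Basis. (v \<bullet> b) *\<^sub>R frechet_derivative (\<lambda>z. frechet_derivative f (at z) b) (at x) y)) (at x)"
    by (intro has_derivative_sum has_derivative_scaleR_right D)
  then have "((\<lambda>z. frechet_derivative f (at z) v) has_derivative
     (\<lambda>y. \<Sum>b\<in>Basis. (v \<bullet> b) *\<^sub>R frechet_derivative (\<lambda>z. frechet_derivative f (at z) b) (at x) y)) (at x)"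
    by (rule has_derivative_transform_within_open[OF _ assms(1,2)]) (rule linear_basis_expand[OF lin, symmetric])
  then show ?thesis by (simp add: frechet_derivative_eq)
qed

text \<open>The error is linear in \<open>v\<close> and quadratic in \<open>y\<close> on purpose:
  \<open>v\<close> will be the velocity of an H^1 curve, possibly unbounded, and \<open>y\<close> a
  uniformly small displacement. Expanding \<open>v\<close> in the basis produces the
  linearity.\<close>

lemma Ck_on_derivative_taylor_segment:
  fixes f :: "'a::euclidean_space \<Rightarrow> 'b::euclidean_space"
  assumes "open U" "Ck_on (Suc (Suc (Suc k))) U f" "compact K" "K \<subseteq> U"
  obtains C where "C \<ge> 0" "\<And>x y v. (\<And>s. s \<in> {0..1} \<Longrightarrow> x + s *\<^sub>R y \<in> K) \<Longrightarrow>
    norm (frechet_derivative f (at (x + y)) v - frechet_derivative f (at x) v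
       - frechet_derivative (\<lambda>z. frechet_derivative f (at z) v) (at x) y) \<le> C * norm v * (norm y * norm y)"
proof -
  let ?D = "frechet_derivative f"
  have "\<exists>C\<ge>0. \<forall>x y. (\<forall>s\<in>{0..1}. x + s *\<^sub>R y \<in> K) \<longrightarrow>
    norm (?D (at (x + y)) b - ?D (at x) b - frechet_derivative (\<lambda>z. ?D (at z) b) (at x) y) \<le> C * (norm y * norm y)" for b
    by (rule Ck_on_taylor_segment[of k U "\<lambda>x. ?D (at x) b" K])
       (use assms in \<open>auto simp del: Ck_on.simps(2) simp: Ck_on.simps(2)[of "Suc (Suc k)"]\<close>)
  then obtain C where C: "\<And>b. C b \<ge> 0" "\<And>b x y. (\<And>s. s\<in>{0..1} \<Longrightarrow> x + s *\<^sub>R y \<in> K) \<Longrightarrow>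
    norm (?D (at (x + y)) b - ?D (at x) b - frechet_derivative (\<lambda>z. ?D (at z) b) (at x) y) \<le> C b * (norm y * norm y)" by metis
  show ?thesis
  proof (rule that[of "\<Sum>b\<in>Basis. C b"])
    show "0 \<le> (\<Sum>b\<in>Basis. C b)" by (intro sum_nonneg C)
    fix x y v assume seg: "\<And>s. s \<in> {0..1} \<Longrightarrow> x + s *\<^sub>R y \<in> K"
    have xU: "x \<in> U" "x + y \<in> U" using seg[of 0] seg[of 1] assms(4) by auto
    then have lin: "linear (?D (at x))" "linear (?D (at (x + y)))"
      using has_derivative_linear[OF Ck_on_has_derivative[OF assms(2)]] by blast+
    have "?D (at (x + y)) v - ?D (at x) v - frechet_derivative (\<lambda>z. ?D (at z) v) (at x) y =
      (\<Sum>b\<in>Basis. (v \<bullet> b) *\<^sub>R (?D (at (x + y)) b - ?D (at x) b - frechet_derivative (\<lambda>z. ?D (at z) b) (at x) y))"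
      using linear_basis_expand[OF lin(1), of v] linear_basis_expand[OF lin(2), of v]
        second_derivative_basis_expand[OF assms(1) xU(1) assms(2), of v y] by (simp only: sum_subtractf scaleR_diff_right)
    also have "norm \<dots> \<le> (\<Sum>b\<in>Basis. norm v * (C b * (norm y * norm y)))"
      by (rule order_trans[OF norm_sum sum_mono]) (use seg in \<open>auto intro!: mult_mono C simp: Basis_le_norm\<close>)
    finally show "norm (?D (at (x + y)) v - ?D (at x) v - frechet_derivative (\<lambda>z. ?D (at z) v) (at x) y) \<le> (\<Sum>b\<in>Basis. C b) * norm v * (norm y * norm y)"
      by (simp only: sum_distrib_left sum_distrib_right mult_ac)
  qed
qed

section \<open>Smooth maps on arbitrary sets\<close>

lemma Ck_on_local:
  assumes "\<And>x. x \<in> U \<Longrightarrow> \<exists>V. open V \<and> x \<in> V \<and> Ck_on k V f"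
  shows "Ck_on k U f"
  using assms
proof (induction k arbitrary: f)
  case 0
  show ?case unfolding Ck_on.simps
  proof (intro continuous_at_imp_continuous_on ballI)
    fix x assume "x \<in> U"
    then obtain V where "open V" "x \<in> V" "continuous_on V f" using 0 by auto
    then show "isCont f x" by (simp add: continuous_on_eq_continuous_at)
  qed
next
  case (Suc k)
  have C: "\<exists>V. open V \<and> x \<in> V \<and> Ck_on (Suc k) V f" if "x \<in> U" for x by (rule Suc.prems[OF that])
  have "f differentiable (at x)" if x: "x \<in> U" for x
  proof -
    obtain V where "x \<in> V" "Ck_on (Suc k) V f" using C[OF x] by blast
    then show ?thesis by simp
  qed
  moreover have "Ck_on k U (\<lambda>x. frechet_derivative f (at x) v)" for v
  proof (rule Suc.IH)
    fix x assume "x \<in> U"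
    then obtain V where "open V" "x \<in> V" "Ck_on (Suc k) V f" using C by blast
    then show "\<exists>V. open V \<and> x \<in> V \<and> Ck_on k V (\<lambda>x. frechet_derivative f (at x) v)"
      by (intro exI[of _ V]) simp
  qed
  ultimately show ?case by simp
qed

lemma smooth_onI:
  "open U \<Longrightarrow> (\<And>k. Ck_on k U f) \<Longrightarrow> smooth_on U f"
  unfolding smooth_on_def by blast

lemma smooth_onE:
  assumes "smooth_on S f" "x \<in> S"
  obtains U g where "open U" "x \<in> U" "\<And>k. Ck_on k U g" "\<And>y. y \<in> S \<Longrightarrow> y \<in> U \<Longrightarrow> g y = f y"
proof -
  have "\<exists>U g. open U \<and> x \<in> U \<and> (\<forall>k. Ck_on k U g) \<and> (\<forall>y\<in>S \<inter> U. g y = f y)"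
    using assms unfolding smooth_on_def by (rule bspec)
  then obtain U g where *: "open U" "x \<in> U" "\<forall>k. Ck_on k U g" "\<forall>y\<in>S \<inter> U. g y = f y"
    by (elim exE conjE)
  show thesis by (rule that[OF *(1,2) spec[OF *(3)]]) (use *(4) in simp)
qed

text \<open>On an open set a local extension coincides with \<open>f\<close> near each point, so it
  has the same derivatives there.\<close>

lemma smooth_on_Ck_on:
  assumes "open U" "smooth_on U f" shows "Ck_on k U f"
proof (rule Ck_on_local)
  fix x assume "x \<in> U"
  obtain V g where V: "open V" "x \<in> V" "\<And>k. Ck_on k V g" "\<And>y. y \<in> U \<Longrightarrow> y \<in> V \<Longrightarrow> g y = f y"
    by (rule smooth_onE[OF assms(2) \<open>x \<in> U\<close>]) blast
  have "Ck_on k (U \<inter> V) f"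
    by (rule Ck_on_cong[OF open_Int[OF assms(1) V(1)] _ Ck_on_subset[OF V(3) Int_lower2]]) (simp add: V(4))
  then show "\<exists>V. open V \<and> x \<in> V \<and> Ck_on k V f"
    using open_Int[OF assms(1) V(1)] V(2) \<open>x \<in> U\<close> by (intro exI[of _ "U \<inter> V"]) simp
qed

lemma smooth_on_subset:
  assumes "smooth_on T f" "S \<subseteq> T" shows "smooth_on S f"
  unfolding smooth_on_def
proof
  fix x assume x: "x \<in> S"
  obtain U g where U: "open U" "x \<in> U" "\<And>k. Ck_on k U g" "\<And>y. y \<in> T \<Longrightarrow> y \<in> U \<Longrightarrow> g y = f y"
    by (rule smooth_onE[OF assms(1) subsetD[OF assms(2) x]]) blast
  then show "\<exists>U g. open U \<and> x \<in> U \<and> (\<forall>k. Ck_on k U g) \<and> (\<forall>y\<in>S \<inter> U. g y = f y)"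
    using subsetD[OF assms(2)] by (intro exI[of _ U] exI[of _ g]) simp
qed

lemma smooth_on_cong:
  assumes "\<And>x. x \<in> S \<Longrightarrow> f x = g x" "smooth_on S f" shows "smooth_on S g"
  using assms unfolding smooth_on_def by simp

lemma smooth_on_compose:
  assumes f: "smooth_on S f" and g: "smooth_on T g" and "f ` S \<subseteq> T"
  shows "smooth_on S (\<lambda>x. g (f x))"
  unfolding smooth_on_def
proof
  fix x assume x: "x \<in> S"
  obtain U f' where U: "open U" "x \<in> U" "\<And>k. Ck_on k U f'" "\<And>y. y \<in> S \<Longrightarrow> y \<in> U \<Longrightarrow> f' y = f y"
    by (rule smooth_onE[OF f x]) blast
  obtain V g' where V: "open V" "f x \<in> V" "\<And>k. Ck_on k V g'" "\<And>y. y \<in> T \<Longrightarrow> y \<in> V \<Longrightarrow> g' y = g y"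
    by (rule smooth_onE[OF g imageI[OF x, THEN subsetD[OF assms(3)]]]) blast
  define W where "W = U \<inter> f' -` V"
  have W: "open W" unfolding W_def
    using continuous_open_preimage[OF Ck_on_continuous[OF U(3)[of 0]] U(1) V(1)] by simp
  have "Ck_on k W (\<lambda>x. g' (f' x))" for k
    by (rule Ck_on_compose[OF W V(1) _ Ck_on_subset[OF U(3)] V(3)]) (auto simp: W_def)
  moreover have "x \<in> W" using U V x by (simp add: W_def)
  moreover have "g' (f' y) = g (f y)" if "y \<in> S \<inter> W" for y
    using that U(4)[of y] V(4)[of "f y"] assms(3) by (auto simp: W_def)
  ultimately show "\<exists>U h. open U \<and> x \<in> U \<and> (\<forall>k. Ck_on k U h) \<and> (\<forall>y\<in>S \<inter> U. h y = g (f y))"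
    using W by (intro exI[of _ W] exI[of _ "\<lambda>x. g' (f' x)"]) simp
qed

lemma smooth_on_bilinear:
  assumes "bounded_bilinear B" "smooth_on S f" "smooth_on S g"
  shows "smooth_on S (\<lambda>x. B (f x) (g x))"
  unfolding smooth_on_def
proof
  fix x assume x: "x \<in> S"
  obtain U f' where U: "open U" "x \<in> U" "\<And>k. Ck_on k U f'" "\<And>y. y \<in> S \<Longrightarrow> y \<in> U \<Longrightarrow> f' y = f y"
    by (rule smooth_onE[OF assms(2) x]) blast
  obtain V g' where V: "open V" "x \<in> V" "\<And>k. Ck_on k V g'" "\<And>y. y \<in> S \<Longrightarrow> y \<in> V \<Longrightarrow> g' y = g y"
    by (rule smooth_onE[OF assms(3) x]) blast
  show "\<exists>U h. open U \<and> x \<in> U \<and> (\<forall>k. Ck_on k U h) \<and> (\<forall>y\<in>S \<inter> U. h y = B (f y) (g y))"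
    using U V by (intro exI[of _ "U \<inter> V"] exI[of _ "\<lambda>x. B (f' x) (g' x)"])
      (simp add: Ck_on_bilinear[OF open_Int[OF U(1) V(1)] assms(1) Ck_on_subset[OF U(3) Int_lower1] Ck_on_subset[OF V(3) Int_lower2]] open_Int)
qed

lemma smooth_on_add:
  assumes "smooth_on S f" "smooth_on S g"
  shows "smooth_on S (\<lambda>x. f x + g x)"
  unfolding smooth_on_def
proof
  fix x assume x: "x \<in> S"
  obtain U f' where U: "open U" "x \<in> U" "\<And>k. Ck_on k U f'" "\<And>y. y \<in> S \<Longrightarrow> y \<in> U \<Longrightarrow> f' y = f y"
    by (rule smooth_onE[OF assms(1) x]) blast
  obtain V g' where V: "open V" "x \<in> V" "\<And>k. Ck_on k V g'" "\<And>y. y \<in> S \<Longrightarrow> y \<in> V \<Longrightarrow> g' y = g y"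
    by (rule smooth_onE[OF assms(2) x]) blast
  show "\<exists>U h. open U \<and> x \<in> U \<and> (\<forall>k. Ck_on k U h) \<and> (\<forall>y\<in>S \<inter> U. h y = f y + g y)"
    using U V by (intro exI[of _ "U \<inter> V"] exI[of _ "\<lambda>x. f' x + g' x"])
      (simp add: Ck_on_add[OF open_Int[OF U(1) V(1)] Ck_on_subset[OF U(3) Int_lower1] Ck_on_subset[OF V(3) Int_lower2]] open_Int)
qed

lemma smooth_on_linear: "bounded_linear f \<Longrightarrow> smooth_on S f"
  by (rule smooth_on_subset[of UNIV]) (auto intro: smooth_onI Ck_on_linear)

lemma smooth_on_const: "smooth_on S (\<lambda>x. c)"
  by (rule smooth_on_subset[of UNIV]) (auto intro: smooth_onI Ck_on_const)

lemma smooth_on_id: "smooth_on S (\<lambda>x. x)"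
  by (rule smooth_on_linear) simp

lemmas smooth_on_scaleR = smooth_on_bilinear[OF bounded_bilinear_scaleR]
  and smooth_on_mult = smooth_on_bilinear[OF bounded_bilinear_mult]

lemma smooth_on_diff:
  assumes "smooth_on S f" "smooth_on S g"
  shows "smooth_on S (\<lambda>x. f x - g x)"
  using smooth_on_add[OF assms(1) smooth_on_scaleR[OF smooth_on_const[of S "-1"] assms(2)]] by simp

lemma smooth_on_continuous: "smooth_on S f \<Longrightarrow> continuous_on S f"
proof -
  assume f: "smooth_on S f"
  have "continuous (at x within S) f" if x: "x \<in> S" for x
  proof -
    obtain U f' where U: "open U" "x \<in> U" "\<And>k. Ck_on k U f'" "\<And>y. y \<in> S \<Longrightarrow> y \<in> U \<Longrightarrow> f' y = f y"
      by (rule smooth_onE[OF f x]) blast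
    have "continuous_on U f'" by (rule Ck_on_continuous[OF U(3)])
    then have "isCont f' x" using U(1,2) by (simp add: continuous_on_eq_continuous_at)
    then have "(f' \<longlongrightarrow> f' x) (at x within S)"
      by (simp add: continuous_at_imp_continuous_at_within flip: continuous_within)
    moreover have "\<forall>\<^sub>F y in at x within S. f' y = f y"
      unfolding eventually_at_topological by (intro exI[of _ U]) (simp add: U(1,2,4))
    ultimately have "(f \<longlongrightarrow> f' x) (at x within S)" by (rule Lim_transform_eventually)
    then show ?thesis using U(4)[OF x U(2)] unfolding continuous_within by simp
  qed
  then show ?thesis by (simp add: continuous_on_eq_continuous_within)
qed

lemma Ck_on_SucI_vector:
  fixes f :: "real \<Rightarrow> 'a::euclidean_space"
  assumes "open U" "\<And>x. x \<in> U \<Longrightarrow> (f has_vector_derivative f' x) (at x)" "Ck_on k U f'"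
  shows "Ck_on (Suc k) U f"
proof (rule Ck_on_SucI[where f'="\<lambda>x v. v *\<^sub>R f' x"])
  show "(f has_derivative (\<lambda>v. v *\<^sub>R f' x)) (at x)" if "x \<in> U" for x
    using assms(2)[OF that] by (simp add: has_vector_derivative_def)
  show "Ck_on k U (\<lambda>x. v *\<^sub>R f' x)" for v
    by (rule Ck_on_scaleR[OF assms(1) Ck_on_const assms(3)])
qed (rule assms(1))

lemma Ck_on_vector_derivative:
  fixes f :: "real \<Rightarrow> 'a::euclidean_space"
  assumes "Ck_on (Suc k) U f" "x \<in> U"
  shows "(f has_vector_derivative frechet_derivative f (at x) 1) (at x)"
proof -
  have D: "(f has_derivative frechet_derivative f (at x)) (at x)" by (rule Ck_on_has_derivative[OF assms])
  have "frechet_derivative f (at x) = (\<lambda>h. h *\<^sub>R frechet_derivative f (at x) 1)"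
  proof
    show "frechet_derivative f (at x) h = h *\<^sub>R frechet_derivative f (at x) 1" for h
      using linear_scale[OF has_derivative_linear[OF D], of h 1] by simp
  qed
  with D show ?thesis unfolding has_vector_derivative_def by simp
qed

text \<open>The derivative within the interval agrees, also at the end points, with the derivative
  of a local smooth extension. It is therefore again locally the restriction of a smooth map, and
  the argument can be iterated.\<close>

lemma smooth_on_curve_derivative:
  fixes c :: "real \<Rightarrow> 'a::euclidean_space"
  assumes "smooth_on {a..b} c" "a < b"
  defines "c' \<equiv> \<lambda>t. vector_derivative c (at t within {a..b})"
  shows "\<And>t. t \<in> {a..b} \<Longrightarrow> (c has_vector_derivative c' t) (at t within {a..b})"
    and "smooth_on {a..b} c'"
proof -
  have loc: "\<exists>U g. open U \<and> t \<in> U \<and> (\<forall>k. Ck_on k U g) \<and>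
     (\<forall>s\<in>{a..b} \<inter> U. g s = c s \<and> (c has_vector_derivative frechet_derivative g (at s) 1) (at s within {a..b}))"
    if t: "t \<in> {a..b}" for t
  proof -
    obtain U g where U: "open U" "t \<in> U" "\<And>k. Ck_on k U g" "\<And>y. y \<in> {a..b} \<Longrightarrow> y \<in> U \<Longrightarrow> g y = c y"
      by (rule smooth_onE[OF assms(1) t]) blast
    have "(c has_vector_derivative frechet_derivative g (at s) 1) (at s within {a..b})" if s: "s \<in> {a..b} \<inter> U" for s
    proof -
      have "(g has_vector_derivative frechet_derivative g (at s) 1) (at s within {a..b})"
        by (rule has_vector_derivative_at_within[OF Ck_on_vector_derivative[OF U(3)]]) (use s in simp)
      then have "(g has_vector_derivative frechet_derivative g (at s) 1) (at s within {a..b} \<inter> U)"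
        by (rule has_vector_derivative_within_subset) auto
      then have "(c has_vector_derivative frechet_derivative g (at s) 1) (at s within {a..b} \<inter> U)"
        by (rule has_vector_derivative_transform[OF s, rotated]) (use U(4) in auto)
      moreover have "at s within {a..b} \<inter> U = at s within {a..b}"
        by (rule at_within_nhd[of s U]) (use s U(1) in auto)
      ultimately show ?thesis by simp
    qed
    then show ?thesis using U by (intro exI[of _ U] exI[of _ g]) simp
  qed
  have uniq: "c' s = v" if "(c has_vector_derivative v) (at s within {a..b})" "s \<in> {a..b}" for s v
    unfolding c'_def by (rule vector_derivative_within_cbox[of a b s c v, simplified]) (use that assms(2) in auto)
  show "(c has_vector_derivative c' t) (at t within {a..b})" if "t \<in> {a..b}" for t
  proof -
    obtain U g where "t \<in> U" "\<forall>s\<in>{a..b} \<inter> U. g s = c s \<and> (c has_vector_derivative frechet_derivative g (at s) 1) (at s within {a..b})"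
      using loc[OF \<open>t \<in> {a..b}\<close>] by (elim exE conjE)
    then have "(c has_vector_derivative frechet_derivative g (at t) 1) (at t within {a..b})"
      using \<open>t \<in> {a..b}\<close> by simp
    then show ?thesis using uniq \<open>t \<in> {a..b}\<close> by simp
  qed
  show "smooth_on {a..b} c'" unfolding smooth_on_def
  proof
    fix t assume t: "t \<in> {a..b}"
    obtain U g where U: "open U" "t \<in> U" "\<forall>k. Ck_on k U g"
      "\<forall>s\<in>{a..b} \<inter> U. g s = c s \<and> (c has_vector_derivative frechet_derivative g (at s) 1) (at s within {a..b})"
      using loc[OF t] by (elim exE conjE)
    have "Ck_on k U (\<lambda>s. frechet_derivative g (at s) 1)" for k using U(3)[rule_format, of "Suc k"] by simp
    moreover have "frechet_derivative g (at s) 1 = c' s" if "s \<in> {a..b} \<inter> U" for s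
      using uniq[of "frechet_derivative g (at s) 1" s] U(4) that by simp
    ultimately show "\<exists>U g. open U \<and> t \<in> U \<and> (\<forall>k. Ck_on k U g) \<and> (\<forall>y\<in>{a..b} \<inter> U. g y = c' y)"
      using U(1,2) by (intro exI[of _ U] exI[of _ "\<lambda>s. frechet_derivative g (at s) 1"]) simp
  qed
qed

section \<open>Smooth cut-off functions\<close>

text \<open>The functions \<open>x^(-n) exp(-1/x)\<close>, extended by zero. The family over all
  \<open>n\<close> is closed under differentiation up to linear combinations, so one induction on
  the order proves all of them smooth.\<close>

definition flat :: "nat \<Rightarrow> real \<Rightarrow> real" where
  "flat n x = (if x > 0 then (1 / x) ^ n * exp (- (1 / x)) else 0)"

lemma flat_tendsto_0: "(flat n \<longlongrightarrow> 0) (at 0)"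
proof -
  have "((\<lambda>x::real. (inverse x) ^ n / exp (inverse x)) \<longlongrightarrow> 0) (at_right 0)"
    using filterlim_compose[OF tendsto_power_div_exp_0 filterlim_inverse_at_top_right] .
  then have "(flat n \<longlongrightarrow> 0) (at_right 0)"
    by (rule Lim_transform_eventually)
       (auto simp: flat_def eventually_at_filter divide_inverse exp_minus)
  moreover have "(flat n \<longlongrightarrow> 0) (at_left 0)"
    by (rule Lim_transform_eventually[OF tendsto_const]) (auto simp: flat_def eventually_at_filter)
  ultimately show ?thesis using filterlim_split_at_real by blast
qed

lemma flat_has_derivative:
  "(flat n has_real_derivative (flat (n + 2) x - real n * flat (n + 1) x)) (at x)"
proof -
  consider "x > 0" | "x < 0" | "x = 0" by linarith
  then show ?thesis
  proof cases
    case 1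
    have inv: "((\<lambda>x. 1 / x) has_real_derivative - (1 / x\<^sup>2)) (at x)"
      using 1 by (auto intro!: derivative_eq_intros simp: power2_eq_square)
    have e: "((\<lambda>x. exp (- (1 / x))) has_real_derivative exp (- (1 / x)) * - (- (1 / x\<^sup>2))) (at x)"
      by (intro DERIV_fun_exp DERIV_minus inv)
    have "((\<lambda>x. (1 / x) ^ n) has_real_derivative - (real n * (1 / x) ^ (n + 1))) (at x)"
    proof (cases n)
      case (Suc m)
      show ?thesis unfolding Suc
        by (rule DERIV_cong[OF DERIV_power_Suc[OF inv]]) (use 1 in \<open>simp add: field_simps power2_eq_square\<close>)
    qed simp
    then have "((\<lambda>x. (1 / x) ^ n * exp (- (1 / x))) has_real_derivative (flat (n + 2) x - real n * flat (n + 1) x)) (at x)"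
      by (rule DERIV_cong[OF DERIV_mult[OF _ e]]) (use 1 in \<open>simp add: flat_def field_simps power2_eq_square\<close>)
    then show ?thesis
      by (rule DERIV_cong_ev[THEN iffD1, OF refl _ refl, rotated])
         (use 1 eventually_nhds_in_open[of "{0<..}" x] in \<open>auto elim!: eventually_mono simp: flat_def\<close>)
  next
    case 2
    have "((\<lambda>x. 0) has_real_derivative (flat (n + 2) x - real n * flat (n + 1) x)) (at x)"
      using 2 by (simp add: flat_def)
    then show ?thesis
      by (rule DERIV_cong_ev[THEN iffD1, OF refl _ refl, rotated])
         (use 2 eventually_nhds_in_open[of "{..<0}" x] in \<open>auto elim!: eventually_mono simp: flat_def\<close>)
  next
    case 3
    \<comment> \<open>At the origin the difference quotient of \<open>flat n\<close> is
      \<open>flat (Suc n)\<close>, which tends to zero.\<close>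
    have "((\<lambda>h. (flat n (0 + h) - flat n 0) / h) \<longlongrightarrow> 0) (at 0)"
      by (rule Lim_transform_eventually[OF flat_tendsto_0[of "Suc n"]])
         (auto simp: flat_def eventually_at_filter)
    then show ?thesis unfolding DERIV_def 3 by (simp add: flat_def)
  qed
qed

lemma Ck_on_flat: "Ck_on k UNIV (flat n)"
proof (induction k arbitrary: n)
  case 0
  show ?case using DERIV_isCont[OF flat_has_derivative] by (simp add: continuous_at_imp_continuous_on)
next
  case (Suc k)
  show ?case
  proof (rule Ck_on_SucI_vector)
    show "(flat n has_vector_derivative (flat (n + 2) x - real n * flat (n + 1) x)) (at x)" for x
      using flat_has_derivative by (simp add: has_real_derivative_iff_has_vector_derivative)
    show "Ck_on k UNIV (\<lambda>x. flat (n + 2) x - real n * flat (n + 1) x)"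
      by (intro Ck_on_diff Ck_on_mult Ck_on_const Suc.IH) auto
  qed simp
qed

text \<open>The standard smooth step, constant on each side of \<open>[0,1]\<close>. Its rescalings
  give the approximate indicators used for weak derivatives and later the partition of
  unity.\<close>

definition step :: "real \<Rightarrow> real" where
  "step x = flat 0 x / (flat 0 x + flat 0 (1 - x))"

lemma flat_nonneg: "flat n x \<ge> 0" by (simp add: flat_def)

lemma step_denominator_pos: "flat 0 x + flat 0 (1 - x) > 0"
proof (cases "x > 0")
  case True then show ?thesis using flat_nonneg[of 0 "1 - x"] by (simp add: flat_def add_pos_nonneg)
next
  case False then show ?thesis by (simp add: flat_def)
qed

lemma step_eq_0: "x \<le> 0 \<Longrightarrow> step x = 0" and step_eq_1: "x \<ge> 1 \<Longrightarrow> step x = 1"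
  by (auto simp: step_def flat_def)

lemma step_bounds: "0 \<le> step x" "step x \<le> 1"
  using flat_nonneg[of 0 x] flat_nonneg[of 0 "1 - x"] step_denominator_pos[of x]
  by (auto simp: step_def)

text \<open>The quotient solves a one-dimensional linear equation with positive coefficient, so
  \<open>Ck_on_inv_linear\<close> serves as the quotient rule.\<close>

lemma Ck_on_step: "Ck_on k UNIV step"
proof (rule Ck_on_inv_linear[where Q="\<lambda>x e. (flat 0 x + flat 0 (1 - x)) * e" and y="flat 0"])
  have "Ck_on k UNIV (\<lambda>x. flat 0 (1 - x))"
    by (rule Ck_on_compose[OF open_UNIV open_UNIV _ Ck_on_diff[OF open_UNIV Ck_on_const Ck_on_linear[OF open_UNIV bounded_linear_ident]] Ck_on_flat]) simp
  then show "Ck_on k UNIV (\<lambda>x. (flat 0 x + flat 0 (1 - x)) * e)" for e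
    by (intro Ck_on_mult Ck_on_add Ck_on_const Ck_on_flat) auto
  show "inj (\<lambda>e. (flat 0 x + flat 0 (1 - x)) * e)" for x
    using step_denominator_pos[of x] by (auto simp: inj_on_def)
  show "linear ((*) (flat 0 x + flat 0 (1 - x)))" for x by (rule linear_times)
  show "(flat 0 x + flat 0 (1 - x)) * step x = flat 0 x" for x
    using step_denominator_pos[of x] by (simp add: step_def)
qed (auto intro: Ck_on_flat)

lemma smooth_on_step_affine: "smooth_on S (\<lambda>x. step (p * x + q))"
proof (rule smooth_on_compose[where T=UNIV and g=step and f="\<lambda>x. p * x + q"])
  show "smooth_on S (\<lambda>x. p * x + q)"
    by (intro smooth_on_add smooth_on_mult smooth_on_const smooth_on_id)
qed (auto intro: smooth_onI Ck_on_step)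

lemma test_functions_Ck_on: "\<phi> \<in> test_functions U \<Longrightarrow> Ck_on k UNIV \<phi>"
  by (rule smooth_on_Ck_on[OF open_UNIV]) (simp add: test_functions_def)

lemma test_functions_has_derivative:
  assumes "\<phi> \<in> test_functions U" shows "(\<phi> has_real_derivative deriv \<phi> x) (at x)"
proof -
  have "(\<phi> has_vector_derivative frechet_derivative \<phi> (at x) 1) (at x)"
    by (rule Ck_on_vector_derivative[OF test_functions_Ck_on[OF assms, of "Suc 0"]]) simp
  then have "\<phi> field_differentiable (at x)"
    unfolding field_differentiable_def has_real_derivative_iff_has_vector_derivative by blast
  then show ?thesis by (simp add: DERIV_deriv_iff_field_differentiable)
qed

lemma test_functions_deriv:
  assumes "\<phi> \<in> test_functions U" shows "deriv \<phi> \<in> test_functions U"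
proof -
  obtain K where K: "compact K" "K \<subseteq> U" "\<And>x. x \<notin> K \<Longrightarrow> \<phi> x = 0"
    using assms unfolding test_functions_def by blast
  have eq: "frechet_derivative \<phi> (at x) 1 = deriv \<phi> x" for x
    using frechet_derivative_eq[of \<phi> "(*) (deriv \<phi> x)" x] test_functions_has_derivative[OF assms, of x]
    by (simp add: has_field_derivative_def)
  have "Ck_on k UNIV (deriv \<phi>)" for k
  proof -
    have "Ck_on k UNIV (\<lambda>x. frechet_derivative \<phi> (at x) 1)"
      using test_functions_Ck_on[OF assms, of "Suc k"] by simp
    then show ?thesis unfolding eq .
  qed
  then have "smooth_on UNIV (deriv \<phi>)" by (simp add: smooth_onI)
  moreover have "deriv \<phi> x = 0" if "x \<notin> K" for x
  proof -
    have "((\<lambda>x. 0) has_real_derivative deriv \<phi> x) (at x)"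
      by (rule has_field_derivative_transform_within_open[OF test_functions_has_derivative[OF assms], of "- K"])
         (use that K compact_imp_closed in auto)
    then show ?thesis using DERIV_const DERIV_unique by blast
  qed
  ultimately show ?thesis using K(1,2) by (auto simp: test_functions_def)
qed

lemma test_functions_mult:
  assumes "\<phi> \<in> test_functions U" "smooth_on UNIV \<rho>" "\<And>x. x \<notin> L \<Longrightarrow> \<rho> x = 0" "closed L"
  shows "(\<lambda>x. \<phi> x * \<rho> x) \<in> test_functions (U \<inter> L)"
proof -
  obtain K where K: "compact K" "K \<subseteq> U" "\<And>x. x \<notin> K \<Longrightarrow> \<phi> x = 0"
    using assms(1) unfolding test_functions_def by blast
  have "smooth_on UNIV (\<lambda>x. \<phi> x * \<rho> x)" using assms by (intro smooth_on_mult) (auto simp: test_functions_def)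
  moreover have "compact (K \<inter> L)" using K assms by (simp add: compact_Int_closed)
  moreover have "\<forall>x. x \<notin> K \<inter> L \<longrightarrow> \<phi> x * \<rho> x = 0" using K(3) assms(3) by auto
  moreover have "K \<inter> L \<subseteq> U \<inter> L" using K(2) by auto
  ultimately show ?thesis unfolding test_functions_def by blast
qed

lemma test_functions_continuous: "\<phi> \<in> test_functions U \<Longrightarrow> continuous_on S \<phi>"
  using Ck_on_continuous[OF test_functions_Ck_on] continuous_on_subset by blast

definition step' :: "real \<Rightarrow> real" where "step' x = frechet_derivative step (at x) 1"

lemma step_has_derivative: "(step has_real_derivative step' x) (at x)"
  unfolding step'_def has_real_derivative_iff_has_vector_derivative
  by (rule Ck_on_vector_derivative[OF Ck_on_step[of "Suc 0"]]) simp

lemma step'_continuous: "continuous_on S step'"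
proof -
  have "continuous_on UNIV (\<lambda>x. frechet_derivative step (at x) 1)"
    using Ck_on_step[of "Suc 0"] by simp
  then show ?thesis unfolding step'_def[abs_def] by (rule continuous_on_subset) simp
qed

lemma step'_eq_0: assumes "x \<notin> {0..1}" shows "step' x = 0"
proof -
  consider "x < 0" | "x > 1" using assms by force
  then show ?thesis
  proof cases
    case 1
    have "((\<lambda>x. 0) has_real_derivative step' x) (at x)"
      by (rule has_field_derivative_transform_within_open[OF step_has_derivative, of "{..<0}"]) (use 1 in \<open>auto simp: step_eq_0\<close>)
    then show ?thesis using DERIV_const DERIV_unique by blast
  next
    case 2
    have "((\<lambda>x. 1) has_real_derivative step' x) (at x)"
      by (rule has_field_derivative_transform_within_open[OF step_has_derivative, of "{1<..}"]) (use 2 in \<open>auto simp: step_eq_1\<close>)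
    then show ?thesis using DERIV_const DERIV_unique by blast
  qed
qed

lemma step'_bounded: obtains C where "C > 0" "\<And>x. \<bar>step' x\<bar> \<le> C"
proof -
  have "bounded (step' ` {0..1})"
    using compact_continuous_image[OF step'_continuous] compact_imp_bounded by blast
  then obtain C where "C > 0" "\<And>x. x \<in> {0..1} \<Longrightarrow> \<bar>step' x\<bar> \<le> C"
    unfolding bounded_pos by auto
  then show thesis using step'_eq_0 by (metis abs_zero less_imp_le that)
qed

section \<open>Absolutely continuous curves\<close>

text \<open>Absolute continuity is encoded by an indefinite integral: the density \<open>g\<close>
  plays the role of the derivative and is determined only up to a negligible set. All derivative
  computations for Sobolev curves are statements about such pairs.\<close>

definition ac_on :: "real \<Rightarrow> real \<Rightarrow> (real \<Rightarrow> 'a::euclidean_space) \<Rightarrow> (real \<Rightarrow> 'a) \<Rightarrow> bool" where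
  "ac_on a b f g \<longleftrightarrow> g absolutely_integrable_on {a..b} \<and> (\<forall>x\<in>{a..b}. f x = f a + integral {a..x} g)"

lemma ac_on_integrable: "ac_on a b f g \<Longrightarrow> g integrable_on {a..b}"
  unfolding ac_on_def using absolutely_integrable_imp_integrable
  by (metis set_lebesgue_integral_eq_integral(1))

lemma ac_on_absolutely_integrable: "ac_on a b f g \<Longrightarrow> g absolutely_integrable_on {a..b}"
  by (simp add: ac_on_def)

lemma ac_on_increment:
  assumes "ac_on a b f g" "a \<le> x" "x \<le> y" "y \<le> b"
  shows "f y - f x = integral {x..y} g"
proof -
  have g: "g integrable_on {a..y}"
    using integrable_on_subinterval[OF ac_on_integrable[OF assms(1)], of a y] assms by auto
  have "f y = f a + integral {a..y} g" "f x = f a + integral {a..x} g"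
    using assms(1) assms(2-4) unfolding ac_on_def by (metis atLeastAtMost_iff order_trans)+
  then have "f y - f x = integral {a..y} g - integral {a..x} g" by (metis add_diff_cancel_left)
  then show ?thesis
    unfolding Henstock_Kurzweil_Integration.integral_combine[OF assms(2,3) g, symmetric] by (metis add_diff_cancel_left')
qed

lemma ac_onI:
  assumes "g absolutely_integrable_on {a..b}" "\<And>x. a \<le> x \<Longrightarrow> x \<le> b \<Longrightarrow> f x - f a = integral {a..x} g"
  shows "ac_on a b f g"
  unfolding ac_on_def
proof (intro conjI ballI)
  fix x assume "x \<in> {a..b}"
  then have "f x - f a = integral {a..x} g" by (intro assms(2)) auto
  then show "f x = f a + integral {a..x} g" by (metis add.commute diff_add_cancel)
qed (rule assms(1))

lemma ac_on_subinterval: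
  assumes "ac_on a b f g" "a \<le> c" "c \<le> d" "d \<le> b"
  shows "ac_on c d f g"
proof (rule ac_onI)
  show "g absolutely_integrable_on {c..d}"
    using absolutely_integrable_on_subinterval[OF ac_on_absolutely_integrable[OF assms(1)], of c d] assms by auto
qed (use ac_on_increment[OF assms(1)] assms in auto)

lemma ac_on_continuous:
  assumes "ac_on a b f g" shows "continuous_on {a..b} f"
proof -
  have "continuous_on {a..b} (\<lambda>x. f a + integral {a..x} g)"
    by (intro continuous_intros indefinite_integral_continuous_1 ac_on_integrable[OF assms])
  then show ?thesis
    by (rule continuous_on_eq) (metis ac_on_def assms)
qed

lemma ac_on_combine:
  assumes 1: "ac_on a c f g" and 2: "ac_on c b f g" and le: "a \<le> c" "c \<le> b"
  shows "ac_on a b f g"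
proof (rule ac_onI)
  show abs: "g absolutely_integrable_on {a..b}"
    using absolutely_integrable_on_combine[OF ac_on_absolutely_integrable[OF 1] ac_on_absolutely_integrable[OF 2] le] .
  fix x assume x: "a \<le> x" "x \<le> b"
  show "f x - f a = integral {a..x} g"
  proof (cases "x \<le> c")
    case True then show ?thesis using ac_on_increment[OF 1 _ x(1)] by auto
  next
    case False
    have "g integrable_on {a..x}"
      using absolutely_integrable_on_subinterval[OF abs, of a x] x absolutely_integrable_imp_integrable
      by (auto simp: set_lebesgue_integral_eq_integral(1))
    from Henstock_Kurzweil_Integration.integral_combine[OF le(1) _ this] show ?thesis
      using ac_on_increment[OF 1 order_refl le(1)] ac_on_increment[OF 2 order_refl, of x] False x by (auto simp: algebra_simps)
  qed
qed

lemma ac_on_cong: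
  assumes ac: "ac_on a b f g" and f: "\<And>x. x \<in> {a..b} \<Longrightarrow> f' x = f x"
    and N: "negligible N" and g: "\<And>x. x \<in> {a..b} - N \<Longrightarrow> g' x = g x"
  shows "ac_on a b f' g'"
proof (rule ac_onI)
  show "g' absolutely_integrable_on {a..b}"
    by (rule absolutely_integrable_spike[OF ac_on_absolutely_integrable[OF ac] N g])
  fix x assume x: "a \<le> x" "x \<le> b"
  have "integral {a..x} g = integral {a..x} g'"
    by (rule integral_spike[OF N]) (use g x in auto)
  then show "f' x - f' a = integral {a..x} g'"
    using ac_on_increment[OF ac order_refl x] f[of x] f[of a] x by auto
qed

lemma absolutely_integrable_continuous_mult:
  fixes B :: "'a::euclidean_space \<Rightarrow> 'b::euclidean_space \<Rightarrow> 'c::euclidean_space"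
  assumes "bounded_bilinear B" "continuous_on {a..b} h" "g absolutely_integrable_on {a..b::real}"
  shows "(\<lambda>x. B (h x) (g x)) absolutely_integrable_on {a..b}"
proof (rule absolutely_integrable_bounded_measurable_product[where h=B and f=h and g=g])
  show "bilinear B" using assms(1) by (simp add: bilinear_conv_bounded_bilinear)
  show "h \<in> borel_measurable (lebesgue_on {a..b})"
    by (rule continuous_imp_measurable_on_sets_lebesgue[OF assms(2)]) auto
  show "bounded (h ` {a..b})" using assms(2) compact_continuous_image compact_imp_bounded by blast
qed (use assms(3) in auto)

lemma absolutely_integrable_mult_continuous:
  fixes B :: "'a::euclidean_space \<Rightarrow> 'b::euclidean_space \<Rightarrow> 'c::euclidean_space"
  assumes "bounded_bilinear B" "continuous_on {a..b} h" "g absolutely_integrable_on {a..b::real}"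
  shows "(\<lambda>x. B (g x) (h x)) absolutely_integrable_on {a..b}"
  using absolutely_integrable_continuous_mult[OF bounded_bilinear.flip[OF assms(1)] assms(2,3)] .

lemma ac_on_linear:
  assumes L: "bounded_linear L" and ac: "ac_on a b f g"
  shows "ac_on a b (\<lambda>x. L (f x)) (\<lambda>x. L (g x))"
proof (rule ac_onI)
  show "(\<lambda>x. L (g x)) absolutely_integrable_on {a..b}"
    using absolutely_integrable_linear[OF ac_on_absolutely_integrable[OF ac] L] by (simp add: o_def)
  fix x assume x: "a \<le> x" "x \<le> b"
  have "g integrable_on {a..x}"
    using integrable_on_subinterval[OF ac_on_integrable[OF ac], of a x] x by auto
  from integral_linear[OF this L] show "L (f x) - L (f a) = integral {a..x} (\<lambda>x. L (g x))"
    using ac_on_increment[OF ac order_refl x] linear_diff[OF bounded_linear.linear[OF L], of "f x" "f a"] by (simp add: o_def)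
qed

lemma ac_on_add:
  assumes 1: "ac_on a b f g" and 2: "ac_on a b f' g'"
  shows "ac_on a b (\<lambda>x. f x + f' x) (\<lambda>x. g x + g' x)"
proof (rule ac_onI)
  show "(\<lambda>x. g x + g' x) absolutely_integrable_on {a..b}"
    using ac_on_absolutely_integrable[OF 1] ac_on_absolutely_integrable[OF 2] by (rule set_integral_add)
  fix x assume x: "a \<le> x" "x \<le> b"
  have "g integrable_on {a..x}" "g' integrable_on {a..x}"
    using integrable_on_subinterval[OF ac_on_integrable[OF 1], of a x] integrable_on_subinterval[OF ac_on_integrable[OF 2], of a x] x by auto
  then show "f x + f' x - (f a + f' a) = integral {a..x} (\<lambda>x. g x + g' x)"
    using ac_on_increment[OF 1 order_refl x] ac_on_increment[OF 2 order_refl x] by (simp add: Henstock_Kurzweil_Integration.integral_add algebra_simps)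
qed

lemma ac_on_C1:
  assumes "a \<le> b" "\<And>t. t \<in> {a..b} \<Longrightarrow> (f has_vector_derivative g t) (at t within {a..b})" "continuous_on {a..b} g"
  shows "ac_on a b f g"
proof (rule ac_onI)
  show "g absolutely_integrable_on {a..b}" by (rule absolutely_integrable_continuous_real[OF assms(3)])
  fix x assume x: "a \<le> x" "x \<le> b"
  have "(g has_integral (f x - f a)) {a..x}"
    by (rule fundamental_theorem_of_calculus[OF x(1)])
       (use assms(2) x in \<open>auto intro: has_vector_derivative_within_subset[where S="{a..b}"]\<close>)
  then show "f x - f a = integral {a..x} g" by (simp add: integral_unique)
qed

text \<open>All integrals of the difference over subintervals vanish, so its averages do, and by
  Lebesgue differentiation it is zero off a negligible set. Differentiating an identity between
  curves will mean writing both sides as \<open>ac_on\<close> pairs and applying this lemma.\<close>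

lemma ac_on_unique:
  assumes 1: "ac_on a b f g" and 2: "ac_on a b f h"
  obtains N where "negligible N" "\<And>x. x \<in> {a..b} - N \<Longrightarrow> g x = h x"
proof -
  define u where "u x = (if x \<in> {a..b} then g x - h x else 0)" for x
  have gh: "(\<lambda>x. g x - h x) integrable_on {a..b}"
    by (intro Henstock_Kurzweil_Integration.integrable_diff ac_on_integrable[OF 1] ac_on_integrable[OF 2])
  have zero: "integral {x..y} (\<lambda>x. g x - h x) = 0" if "a \<le> x" "x \<le> y" "y \<le> b" for x y
  proof -
    have "g integrable_on {x..y}" "h integrable_on {x..y}"
      using integrable_on_subinterval[OF ac_on_integrable[OF 1]] integrable_on_subinterval[OF ac_on_integrable[OF 2]] that by auto
    then show ?thesis
      using ac_on_increment[OF 1 that] ac_on_increment[OF 2 that] by (simp add: Henstock_Kurzweil_Integration.integral_diff)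
  qed
  \<comment> \<open>The difference is extended by zero, since the averages below are taken over
    intervals that may leave \<open>[a,b]\<close>.\<close>
  have int: "(u has_integral 0) (cbox x y)" for x y
  proof -
    have "((\<lambda>x. g x - h x) has_integral 0) ({a..b} \<inter> {x..y})"
    proof (cases "max a x \<le> min b y")
      case True
      have "(\<lambda>x. g x - h x) integrable_on {max a x..min b y}"
        by (rule integrable_on_subinterval[OF gh]) auto
      then show ?thesis using zero[of "max a x" "min b y"] True by (simp add: has_integral_iff)
    next
      case False
      then have "{a..b} \<inter> {x..y} = {}" by auto
      then show ?thesis by simp
    qed
    then show ?thesis unfolding u_def cbox_interval has_integral_restrict_Int .
  qed
  then have "u integrable_on cbox x y" for x y by blast
  from integrable_ccontinuous_explicit[of u, OF this]
  obtain N where N: "negligible N" "\<And>x e. \<lbrakk>x \<notin> N; 0 < e\<rbrakk> \<Longrightarrow> \<exists>d>0. \<forall>k. 0 < k \<and> k < d \<longrightarrow>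
       norm (integral (cbox x (x + k *\<^sub>R One)) u /\<^sub>R k ^ DIM(real) - u x) < e"
    by blast
  show thesis
  proof (rule that[OF N(1)])
    fix x assume x: "x \<in> {a..b} - N"
    have "norm (u x) < e" if e: "e > 0" for e
    proof -
      obtain d where d: "d > 0" "\<forall>k. 0 < k \<and> k < d \<longrightarrow> norm (integral (cbox x (x + k *\<^sub>R One)) u /\<^sub>R k ^ DIM(real) - u x) < e"
        using N(2)[of x e] x e by auto
      have "norm (integral (cbox x (x + (d/2) *\<^sub>R One)) u /\<^sub>R (d/2) ^ DIM(real) - u x) < e"
        by (rule d(2)[rule_format]) (use d(1) in simp)
      then show ?thesis by (simp only: integral_unique[OF int]) simp
    qed
    then have "u x = 0" by (metis less_irrefl norm_eq_zero zero_less_norm_iff)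
    then show "g x = h x" using x by (simp add: u_def)
  qed
qed

lemma compact_open_tube:
  fixes K :: "'a::euclidean_space set"
  assumes "compact K" "open U" "K \<subseteq> U"
  obtains e K' where "e > 0" "compact K'" "K' \<subseteq> U" "\<And>x y. x \<in> K \<Longrightarrow> norm y \<le> e \<Longrightarrow> x + y \<in> K'"
proof -
  obtain e where e: "e > 0" "(\<Union>x\<in>K. cball x e) \<subseteq> U"
    using compact_subset_open_imp_cball_epsilon_subset[OF assms] by blast
  show thesis
  proof (rule that[OF e(1)])
    show "compact {x + y |x y. x \<in> K \<and> y \<in> cball 0 e}" using assms(1) by (intro compact_sums) auto
    have "x + y \<in> cball x e" if "norm y \<le> e" for x y :: 'a using that by (simp add: dist_norm)
    then show "{x + y |x y. x \<in> K \<and> y \<in> cball 0 e} \<subseteq> U" using e(2) by (auto simp: subset_eq)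
  qed auto
qed

text \<open>The right side is additive over adjacent intervals and the left side subadditive, so it
  suffices to peel off pieces of length \<open>d/2\<close>, which meet the strict local
  condition.\<close>

lemma local_to_global_increment_bound:
  fixes D :: "real \<Rightarrow> 'a::real_normed_vector" and m :: "real \<Rightarrow> real"
  assumes "d > 0" and loc: "\<And>x y. a \<le> x \<Longrightarrow> x \<le> y \<Longrightarrow> y \<le> b \<Longrightarrow> y - x < d \<Longrightarrow> norm (D y - D x) \<le> m y - m x"
    and "a \<le> x" "x \<le> y" "y \<le> b"
  shows "norm (D y - D x) \<le> m y - m x"
proof -
  have "\<forall>x y. a \<le> x \<longrightarrow> x \<le> y \<longrightarrow> y \<le> b \<longrightarrow> y - x \<le> real n * (d/2) \<longrightarrow> norm (D y - D x) \<le> m y - m x" for n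
  proof (induction n)
    case 0 then show ?case by auto
  next
    case (Suc n)
    show ?case
    proof (intro allI impI)
      fix x y assume xy: "a \<le> x" "x \<le> y" "y \<le> b" "y - x \<le> real (Suc n) * (d/2)"
      show "norm (D y - D x) \<le> m y - m x"
      proof (cases "y - x < d")
        case True then show ?thesis using loc xy by blast
      next
        case False
        have "norm (D (y - d/2) - D x) \<le> m (y - d/2) - m x"
          using Suc.IH xy False \<open>d > 0\<close> by (auto simp: algebra_simps)
        moreover have "norm (D y - D (y - d/2)) \<le> m y - m (y - d/2)"
          using loc[of "y - d/2" y] xy False \<open>d > 0\<close> by auto
        ultimately show ?thesis using norm_triangle_ineq[of "D y - D (y - d/2)" "D (y - d/2) - D x"] by simp
      qed
    qed
  qed
  moreover obtain n :: nat where "y - x \<le> real n * (d/2)"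
    using reals_Archimedean3[of "d/2"] \<open>d > 0\<close> by (metis half_gt_zero less_imp_le)
  ultimately show ?thesis using assms(3-5) by blast
qed

lemma norm_integral_le_integral_norm:
  fixes g :: "real \<Rightarrow> 'a::euclidean_space"
  assumes "g absolutely_integrable_on {x..y}"
  shows "norm (integral {x..y} g) \<le> integral {x..y} (\<lambda>t. norm (g t))"
  using assms by (intro integral_norm_bound_integral) (auto simp: absolutely_integrable_on_def)

text \<open>Almost everywhere differentiability is not needed: on a short interval \<open>[x,y]\<close> both
  \<open>h (f y) - h (f x)\<close> and the integral of \<open>h' (f t) (g t)\<close> differ from \<open>h' (f x) (f y - f x)\<close> by at
  most a small multiple of the integral of \<open>norm g\<close>.\<close>

lemma ac_on_chain:
  fixes f :: "real \<Rightarrow> 'a::euclidean_space" and h :: "'a \<Rightarrow> 'b::euclidean_space"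
  assumes ac: "ac_on a b f g" and "a \<le> b" and U: "open U" and fU: "\<And>t. t \<in> {a..b} \<Longrightarrow> f t \<in> U"
    and h: "\<And>y. y \<in> U \<Longrightarrow> (h has_derivative h' y) (at y)"
    and h': "\<And>v. continuous_on U (\<lambda>y. h' y v)"
  shows "ac_on a b (\<lambda>t. h (f t)) (\<lambda>t. h' (f t) (g t))"
proof -
  have cf: "continuous_on {a..b} f" by (rule ac_on_continuous[OF ac])
  have ga: "g absolutely_integrable_on {a..b}" by (rule ac_on_absolutely_integrable[OF ac])
  have gn: "(\<lambda>t. norm (g t)) absolutely_integrable_on {a..b}" by (rule absolutely_integrable_norm[OF ga, unfolded o_def])
  define G where "G t = h' (f t) (g t)" for t
  have lin: "linear (h' y)" if "y \<in> U" for y using h[OF that] has_derivative_linear by blast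
  have Geq: "(\<Sum>e\<in>Basis. (g t \<bullet> e) *\<^sub>R h' (f t) e) = G t" if "t \<in> {a..b}" for t
    unfolding G_def using linear_basis_expand[OF lin[OF fU[OF that]], of "g t"] by simp
  have Ga: "G absolutely_integrable_on {a..b}"
  proof -
    have "(\<lambda>t. \<Sum>e\<in>Basis. (g t \<bullet> e) *\<^sub>R h' (f t) e) absolutely_integrable_on {a..b}"
    proof (intro absolutely_integrable_sum finite_Basis)
      fix e :: 'a
      have "(\<lambda>t. g t \<bullet> e) absolutely_integrable_on {a..b}"
        using absolutely_integrable_linear[OF ga bounded_linear_inner_left] by (simp add: o_def)
      moreover have "continuous_on {a..b} (\<lambda>t. h' (f t) e)"
        by (rule continuous_on_compose2[OF h' cf]) (use fU in auto)
      ultimately show "(\<lambda>t. (g t \<bullet> e) *\<^sub>R h' (f t) e) absolutely_integrable_on {a..b}"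
        using absolutely_integrable_mult_continuous[OF bounded_bilinear_scaleR] by blast
    qed
    then show ?thesis
      by (rule absolutely_integrable_spike[OF _ negligible_empty]) (use Geq in simp)
  qed
  have Gi: "G integrable_on {x..y}" and gi: "(\<lambda>t. norm (g t)) integrable_on {x..y}" and gai: "g absolutely_integrable_on {x..y}"
    if "a \<le> x" "y \<le> b" for x y
    using absolutely_integrable_on_subinterval[OF Ga, of x y] absolutely_integrable_on_subinterval[OF gn, of x y]
      absolutely_integrable_on_subinterval[OF ga, of x y] that by (simp_all add: set_lebesgue_integral_eq_integral(1))
  \<comment> \<open>\<open>m\<close> measures the variation of \<open>f\<close>, and
    \<open>D\<close> is the defect of the claimed formula. Increments of \<open>D\<close> turn out
    to be at most \<open>\<eta>\<close> times those of \<open>m\<close> for every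
    \<open>\<eta> > 0\<close>, so \<open>D\<close> is constant.\<close>
  define m where "m x = integral {a..x} (\<lambda>t. norm (g t))" for x
  define D where "D x = h (f x) - integral {a..x} G" for x
  have m: "m y - m x = integral {x..y} (\<lambda>t. norm (g t))" if "a \<le> x" "x \<le> y" "y \<le> b" for x y
    using Henstock_Kurzweil_Integration.integral_combine[OF that(1,2) gi[OF order_refl that(3)]] by (simp add: m_def)
  have D: "D y - D x = h (f y) - h (f x) - integral {x..y} G" if "a \<le> x" "x \<le> y" "y \<le> b" for x y
    using Henstock_Kurzweil_Integration.integral_combine[OF that(1,2) Gi[OF order_refl that(3)]] by (simp add: D_def algebra_simps)
  have fm: "norm (f y - f x) \<le> m y - m x" if "a \<le> x" "x \<le> y" "y \<le> b" for x y
    unfolding m[OF that] ac_on_increment[OF ac that]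
    by (rule norm_integral_le_integral_norm) (rule gai; use that in auto)
  define K where "K = f ` {a..b}"
  have K: "compact K" "K \<subseteq> U" using cf fU by (auto simp: K_def compact_continuous_image)
  obtain e0 K' where e0: "e0 > 0" "compact K'" "K' \<subseteq> U" "\<And>x y. x \<in> K \<Longrightarrow> norm y \<le> e0 \<Longrightarrow> x + y \<in> K'"
    by (rule compact_open_tube[OF K(1) U K(2)]) blast
  have est: "norm (D y - D x) \<le> \<eta> * (m y - m x)" if \<eta>: "\<eta> > 0" and xy: "a \<le> x" "x \<le> y" "y \<le> b" for \<eta> x y
  proof -
    have "\<exists>r>0. \<forall>p\<in>K'. \<forall>q\<in>K'. norm (q - p) < r \<longrightarrow> (\<forall>v. norm (h' q v - h' p v) \<le> (\<eta>/2) * norm v)"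
    proof -
      \<comment> \<open>\<open>\<kappa>\<close> spreads \<open>\<eta>/2\<close> over the basis
        vectors; the two error terms \<open>A\<close> and \<open>B\<close> below use one half of
        \<open>\<eta>\<close> each.\<close>
      define \<kappa> where "\<kappa> = \<eta> / (2 * real DIM('a))"
      have \<kappa>: "\<kappa> > 0" using \<eta> by (simp add: \<kappa>_def)
      have "\<forall>e\<in>Basis. \<exists>r>0. \<forall>p\<in>K'. \<forall>q\<in>K'. dist q p < r \<longrightarrow> dist (h' q e) (h' p e) < \<kappa>"
      proof
        fix e :: 'a
        have "uniformly_continuous_on K' (\<lambda>y. h' y e)"
          using compact_uniformly_continuous[OF continuous_on_subset[OF h' e0(3)] e0(2)] .
        then show "\<exists>r>0. \<forall>p\<in>K'. \<forall>q\<in>K'. dist q p < r \<longrightarrow> dist (h' q e) (h' p e) < \<kappa>"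
          unfolding uniformly_continuous_on_def using \<kappa> by blast
      qed
      then obtain r where r: "\<And>e. e \<in> Basis \<Longrightarrow> r e > 0"
        "\<And>e p q. e \<in> Basis \<Longrightarrow> p \<in> K' \<Longrightarrow> q \<in> K' \<Longrightarrow> dist q p < r e \<Longrightarrow> dist (h' q e) (h' p e) < \<kappa>" by metis
      show ?thesis
      proof (intro exI[of _ "Min (r ` Basis)"] conjI ballI impI allI)
        show "0 < Min (r ` Basis)" using r(1) by simp
        fix p q v assume pq: "p \<in> K'" "q \<in> K'" "norm (q - p) < Min (r ` Basis)"
        have pU: "p \<in> U" "q \<in> U" using pq e0(3) by auto
        have "h' q v - h' p v = (\<Sum>e\<in>Basis. (v \<bullet> e) *\<^sub>R (h' q e - h' p e))"
          using linear_basis_expand[OF lin[OF pU(1)], of v] linear_basis_expand[OF lin[OF pU(2)], of v]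
          by (simp only: sum_subtractf scaleR_diff_right)
        also have "norm \<dots> \<le> (\<Sum>e\<in>(Basis::'a set). norm v * \<kappa>)"
        proof (rule order_trans[OF norm_sum sum_mono])
          fix e :: 'a assume e: "e \<in> Basis"
          have "norm (q - p) < r e" using pq(3) e by simp
          then have "norm (h' q e - h' p e) \<le> \<kappa>" using r(2)[OF e pq(1,2)] by (simp add: dist_norm)
          then show "norm ((v \<bullet> e) *\<^sub>R (h' q e - h' p e)) \<le> norm v * \<kappa>"
            using e by (auto intro!: mult_mono simp: Basis_le_norm)
        qed
        also have "\<dots> = (\<eta>/2) * norm v" by (simp add: \<kappa>_def)
        finally show "norm (h' q v - h' p v) \<le> (\<eta>/2) * norm v" .
      qed
    qed
    then obtain r where r: "r > 0" "\<And>p q v. p\<in>K' \<Longrightarrow> q\<in>K' \<Longrightarrow> norm (q - p) < r \<Longrightarrow> norm (h' q v - h' p v) \<le> (\<eta>/2) * norm v"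
      by blast
    have "uniformly_continuous_on {a..b} f" using compact_uniformly_continuous[OF cf] by simp
    then obtain d where d: "d > 0" "\<And>s t. s \<in> {a..b} \<Longrightarrow> t \<in> {a..b} \<Longrightarrow> dist s t < d \<Longrightarrow> dist (f s) (f t) < min r e0"
      unfolding uniformly_continuous_on_def using r(1) e0(1) by (metis min_less_iff_conj)
    have "norm (D y - D x) \<le> \<eta> * m y - \<eta> * m x"
    proof (rule local_to_global_increment_bound[OF d(1) _ xy])
      fix x y assume xy: "a \<le> x" "x \<le> y" "y \<le> b" "y - x < d"
      have fd: "norm (f t - f x) < r" "norm (f t - f x) \<le> e0" if "t \<in> {x..y}" for t
        using d(2)[of t x] xy that by (auto simp: dist_norm)
      have fK: "f x \<in> K" using xy by (auto simp: K_def)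
      have inK': "f x + s *\<^sub>R (f y - f x) \<in> K'" if "s \<in> {0..1}" for s
      proof (rule e0(4)[OF fK])
        have "norm (s *\<^sub>R (f y - f x)) \<le> norm (f y - f x)" using that by (simp add: mult_left_le_one_le)
        then show "norm (s *\<^sub>R (f y - f x)) \<le> e0" using fd(2)[of y] xy by simp
      qed
      have near: "norm ((f x + s *\<^sub>R (f y - f x)) - f x) < r" if "s \<in> {0..1}" for s
      proof -
        have "norm (s *\<^sub>R (f y - f x)) \<le> norm (f y - f x)" using that by (simp add: mult_left_le_one_le)
        then show ?thesis using fd(1)[of y] xy by simp
      qed
      have fxK: "f x \<in> K'" using inK'[of 0] by simp
      have A: "norm (h (f y) - h (f x) - h' (f x) (f y - f x)) \<le> (\<eta>/2) * norm (f y - f x)"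
      proof -
        define p where "p s = h (f x + s *\<^sub>R (f y - f x)) - s *\<^sub>R h' (f x) (f y - f x)" for s
        have "norm (p 1 - p 0) \<le> ((\<eta>/2) * norm (f y - f x)) * (1 - 0)"
        proof (rule vector_derivative_norm_bound)
          fix s :: real assume s: "s \<in> {0..1}"
          have "((\<lambda>s. h (f x + s *\<^sub>R (f y - f x))) has_vector_derivative h' (f x + s *\<^sub>R (f y - f x)) (f y - f x)) (at s within {0..1})"
            by (rule has_derivative_along_line[OF h]) (use inK'[OF s] e0(3) in auto)
          moreover have "((\<lambda>s. s *\<^sub>R h' (f x) (f y - f x)) has_vector_derivative h' (f x) (f y - f x)) (at s within {0..1})"
            by (auto intro!: derivative_eq_intros simp: has_vector_derivative_def)
          ultimately show "(p has_vector_derivative (h' (f x + s *\<^sub>R (f y - f x)) (f y - f x) - h' (f x) (f y - f x))) (at s within {0..1})"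
            unfolding p_def by (rule has_vector_derivative_diff)
          show "norm (h' (f x + s *\<^sub>R (f y - f x)) (f y - f x) - h' (f x) (f y - f x)) \<le> (\<eta>/2) * norm (f y - f x)"
            by (rule r(2)[OF fxK inK'[OF s] near[OF s]])
        qed simp
        then show ?thesis by (simp add: p_def algebra_simps)
      qed
      have B: "norm (integral {x..y} G - h' (f x) (f y - f x)) \<le> (\<eta>/2) * (m y - m x)"
      proof -
        have blin: "bounded_linear (h' (f x))" using lin fK K(2) linear_conv_bounded_linear by blast
        have gi': "g integrable_on {x..y}" using gai[of x y] xy set_lebesgue_integral_eq_integral(1) by blast
        have hg: "(\<lambda>t. h' (f x) (g t)) integrable_on {x..y}"
          using integrable_linear[OF gi' blin] by (simp add: o_def)
        have "h' (f x) (f y - f x) = integral {x..y} (\<lambda>t. h' (f x) (g t))"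
          using integral_linear[OF gi' blin] ac_on_increment[OF ac xy(1-3)] by (simp add: o_def)
        then have "integral {x..y} G - h' (f x) (f y - f x) = integral {x..y} (\<lambda>t. G t - h' (f x) (g t))"
          using Henstock_Kurzweil_Integration.integral_diff[OF Gi[OF xy(1,3)] hg] by simp
        also have "norm \<dots> \<le> integral {x..y} (\<lambda>t. (\<eta>/2) * norm (g t))"
        proof (rule integral_norm_bound_integral)
          show "(\<lambda>t. G t - h' (f x) (g t)) integrable_on {x..y}"
            by (rule Henstock_Kurzweil_Integration.integrable_diff[OF Gi[OF xy(1,3)] hg])
          show "(\<lambda>t. (\<eta>/2) * norm (g t)) integrable_on {x..y}"
            using integrable_cmul[OF gi[OF xy(1,3)], of "\<eta>/2"] by simp
          fix t assume t: "t \<in> {x..y}"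
          have "f t = f x + (f t - f x)" by simp
          then have "f t \<in> K'" using e0(4)[OF fK fd(2)[OF t]] by metis
          then show "norm (G t - h' (f x) (g t)) \<le> (\<eta>/2) * norm (g t)"
            unfolding G_def by (rule r(2)[OF fxK _ fd(1)[OF t]])
        qed
        also have "\<dots> = (\<eta>/2) * (m y - m x)" by (simp add: m[OF xy(1-3)])
        finally show ?thesis .
      qed
      have "D y - D x = (h (f y) - h (f x) - h' (f x) (f y - f x)) - (integral {x..y} G - h' (f x) (f y - f x))"
        using D[OF xy(1-3)] by simp
      also have "norm \<dots> \<le> (\<eta>/2) * norm (f y - f x) + (\<eta>/2) * (m y - m x)"
        by (rule order_trans[OF norm_triangle_ineq4 add_mono[OF A B]])
      also have "\<dots> \<le> (\<eta>/2) * (m y - m x) + (\<eta>/2) * (m y - m x)"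
        by (rule add_right_mono[OF mult_left_mono[OF fm[OF xy(1-3)]]]) (use \<eta> in simp)
      finally show "norm (D y - D x) \<le> \<eta> * m y - \<eta> * m x" by (simp add: algebra_simps)
    qed
    then show ?thesis by (simp add: algebra_simps)
  qed
  have Dc: "D x = D a" if x: "a \<le> x" "x \<le> b" for x
  proof (rule ccontr)
    assume "D x \<noteq> D a"
    then have pos: "norm (D x - D a) > 0" by simp
    have mp: "m x - m a \<ge> 0" using fm[OF order_refl x] norm_ge_zero order_trans by blast
    \<comment> \<open>\<open>\<eta>\<close> is chosen so that the bound is at most half of the left
      side; the added 1 covers the case \<open>m x = m a\<close>.\<close>
    have "norm (D x - D a) \<le> norm (D x - D a) / (2 * (m x - m a + 1)) * (m x - m a)"
      using est[of "norm (D x - D a) / (2 * (m x - m a + 1))", OF _ order_refl x] pos mp by simp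
    also have "\<dots> \<le> norm (D x - D a) / 2" using mp pos by (simp add: field_simps)
    finally show False using pos by simp
  qed
  have "h (f x) - h (f a) = integral {a..x} G" if "a \<le> x" "x \<le> b" for x
  proof -
    have "h (f x) - h (f a) - integral {a..x} G = 0"
      unfolding D[OF order_refl that, symmetric] Dc[OF that] by (rule diff_self)
    then show ?thesis by simp
  qed
  then show ?thesis unfolding G_def[symmetric] using Ga by (intro ac_onI) auto
qed

lemma ac_on_Pair:
  fixes f :: "real \<Rightarrow> 'a::euclidean_space" and f' :: "real \<Rightarrow> 'b::euclidean_space"
  assumes "ac_on a b f g" "ac_on a b f' g'"
  shows "ac_on a b (\<lambda>x. (f x, f' x)) (\<lambda>x. (g x, g' x))"
proof -
  have 1: "bounded_linear (\<lambda>x::'a. (x, 0::'b))" and 2: "bounded_linear (\<lambda>x::'b. (0::'a, x))"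
    by (auto intro!: bounded_linear_intros bounded_linear_Pair)
  show ?thesis using ac_on_add[OF ac_on_linear[OF 1 assms(1)] ac_on_linear[OF 2 assms(2)]] by simp
qed

text \<open>The product rule is the chain rule for \<open>B\<close> on the product space, applied to
  the curve \<open>(f, f')\<close>.\<close>

lemma ac_on_bilinear:
  fixes B :: "'a::euclidean_space \<Rightarrow> 'b::euclidean_space \<Rightarrow> 'c::euclidean_space"
  assumes "bounded_bilinear B" "ac_on a b f g" "ac_on a b f' g'" "a \<le> b"
  shows "ac_on a b (\<lambda>x. B (f x) (f' x)) (\<lambda>x. B (f x) (g' x) + B (g x) (f' x))"
proof -
  interpret bounded_bilinear B by fact
  have "ac_on a b (\<lambda>t. (\<lambda>p. B (fst p) (snd p)) (f t, f' t)) (\<lambda>t. (\<lambda>p q. B (fst p) (snd q) + B (fst q) (snd p)) (f t, f' t) (g t, g' t))"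
  proof (rule ac_on_chain[OF ac_on_Pair[OF assms(2,3)] assms(4) open_UNIV])
    show "((\<lambda>p. B (fst p) (snd p)) has_derivative (\<lambda>q. B (fst y) (snd q) + B (fst q) (snd y))) (at y)" for y
      by (rule FDERIV[OF has_derivative_fst[OF has_derivative_ident] has_derivative_snd[OF has_derivative_ident]])
    show "continuous_on UNIV (\<lambda>p. B (fst p) (snd v) + B (fst v) (snd p))" for v
      by (intro continuous_intros continuous_on)
  qed auto
  then show ?thesis by simp
qed

section \<open>Weak derivatives and the Dirichlet energy\<close>

lemma integrable_lebesgue_on_iff:
  "integrable (lebesgue_on {a..b::real}) f \<longleftrightarrow> f absolutely_integrable_on {a..b}"
  by (simp add: integrable_restrict_space set_integrable_def)

lemma lebesgue_integral_Icc:
  fixes f :: "real \<Rightarrow> 'a::euclidean_space"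
  assumes "f absolutely_integrable_on {a..b}"
  shows "(LINT t|lebesgue_on {a..b}. f t) = integral {a..b} f"
  using assms by (intro lebesgue_integral_eq_integral) (auto simp: integrable_lebesgue_on_iff)

lemma absolutely_integrable_if_square:
  fixes g :: "real \<Rightarrow> 'a::euclidean_space"
  assumes "g \<in> borel_measurable (lebesgue_on {a..b})" "integrable (lebesgue_on {a..b}) (\<lambda>t. (norm (g t))\<^sup>2)"
  shows "g absolutely_integrable_on {a..b}"
proof -
  have "integrable (lebesgue_on {a..b}) (\<lambda>t. (1::real))"
    by (simp add: integrable_lebesgue_on_iff)
  then have "integrable (lebesgue_on {a..b}) (\<lambda>t. 1 + (norm (g t))\<^sup>2)"
    using assms(2) by (rule Bochner_Integration.integrable_add)
  then have "integrable (lebesgue_on {a..b}) g"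
  proof (rule Bochner_Integration.integrable_bound[OF _ assms(1)], intro AE_I2)
    fix t
    have "norm (g t) \<le> 1 + (norm (g t))\<^sup>2"
      using zero_le_power2[of "norm (g t) - 1/2"] by (simp add: power2_eq_square algebra_simps)
    then show "norm (g t) \<le> norm (1 + (norm (g t))\<^sup>2)" by simp
  qed
  then show ?thesis by (simp add: integrable_lebesgue_on_iff)
qed

lemma L2_I_iff:
  "g \<in> L2_I \<longleftrightarrow> g absolutely_integrable_on {0..1} \<and> (\<lambda>t. (norm (g t))\<^sup>2) integrable_on {0..1}"
proof
  assume "g \<in> L2_I"
  then have g: "g \<in> borel_measurable (lebesgue_on {0..1})" "integrable (lebesgue_on {0..1}) (\<lambda>t. (norm (g t))\<^sup>2)"
    by (auto simp: L2_I_def)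
  show "g absolutely_integrable_on {0..1} \<and> (\<lambda>t. (norm (g t))\<^sup>2) integrable_on {0..1}"
    using absolutely_integrable_if_square[OF g] integrable_on_lebesgue_on[OF g(2)] by simp
next
  assume g: "g absolutely_integrable_on {0..1} \<and> (\<lambda>t. (norm (g t))\<^sup>2) integrable_on {0..1}"
  then have "(\<lambda>t. (norm (g t))\<^sup>2) absolutely_integrable_on {0..1}"
    by (intro nonnegative_absolutely_integrable_1) auto
  then show "g \<in> L2_I"
    using absolutely_integrable_imp_borel_measurable[OF conjunct1[OF g]] by (simp add: L2_I_def integrable_lebesgue_on_iff)
qed

lemma regular_distr_eq_integral:
  assumes "f absolutely_integrable_on {0..1}" "continuous_on {0..1} \<phi>"
  shows "regular_distr f \<phi> = integral {0..1} (\<lambda>t. \<phi> t *\<^sub>R f t)"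
  unfolding regular_distr_def
  by (rule lebesgue_integral_Icc[OF absolutely_integrable_continuous_mult[OF bounded_bilinear_scaleR assms(2,1)]])

lemma ac_on_test_function:
  assumes "\<phi> \<in> test_functions U" "a \<le> b" shows "ac_on a b \<phi> (deriv \<phi>)"
proof (rule ac_on_C1[OF assms(2)])
  show "(\<phi> has_vector_derivative deriv \<phi> t) (at t within {a..b})" for t
    using test_functions_has_derivative[OF assms(1)] has_vector_derivative_at_within
    unfolding has_real_derivative_iff_has_vector_derivative by blast
  show "continuous_on {a..b} (deriv \<phi>)" by (rule test_functions_continuous[OF test_functions_deriv[OF assms(1)]])
qed

lemma test_functions_boundary:
  assumes "\<phi> \<in> test_functions {a<..<b}" shows "\<phi> a = 0" "\<phi> b = 0"
  using assms unfolding test_functions_def by force+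

text \<open>Integration by parts: the product of \<open>\<phi>\<close> and \<open>f\<close> has a
  density by the product rule and vanishes at both ends.\<close>

lemma ac_on_imp_has_weak_deriv:
  fixes f :: "real \<Rightarrow> 'a::euclidean_space"
  assumes ac: "ac_on 0 1 f g" and g: "(\<lambda>t. (norm (g t))\<^sup>2) integrable_on {0..1}"
  shows "has_weak_deriv f g"
  unfolding has_weak_deriv_def distr_eq_on_I_def
proof (intro conjI ballI)
  have ga: "g absolutely_integrable_on {0..1}" by (rule ac_on_absolutely_integrable[OF ac])
  show "g \<in> L2_I" using ga g by (simp add: L2_I_iff)
  fix \<phi> assume \<phi>: "\<phi> \<in> test_functions {0<..<1::real}"
  have fa: "f absolutely_integrable_on {0..1}" by (rule absolutely_integrable_continuous_real[OF ac_on_continuous[OF ac]])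
  note c\<phi> = test_functions_continuous[OF \<phi>] and c\<phi>' = test_functions_continuous[OF test_functions_deriv[OF \<phi>]]
  have "ac_on 0 1 (\<lambda>t. \<phi> t *\<^sub>R f t) (\<lambda>t. \<phi> t *\<^sub>R g t + deriv \<phi> t *\<^sub>R f t)"
    by (rule ac_on_bilinear[OF bounded_bilinear_scaleR ac_on_test_function[OF \<phi>] ac]) auto
  from ac_on_increment[OF this, of 0 1]
  have "integral {0..1} (\<lambda>t. \<phi> t *\<^sub>R g t + deriv \<phi> t *\<^sub>R f t) = 0"
    using test_functions_boundary[OF \<phi>] by simp
  moreover have "(\<lambda>t. \<phi> t *\<^sub>R g t) absolutely_integrable_on {0..1}" "(\<lambda>t. deriv \<phi> t *\<^sub>R f t) absolutely_integrable_on {0..1}"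
    by (rule absolutely_integrable_continuous_mult[OF bounded_bilinear_scaleR c\<phi> ga])
       (rule absolutely_integrable_continuous_mult[OF bounded_bilinear_scaleR c\<phi>' fa])
  ultimately have "integral {0..1} (\<lambda>t. \<phi> t *\<^sub>R g t) + integral {0..1} (\<lambda>t. deriv \<phi> t *\<^sub>R f t) = 0"
    by (simp add: Henstock_Kurzweil_Integration.integral_add set_lebesgue_integral_eq_integral(1))
  then show "distr_deriv (regular_distr f) \<phi> = regular_distr g \<phi>"
    unfolding distr_deriv_def regular_distr_eq_integral[OF fa c\<phi>'] regular_distr_eq_integral[OF ga c\<phi>]
    by (simp add: add_eq_0_iff2)
qed

lemma step_affine_has_derivative:
  "((\<lambda>x. step (r * (x - a))) has_real_derivative r * step' (r * (x - a))) (at x)"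
  by (rule DERIV_cong[OF DERIV_chain2[OF step_has_derivative]])
     (auto intro!: derivative_eq_intros)

text \<open>For large \<open>n\<close> the function \<open>n step'(n (x - a))\<close> has integral
  one over \<open>[0,1]\<close>, lives on \<open>[a, a + 1/n]\<close> and is bounded by a multiple
  of \<open>n\<close>; it averages \<open>f\<close> just to the right of \<open>a\<close>.\<close>

lemma step'_approximate_identity:
  fixes f :: "real \<Rightarrow> 'a::euclidean_space"
  assumes f: "continuous_on {0..1} f" and a: "0 < a" "a < 1"
  shows "(\<lambda>n. integral {0..1} (\<lambda>x. (real n * step' (real n * (x - a))) *\<^sub>R f x)) \<longlonglongrightarrow> f a"
proof (rule LIMSEQ_I)
  fix e :: real assume e: "e > 0"
  obtain C where C: "C > 0" "\<And>x. \<bar>step' x\<bar> \<le> C" using step'_bounded by blast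
  have "\<exists>d>0. \<forall>x\<in>{0..1}. dist x a < d \<longrightarrow> dist (f x) (f a) < e / (2 * C)"
    using f a e C(1) unfolding continuous_on_iff by (metis atLeastAtMost_iff divide_pos_pos less_imp_le mult_pos_pos zero_less_numeral)
  then obtain d where d: "d > 0" "\<And>x. x \<in> {0..1} \<Longrightarrow> \<bar>x - a\<bar> < d \<Longrightarrow> norm (f x - f a) < e / (2 * C)"
    by (auto simp: dist_norm)
  \<comment> \<open>This makes \<open>1/n\<close> smaller than both \<open>d\<close> and
    \<open>1 - a\<close>: the support stays in \<open>(0,1)\<close>, and \<open>f\<close> differs
    from \<open>f a\<close> by less than \<open>e/(2 C)\<close> on it. Height \<open>n C\<close>
    times width \<open>1/n\<close> then leaves \<open>e/2\<close>.\<close>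
  obtain n0 :: nat where n0: "1 / min d (1 - a) < real n0" using reals_Archimedean2 by blast
  show "\<exists>n0. \<forall>n\<ge>n0. norm (integral {0..1} (\<lambda>x. (real n * step' (real n * (x - a))) *\<^sub>R f x) - f a) < e"
  proof (intro exI allI impI)
    fix n assume "n \<ge> n0"
    define r where "r = real n"
    have md: "min d (1 - a) > 0" using d a by simp
    have r: "1 / min d (1 - a) < r" using n0 \<open>n \<ge> n0\<close> by (simp add: r_def)
    have r0: "r > 0" using md r by (smt (verit) divide_pos_pos)
    have rd: "1 / r < min d (1 - a)"
      using r unfolding pos_divide_less_eq[OF md] pos_divide_less_eq[OF r0] by (simp only: mult.commute)
    define \<beta> where "\<beta> x = r * step' (r * (x - a))" for x
    have \<beta>0: "\<beta> x = 0" if "x \<notin> {a..a + 1/r}" for x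
    proof -
      have "r * (x - a) \<notin> {0..1}" using that r0 by (auto simp: field_simps)
      then show ?thesis by (simp add: \<beta>_def step'_eq_0)
    qed
    have c\<beta>: "continuous_on {0..1} \<beta>" unfolding \<beta>_def
      by (intro continuous_intros continuous_on_compose2[OF step'_continuous[of UNIV]]) auto
    have "(\<beta> has_integral (step (r * (1 - a)) - step (r * (0 - a)))) {0..1}"
      unfolding \<beta>_def
      by (rule fundamental_theorem_of_calculus)
         (auto intro!: has_vector_derivative_at_within step_affine_has_derivative[unfolded has_real_derivative_iff_has_vector_derivative])
    moreover have "step (r * (1 - a)) = 1" using rd r0 a by (intro step_eq_1) (auto simp: field_simps)
    moreover have "step (r * (0 - a)) = 0" using r0 a by (intro step_eq_0) (auto simp: field_simps)
    ultimately have \<beta>1: "(\<beta> has_integral 1) {0..1}" by simp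
    have 1: "((\<lambda>x. \<beta> x *\<^sub>R f a) has_integral f a) {0..1}"
      using has_integral_scaleR_left[OF \<beta>1, of "f a"] by simp
    have 2: "(\<lambda>x. \<beta> x *\<^sub>R f x) integrable_on {0..1}"
      by (intro integrable_continuous_real continuous_intros c\<beta> f)
    have "integral {0..1} (\<lambda>x. \<beta> x *\<^sub>R f x) - f a = integral {0..1} (\<lambda>x. \<beta> x *\<^sub>R f x - \<beta> x *\<^sub>R f a)"
      using Henstock_Kurzweil_Integration.integral_diff[OF 2 has_integral_integrable[OF 1]] integral_unique[OF 1] by simp
    also have "norm \<dots> \<le> integral {0..1} (\<lambda>x. if x \<in> {a..a+1/r} then r * (e / 2) else 0)"
    proof (rule integral_norm_bound_integral)
      show "(\<lambda>x. \<beta> x *\<^sub>R f x - \<beta> x *\<^sub>R f a) integrable_on {0..1}"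
        using Henstock_Kurzweil_Integration.integrable_diff[OF 2 has_integral_integrable[OF 1]] .
      show "(\<lambda>x. if x \<in> {a..a+1/r} then r * (e / 2) else 0) integrable_on {0..1}"
        using rd a by (intro integrable_on_superset[where S="{a..a+1/r}", OF integrable_eq[OF integrable_const_ivl[of "r * (e/2)"]]]) auto
      fix x :: real assume x: "x \<in> {0..1}"
      show "norm (\<beta> x *\<^sub>R f x - \<beta> x *\<^sub>R f a) \<le> (if x \<in> {a..a+1/r} then r * (e / 2) else 0)"
      proof (cases "x \<in> {a..a+1/r}")
        case True
        have "\<bar>x - a\<bar> < d" using True rd by auto
        then have "norm (f x - f a) \<le> e / (2 * C)" using d(2)[OF x] by simp
        moreover have "\<bar>\<beta> x\<bar> \<le> r * C" unfolding \<beta>_def using C(2) r0 by (simp add: abs_mult)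
        ultimately have "\<bar>\<beta> x\<bar> * norm (f x - f a) \<le> (r * C) * (e / (2 * C))"
          by (intro mult_mono) (use r0 C in auto)
        then show ?thesis using True C(1) by (simp flip: scaleR_diff_right)
      next
        case False then show ?thesis using \<beta>0 by auto
      qed
    qed
    also have "\<dots> = integral {a..a+1/r} (\<lambda>x. r * (e/2))"
    proof -
      have "{a..a+1/r} \<inter> {0..1} = {a..a+1/r}" using rd a by auto
      then show ?thesis by (simp only: integral_restrict_Int)
    qed
    also have "\<dots> = e/2" using r0 by simp
    finally show "norm (integral {0..1} (\<lambda>x. (real n * step' (real n * (x - a))) *\<^sub>R f x) - f a) < e"
      using e by (simp add: \<beta>_def r_def)
  qed
qed

text \<open>Testing with smooth approximations of the indicator of \<open>(a,b]\<close> yields the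
  increment formula for interior \<open>a < b\<close>, because the derivatives of these test
  functions are differences of two approximate identities. Continuity of \<open>f\<close> then
  reaches the end points.\<close>

lemma has_weak_deriv_imp_ac_on:
  fixes f :: "real \<Rightarrow> 'a::euclidean_space"
  assumes f: "continuous_on {0..1} f" and w: "has_weak_deriv f g"
  shows "ac_on 0 1 f g"
proof -
  have ga: "g absolutely_integrable_on {0..1}" using w by (simp add: has_weak_deriv_def L2_I_iff)
  have gi: "g integrable_on {x..y}" if "0 \<le> x" "y \<le> 1" for x y
    using absolutely_integrable_on_subinterval[OF ga, of x y] that by (simp add: set_lebesgue_integral_eq_integral(1))
  have fa: "f absolutely_integrable_on {0..1}" by (rule absolutely_integrable_continuous_real[OF f])
  have main: "f b - f a = integral {a..b} g" if ab: "0 < a" "a < b" "b < 1" for a b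
  proof -
    define \<phi> where "\<phi> n x = step (real n * (x - a)) - step (real n * (x - b))" for n x
    define \<phi>' where "\<phi>' n x = real n * step' (real n * (x - a)) - real n * step' (real n * (x - b))" for n x
    \<comment> \<open>For \<open>n \<ge> n0\<close> the descending flank ends before 1, so the
      support \<open>[a, b + 1/n]\<close> lies in the open interval.\<close>
    obtain n0 :: nat where n0: "1 / (1 - b) < real n0" using reals_Archimedean2 by blast
    have n0': "n \<ge> n0 \<Longrightarrow> real n > 0 \<and> b + 1 / real n < 1" for n
    proof -
      assume "n \<ge> n0"
      then have "1 / (1 - b) < real n" using n0 by simp
      moreover from this have "real n > 0" using ab by (smt (verit) divide_pos_pos)
      ultimately show ?thesis using ab by (simp add: field_simps)
    qed
    have D: "(\<phi> n has_real_derivative \<phi>' n x) (at x)" for n x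
      unfolding \<phi>_def \<phi>'_def by (intro DERIV_diff step_affine_has_derivative)
    then have der: "deriv (\<phi> n) = \<phi>' n" for n by (auto intro: DERIV_imp_deriv)
    have test: "\<phi> n \<in> test_functions {0<..<1}" if "n \<ge> n0" for n
      unfolding test_functions_def mem_Collect_eq
    proof (intro conjI exI[of _ "{a..b + 1 / real n}"] allI impI)
      have "smooth_on UNIV (\<lambda>x. step (real n * x + (- real n * a)) - step (real n * x + (- real n * b)))"
        by (intro smooth_on_diff smooth_on_step_affine)
      then show "smooth_on UNIV (\<phi> n)" by (simp add: \<phi>_def[abs_def] algebra_simps)
      show "{a..b + 1 / real n} \<subseteq> {0<..<1}" using n0'[OF that] ab by auto
      fix x assume "x \<notin> {a..b + 1 / real n}"
      then consider "x < a" | "x > b + 1 / real n" by force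
      then show "\<phi> n x = 0"
      proof cases
        case 1
        then have "real n * (x - a) \<le> 0" "real n * (x - b) \<le> 0" using ab by (auto simp: mult_le_0_iff)
        then show ?thesis by (simp add: \<phi>_def step_eq_0)
      next
        case 2
        have "real n * (x - b) \<ge> 1" using 2 n0'[OF that] by (simp add: field_simps)
        moreover have "real n * (x - a) \<ge> real n * (x - b)" using ab by (intro mult_left_mono) auto
        ultimately show ?thesis by (simp add: \<phi>_def step_eq_1)
      qed
    qed simp
    have eq: "integral {0..1} (\<lambda>x. \<phi> n x *\<^sub>R g x) = - integral {0..1} (\<lambda>x. \<phi>' n x *\<^sub>R f x)" if "n \<ge> n0" for n
    proof -
      have "distr_deriv (regular_distr f) (\<phi> n) = regular_distr g (\<phi> n)"
        using w test[OF that] unfolding has_weak_deriv_def distr_eq_on_I_def by blast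
      then show ?thesis
        unfolding distr_deriv_def der regular_distr_eq_integral[OF ga test_functions_continuous[OF test[OF that]]]
          regular_distr_eq_integral[OF fa test_functions_continuous[OF test_functions_deriv[OF test[OF that]], unfolded der]]
        by simp
    qed
    have L1: "(\<lambda>n. integral {0..1} (\<lambda>x. \<phi>' n x *\<^sub>R f x)) \<longlonglongrightarrow> f a - f b"
    proof -
      have c: "continuous_on {0..1} (\<lambda>x. (real n * step' (real n * (x - c))) *\<^sub>R f x)" for n c
        by (intro continuous_intros f continuous_on_compose2[OF step'_continuous[of UNIV]]) auto
      have "integral {0..1} (\<lambda>x. \<phi>' n x *\<^sub>R f x) = integral {0..1} (\<lambda>x. (real n * step' (real n * (x - a))) *\<^sub>R f x)
          - integral {0..1} (\<lambda>x. (real n * step' (real n * (x - b))) *\<^sub>R f x)" for n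
        unfolding \<phi>'_def scaleR_diff_left
        by (intro Henstock_Kurzweil_Integration.integral_diff integrable_continuous_real c)
      then show ?thesis using ab by (auto intro!: tendsto_diff step'_approximate_identity f)
    qed
    \<comment> \<open>Dominated convergence. At \<open>x = a\<close> the ascending step is zero and
      at \<open>x = b\<close> the descending one has not begun, which is why the limit is the
      indicator of a half-open interval.\<close>
    have L2: "(\<lambda>n. integral {0..1} (\<lambda>x. \<phi> (n + n0) x *\<^sub>R g x)) \<longlonglongrightarrow> integral {0..1} (\<lambda>x. (if x \<in> {a<..b} then 1 else 0) *\<^sub>R g x)"
    proof (rule dominated_convergence(2)[where h="\<lambda>x. norm (g x)"])
      show "(\<lambda>x. \<phi> (n + n0) x *\<^sub>R g x) integrable_on {0..1}" for n
        using absolutely_integrable_continuous_mult[OF bounded_bilinear_scaleR test_functions_continuous[OF test] ga]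
        by (simp add: set_lebesgue_integral_eq_integral(1))
      show "(\<lambda>x. norm (g x)) integrable_on {0..1}" using ga unfolding absolutely_integrable_on_def by blast
      fix x :: real assume x: "x \<in> {0..1}"
      show "norm (\<phi> (n + n0) x *\<^sub>R g x) \<le> norm (g x)" for n
      proof -
        have "\<bar>\<phi> (n + n0) x\<bar> \<le> 1" unfolding \<phi>_def using step_bounds by (smt (verit))
        then show ?thesis by (simp add: mult_left_le_one_le)
      qed
      have "eventually (\<lambda>n. \<phi> (n + n0) x = (if x \<in> {a<..b} then 1 else 0)) sequentially"
      proof -
        have st: "eventually (\<lambda>n. step (real (n + n0) * (x - c)) = (if x > c then 1 else 0)) sequentially" for c
        proof (cases "x > c")
          case True
          obtain N :: nat where N: "1 / (x - c) < real N" using reals_Archimedean2 by blast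
          have "step (real (n + n0) * (x - c)) = 1" if "n \<ge> N" for n
          proof (rule step_eq_1)
            have "1 / (x - c) \<le> real (n + n0)" using N that by simp
            then show "1 \<le> real (n + n0) * (x - c)" using True by (simp add: field_simps)
          qed
          then show ?thesis using True by (auto simp: eventually_sequentially)
        next
          case False
          then have "step (real (n + n0) * (x - c)) = 0" for n by (intro step_eq_0) (simp add: mult_le_0_iff)
          then show ?thesis using False by simp
        qed
        show ?thesis using st[of a] st[of b]
          by eventually_elim (use ab in \<open>auto simp: \<phi>_def\<close>)
      qed
      then have "eventually (\<lambda>n. (if x \<in> {a<..b} then 1 else 0) *\<^sub>R g x = \<phi> (n + n0) x *\<^sub>R g x) sequentially"
        by eventually_elim simp
      then show "(\<lambda>n. \<phi> (n + n0) x *\<^sub>R g x) \<longlonglongrightarrow> (if x \<in> {a<..b} then 1 else 0) *\<^sub>R g x"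
        by (rule Lim_transform_eventually[OF tendsto_const])
    qed
    have "(\<lambda>n. integral {0..1} (\<lambda>x. \<phi> (n + n0) x *\<^sub>R g x)) \<longlonglongrightarrow> - (f a - f b)"
      using tendsto_minus[OF LIMSEQ_ignore_initial_segment[OF L1, of n0]] by (simp add: eq)
    then have "f b - f a = integral {0..1} (\<lambda>x. (if x \<in> {a<..b} then 1 else 0) *\<^sub>R g x)"
      using LIMSEQ_unique[OF L2] by simp
    also have "\<dots> = integral {0..1} (\<lambda>x. if x \<in> {a..b} then g x else 0)"
      by (rule integral_spike[of "{a}"]) auto
    also have "\<dots> = integral {a..b} g"
    proof -
      have "{a..b} \<inter> {0..1} = {a..b}" using ab by auto
      then show ?thesis by (simp only: integral_restrict_Int)
    qed
    finally show ?thesis .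
  qed
  \<comment> \<open>The defect is constant inside and continuous up to the boundary, hence constant
    on the closed interval.\<close>
  define u where "u x = f x - integral {0..x} g" for x
  have cu: "continuous_on (closure {0<..<1}) u"
    unfolding u_def using f gi[of 0 1] by (auto intro!: continuous_intros indefinite_integral_continuous_1)
  have uc: "u x = u (1/2)" if x: "x \<in> {0<..<1}" for x
  proof -
    have "u b = u a" if "0 < a" "a < b" "b < 1" for a b
      using Henstock_Kurzweil_Integration.integral_combine[of 0 a b g] gi[of 0 b] main[OF that] that
      by (simp add: u_def algebra_simps)
    then have *: "u x = u (1/2)" if "x < 1/2 \<or> 1/2 < x" using x that by force
    show ?thesis
    proof (cases "x = 1/2")
      case True show ?thesis unfolding True ..
    next
      case False
      then have "x < 1/2 \<or> 1/2 < x" by linarith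
      then show ?thesis by (rule *)
    qed
  qed
  have u: "u x = u (1/2)" if "x \<in> {0..1}" for x
    by (rule continuous_constant_on_closure[OF cu uc]) (use that in auto)
  show ?thesis
  proof (rule ac_onI[OF ga])
    fix x :: real assume "0 \<le> x" "x \<le> 1"
    then have "u x = u 0" using u[of x] u[of 0] by simp
    then show "f x - f 0 = integral {0..x} g" by (simp add: u_def algebra_simps)
  qed
qed

lemma H1_I_ac_on:
  assumes "f \<in> H1_I"
  shows "ac_on 0 1 f (weak_deriv f)" "(\<lambda>t. (norm (weak_deriv f t))\<^sup>2) integrable_on {0..1}"
    "has_weak_deriv f (weak_deriv f)"
proof -
  obtain g where "has_weak_deriv f g" using assms by (auto simp: H1_I_def)
  then show w: "has_weak_deriv f (weak_deriv f)" unfolding weak_deriv_def by (rule someI[of "has_weak_deriv f"])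
  then show "ac_on 0 1 f (weak_deriv f)" using assms by (intro has_weak_deriv_imp_ac_on) (auto simp: H1_I_def)
  show "(\<lambda>t. (norm (weak_deriv f t))\<^sup>2) integrable_on {0..1}" using w by (simp add: has_weak_deriv_def L2_I_iff)
qed

lemma ac_on_imp_H1_I:
  assumes "ac_on 0 1 f g" "(\<lambda>t. (norm (g t))\<^sup>2) integrable_on {0..1}"
  shows "f \<in> H1_I"
  using ac_on_continuous[OF assms(1)] ac_on_imp_has_weak_deriv[OF assms] by (auto simp: H1_I_def)

text \<open>\<open>weak_deriv\<close> is an arbitrary choice. As a density it is unique off a
  negligible set, so any density of \<open>f\<close> computes the energy.\<close>

lemma J1_eq:
  assumes ac: "ac_on 0 1 f g" and g: "(\<lambda>t. (norm (g t))\<^sup>2) integrable_on {0..1}"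
  shows "J1 f = integral {0..1} (\<lambda>t. (norm (g t))\<^sup>2)"
proof -
  note H = H1_I_ac_on[OF ac_on_imp_H1_I[OF assms]]
  obtain N where N: "negligible N" "\<And>x. x \<in> {0..1} - N \<Longrightarrow> g x = weak_deriv f x"
    using ac_on_unique[OF ac H(1)] by blast
  have "(\<lambda>t. (norm (weak_deriv f t))\<^sup>2) absolutely_integrable_on {0..1}"
    using H(2) by (intro nonnegative_absolutely_integrable_1) auto
  then have "J1 f = integral {0..1} (\<lambda>t. (norm (weak_deriv f t))\<^sup>2)"
    unfolding J1_def by (rule lebesgue_integral_Icc)
  also have "\<dots> = integral {0..1} (\<lambda>t. (norm (g t))\<^sup>2)"
    by (rule integral_spike[OF N(1)]) (simp add: N(2))
  finally show ?thesis .
qed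

section \<open>First variation of the energy\<close>

lemma ac_on_const: "a \<le> b \<Longrightarrow> ac_on a b (\<lambda>t. c) (\<lambda>t. 0)"
  by (rule ac_on_C1) auto

lemma ac_on_sum:
  fixes f :: "'i \<Rightarrow> real \<Rightarrow> 'a::euclidean_space"
  assumes "a \<le> b" "\<And>i. i \<in> I \<Longrightarrow> ac_on a b (f i) (g i)"
  shows "ac_on a b (\<lambda>t. \<Sum>i\<in>I. f i t) (\<lambda>t. \<Sum>i\<in>I. g i t)"
  using assms(2)
  by (induction I rule: infinite_finite_induct) (simp_all add: ac_on_const[OF assms(1)] ac_on_add)

text \<open>Pointwise expansion of the energy density of a perturbed velocity. In the constant, 1
  stems from the square of \<open>e \<eta>\<close>, \<open>2 C + C^2\<close> from the error term
  together with \<open>e^2 \<le> 1\<close>, and the factor 2 from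
  \<open>(x + y)^2 \<le> 2 (x^2 + y^2)\<close>.\<close>

lemma square_perturbation:
  fixes g \<eta> h :: "'a::real_inner"
  assumes h: "norm (h - (g + e *\<^sub>R \<eta>)) \<le> e\<^sup>2 * C * (norm g + norm \<eta>)" and "\<bar>e\<bar> \<le> 1" "C \<ge> 0"
  shows "(norm h)\<^sup>2 \<le> (norm g)\<^sup>2 + 2 * e * (g \<bullet> \<eta>) + e\<^sup>2 * (1 + 2 * (2 * C + C\<^sup>2)) * ((norm g)\<^sup>2 + (norm \<eta>)\<^sup>2)"
proof -
  define q where "q = norm g + norm \<eta>"
  define p where "p = norm (g + e *\<^sub>R \<eta>)"
  have q: "q \<ge> 0" and p: "p \<ge> 0" by (auto simp: q_def p_def)
  have e2: "e\<^sup>2 \<le> 1" "e\<^sup>2 \<ge> 0" using assms(2) by (auto simp: abs_square_le_1)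
  have pq: "p \<le> q"
  proof -
    have "norm (e *\<^sub>R \<eta>) \<le> norm \<eta>" using assms(2) by (simp add: mult_left_le_one_le)
    then show ?thesis using norm_triangle_ineq[of g "e *\<^sub>R \<eta>"] by (simp add: p_def q_def)
  qed
  have np: "norm h \<le> p + e\<^sup>2 * C * q"
    using norm_triangle_ineq[of "h - (g + e *\<^sub>R \<eta>)" "g + e *\<^sub>R \<eta>"] h by (simp add: p_def q_def)
  have "(norm h)\<^sup>2 \<le> (p + e\<^sup>2 * C * q)\<^sup>2" using np by (intro power_mono) auto
  also have "\<dots> = p\<^sup>2 + e\<^sup>2 * (2 * C * (p * q)) + e\<^sup>2 * (e\<^sup>2 * (C\<^sup>2 * q\<^sup>2))"
    by (simp add: power2_eq_square algebra_simps)
  also have "\<dots> \<le> p\<^sup>2 + e\<^sup>2 * (2 * C * (q * q)) + e\<^sup>2 * (1 * (C\<^sup>2 * q\<^sup>2))"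
    using pq q p e2 assms(3) by (intro add_mono mult_left_mono mult_right_mono) auto
  also have "\<dots> = p\<^sup>2 + e\<^sup>2 * ((2 * C + C\<^sup>2) * q\<^sup>2)" by (simp add: power2_eq_square algebra_simps)
  also have "\<dots> \<le> p\<^sup>2 + e\<^sup>2 * ((2 * C + C\<^sup>2) * (2 * ((norm g)\<^sup>2 + (norm \<eta>)\<^sup>2)))"
  proof -
    have "q\<^sup>2 \<le> 2 * ((norm g)\<^sup>2 + (norm \<eta>)\<^sup>2)"
      using zero_le_power2[of "norm g - norm \<eta>"] by (simp add: q_def power2_eq_square algebra_simps)
    then show ?thesis using assms(3) by (intro add_left_mono mult_left_mono) auto
  qed
  also have "p\<^sup>2 = (norm g)\<^sup>2 + 2 * e * (g \<bullet> \<eta>) + e\<^sup>2 * (norm \<eta>)\<^sup>2"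
    unfolding p_def power2_norm_eq_inner by (simp add: inner_add inner_commute power2_eq_square algebra_simps)
  finally have "(norm h)\<^sup>2 \<le> (norm g)\<^sup>2 + 2 * e * (g \<bullet> \<eta>) + e\<^sup>2 * (norm \<eta>)\<^sup>2
      + e\<^sup>2 * ((2 * C + C\<^sup>2) * (2 * ((norm g)\<^sup>2 + (norm \<eta>)\<^sup>2)))" .
  moreover have "e\<^sup>2 * (1 + 2 * (2 * C + C\<^sup>2)) * ((norm g)\<^sup>2 + (norm \<eta>)\<^sup>2) = e\<^sup>2 * (norm g)\<^sup>2 + e\<^sup>2 * (norm \<eta>)\<^sup>2
      + e\<^sup>2 * ((2 * C + C\<^sup>2) * (2 * ((norm g)\<^sup>2 + (norm \<eta>)\<^sup>2)))" by (simp add: algebra_simps)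
  moreover have "0 \<le> e\<^sup>2 * (norm g)\<^sup>2" by simp
  ultimately show ?thesis by linarith
qed

lemma square_integrable_inner:
  fixes g \<eta> :: "real \<Rightarrow> 'a::euclidean_space"
  assumes g: "g absolutely_integrable_on {a..b}" "(\<lambda>t. (norm (g t))\<^sup>2) integrable_on {a..b}"
    and \<eta>: "\<eta> absolutely_integrable_on {a..b}" "(\<lambda>t. (norm (\<eta> t))\<^sup>2) integrable_on {a..b}"
  shows "(\<lambda>t. g t \<bullet> \<eta> t) integrable_on {a..b}"
proof (rule measurable_bounded_by_integrable_imp_integrable[where g="\<lambda>t. (norm (g t))\<^sup>2 + (norm (\<eta> t))\<^sup>2"])
  show "(\<lambda>t. g t \<bullet> \<eta> t) \<in> borel_measurable (lebesgue_on {a..b})"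
    using absolutely_integrable_imp_borel_measurable[OF g(1)] absolutely_integrable_imp_borel_measurable[OF \<eta>(1)]
    by (intro borel_measurable_inner) auto
  show "(\<lambda>t. (norm (g t))\<^sup>2 + (norm (\<eta> t))\<^sup>2) integrable_on {a..b}"
    using g(2) \<eta>(2) by (rule Henstock_Kurzweil_Integration.integrable_add)
  show "norm (g t \<bullet> \<eta> t) \<le> (norm (g t))\<^sup>2 + (norm (\<eta> t))\<^sup>2" for t
  proof -
    have "norm (g t \<bullet> \<eta> t) \<le> norm (g t) * norm (\<eta> t)" by (simp add: Cauchy_Schwarz_ineq2)
    also have "\<dots> \<le> (norm (g t))\<^sup>2 + (norm (\<eta> t))\<^sup>2"
      using zero_le_power2[of "norm (g t) - norm (\<eta> t)", unfolded power2_diff]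
        mult_nonneg_nonneg[OF norm_ge_zero[of "g t"] norm_ge_zero[of "\<eta> t"]] by linarith
    finally show ?thesis .
  qed
qed auto

text \<open>The velocity of the varied curve is
  \<open>Dr(\<gamma> + e \<psi>)(g + e \<eta>)\<close>. Taylor expansion at \<open>\<gamma>\<close>
  gives \<open>Dr(\<gamma>) g + e (D^2 r(\<gamma>)(g, \<psi>) + Dr(\<gamma>) \<eta>)\<close> plus
  second order terms. Differentiating \<open>r(\<gamma>) = \<gamma>\<close> turns the first summand
  into \<open>g\<close>, and differentiating \<open>Dr(\<gamma>) \<psi> = \<psi>\<close> turns the
  bracket into \<open>\<eta>\<close>, so the first order term of the energy is \<open>2 e\<close>
  times the integral of \<open>g \<bullet> \<eta>\<close>.\<close>

lemma energy_variation:
  fixes r :: "'a::euclidean_space \<Rightarrow> 'a" and \<gamma> g \<psi> \<eta> :: "real \<Rightarrow> 'a"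
  assumes U: "open U" and r: "\<And>k. Ck_on k U r" and ab: "a \<le> b"
    and \<gamma>: "ac_on a b \<gamma> g" "(\<lambda>t. (norm (g t))\<^sup>2) integrable_on {a..b}"
    and \<psi>: "ac_on a b \<psi> \<eta>" "(\<lambda>t. (norm (\<eta> t))\<^sup>2) integrable_on {a..b}"
    and \<gamma>U: "\<And>t. t \<in> {a..b} \<Longrightarrow> \<gamma> t \<in> U" and r\<gamma>: "\<And>t. t \<in> {a..b} \<Longrightarrow> r (\<gamma> t) = \<gamma> t"
    and tan: "\<And>t. t \<in> {a..b} \<Longrightarrow> frechet_derivative r (at (\<gamma> t)) (\<psi> t) = \<psi> t"
  shows "\<exists>e0>0. \<exists>C\<ge>0. \<forall>e. \<bar>e\<bar> \<le> e0 \<longrightarrow> (\<forall>t\<in>{a..b}. \<gamma> t + e *\<^sub>R \<psi> t \<in> U) \<and>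
    (\<exists>h. ac_on a b (\<lambda>t. r (\<gamma> t + e *\<^sub>R \<psi> t)) h \<and> (\<lambda>t. (norm (h t))\<^sup>2) integrable_on {a..b} \<and>
       integral {a..b} (\<lambda>t. (norm (h t))\<^sup>2) \<le> integral {a..b} (\<lambda>t. (norm (g t))\<^sup>2)
         + 2 * e * integral {a..b} (\<lambda>t. g t \<bullet> \<eta> t) + C * e\<^sup>2)"
proof -
  let ?D = "frechet_derivative r"
  let ?D2 = "\<lambda>x u v. frechet_derivative (\<lambda>z. ?D (at z) u) (at x) v"
  have r3: "Ck_on (Suc (Suc (Suc 0))) U r" and r2: "Ck_on (Suc (Suc 0)) U r" and r1: "Ck_on (Suc 0) U r" by (rule r)+
  have hd: "(r has_derivative ?D (at x)) (at x)" if "x \<in> U" for x by (rule Ck_on_has_derivative[OF r1 that])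
  have D1: "Ck_on (Suc 0) U (\<lambda>x. ?D (at x) v)" for v using r2 by simp
  have hd2: "((\<lambda>x. ?D (at x) v) has_derivative ?D2 x v) (at x)" if "x \<in> U" for x v
    by (rule Ck_on_has_derivative[OF D1 that])
  have cD: "continuous_on U (\<lambda>x. ?D (at x) v)" for v by (rule Ck_on_continuous[OF D1])
  have cD2: "continuous_on U (\<lambda>x. ?D2 x v w)" for v w using D1[of v] by simp
  have lin: "linear (?D (at x))" if "x \<in> U" for x using hd[OF that] has_derivative_linear by blast
  have ac_r: "ac_on a b (\<lambda>t. r (\<gamma> t)) (\<lambda>t. ?D (at (\<gamma> t)) (g t))"
    by (rule ac_on_chain[OF \<gamma>(1) ab U \<gamma>U hd cD])
  have "ac_on a b \<gamma> (\<lambda>t. ?D (at (\<gamma> t)) (g t))"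
    by (rule ac_on_cong[OF ac_r _ negligible_empty]) (simp_all add: r\<gamma>)
  from ac_on_unique[OF \<gamma>(1) this]
  obtain N1 where N1: "negligible N1" "\<And>t. t \<in> {a..b} - N1 \<Longrightarrow> g t = ?D (at (\<gamma> t)) (g t)" by blast
  have ac_D: "ac_on a b (\<lambda>t. ?D (at (\<gamma> t)) v) (\<lambda>t. ?D2 (\<gamma> t) v (g t))" for v
    by (rule ac_on_chain[OF \<gamma>(1) ab U \<gamma>U hd2 cD2])
  have ac_D\<psi>: "ac_on a b (\<lambda>t. \<Sum>e\<in>Basis. (\<psi> t \<bullet> e) *\<^sub>R ?D (at (\<gamma> t)) e)
      (\<lambda>t. \<Sum>e\<in>Basis. (\<psi> t \<bullet> e) *\<^sub>R ?D2 (\<gamma> t) e (g t) + (\<eta> t \<bullet> e) *\<^sub>R ?D (at (\<gamma> t)) e)"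
    by (intro ac_on_sum[OF ab] ac_on_bilinear[OF bounded_bilinear_scaleR ac_on_linear[OF bounded_linear_inner_left \<psi>(1)] ac_D ab])
  have "ac_on a b \<psi> (\<lambda>t. ?D2 (\<gamma> t) (g t) (\<psi> t) + ?D (at (\<gamma> t)) (\<eta> t))"
  proof (rule ac_on_cong[OF ac_D\<psi> _ negligible_empty])
    fix t assume t: "t \<in> {a..b}"
    show "\<psi> t = (\<Sum>e\<in>Basis. (\<psi> t \<bullet> e) *\<^sub>R ?D (at (\<gamma> t)) e)"
      using linear_basis_expand[OF lin[OF \<gamma>U[OF t]], of "\<psi> t"] tan[OF t] by simp
  next
    fix t assume "t \<in> {a..b} - {}"
    then have t: "\<gamma> t \<in> U" using \<gamma>U by simp
    \<comment> \<open>The product rule differentiates \<open>Dr\<close> along \<open>g\<close> and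
      applies it to \<open>\<psi>\<close>, while the Taylor expansion moves along
      \<open>\<psi>\<close> and applies to \<open>g\<close>; symmetry of the second derivative
      reconciles the two.\<close>
    have "?D2 (\<gamma> t) (g t) (\<psi> t) = ?D2 (\<gamma> t) (\<psi> t) (g t)"
      by (rule Ck_on_second_derivative_commute[OF U t r])
    also have "\<dots> = (\<Sum>e\<in>Basis. (\<psi> t \<bullet> e) *\<^sub>R ?D2 (\<gamma> t) e (g t))"
      by (rule second_derivative_basis_expand[OF U t r2])
    finally show "?D2 (\<gamma> t) (g t) (\<psi> t) + ?D (at (\<gamma> t)) (\<eta> t) =
      (\<Sum>e\<in>Basis. (\<psi> t \<bullet> e) *\<^sub>R ?D2 (\<gamma> t) e (g t) + (\<eta> t \<bullet> e) *\<^sub>R ?D (at (\<gamma> t)) e)"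
      using linear_basis_expand[OF lin[OF t], of "\<eta> t"] by (simp only: sum.distrib)
  qed
  from ac_on_unique[OF \<psi>(1) this]
  obtain N2 where N2: "negligible N2"
    "\<And>t. t \<in> {a..b} - N2 \<Longrightarrow> \<eta> t = ?D2 (\<gamma> t) (g t) (\<psi> t) + ?D (at (\<gamma> t)) (\<eta> t)" by blast
  define N where "N = N1 \<union> N2"
  have N: "negligible N" using N1 N2 by (simp add: N_def)
  define K where "K = \<gamma> ` {a..b}"
  have K: "compact K" "K \<subseteq> U"
    using ac_on_continuous[OF \<gamma>(1)] \<gamma>U by (auto simp: K_def compact_continuous_image)
  obtain d K' where d: "d > 0" "compact K'" "K' \<subseteq> U" "\<And>x y. x \<in> K \<Longrightarrow> norm y \<le> d \<Longrightarrow> x + y \<in> K'"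
    by (rule compact_open_tube[OF K(1) U K(2)]) blast
  have "bounded (\<psi> ` {a..b})"
    using ac_on_continuous[OF \<psi>(1)] compact_continuous_image compact_imp_bounded by blast
  then obtain P where P: "P > 0" "\<And>t. t \<in> {a..b} \<Longrightarrow> norm (\<psi> t) \<le> P"
    unfolding bounded_pos by auto
  obtain C1 where C1: "C1 \<ge> 0" "\<And>x y v. (\<And>s. s \<in> {0..1} \<Longrightarrow> x + s *\<^sub>R y \<in> K') \<Longrightarrow>
     norm (?D (at (x + y)) v - ?D (at x) v - ?D2 x v y) \<le> C1 * norm v * (norm y * norm y)"
    using Ck_on_derivative_taylor_segment[OF U r3 d(2,3)] by blast
  obtain C2 where C2: "C2 \<ge> 0" "\<And>x y v. (\<And>s. s \<in> {0..1} \<Longrightarrow> x + s *\<^sub>R y \<in> K') \<Longrightarrow>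
     norm (?D (at (x + y)) v - ?D (at x) v) \<le> C2 * norm v * norm y"
    using Ck_on_derivative_lipschitz_segment[OF r2 d(2,3)] by blast
  \<comment> \<open>\<open>C1 P^2\<close> bounds the Taylor remainder applied to \<open>g\<close>,
    and \<open>C2 P\<close> the change of \<open>Dr\<close> applied to
    \<open>e \<eta>\<close>.\<close>
  define C where "C = C1 * P\<^sup>2 + C2 * P"
  have C: "C \<ge> 0" using C1 C2 P by (simp add: C_def)
  define C' where "C' = 1 + 2 * (2 * C + C\<^sup>2)"
  have C': "C' \<ge> 0" using C by (simp add: C'_def)
  note ga = ac_on_absolutely_integrable[OF \<gamma>(1)] and \<eta>a = ac_on_absolutely_integrable[OF \<psi>(1)]
  have gi: "(\<lambda>t. g t \<bullet> \<eta> t) integrable_on {a..b}" by (rule square_integrable_inner[OF ga \<gamma>(2) \<eta>a \<psi>(2)])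
  define E where "E = integral {a..b} (\<lambda>t. (norm (g t))\<^sup>2) + integral {a..b} (\<lambda>t. (norm (\<eta> t))\<^sup>2)"
  have E: "E \<ge> 0" unfolding E_def by (intro add_nonneg_nonneg Henstock_Kurzweil_Integration.integral_nonneg \<gamma> \<psi>) auto
  \<comment> \<open>\<open>d / P\<close> keeps the displacement \<open>e \<psi>\<close> within the
    tube of radius \<open>d\<close>; the bound 1 is the smallness required by
    \<open>square_perturbation\<close>.\<close>
  define e0 where "e0 = min 1 (d / P)"
  show ?thesis
  proof (rule exI[of _ e0], intro exI[of _ "C' * E"] conjI allI impI ballI)
    show "e0 > 0" using d P by (simp add: e0_def)
    show "0 \<le> C' * E" using C' E by simp
    fix e assume e: "\<bar>e\<bar> \<le> e0"
    have e1: "\<bar>e\<bar> \<le> 1" and eP: "\<bar>e\<bar> * P \<le> d" using e P by (auto simp: e0_def pos_le_divide_eq)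
    have small: "norm (s *\<^sub>R e *\<^sub>R \<psi> t) \<le> d" if "t \<in> {a..b}" "s \<in> {0..1}" for s t
    proof -
      have "norm (s *\<^sub>R e *\<^sub>R \<psi> t) \<le> norm (e *\<^sub>R \<psi> t)"
        unfolding norm_scaleR[of s] by (rule mult_left_le_one_le) (use that in auto)
      also have "\<dots> \<le> \<bar>e\<bar> * P" using P(2)[OF that(1)] by (simp add: mult_left_mono)
      finally show ?thesis using eP by simp
    qed
    have seg: "\<gamma> t + s *\<^sub>R e *\<^sub>R \<psi> t \<in> K'" if "t \<in> {a..b}" "s \<in> {0..1}" for s t
      by (rule d(4)[OF _ small[OF that]]) (use that in \<open>auto simp: K_def\<close>)
    have inU: "\<gamma> t + e *\<^sub>R \<psi> t \<in> U" if "t \<in> {a..b}" for t using seg[OF that, of 1] d(3) by auto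
    show "t \<in> {a..b} \<Longrightarrow> \<gamma> t + e *\<^sub>R \<psi> t \<in> U" for t by (rule inU)
    \<comment> \<open>On the exceptional set the density is reset to zero, so that the bound by
      \<open>R\<close> holds at every point of the interval.\<close>
    define h where "h t = (if t \<in> N then 0 else ?D (at (\<gamma> t + e *\<^sub>R \<psi> t)) (g t + e *\<^sub>R \<eta> t))" for t
    have "ac_on a b (\<lambda>t. \<gamma> t + e *\<^sub>R \<psi> t) (\<lambda>t. g t + e *\<^sub>R \<eta> t)"
      by (rule ac_on_add[OF \<gamma>(1) ac_on_linear[OF bounded_linear_scaleR_right \<psi>(1)]])
    from ac_on_chain[OF this ab U inU hd cD]
    have ach: "ac_on a b (\<lambda>t. r (\<gamma> t + e *\<^sub>R \<psi> t)) h"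
      by (rule ac_on_cong[OF _ _ N]) (auto simp: h_def)
    define R where "R t = ((norm (g t))\<^sup>2 + 2 * e * (g t \<bullet> \<eta> t)) + (e\<^sup>2 * C') * ((norm (g t))\<^sup>2 + (norm (\<eta> t))\<^sup>2)" for t
    have hR: "(norm (h t))\<^sup>2 \<le> R t" if t: "t \<in> {a..b}" for t
    proof (cases "t \<in> N")
      case False
      have tU: "\<gamma> t \<in> U" by (rule \<gamma>U[OF t])
      have g: "?D (at (\<gamma> t)) (g t) = g t" using N1(2)[of t] t False by (simp add: N_def)
      have \<eta>: "\<eta> t = ?D2 (\<gamma> t) (g t) (\<psi> t) + ?D (at (\<gamma> t)) (\<eta> t)" using N2(2)[of t] t False by (simp add: N_def)
      have lin2: "linear (?D2 (\<gamma> t) (g t))" using hd2[OF tU] has_derivative_linear by blast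
      have "h t = ?D (at (\<gamma> t + e *\<^sub>R \<psi> t)) (g t) + e *\<^sub>R ?D (at (\<gamma> t + e *\<^sub>R \<psi> t)) (\<eta> t)"
        using False lin[OF inU[OF t]] by (simp add: h_def linear_add linear_scale)
      moreover have "g t + e *\<^sub>R \<eta> t = ?D (at (\<gamma> t)) (g t) + ?D2 (\<gamma> t) (g t) (e *\<^sub>R \<psi> t) + e *\<^sub>R ?D (at (\<gamma> t)) (\<eta> t)"
      proof -
        have "e *\<^sub>R \<eta> t = e *\<^sub>R ?D2 (\<gamma> t) (g t) (\<psi> t) + e *\<^sub>R ?D (at (\<gamma> t)) (\<eta> t)"
          using arg_cong[OF \<eta>, of "\<lambda>x. e *\<^sub>R x"] by (simp only: scaleR_add_right)
        then show ?thesis by (simp only: g linear_scale[OF lin2] add.assoc)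
      qed
      ultimately have "h t - (g t + e *\<^sub>R \<eta> t) =
          (?D (at (\<gamma> t + e *\<^sub>R \<psi> t)) (g t) - ?D (at (\<gamma> t)) (g t) - ?D2 (\<gamma> t) (g t) (e *\<^sub>R \<psi> t))
          + e *\<^sub>R (?D (at (\<gamma> t + e *\<^sub>R \<psi> t)) (\<eta> t) - ?D (at (\<gamma> t)) (\<eta> t))"
        by (simp add: algebra_simps)
      also have "norm \<dots> \<le> C1 * norm (g t) * (norm (e *\<^sub>R \<psi> t) * norm (e *\<^sub>R \<psi> t)) + \<bar>e\<bar> * (C2 * norm (\<eta> t) * norm (e *\<^sub>R \<psi> t))"
        unfolding norm_scaleR[of e "_ - _", symmetric]
        by (rule order_trans[OF norm_triangle_ineq add_mono])
           (use C1(2)[OF seg[OF t]] C2(2)[OF seg[OF t], THEN mult_left_mono[where c="\<bar>e\<bar>"]] in auto)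
      also have "\<dots> \<le> C1 * norm (g t) * ((\<bar>e\<bar> * P) * (\<bar>e\<bar> * P)) + \<bar>e\<bar> * (C2 * norm (\<eta> t) * (\<bar>e\<bar> * P))"
        using P(2)[OF t] P(1) C1(1) C2(1) by (intro add_mono mult_left_mono mult_mono) (auto intro!: mult_nonneg_nonneg mult_left_mono)
      also have "\<dots> = e\<^sup>2 * ((C1 * P\<^sup>2) * norm (g t) + (C2 * P) * norm (\<eta> t))"
        by (simp add: power2_eq_square algebra_simps flip: abs_mult)
      also have "\<dots> \<le> e\<^sup>2 * (C * norm (g t) + C * norm (\<eta> t))"
        using C1(1) C2(1) P(1) by (intro mult_left_mono add_mono mult_right_mono) (auto simp: C_def)
      finally have "norm (h t - (g t + e *\<^sub>R \<eta> t)) \<le> e\<^sup>2 * C * (norm (g t) + norm (\<eta> t))" by (simp add: algebra_simps)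
      from square_perturbation[OF this e1 C] show ?thesis by (simp add: R_def C'_def)
    next
      case True
      have "0 \<le> (norm (g t + e *\<^sub>R \<eta> t))\<^sup>2" by simp
      also have "\<dots> = (norm (g t))\<^sup>2 + 2 * e * (g t \<bullet> \<eta> t) + e\<^sup>2 * (norm (\<eta> t))\<^sup>2"
        unfolding power2_norm_eq_inner by (simp add: inner_add inner_commute power2_eq_square algebra_simps)
      also have "\<dots> \<le> R t"
      proof -
        have "e\<^sup>2 * 1 * (norm (\<eta> t))\<^sup>2 \<le> (e\<^sup>2 * C') * ((norm (g t))\<^sup>2 + (norm (\<eta> t))\<^sup>2)"
          using C by (intro mult_mono) (auto simp: C'_def)
        then show ?thesis by (simp add: R_def)
      qed
      finally show ?thesis using True by (simp add: h_def)
    qed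
    have Rint: "(R has_integral (integral {a..b} (\<lambda>t. (norm (g t))\<^sup>2) + 2 * e * integral {a..b} (\<lambda>t. g t \<bullet> \<eta> t)) + (e\<^sup>2 * C') * E) {a..b}"
      unfolding R_def E_def
      by (intro has_integral_add has_integral_mult_right integrable_integral \<gamma> \<psi> gi)
    have hi: "(\<lambda>t. (norm (h t))\<^sup>2) integrable_on {a..b}"
    proof (rule measurable_bounded_by_integrable_imp_integrable[where g=R])
      have [measurable]: "h \<in> borel_measurable (lebesgue_on {a..b})"
        using absolutely_integrable_imp_borel_measurable[OF ac_on_absolutely_integrable[OF ach]] by simp
      show "(\<lambda>t. (norm (h t))\<^sup>2) \<in> borel_measurable (lebesgue_on {a..b})" by measurable
      show "R integrable_on {a..b}" using Rint by blast
    qed (use hR in auto)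
    have "integral {a..b} (\<lambda>t. (norm (h t))\<^sup>2) \<le> integral {a..b} R"
      by (rule integral_le[OF hi _ hR]) (use Rint in auto)
    then show "\<exists>h. ac_on a b (\<lambda>t. r (\<gamma> t + e *\<^sub>R \<psi> t)) h \<and> (\<lambda>t. (norm (h t))\<^sup>2) integrable_on {a..b} \<and>
       integral {a..b} (\<lambda>t. (norm (h t))\<^sup>2) \<le> integral {a..b} (\<lambda>t. (norm (g t))\<^sup>2)
         + 2 * e * integral {a..b} (\<lambda>t. g t \<bullet> \<eta> t) + C' * E * e\<^sup>2"
      using ach hi integral_unique[OF Rint] by (intro exI[of _ h]) (simp add: algebra_simps)
  qed
qed

section \<open>Tangent spaces, local retractions and the second fundamental form\<close>

text \<open>A smooth retraction of an open set onto its intersection with \<open>M\<close>. Asking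
  that \<open>r\<close> map \<open>U\<close> into itself makes \<open>r\<close> idempotent and gives
  sense to \<open>Dr(r x)\<close> for every \<open>x\<close> in \<open>U\<close>.\<close>

locale tube =
  fixes M U :: "'a::euclidean_space set" and r :: "'a \<Rightarrow> 'a"
  assumes open_U: "open U" and r_smooth: "\<And>k. Ck_on k U r"
    and r_in_M: "x \<in> U \<Longrightarrow> r x \<in> M" and r_in_U: "x \<in> U \<Longrightarrow> r x \<in> U"
    and r_fixes: "q \<in> M \<Longrightarrow> q \<in> U \<Longrightarrow> r q = q"
begin

definition "B q = frechet_derivative r (at q)"

lemma r_has_derivative: "x \<in> U \<Longrightarrow> (r has_derivative B x) (at x)"
  unfolding B_def by (rule Ck_on_has_derivative[OF r_smooth])

lemma linear_B: "x \<in> U \<Longrightarrow> linear (B x)"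
  using r_has_derivative has_derivative_linear by blast

lemma r_continuous: "continuous_on U r"
  by (rule Ck_on_continuous[OF r_smooth[of 0]])

text \<open>Both sides of \<open>r (c t) = c t\<close>, valid while \<open>c\<close> stays in
  \<open>U\<close>, are differentiated at \<open>s\<close>. The derivative is taken within
  \<open>S\<close> so that end points of intervals are covered.\<close>

lemma B_fixes_velocity:
  assumes c: "(c has_vector_derivative v) (at s within S)" and "c ` S \<subseteq> M" "s \<in> S" "c s \<in> U"
    and S: "at s within S \<noteq> bot"
  shows "B (c s) v = v"
proof -
  have cont: "(c \<longlongrightarrow> c s) (at s within S)"
    using has_vector_derivative_continuous[OF c] by (simp add: continuous_within)
  have ev: "\<forall>\<^sub>F t in at s within S. r (c t) = c t"
  proof -
    have "\<forall>\<^sub>F t in at s within S. c t \<in> U" using topological_tendstoD[OF cont open_U assms(4)] .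
    moreover have "\<forall>\<^sub>F t in at s within S. t \<in> S" by (simp add: eventually_at_filter)
    ultimately show ?thesis by eventually_elim (rule r_fixes[OF subsetD[OF assms(2) imageI]])
  qed
  have "((\<lambda>t. r (c t)) has_derivative (\<lambda>h. B (c s) (h *\<^sub>R v))) (at s within S)"
    using diff_chain_within[OF c[unfolded has_vector_derivative_def] has_derivative_at_withinI[OF r_has_derivative[OF assms(4)]]]
    by (simp add: o_def)
  then have "((\<lambda>t. r (c t)) has_vector_derivative B (c s) v) (at s within S)"
    using linear_B[OF assms(4)] by (simp add: has_vector_derivative_def linear_scale)
  then have "(c has_vector_derivative B (c s) v) (at s within S)"
    unfolding has_vector_derivative_def
    by (rule has_derivative_transform_eventually[OF _ ev])
       (simp_all add: r_fixes[OF subsetD[OF assms(2) imageI[OF assms(3)]] assms(4)] assms(3))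
  then show ?thesis by (rule vector_derivative_unique_within[OF S _ c])
qed

text \<open>Tangency becomes a linear equation: a curve in \<open>M\<close> is fixed by
  \<open>r\<close>, so its velocity is fixed by \<open>B q\<close>; conversely
  \<open>t \<mapsto> r (q + t v)\<close> is a curve in \<open>M\<close> with velocity
  \<open>B q v = v\<close>.\<close>

lemma tangent_iff:
  assumes q: "q \<in> M" "q \<in> U"
  shows "v \<in> tangent_space M q \<longleftrightarrow> B q v = v"
proof
  assume "v \<in> tangent_space M q"
  then obtain c e where c: "0 < e" "c ` {-e<..<e} \<subseteq> M" "c 0 = q" "(c has_vector_derivative v) (at (0::real))"
    unfolding tangent_space_def by blast
  have "B (c 0) v = v"
  proof (rule B_fixes_velocity[OF has_vector_derivative_at_within[OF c(4)] c(2)])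
    show "at 0 within {-e<..<e} \<noteq> bot" using c(1) by (simp add: at_within_open[of 0 "{-e<..<e}"])
  qed (use c(1,3) q(2) in simp_all)
  then show "B q v = v" using c(3) by simp
next
  assume v: "B q v = v"
  obtain d where d: "d > 0" "ball q d \<subseteq> U" using open_U q(2) open_contains_ball by blast
  define e where "e = d / (norm v + 1)"
  have e: "e > 0" using d by (simp add: e_def add_nonneg_pos)
  have inU: "q + t *\<^sub>R v \<in> U" if "t \<in> {-e<..<e}" for t
  proof -
    have "\<bar>t\<bar> * norm v \<le> e * norm v" using that by (intro mult_right_mono) auto
    also have "\<dots> < e * (norm v + 1)" using e by simp
    also have "\<dots> = d" using add_nonneg_pos[OF norm_ge_zero[of v] zero_less_one] by (simp add: e_def)
    finally have "q + t *\<^sub>R v \<in> ball q d" by (simp add: dist_norm)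
    then show ?thesis using d by blast
  qed
  have "smooth_on {-e<..<e} (\<lambda>t. r (q + t *\<^sub>R v))"
  proof (rule smooth_on_compose[where g=r and f="\<lambda>t. q + t *\<^sub>R v" and T=U])
    show "smooth_on {-e<..<e} (\<lambda>t. q + t *\<^sub>R v)"
      by (rule smooth_on_add[OF smooth_on_const smooth_on_scaleR[OF smooth_on_id smooth_on_const]])
    show "smooth_on U r" by (rule smooth_onI[OF open_U r_smooth])
  qed (rule image_subsetI[OF inU])
  moreover have "((\<lambda>t. r (q + t *\<^sub>R v)) has_vector_derivative v) (at 0)"
    using has_derivative_along_line[of r "B q" q 0 v UNIV] r_has_derivative[OF q(2)] v by simp
  ultimately show "v \<in> tangent_space M q" unfolding tangent_space_def
    using e r_in_M[OF inU] r_fixes[OF q]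
    by (intro CollectI exI[of _ "\<lambda>t. r (q + t *\<^sub>R v)"] exI[of _ e] conjI image_subsetI) simp_all
qed

text \<open>Differentiating \<open>r (r x) = r x\<close> at the fixed point \<open>q\<close> shows
  that \<open>B q\<close> is idempotent.\<close>

lemma B_tangent: assumes q: "q \<in> M" "q \<in> U" shows "B q v \<in> tangent_space M q"
proof -
  have 1: "((\<lambda>x. r (r x)) has_derivative (\<lambda>v. B q (B q v))) (at q)"
    using diff_chain_at[OF r_has_derivative[OF q(2)], of r "B q"] r_has_derivative[OF q(2)] r_fixes[OF q] by (simp add: o_def)
  have "(r has_derivative (\<lambda>v. B q (B q v))) (at q)"
    by (rule has_derivative_transform_within_open[OF 1 open_U q(2)]) (simp add: r_fixes r_in_M r_in_U)
  then have "B q = (\<lambda>v. B q (B q v))" by (rule has_derivative_unique[OF r_has_derivative[OF q(2)]])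
  from fun_cong[OF this, of v] show ?thesis unfolding tangent_iff[OF q] by (rule sym)
qed

lemma subspace_tangent: assumes q: "q \<in> M" "q \<in> U" shows "subspace (tangent_space M q)"
proof -
  have "tangent_space M q = range (B q)"
  proof
    show "tangent_space M q \<subseteq> range (B q)"
    proof
      fix v assume "v \<in> tangent_space M q"
      then have "v = B q v" unfolding tangent_iff[OF q] by (rule sym)
      then show "v \<in> range (B q)" by (rule range_eqI)
    qed
    show "range (B q) \<subseteq> tangent_space M q" by (rule image_subsetI) (rule B_tangent[OF q])
  qed
  then show ?thesis using linear_B[OF q(2)] linear_subspace_image subspace_UNIV by metis
qed

end

lemma closest_point_subspace:
  fixes S :: "'a::euclidean_space set"
  assumes "subspace S"
  shows "closest_point S e \<in> S" "y \<in> S \<Longrightarrow> (e - closest_point S e) \<bullet> y = 0"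
proof -
  have S: "closed S" "S \<noteq> {}" "convex S"
    using closed_subspace[OF assms] subspace_0[OF assms] subspace_imp_convex[OF assms] by auto
  let ?p = "closest_point S e"
  show p: "?p \<in> S" by (rule closest_point_in_set[OF S(1,2)])
  have le: "(e - ?p) \<bullet> z \<le> 0" if "z \<in> S" for z
  proof -
    have "(e - ?p) \<bullet> (?p + z - ?p) \<le> 0"
      by (rule any_closest_point_dot[OF S(3,1) p]) (use that p subspace_add[OF assms] closest_point_le[OF S(1)] in auto)
    then show ?thesis by simp
  qed
  assume "y \<in> S"
  then show "(e - ?p) \<bullet> y = 0" using le[of y] le[of "- y"] subspace_neg[OF assms] by force
qed

lemma closest_point_subspace_eqI:
  fixes S :: "'a::euclidean_space set"
  assumes "subspace S" "x \<in> S" "\<And>y. y \<in> S \<Longrightarrow> (e - x) \<bullet> y = 0"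
  shows "closest_point S e = x"
proof -
  let ?p = "closest_point S e"
  have d: "?p - x \<in> S" using subspace_diff[OF assms(1) closest_point_subspace(1)[OF assms(1)] assms(2)] .
  have "(?p - x) \<bullet> (?p - x) = (e - x) \<bullet> (?p - x) - (e - ?p) \<bullet> (?p - x)" by (simp add: inner_diff_left)
  also have "\<dots> = 0" using assms(3)[OF d] closest_point_subspace(2)[OF assms(1) d] by simp
  finally show ?thesis by simp
qed

lemma closest_point_orthogonal_comp:
  fixes S :: "'a::euclidean_space set"
  assumes "subspace S"
  shows "closest_point (S\<^sup>\<bottom>) e = e - closest_point S e"
proof (rule closest_point_subspace_eqI[OF subspace_orthogonal_comp])
  show "e - closest_point S e \<in> S\<^sup>\<bottom>"
    using closest_point_subspace(2)[OF assms] by (auto simp: orthogonal_comp_def orthogonal_def inner_commute)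
  show "(e - (e - closest_point S e)) \<bullet> y = 0" if "y \<in> S\<^sup>\<bottom>" for y
    using that closest_point_subspace(1)[OF assms] by (auto simp: orthogonal_comp_def orthogonal_def inner_commute)
qed

lemma orthogonal_compD: "x \<in> S\<^sup>\<bottom> \<Longrightarrow> y \<in> S \<Longrightarrow> x \<bullet> y = 0"
  by (auto simp: orthogonal_comp_def orthogonal_def inner_commute)

lemma linear_closest_point_subspace:
  fixes S :: "'a::euclidean_space set"
  assumes "subspace S" shows "linear (closest_point S)"
proof (rule linearI)
  note c = closest_point_subspace[OF assms]
  show "closest_point S (x + y) = closest_point S x + closest_point S y" for x y
  proof (rule closest_point_subspace_eqI[OF assms subspace_add[OF assms c(1) c(1)]])
    fix z assume z: "z \<in> S"
    show "(x + y - (closest_point S x + closest_point S y)) \<bullet> z = 0"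
      using c(2)[OF z, of x] c(2)[OF z, of y] by (simp add: inner_diff_left inner_add_left)
  qed
  show "closest_point S (k *\<^sub>R x) = k *\<^sub>R closest_point S x" for k x
  proof (rule closest_point_subspace_eqI[OF assms subspace_scale[OF assms c(1)]])
    fix z assume z: "z \<in> S"
    show "(k *\<^sub>R x - k *\<^sub>R closest_point S x) \<bullet> z = 0"
      using c(2)[OF z, of x] by (simp flip: scaleR_diff_right)
  qed
qed

text \<open>A product rule for an operator \<open>P x\<close> whose differentiability is known
  vector by vector; the moving argument is expanded in the basis.\<close>

lemma has_derivative_linear_apply:
  fixes P :: "'a::euclidean_space \<Rightarrow> 'b::euclidean_space \<Rightarrow> 'c::euclidean_space"
  assumes "open U" "q \<in> U" and lin: "\<And>x. x \<in> U \<Longrightarrow> linear (P x)"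
    and P: "\<And>e. ((\<lambda>x. P x e) has_derivative P' e) (at q)" and y: "(y has_derivative y') (at q)"
  shows "((\<lambda>x. P x (y x)) has_derivative (\<lambda>u. P q (y' u) + P' (y q) u)) (at q)"
proof -
  have y_b: "((\<lambda>x. y x \<bullet> b) has_derivative (\<lambda>u. y' u \<bullet> b)) (at q)" for b
    by (rule has_derivative_inner_left[OF y])
  have "((\<lambda>x. \<Sum>b\<in>Basis. (y x \<bullet> b) *\<^sub>R P x b) has_derivative
      (\<lambda>u. \<Sum>b\<in>Basis. (y q \<bullet> b) *\<^sub>R P' b u + (y' u \<bullet> b) *\<^sub>R P q b)) (at q)"
    by (intro has_derivative_sum has_derivative_scaleR y_b P)
  then have 1: "((\<lambda>x. P x (y x)) has_derivative
      (\<lambda>u. \<Sum>b\<in>Basis. (y q \<bullet> b) *\<^sub>R P' b u + (y' u \<bullet> b) *\<^sub>R P q b)) (at q)"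
    by (rule has_derivative_transform_within_open[OF _ assms(1,2)]) (rule linear_basis_expand[OF lin, symmetric])
  have "((\<lambda>x. \<Sum>b\<in>Basis. (y q \<bullet> b) *\<^sub>R P x b) has_derivative (\<lambda>u. \<Sum>b\<in>Basis. (y q \<bullet> b) *\<^sub>R P' b u)) (at q)"
    by (intro has_derivative_sum has_derivative_scaleR_right P)
  then have "((\<lambda>x. P x (y q)) has_derivative (\<lambda>u. \<Sum>b\<in>Basis. (y q \<bullet> b) *\<^sub>R P' b u)) (at q)"
    by (rule has_derivative_transform_within_open[OF _ assms(1,2)]) (rule linear_basis_expand[OF lin, symmetric])
  then have "P' (y q) = (\<lambda>u. \<Sum>b\<in>Basis. (y q \<bullet> b) *\<^sub>R P' b u)" by (rule has_derivative_unique[OF P])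
  moreover have "P q (y' u) = (\<Sum>b\<in>Basis. (y' u \<bullet> b) *\<^sub>R P q b)" for u
    by (rule linear_basis_expand[OF lin[OF assms(2)]])
  ultimately have "(\<lambda>u. \<Sum>b\<in>Basis. (y q \<bullet> b) *\<^sub>R P' b u + (y' u \<bullet> b) *\<^sub>R P q b) = (\<lambda>u. P q (y' u) + P' (y q) u)"
    by (simp only: sum.distrib add.commute)
  with 1 show ?thesis by simp
qed

context tube
begin

text \<open>The projection is taken at the foot point \<open>r x\<close>, so that it is defined on
  an open set and has ambient derivatives.\<close>

definition "P x = closest_point (tangent_space M (r x))"
text \<open>\<open>P' x e u\<close> is the derivative of the projection in the direction
  \<open>u\<close>, applied to \<open>e\<close>: the direction comes last.\<close>

definition "P' x e = frechet_derivative (\<lambda>x. P x e) (at x)"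

lemma tangent_r: "x \<in> U \<Longrightarrow> subspace (tangent_space M (r x))"
  by (rule subspace_tangent[OF r_in_M r_in_U])

lemma linear_P: "x \<in> U \<Longrightarrow> linear (P x)"
  unfolding P_def by (rule linear_closest_point_subspace[OF tangent_r])

lemma P_tangent: "x \<in> U \<Longrightarrow> P x e \<in> tangent_space M (r x)"
  unfolding P_def by (rule closest_point_subspace(1)[OF tangent_r])

lemma P_orthogonal: "x \<in> U \<Longrightarrow> v \<in> tangent_space M (r x) \<Longrightarrow> (e - P x e) \<bullet> v = 0"
  unfolding P_def by (rule closest_point_subspace(2)[OF tangent_r])

lemma P_eqI: "x \<in> U \<Longrightarrow> w \<in> tangent_space M (r x) \<Longrightarrow> (\<And>v. v \<in> tangent_space M (r x) \<Longrightarrow> (e - w) \<bullet> v = 0) \<Longrightarrow> P x e = w"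
  unfolding P_def by (rule closest_point_subspace_eqI[OF tangent_r])

lemma P_id: "x \<in> U \<Longrightarrow> v \<in> tangent_space M (r x) \<Longrightarrow> P x v = v"
  by (rule P_eqI) auto

lemma P_symmetric: assumes "x \<in> U" shows "P x a \<bullet> b = a \<bullet> P x b"
  using P_orthogonal[OF assms P_tangent[OF assms, of b], of a] P_orthogonal[OF assms P_tangent[OF assms, of a], of b]
  by (simp add: inner_diff_left inner_diff_right inner_commute)

text \<open>With \<open>B = Dr(r x)\<close>, a projection onto the tangent space that need not be orthogonal, the
  orthogonal projection \<open>w\<close> of \<open>e\<close> solves \<open>(1 - B - B\<^sup>T) w = - B\<^sup>T e\<close>, an equation with smooth
  coefficients whose operator is injective.\<close>

lemma P_smooth: "Ck_on k U (\<lambda>x. P x e)"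
proof -
  define BT where "BT x v = (\<Sum>b\<in>Basis. (v \<bullet> B (r x) b) *\<^sub>R b)" for x v
  have BT: "BT x v \<bullet> w = v \<bullet> B (r x) w" if "x \<in> U" for x v w
  proof -
    have "v \<bullet> B (r x) w = v \<bullet> (\<Sum>b\<in>Basis. (w \<bullet> b) *\<^sub>R B (r x) b)"
      using linear_basis_expand[OF linear_B[OF r_in_U[OF that]], of w] by simp
    then show ?thesis by (simp add: BT_def inner_sum_left inner_sum_right inner_commute mult.commute)
  qed
  have Bs: "Ck_on k U (\<lambda>x. B (r x) v)" for v k
  proof (rule Ck_on_compose[OF open_U open_U _ r_smooth])
    show "r ` U \<subseteq> U" using r_in_U by auto
    show "Ck_on k U (\<lambda>x. B x v)" using r_smooth[of "Suc k"] by (simp add: B_def)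
  qed
  have BTs: "Ck_on k U (\<lambda>x. BT x v)" for v k
    unfolding BT_def by (intro Ck_on_sum[OF open_U] Ck_on_scaleR[OF open_U] Ck_on_inner[OF open_U] Ck_on_const Bs)
  have linBT: "linear (BT x)" for x
    unfolding BT_def by (rule linearI) (simp_all add: inner_add_left scaleR_add_left sum.distrib scaleR_sum_right)
  show ?thesis
  proof (rule Ck_on_inv_linear[where Q="\<lambda>x v. v - B (r x) v - BT x v" and y="\<lambda>x. - BT x e", OF open_U])
    show "linear (\<lambda>v. v - B (r x) v - BT x v)" if "x \<in> U" for x
      by (intro linear_compose_sub linear_id[unfolded id_def] linear_B r_in_U that linBT)
    show "inj (\<lambda>v. v - B (r x) v - BT x v)" if x: "x \<in> U" for x
    proof -
      have lin: "linear (\<lambda>v. v - B (r x) v - BT x v)"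
        by (intro linear_compose_sub linear_id[unfolded id_def] linear_B r_in_U x linBT)
      have "v = 0" if v: "v - B (r x) v - BT x v = 0" for v
      proof -
        note l = linear_B[OF r_in_U[OF x]]
        have BB: "B (r x) (B (r x) w) = B (r x) w" for w
          using tangent_iff[OF r_in_M[OF x] r_in_U[OF x]] B_tangent[OF r_in_M[OF x] r_in_U[OF x]] by blast
        have eq: "v - B (r x) v = BT x v" using v by simp
        have "B (r x) (BT x v) = 0" unfolding eq[symmetric] linear_diff[OF l] BB by simp
        then have "BT x v \<bullet> BT x v = 0" using BT[OF x, of v "BT x v"] by simp
        then have z: "BT x v = 0" by simp
        then have "v = B (r x) v" using eq by simp
        then have "v \<bullet> v = 0" using BT[OF x, of v v] z by simp
        then show ?thesis by simp
      qed
      then show ?thesis using linear_injective_0[OF lin] by blast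
    qed
    show "Ck_on k U (\<lambda>x. v - B (r x) v - BT x v)" for v
      by (intro Ck_on_diff[OF open_U] Ck_on_const Bs BTs)
    show "Ck_on k U (\<lambda>x. - BT x e)" by (rule Ck_on_minus[OF open_U BTs])
    show "P x e - B (r x) (P x e) - BT x (P x e) = - BT x e" if x: "x \<in> U" for x
    proof -
      have 1: "B (r x) (P x e) = P x e"
        using tangent_iff[OF r_in_M[OF x] r_in_U[OF x]] P_tangent[OF x] by blast
      have "BT x (e - P x e) \<bullet> BT x (e - P x e) = 0"
        unfolding BT[OF x] by (rule P_orthogonal[OF x B_tangent[OF r_in_M[OF x] r_in_U[OF x]]])
      then have "BT x (e - P x e) = 0" by simp
      then show ?thesis unfolding linear_diff[OF linBT] by (simp add: 1)
    qed
  qed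
qed

lemma P_has_derivative: "x \<in> U \<Longrightarrow> ((\<lambda>x. P x e) has_derivative P' x e) (at x)"
  unfolding P'_def by (rule Ck_on_has_derivative[OF P_smooth])

lemma P'_continuous: "continuous_on U (\<lambda>x. P' x e v)"
  using P_smooth[of "Suc 0" e] by (simp add: P'_def)

lemma P_apply_has_derivative:
  assumes "x \<in> U" "(y has_derivative y') (at x)"
  shows "((\<lambda>x. P x (y x)) has_derivative (\<lambda>u. P x (y' u) + P' x (y x) u)) (at x)"
  by (rule has_derivative_linear_apply[OF open_U assms(1) linear_P P_has_derivative[OF assms(1)] assms(2)])

text \<open>Self-adjointness passes from the projections to their derivative by differentiating
  \<open>P x a \<bullet> b = a \<bullet> P x b\<close>.\<close>

lemma P'_symmetric: assumes x: "x \<in> U" shows "P' x a u \<bullet> b = a \<bullet> P' x b u"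
proof -
  have "((\<lambda>x. P x a \<bullet> b) has_derivative (\<lambda>u. P' x a u \<bullet> b)) (at x)"
    by (rule has_derivative_inner_left[OF P_has_derivative[OF x]])
  then have "((\<lambda>x. a \<bullet> P x b) has_derivative (\<lambda>u. P' x a u \<bullet> b)) (at x)"
    by (rule has_derivative_transform_within_open[OF _ open_U x]) (rule P_symmetric)
  moreover have "((\<lambda>x. a \<bullet> P x b) has_derivative (\<lambda>u. a \<bullet> P' x b u)) (at x)"
    by (rule has_derivative_inner_right[OF P_has_derivative[OF x]])
  ultimately have "(\<lambda>u. P' x a u \<bullet> b) = (\<lambda>u. a \<bullet> P' x b u)" by (rule has_derivative_unique)
  then show ?thesis by (rule fun_cong)
qed

text \<open>Differentiate \<open>P (P v) = P v\<close> and cancel, using that the tangent vector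
  \<open>v\<close> is fixed by the projection at \<open>x\<close>.\<close>

lemma P_P'_eq_0: assumes x: "x \<in> U" and v: "v \<in> tangent_space M (r x)" shows "P x (P' x v u) = 0"
proof -
  have "((\<lambda>x. P x (P x v)) has_derivative (\<lambda>u. P x (P' x v u) + P' x (P x v) u)) (at x)"
    by (rule P_apply_has_derivative[OF x P_has_derivative[OF x]])
  then have "((\<lambda>x. P x v) has_derivative (\<lambda>u. P x (P' x v u) + P' x (P x v) u)) (at x)"
    by (rule has_derivative_transform_within_open[OF _ open_U x]) (simp add: P_id P_tangent)
  then have "(\<lambda>u. P x (P' x v u) + P' x (P x v) u) = P' x v" by (rule has_derivative_unique[OF _ P_has_derivative[OF x]])
  then have "P x (P' x v u) + P' x (P x v) u = P' x v u" by (rule fun_cong)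
  then show ?thesis by (simp add: P_id[OF x v])
qed

text \<open>The description is met by the extension \<open>x \<mapsto> P x v\<close>, whose
  derivative along \<open>u\<close> is already normal. For any other admissible extension
  \<open>V\<close>, differentiating \<open>P (V \<circ> r) = V \<circ> r\<close> along the tangent
  vector \<open>u\<close> shows that the normal part of \<open>DV u\<close> is the same
  \<open>P' q v u\<close>.\<close>

lemma second_fundamental_form_eq:
  assumes q: "q \<in> M" "q \<in> U" and u: "u \<in> tangent_space M q" and v: "v \<in> tangent_space M q"
  shows "second_fundamental_form M q u v = - P' q v u"
  unfolding second_fundamental_form_def
proof (rule the_equality)
  have rq: "r q = q" by (rule r_fixes[OF q])
  note sub = subspace_tangent[OF q]
  have Pq: "P q = closest_point (tangent_space M q)" by (simp add: P_def rq)
  show "\<exists>U V. open U \<and> q \<in> U \<and> smooth_on U V \<and> (\<forall>q\<in>M \<inter> U. V q \<in> tangent_space M q) \<and> V q = v \<and>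
        - P' q v u = - closest_point ((tangent_space M q)\<^sup>\<bottom>) (frechet_derivative V (at q) u)"
  proof (intro exI[of _ U] exI[of _ "\<lambda>x. P x v"] conjI ballI)
    show "smooth_on U (\<lambda>x. P x v)" by (rule smooth_onI[OF open_U P_smooth])
    show "P q' v \<in> tangent_space M q'" if "q' \<in> M \<inter> U" for q'
      using P_tangent[of q' v] r_fixes[of q'] that by simp
    show "P q v = v" using P_id[OF q(2)] v rq by simp
    have "closest_point (tangent_space M q) (P' q v u) = 0" using P_P'_eq_0[OF q(2)] v rq by (simp add: Pq)
    then show "- P' q v u = - closest_point ((tangent_space M q)\<^sup>\<bottom>) (frechet_derivative (\<lambda>x. P x v) (at q) u)"
      by (simp add: closest_point_orthogonal_comp[OF sub] flip: P'_def)
  qed (use open_U q in auto)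
  fix w
  assume "\<exists>U V. open U \<and> q \<in> U \<and> smooth_on U V \<and> (\<forall>q\<in>M \<inter> U. V q \<in> tangent_space M q) \<and> V q = v \<and>
        w = - closest_point ((tangent_space M q)\<^sup>\<bottom>) (frechet_derivative V (at q) u)"
  then obtain U' V where U': "open U'" "q \<in> U'" "smooth_on U' V" "\<forall>q\<in>M \<inter> U'. V q \<in> tangent_space M q" "V q = v"
    "w = - closest_point ((tangent_space M q)\<^sup>\<bottom>) (frechet_derivative V (at q) u)" by (elim exE conjE)
  define z where "z = frechet_derivative V (at q) u"
  \<comment> \<open>\<open>V\<close> is tangent only along \<open>M\<close>; composing with
    \<open>r\<close>, on the part of \<open>U\<close> that \<open>r\<close> sends into
    \<open>U'\<close>, gives an identity on an open set that can be differentiated.\<close>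
  define W where "W = U \<inter> r -` U'"
  have W: "open W" "q \<in> W" unfolding W_def
    using continuous_open_preimage[OF r_continuous open_U U'(1)] q U'(2) rq by auto
  have V: "(V has_derivative frechet_derivative V (at q)) (at q)"
    by (rule Ck_on_has_derivative[OF smooth_on_Ck_on[OF U'(1,3), of "Suc 0"] U'(2)])
  have Vr: "((\<lambda>x. V (r x)) has_derivative (\<lambda>u. frechet_derivative V (at q) (B q u))) (at q)"
    using diff_chain_at[OF r_has_derivative[OF q(2)], of V] V rq by (simp add: o_def)
  from P_apply_has_derivative[OF q(2) Vr]
  have "((\<lambda>x. P x (V (r x))) has_derivative (\<lambda>u. P q (frechet_derivative V (at q) (B q u)) + P' q (V (r q)) u)) (at q)" .
  then have "((\<lambda>x. V (r x)) has_derivative (\<lambda>u. P q (frechet_derivative V (at q) (B q u)) + P' q (V (r q)) u)) (at q)"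
    by (rule has_derivative_transform_within_open[OF _ W]) (use U'(4) r_in_M in \<open>auto simp: W_def intro!: P_id\<close>)
  with Vr have "(\<lambda>u. frechet_derivative V (at q) (B q u)) = (\<lambda>u. P q (frechet_derivative V (at q) (B q u)) + P' q (V (r q)) u)"
    by (rule has_derivative_unique)
  then have *: "frechet_derivative V (at q) (B q u) = P q (frechet_derivative V (at q) (B q u)) + P' q (V (r q)) u" by (rule fun_cong)
  have "B q u = u" using u tangent_iff[OF q] by blast
  with * have "z = P q z + P' q v u" unfolding z_def rq U'(5) by simp
  then have "z - P q z = P' q v u" by (metis add_diff_cancel_left')
  then show "w = - P' q v u"
    unfolding U'(6) closest_point_orthogonal_comp[OF sub] z_def[symmetric] Pq[symmetric] by simp
qed

end

section \<open>Construction of local retractions from parametrizations\<close>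

lemma subspace_projection:
  fixes E :: "'a::euclidean_space set"
  assumes "subspace E"
  obtains \<pi> where "bounded_linear \<pi>" "\<And>x. \<pi> x \<in> E" "\<And>x. x \<in> E \<Longrightarrow> \<pi> x = x"
proof (rule that)
  show "bounded_linear (closest_point E)"
    by (rule linear_conv_bounded_linear[THEN iffD1, OF linear_closest_point_subspace[OF assms]])
  show "closest_point E x \<in> E" for x by (rule closest_point_subspace(1)[OF assms])
  show "closest_point E x = x" if "x \<in> E" for x by (rule closest_point_self[OF that])
qed

text \<open>The map \<open>r\<close> sends a nearby point into \<open>E\<close> by an ambient
  extension of the inverse parametrization followed by the projection onto \<open>E\<close>, then
  back to \<open>M\<close> by the parametrization. The dimension bound is recorded for the later
  appeal to invariance of domain.\<close>

lemma smooth_submanifold_tube: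
  fixes M :: "'a::euclidean_space set"
  assumes M: "smooth_submanifold m M" and p: "p \<in> M"
  obtains U r where "p \<in> U" "tube M U r" "m \<le> dim (tangent_space M p)"
proof -
  have "\<exists>W (E :: 'a set) V f. p \<in> W \<and> openin (top_of_set M) W \<and>
        subspace E \<and> dim E = m \<and> openin (top_of_set E) V \<and> diffeomorphism_on V W f"
    using M p unfolding smooth_submanifold_def by (rule bspec)
  then obtain W and E V :: "'a set" and f where ch: "p \<in> W" "openin (top_of_set M) W" "subspace E" "dim E = m"
      "openin (top_of_set E) V" "diffeomorphism_on V W f"
    by (elim exE conjE)
  define h where "h = the_inv_into V f"
  have bij: "bij_betw f V W" and sf: "smooth_on V f" and sh: "smooth_on W h"
    using ch(6) by (simp_all add: diffeomorphism_on_def h_def)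
  have inj: "inj_on f V" and im: "f ` V = W" using bij by (simp_all add: bij_betw_def)
  have hf: "h (f x) = x" if "x \<in> V" for x
    unfolding h_def by (rule the_inv_into_f_f[OF inj that])
  have fh: "f (h q) = q" if "q \<in> W" for q
    unfolding h_def by (rule f_the_inv_into_f[OF inj]) (simp add: im that)
  have hV: "h q \<in> V" if "q \<in> W" for q
    unfolding h_def by (rule the_inv_into_into[OF inj _ order_refl]) (simp add: im that)
  have fW: "f x \<in> W" if "x \<in> V" for x unfolding im[symmetric] by (rule imageI[OF that])
  obtain W' where W': "open W'" "W = M \<inter> W'" using ch(2) openin_open by blast
  obtain V' where V': "open V'" "V = E \<inter> V'" using ch(5) openin_open by blast
  obtain \<pi> where \<pi>: "bounded_linear \<pi>" "\<And>x. \<pi> x \<in> E" "\<And>x. x \<in> E \<Longrightarrow> \<pi> x = x" using subspace_projection[OF ch(3)] by blast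
  obtain H h' where H: "open H" "p \<in> H" "\<And>k. Ck_on k H h'" "\<And>y. y \<in> W \<Longrightarrow> y \<in> H \<Longrightarrow> h' y = h y"
    by (rule smooth_onE[OF sh ch(1)]) blast
  obtain G g where G: "open G" "h p \<in> G" "\<And>k. Ck_on k G g" "\<And>y. y \<in> V \<Longrightarrow> y \<in> G \<Longrightarrow> g y = f y"
    by (rule smooth_onE[OF sf hV[OF ch(1)]]) blast
  define \<rho> where "\<rho> q = \<pi> (h' q)" for q
  have \<rho>s: "Ck_on k H \<rho>" for k unfolding \<rho>_def by (rule Ck_on_bounded_linear[OF H(1) \<pi>(1) H(3)])
  \<comment> \<open>The domain forces \<open>\<rho> q\<close> into \<open>V\<close> and
    \<open>G\<close>, where the extension \<open>g\<close> agrees with \<open>f\<close>, and places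
    points of \<open>M\<close> in the patch \<open>W\<close>, where \<open>h\<close> inverts
    \<open>f\<close>.\<close>
  define U0 where "U0 = (H \<inter> \<rho> -` (G \<inter> V')) \<inter> W'"
  have oU0: "open U0" unfolding U0_def
    by (rule open_Int[OF continuous_open_preimage[OF Ck_on_continuous[OF \<rho>s[of 0]] H(1) open_Int[OF G(1) V'(1)]] W'(1)])
  define r where "r q = g (\<rho> q)" for q
  have rs0: "Ck_on k U0 r" for k unfolding r_def
  proof (rule Ck_on_compose[OF oU0 G(1) _ Ck_on_subset[OF \<rho>s] G(3)])
    show "\<rho> ` U0 \<subseteq> G" by (rule image_subsetI) (simp add: U0_def)
    show "U0 \<subseteq> H" by (rule subsetI) (simp add: U0_def)
  qed
  have \<rho>V: "\<rho> q \<in> V" "\<rho> q \<in> G" if "q \<in> U0" for q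
    using that \<pi>(2)[of "h' q"] unfolding V'(2) by (simp_all add: U0_def \<rho>_def)
  have r_eq: "r q = f (\<rho> q)" if "q \<in> U0" for q
    unfolding r_def by (rule G(4)[OF \<rho>V[OF that]])
  have rM0: "r q \<in> M" if "q \<in> U0" for q
    using fW[OF \<rho>V(1)[OF that]] unfolding r_eq[OF that] W'(2) by blast
  have \<rho>h: "\<rho> q = h q" if "q \<in> W" "q \<in> H" for q
  proof -
    have "h q \<in> E" using hV[OF that(1)] unfolding V'(2) by blast
    then show ?thesis unfolding \<rho>_def H(4)[OF that] by (rule \<pi>(3))
  qed
  have rfix0: "r q = q" if "q \<in> M" "q \<in> U0" for q
  proof -
    have q: "q \<in> W" "q \<in> H" using that by (simp_all add: W'(2) U0_def)
    show ?thesis unfolding r_eq[OF that(2)] \<rho>h[OF q] by (rule fh[OF q(1)])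
  qed
  have pU0: "p \<in> U0"
    using H(2) G(2) hV[OF ch(1)] ch(1) \<rho>h[OF ch(1) H(2)] by (simp add: U0_def V'(2) W'(2))
  \<comment> \<open>Passing to points whose image also lies in \<open>U0\<close> makes the domain
    invariant under \<open>r\<close>, because such images are fixed points.\<close>
  define U where "U = U0 \<inter> r -` U0"
  have "tube M U r"
  proof
    show "open U" unfolding U_def by (rule continuous_open_preimage[OF Ck_on_continuous[OF rs0[of 0]] oU0 oU0])
    show "Ck_on k U r" for k by (rule Ck_on_subset[OF rs0]) (auto simp: U_def)
    show "r x \<in> M" if "x \<in> U" for x using that rM0 by (simp add: U_def)
    show "r x \<in> U" if "x \<in> U" for x
    proof -
      have x: "x \<in> U0" "r x \<in> U0" using that by (auto simp: U_def)
      have "r (r x) = r x" by (rule rfix0[OF rM0[OF x(1)] x(2)])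
      then show ?thesis using x by (simp add: U_def)
    qed
    show "r q = q" if "q \<in> M" "q \<in> U" for q using rfix0 that by (simp add: U_def)
  qed
  moreover have "p \<in> U" using pU0 rfix0[OF p pU0] by (simp add: U_def)
  \<comment> \<open>The derivative of the parametrization at \<open>h p\<close> is injective on
    \<open>E\<close>, since the derivative of the extended inverse undoes it, and its values on
    \<open>E\<close> are velocities of curves in \<open>M\<close>.\<close>
  moreover have "m \<le> dim (tangent_space M p)"
  proof -
    interpret tube M U r by fact
    define L where "L = frechet_derivative g (at (h p))"
    have gd: "(g has_derivative L) (at (h p))" unfolding L_def by (rule Ck_on_has_derivative[OF G(3) G(2)])
    have hd: "(h' has_derivative frechet_derivative h' (at p)) (at p)" by (rule Ck_on_has_derivative[OF H(3) H(2)])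
    have x0: "h p \<in> V" by (rule hV[OF ch(1)])
    have gp: "g (h p) = p" unfolding G(4)[OF x0 G(2)] by (rule fh[OF ch(1)])
    define O' where "O' = (G \<inter> g -` H) \<inter> V'"
    have O': "open O'" "h p \<in> O'" unfolding O'_def
      using continuous_open_preimage[OF Ck_on_continuous[OF G(3)[of 0]] G(1) H(1)] V'(1) x0 G(2) H(2) gp
      by (simp_all add: open_Int V'(2))
    have line: "\<exists>e>0. \<forall>t\<in>{-e<..<e}. h p + t *\<^sub>R v \<in> V \<and> h p + t *\<^sub>R v \<in> O'" if v: "v \<in> E" for v
    proof -
      have "isCont (\<lambda>t. h p + t *\<^sub>R v) 0" by (intro continuous_intros)
      then have "\<forall>\<^sub>F t in at 0. h p + t *\<^sub>R v \<in> O'"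
        using topological_tendstoD[of "\<lambda>t. h p + t *\<^sub>R v" "h p" "at 0" O'] O' by (simp add: isCont_def)
      then obtain e where e: "e > 0" "\<And>t. t \<noteq> 0 \<Longrightarrow> \<bar>t\<bar> < e \<Longrightarrow> h p + t *\<^sub>R v \<in> O'"
        unfolding eventually_at by (auto simp: dist_norm)
      have "h p + t *\<^sub>R v \<in> O'" if "t \<in> {-e<..<e}" for t using e(2)[of t] that O'(2) by (cases "t = 0") auto
      moreover have "h p + t *\<^sub>R v \<in> E" for t using x0 v unfolding V'(2) by (intro subspace_add subspace_scale ch(3)) blast+
      ultimately show ?thesis using e(1) unfolding V'(2) by (intro exI[of _ e]) (simp add: O'_def)
    qed
    have LT: "L v \<in> tangent_space M p" and inv: "frechet_derivative h' (at p) (L v) = v" if v: "v \<in> E" for v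
    proof -
      obtain e where e: "e > 0" "\<And>t. t\<in>{-e<..<e} \<Longrightarrow> h p + t *\<^sub>R v \<in> V \<and> h p + t *\<^sub>R v \<in> O'" using line[OF v] by blast
      have g_eq: "g (h p + t *\<^sub>R v) = f (h p + t *\<^sub>R v)" if "t \<in> {-e<..<e}" for t
        by (rule G(4)) (use e(2)[OF that] in \<open>simp_all add: O'_def\<close>)
      have vd: "((\<lambda>t. g (h p + t *\<^sub>R v)) has_vector_derivative L v) (at 0)"
        using has_derivative_along_line[of g L "h p" 0 v UNIV] gd by simp
      have "B (g (h p + 0 *\<^sub>R v)) (L v) = L v"
      proof (rule B_fixes_velocity[OF has_vector_derivative_at_within[OF vd]])
        show "(\<lambda>t. g (h p + t *\<^sub>R v)) ` {-e<..<e} \<subseteq> M"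
        proof (rule image_subsetI)
          fix t assume t: "t \<in> {-e<..<e}"
          have "f (h p + t *\<^sub>R v) \<in> W" using e(2)[OF t] by (intro fW) blast
          then show "g (h p + t *\<^sub>R v) \<in> M" unfolding g_eq[OF t] W'(2) by blast
        qed
        show "at 0 within {-e<..<e} \<noteq> bot" using e(1) by (simp add: at_within_open[of 0 "{-e<..<e}"])
      qed (use e(1) gp \<open>p \<in> U\<close> in simp_all)
      then show "L v \<in> tangent_space M p" using tangent_iff[OF p \<open>p \<in> U\<close>] gp by simp
      have "((\<lambda>t. h' (g (h p + t *\<^sub>R v))) has_vector_derivative frechet_derivative h' (at p) (L v)) (at 0)"
        using has_derivative_along_line[of "\<lambda>x. h' (g x)" "\<lambda>x. frechet_derivative h' (at p) (L x)" "h p" 0 v UNIV]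
          diff_chain_at[OF gd, of h'] hd gp by (simp add: o_def)
      moreover have "((\<lambda>t. h' (g (h p + t *\<^sub>R v))) has_vector_derivative v) (at 0)"
      proof (rule has_vector_derivative_transform_within_open[of "\<lambda>t. h p + t *\<^sub>R v" _ _ "{-e<..<e}"])
        show "((\<lambda>t. h p + t *\<^sub>R v) has_vector_derivative v) (at 0)"
          using has_derivative_along_line[of "\<lambda>x. x" "\<lambda>x. x" "h p" 0 v UNIV] by simp
        show "h p + t *\<^sub>R v = h' (g (h p + t *\<^sub>R v))" if "t \<in> {-e<..<e}" for t
        proof -
          have V: "h p + t *\<^sub>R v \<in> V" and g: "g (h p + t *\<^sub>R v) \<in> H" using e(2)[OF that] by (simp_all add: O'_def)
          have "h' (g (h p + t *\<^sub>R v)) = h (f (h p + t *\<^sub>R v))"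
            using H(4)[OF fW[OF V]] g unfolding g_eq[OF that] by blast
          then show ?thesis unfolding hf[OF V] by (rule sym)
        qed
      qed (use e(1) in simp_all)
      ultimately show "frechet_derivative h' (at p) (L v) = v" by (rule vector_derivative_unique_at)
    qed
    have "inj_on L (span E)" unfolding span_eq_iff[THEN iffD2, OF ch(3)]
      by (rule inj_on_inverseI[of _ "frechet_derivative h' (at p)"]) (rule inv)
    then have "dim (L ` E) = dim E" by (rule dim_image_eq[OF has_derivative_linear[OF gd]])
    moreover have "dim (L ` E) \<le> dim (tangent_space M p)" by (rule dim_subset) (use LT in auto)
    ultimately show ?thesis using ch(4) by simp
  qed
  ultimately show thesis by (intro that)
qed

section \<open>Geodesics\<close>

text \<open>One-sided at the end points, matching \<open>unit_time_geodesic\<close> and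
  \<open>initial_velocity\<close>.\<close>

definition vel :: "(real \<Rightarrow> 'a::euclidean_space) \<Rightarrow> real \<Rightarrow> 'a" where
  "vel c t = vector_derivative c (at t within {0..1})"

lemma vel_eqI: "(c has_vector_derivative v) (at t within {0..1}) \<Longrightarrow> t \<in> {0..1} \<Longrightarrow> vel c t = v"
  unfolding vel_def using vector_derivative_within_cbox[of 0 1 t c v] by simp

lemma vel_cong:
  assumes "\<And>s. s \<in> {0..1} \<Longrightarrow> f s = g s" "t \<in> {0..1}" shows "vel f t = vel g t"
proof -
  have "(f has_vector_derivative D) (at t within {0..1}) = (g has_vector_derivative D) (at t within {0..1})" for D
    using has_vector_derivative_transform[OF assms(2), of g f D] has_vector_derivative_transform[OF assms(2), of f g D] assms(1)
    by auto
  then show ?thesis by (simp add: vel_def vector_derivative_def)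
qed

lemma smooth_on_vel:
  assumes "smooth_on {0..1} c"
  shows "t \<in> {0..1} \<Longrightarrow> (c has_vector_derivative vel c t) (at t within {0..1})" "smooth_on {0..1} (vel c)"
  using smooth_on_curve_derivative[OF assms zero_less_one] by (simp_all add: vel_def[abs_def])

lemma geodesic_smooth: "unit_time_geodesic M c \<Longrightarrow> smooth_on {0..1} c"
  by (simp add: unit_time_geodesic_def)

lemma geodesic_in_M: "unit_time_geodesic M c \<Longrightarrow> t \<in> {0..1} \<Longrightarrow> c t \<in> M"
  unfolding unit_time_geodesic_def by blast

lemma geodesic_vel:
  "unit_time_geodesic M c \<Longrightarrow> t \<in> {0..1} \<Longrightarrow> (c has_vector_derivative vel c t) (at t within {0..1})"
  by (rule smooth_on_vel(1)[OF geodesic_smooth])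

lemma geodesic_acc:
  "unit_time_geodesic M c \<Longrightarrow> t \<in> {0..1} \<Longrightarrow> (vel c has_vector_derivative vel (vel c) t) (at t within {0..1})"
  by (rule smooth_on_vel(1)[OF smooth_on_vel(2)[OF geodesic_smooth]])

lemma geodesic_continuous:
  assumes "unit_time_geodesic M c"
  shows "continuous_on {0..1} c" "continuous_on {0..1} (vel c)" "continuous_on {0..1} (vel (vel c))"
  by (intro smooth_on_continuous smooth_on_vel(2) geodesic_smooth[OF assms])+

lemma geodesic_acc_normal:
  "unit_time_geodesic M c \<Longrightarrow> t \<in> {0..1} \<Longrightarrow> vel (vel c) t \<in> (tangent_space M (c t))\<^sup>\<bottom>"
  unfolding unit_time_geodesic_def vel_def[abs_def] by blast

lemma initial_velocity_vel: "initial_velocity c = vel c 0"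
  by (simp add: initial_velocity_def vel_def)

lemma at_within_unit_interval: "t \<in> {0..1::real} \<Longrightarrow> at t within {0..1} \<noteq> bot"
  using at_within_Icc_at_left[of 0 1] by (simp add: trivial_limit_within islimpt_Icc)

lemma (in tube) geodesic_vel_tangent:
  assumes c: "unit_time_geodesic M c" and t: "t \<in> {0..1}" and "c t \<in> U"
  shows "vel c t \<in> tangent_space M (c t)"
proof -
  have "c ` {0..1} \<subseteq> M" using c by (simp add: unit_time_geodesic_def)
  from B_fixes_velocity[OF geodesic_vel[OF c t] this t assms(3) at_within_unit_interval[OF t]]
  show ?thesis unfolding tangent_iff[OF geodesic_in_M[OF c t] assms(3)] .
qed

lemma geodesic_vel_tangent':
  assumes M: "smooth_submanifold m M" and c: "unit_time_geodesic M c" and t: "t \<in> {0..1}"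
  shows "vel c t \<in> tangent_space M (c t)"
proof -
  obtain U r where "c t \<in> U" "tube M U r" using smooth_submanifold_tube[OF M geodesic_in_M[OF c t]] by blast
  then show ?thesis using tube.geodesic_vel_tangent[OF _ c t] by blast
qed

text \<open>For fixed \<open>e\<close> the identity
  \<open>c' \<bullet> P(c) e = c' \<bullet> e\<close> is differentiated; normality of
  \<open>c''\<close> removes \<open>c'' \<bullet> P(c) e\<close>, and \<open>P'_symmetric\<close>
  moves \<open>P'\<close> to the other factor. Normality of the acceleration thus becomes a
  differential equation with smooth right-hand side.\<close>

lemma (in tube) geodesic_equation:
  assumes c: "unit_time_geodesic M c" and t: "t \<in> {0..1}" and U: "c t \<in> U"
  shows "vel (vel c) t = P' (c t) (vel c t) (vel c t)"
proof (rule vector_eq_rdot[THEN iffD1], rule allI)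
  fix e
  have rc: "r (c s) = c s" if "s \<in> {0..1}" "c s \<in> U" for s by (rule r_fixes[OF geodesic_in_M[OF c that(1)] that(2)])
  have dP: "((\<lambda>s. P (c s) e) has_vector_derivative P' (c t) e (vel c t)) (at t within {0..1})"
  proof -
    have "((\<lambda>s. P (c s) e) has_derivative (\<lambda>h. P' (c t) e (h *\<^sub>R vel c t))) (at t within {0..1})"
      using diff_chain_within[OF geodesic_vel[OF c t, unfolded has_vector_derivative_def] has_derivative_at_withinI[OF P_has_derivative[OF U, of e]]]
      by (simp add: o_def)
    then show ?thesis
      using has_derivative_linear[OF P_has_derivative[OF U, of e]] by (simp add: has_vector_derivative_def linear_scale)
  qed
  have 1: "((\<lambda>s. vel c s \<bullet> P (c s) e) has_vector_derivative
      (vel c t \<bullet> P' (c t) e (vel c t) + vel (vel c) t \<bullet> P (c t) e)) (at t within {0..1})"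
    by (rule bounded_bilinear.has_vector_derivative[OF bounded_bilinear_inner geodesic_acc[OF c t] dP])
  have ev: "\<forall>\<^sub>F s in at t within {0..1}. vel c s \<bullet> P (c s) e = vel c s \<bullet> e"
  proof -
    have "(c \<longlongrightarrow> c t) (at t within {0..1})"
      using geodesic_continuous(1)[OF c] t by (simp add: continuous_on_def)
    then have "\<forall>\<^sub>F s in at t within {0..1}. c s \<in> U" by (rule topological_tendstoD[OF _ open_U U])
    moreover have "\<forall>\<^sub>F s in at t within {0..1}. s \<in> {0..1}" by (simp add: eventually_at_filter)
    ultimately show ?thesis
    proof eventually_elim
      case (elim s)
      have "vel c s \<bullet> P (c s) e = P (c s) (vel c s) \<bullet> e" by (rule P_symmetric[OF elim(1), symmetric])
      also have "P (c s) (vel c s) = vel c s"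
        by (rule P_id[OF elim(1)]) (simp add: rc[OF elim(2,1)] geodesic_vel_tangent[OF c elim(2,1)])
      finally show ?case .
    qed
  qed
  have eq_t: "vel c t \<bullet> P (c t) e = vel c t \<bullet> e"
    using P_symmetric[OF U, of "vel c t" e] P_id[OF U, of "vel c t"] geodesic_vel_tangent[OF c t U] rc[OF t U] by simp
  have "((\<lambda>s. vel c s \<bullet> e) has_vector_derivative
      (vel c t \<bullet> P' (c t) e (vel c t) + vel (vel c) t \<bullet> P (c t) e)) (at t within {0..1})"
    unfolding has_vector_derivative_def
    by (rule has_derivative_transform_eventually[OF 1[unfolded has_vector_derivative_def] ev eq_t t])
  moreover have "((\<lambda>s. vel c s \<bullet> e) has_vector_derivative vel (vel c) t \<bullet> e) (at t within {0..1})"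
    using bounded_linear.has_vector_derivative[OF bounded_linear_inner_left geodesic_acc[OF c t]] .
  ultimately have "vel c t \<bullet> P' (c t) e (vel c t) + vel (vel c) t \<bullet> P (c t) e = vel (vel c) t \<bullet> e"
    by (rule vector_derivative_unique_within[OF at_within_unit_interval[OF t]])
  moreover have "vel (vel c) t \<bullet> P (c t) e = 0"
    by (rule orthogonal_compD[OF geodesic_acc_normal[OF c t]]) (use P_tangent[OF U, of e] rc[OF t U] in simp)
  ultimately show "vel (vel c) t \<bullet> e = P' (c t) (vel c t) (vel c t) \<bullet> e"
    using P'_symmetric[OF U, of "vel c t" "vel c t" e] by simp
qed

section \<open>Uniqueness of geodesics\<close>

text \<open>On an interval so short that \<open>L d \<le> 1/2\<close>, the maximal distance between
  the two solutions is at most half of itself, hence zero. The equation is demanded only while a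
  solution lies in \<open>\<Omega>\<close>, as the geodesic field is used on one tube at a
  time.\<close>

lemma ode_locally_unique:
  fixes z1 z2 :: "real \<Rightarrow> 'a::euclidean_space" and G :: "'a \<Rightarrow> 'a"
  assumes \<Omega>: "open \<Omega>" and G: "Ck_on (Suc 0) \<Omega> G"
    and z1: "\<And>t. t \<in> {a..b} \<Longrightarrow> z1 t \<in> \<Omega> \<Longrightarrow> (z1 has_vector_derivative G (z1 t)) (at t within {a..b})"
    and z2: "\<And>t. t \<in> {a..b} \<Longrightarrow> z2 t \<in> \<Omega> \<Longrightarrow> (z2 has_vector_derivative G (z2 t)) (at t within {a..b})"
    and c1: "continuous_on {a..b} z1" and c2: "continuous_on {a..b} z2"
    and s: "s \<in> {a..b}" "z1 s = z2 s" "z1 s \<in> \<Omega>"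
  shows "\<exists>d>0. \<forall>t\<in>{a..b}. \<bar>t - s\<bar> < d \<longrightarrow> z1 t = z2 t"
proof -
  obtain \<rho> where \<rho>: "\<rho> > 0" "cball (z1 s) \<rho> \<subseteq> \<Omega>" using \<Omega> s(3) open_contains_cball by blast
  obtain L where L: "L \<ge> 0" "\<And>x y. (\<And>\<sigma>. \<sigma> \<in> {0..1} \<Longrightarrow> x + \<sigma> *\<^sub>R y \<in> cball (z1 s) \<rho>) \<Longrightarrow> norm (G (x + y) - G x) \<le> L * norm y"
    using Ck_on_lipschitz_segment[OF G compact_cball \<rho>(2)] by blast
  have lip: "norm (G y - G x) \<le> L * norm (y - x)" if "x \<in> cball (z1 s) \<rho>" "y \<in> cball (z1 s) \<rho>" for x y
  proof -
    have "x + \<sigma> *\<^sub>R (y - x) \<in> cball (z1 s) \<rho>" if \<sigma>: "\<sigma> \<in> {0..1}" for \<sigma>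
    proof -
      have "(1 - \<sigma>) *\<^sub>R x + \<sigma> *\<^sub>R y \<in> cball (z1 s) \<rho>"
        by (rule convexD[OF convex_cball \<open>x \<in> _\<close> \<open>y \<in> _\<close>]) (use \<sigma> in auto)
      then show ?thesis by (simp add: algebra_simps)
    qed
    from L(2)[OF this] show ?thesis by simp
  qed
  have "\<exists>d>0. \<forall>t\<in>{a..b}. dist t s < d \<longrightarrow> dist (z1 t) (z1 s) < \<rho>"
    using c1 s(1) \<rho>(1) unfolding continuous_on_iff by blast
  then obtain d1 where d1: "d1 > 0" "\<And>t. t \<in> {a..b} \<Longrightarrow> dist t s < d1 \<Longrightarrow> dist (z1 t) (z1 s) < \<rho>" by blast
  have "\<exists>d>0. \<forall>t\<in>{a..b}. dist t s < d \<longrightarrow> dist (z2 t) (z2 s) < \<rho>"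
    using c2 s(1) \<rho>(1) unfolding continuous_on_iff by blast
  then obtain d2 where d2: "d2 > 0" "\<And>t. t \<in> {a..b} \<Longrightarrow> dist t s < d2 \<Longrightarrow> dist (z2 t) (z2 s) < \<rho>" by blast
  \<comment> \<open>Below \<open>d1\<close> and \<open>d2\<close> both solutions stay in the ball
    where \<open>G\<close> is Lipschitz; the bound \<open>1 / (L + 1)\<close>, halved, gives
    \<open>L d \<le> 1/2\<close>.\<close>
  define d where "d = min (min d1 d2) (1 / (L + 1)) / 2"
  have d: "d > 0" "d < d1" "d < d2" "L * d < 1/2 \<or> L * d \<le> 1/2"
  proof -
    show "d > 0" "d < d1" "d < d2" using d1(1) d2(1) L(1) by (auto simp: d_def min_def)
    have "d \<le> 1 / (L + 1) / 2" unfolding d_def by (intro divide_right_mono) auto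
    then have "L * d \<le> L * (1 / (L + 1) / 2)" using L(1) by (intro mult_left_mono) auto
    also have "\<dots> \<le> 1/2" using L(1) by (simp add: field_simps)
    finally show "L * d < 1/2 \<or> L * d \<le> 1/2" by blast
  qed
  define J where "J = {max a (s - d)..min b (s + d)}"
  have J: "t \<in> {a..b}" "\<bar>t - s\<bar> \<le> d" if "t \<in> J" for t using that by (auto simp: J_def)
  have sJ: "s \<in> J" using s d by (auto simp: J_def)
  have inb: "z1 t \<in> cball (z1 s) \<rho>" "z2 t \<in> cball (z1 s) \<rho>" if "t \<in> J" for t
    using d1(2)[of t] d2(2)[of t] J[OF that] d s(2) by (auto simp: dist_norm norm_minus_commute)
  define \<delta> where "\<delta> t = z1 t - z2 t" for t
  have c\<delta>: "continuous_on J (\<lambda>t. norm (\<delta> t))" unfolding \<delta>_def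
    by (intro continuous_intros continuous_on_subset[OF c1] continuous_on_subset[OF c2]) (auto simp: J_def)
  obtain t where t: "t \<in> J" "\<And>u. u \<in> J \<Longrightarrow> norm (\<delta> u) \<le> norm (\<delta> t)"
    using continuous_attains_sup[OF _ _ c\<delta>] sJ unfolding J_def by (metis compact_Icc empty_iff)
  have der: "(\<delta> has_vector_derivative (G (z1 u) - G (z2 u))) (at u within J)" if "u \<in> J" for u
  proof -
    have "(z1 has_vector_derivative G (z1 u)) (at u within {a..b})" "(z2 has_vector_derivative G (z2 u)) (at u within {a..b})"
      using z1[OF J(1)[OF that]] z2[OF J(1)[OF that]] inb[OF that] \<rho>(2) by blast+
    then have "(\<delta> has_vector_derivative (G (z1 u) - G (z2 u))) (at u within {a..b})"
      unfolding \<delta>_def by (rule has_vector_derivative_diff)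
    then show ?thesis by (rule has_vector_derivative_within_subset) (auto simp: J_def)
  qed
  have bd: "norm (G (z1 u) - G (z2 u)) \<le> L * norm (\<delta> t)" if "u \<in> J" for u
    using lip[OF inb(2)[OF that] inb(1)[OF that]] mult_left_mono[OF t(2)[OF that] L(1)] by (simp add: \<delta>_def)
  have half: "norm (\<delta> t - \<delta> s) \<le> (L * norm (\<delta> t)) * \<bar>t - s\<bar>"
  proof (cases "s \<le> t")
    case True
    have sub: "{s..t} \<subseteq> J" using t(1) sJ by (auto simp: J_def)
    have "norm (\<delta> t - \<delta> s) \<le> (L * norm (\<delta> t)) * (t - s)"
      by (rule vector_derivative_norm_bound[OF True has_vector_derivative_within_subset[OF der sub] bd]) (use sub in auto)
    then show ?thesis using True by simp
  next
    case False
    have sub: "{t..s} \<subseteq> J" using t(1) sJ by (auto simp: J_def)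
    have "norm (\<delta> s - \<delta> t) \<le> (L * norm (\<delta> t)) * (s - t)"
      by (rule vector_derivative_norm_bound[OF _ has_vector_derivative_within_subset[OF der sub] bd]) (use sub False in auto)
    then show ?thesis using False by (simp add: norm_minus_commute)
  qed
  have "norm (\<delta> t) \<le> (L * norm (\<delta> t)) * d"
  proof -
    have "norm (\<delta> t) \<le> (L * norm (\<delta> t)) * \<bar>t - s\<bar>" using half s(2) by (simp add: \<delta>_def)
    also have "\<dots> \<le> (L * norm (\<delta> t)) * d" using J(2)[OF t(1)] L(1) by (intro mult_left_mono) auto
    finally show ?thesis .
  qed
  also have "\<dots> = (L * d) * norm (\<delta> t)" by simp
  also have "\<dots> \<le> 1/2 * norm (\<delta> t)" using d(4) by (intro mult_right_mono) auto
  finally have z: "norm (\<delta> t) \<le> 0" by simp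
  show ?thesis
  proof (intro exI[of _ d] conjI ballI impI)
    fix u assume "u \<in> {a..b}" "\<bar>u - s\<bar> < d"
    then have "u \<in> J" by (auto simp: J_def)
    then show "z1 u = z2 u" using t(2)[of u] z by (simp add: \<delta>_def)
  qed (rule d(1))
qed

context tube
begin

definition geodesic_field :: "'a \<times> 'a \<Rightarrow> 'a \<times> 'a" where
  "geodesic_field z = (snd z, P' (fst z) (snd z) (snd z))"

lemma P'_expand:
  assumes x: "x \<in> U" shows "P' x v u = (\<Sum>b\<in>Basis. (v \<bullet> b) *\<^sub>R P' x b u)"
proof -
  have "((\<lambda>x. P x v) has_derivative (\<lambda>u. \<Sum>b\<in>Basis. (v \<bullet> b) *\<^sub>R P' x b u)) (at x)"
  proof (rule has_derivative_transform_within_open[OF _ open_U x])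
    show "((\<lambda>x. \<Sum>b\<in>Basis. (v \<bullet> b) *\<^sub>R P x b) has_derivative (\<lambda>u. \<Sum>b\<in>Basis. (v \<bullet> b) *\<^sub>R P' x b u)) (at x)"
      by (intro has_derivative_sum has_derivative_scaleR_right P_has_derivative[OF x])
    show "(\<Sum>b\<in>Basis. (v \<bullet> b) *\<^sub>R P y b) = P y v" if "y \<in> U" for y
      by (rule linear_basis_expand[OF linear_P[OF that], symmetric])
  qed
  then have "P' x v = (\<lambda>u. \<Sum>b\<in>Basis. (v \<bullet> b) *\<^sub>R P' x b u)" by (rule has_derivative_unique[OF P_has_derivative[OF x]])
  then show ?thesis by (rule fun_cong)
qed

text \<open>The quadratic term is expanded in both velocity arguments, because smoothness of
  \<open>P'\<close> in the base point is known for fixed arguments.\<close>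

lemma geodesic_field_smooth: "Ck_on k (U \<times> UNIV) geodesic_field"
proof -
  have o: "open (U \<times> (UNIV :: 'a set))" using open_U by (intro open_Times) auto
  have s: "Ck_on k (U \<times> UNIV) (\<lambda>z::'a\<times>'a. snd z \<bullet> b)" for b :: 'a and k
    by (rule Ck_on_inner[OF o Ck_on_linear[OF o bounded_linear_snd] Ck_on_const])
  have p: "Ck_on k (U \<times> UNIV) (\<lambda>z::'a\<times>'a. P' (fst z) b d)" for b d and k
  proof (rule Ck_on_compose[OF o open_U _ Ck_on_linear[OF o bounded_linear_fst], where g="\<lambda>x. P' x b d"])
    show "Ck_on k U (\<lambda>x. P' x b d)" using P_smooth[of "Suc k" b] by (simp add: P'_def)
  qed auto
  have "Ck_on k (U \<times> UNIV) (\<lambda>z::'a\<times>'a. (snd z, 0::'a) + (0::'a, \<Sum>b\<in>Basis. (snd z \<bullet> b) *\<^sub>R (\<Sum>d\<in>Basis. (snd z \<bullet> d) *\<^sub>R P' (fst z) b d)))"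
  proof (rule Ck_on_add[OF o])
    show "Ck_on k (U \<times> UNIV) (\<lambda>z::'a\<times>'a. (snd z, 0::'a))"
      by (rule Ck_on_linear[OF o]) (intro bounded_linear_Pair bounded_linear_snd bounded_linear_zero)
    show "Ck_on k (U \<times> UNIV) (\<lambda>z::'a\<times>'a. (0::'a, \<Sum>b\<in>Basis. (snd z \<bullet> b) *\<^sub>R (\<Sum>d\<in>Basis. (snd z \<bullet> d) *\<^sub>R P' (fst z) b d)))"
      by (rule Ck_on_bounded_linear[OF o, where L="\<lambda>x. (0, x)"])
         (intro bounded_linear_Pair bounded_linear_zero bounded_linear_ident Ck_on_sum[OF o] Ck_on_scaleR[OF o] s p)+
  qed
  then show ?thesis
  proof (rule Ck_on_cong[OF o, rotated])
    fix z :: "'a \<times> 'a" assume "z \<in> U \<times> UNIV"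
    then have f: "fst z \<in> U" by auto
    have "P' (fst z) (snd z) (snd z) = (\<Sum>b\<in>Basis. (snd z \<bullet> b) *\<^sub>R P' (fst z) b (snd z))" by (rule P'_expand[OF f])
    also have "\<dots> = (\<Sum>b\<in>Basis. (snd z \<bullet> b) *\<^sub>R (\<Sum>d\<in>Basis. (snd z \<bullet> d) *\<^sub>R P' (fst z) b d))"
      using linear_basis_expand[OF has_derivative_linear[OF P_has_derivative[OF f]], of _ "snd z"] by simp
    finally show "(snd z, 0::'a) + (0::'a, \<Sum>b\<in>Basis. (snd z \<bullet> b) *\<^sub>R (\<Sum>d\<in>Basis. (snd z \<bullet> d) *\<^sub>R P' (fst z) b d)) = geodesic_field z"
      by (simp add: geodesic_field_def)
  qed
qed

lemma geodesic_field_solution: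
  assumes c: "unit_time_geodesic M c" and t: "t \<in> {0..1}" and U: "(c t, vel c t) \<in> U \<times> UNIV"
  shows "((\<lambda>t. (c t, vel c t)) has_vector_derivative geodesic_field (c t, vel c t)) (at t within {0..1})"
  using has_vector_derivative_Pair[OF geodesic_vel[OF c t] geodesic_acc[OF c t]] geodesic_equation[OF c t] U
  by (simp add: geodesic_field_def)

end

text \<open>The times at which positions and velocities both agree form a closed set, which is open
  by local uniqueness for the first order system; the interval is connected.\<close>

lemma geodesic_unique:
  assumes M: "smooth_submanifold m M" and c: "unit_time_geodesic M c" and d: "unit_time_geodesic M d"
    and 0: "c 0 = d 0" "vel c 0 = vel d 0" and t: "t \<in> {0..1}"
  shows "c t = d t" "vel c t = vel d t"
proof -
  define z1 z2 where "z1 t = (c t, vel c t)" and "z2 t = (d t, vel d t)" for t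
  have c1: "continuous_on {0..1} z1" and c2: "continuous_on {0..1} z2"
    unfolding z1_def z2_def by (intro continuous_on_Pair geodesic_continuous[OF c] geodesic_continuous[OF d])+
  define A where "A = {t \<in> {0..1}. z1 t = z2 t}"
  have "closedin (top_of_set {0..1}) A"
  proof -
    have "closedin (top_of_set {0..1}) ({0..1} \<inter> (\<lambda>t. z1 t - z2 t) -` {0})"
      by (rule continuous_closedin_preimage[OF continuous_on_diff[OF c1 c2]]) auto
    moreover have "{0..1} \<inter> (\<lambda>t. z1 t - z2 t) -` {0} = A" by (auto simp: A_def)
    ultimately show ?thesis by simp
  qed
  moreover have "openin (top_of_set {0..1}) A"
  proof (subst openin_euclidean_subtopology_iff, intro conjI ballI)
    show "A \<subseteq> {0..1}" by (auto simp: A_def)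
    fix s assume "s \<in> A"
    then have s: "s \<in> {0..1}" "z1 s = z2 s" by (auto simp: A_def)
    obtain U r where U: "c s \<in> U" "tube M U r" using smooth_submanifold_tube[OF M geodesic_in_M[OF c s(1)]] by blast
    interpret tube M U r by fact
    have o: "open (U \<times> (UNIV :: 'a set))" using open_U by (intro open_Times) auto
    have "\<exists>e>0. \<forall>t\<in>{0..1}. \<bar>t - s\<bar> < e \<longrightarrow> z1 t = z2 t"
    proof (rule ode_locally_unique[OF o geodesic_field_smooth _ _ c1 c2 s])
      show "(z1 has_vector_derivative geodesic_field (z1 t)) (at t within {0..1})" if "t \<in> {0..1}" "z1 t \<in> U \<times> UNIV" for t
        using geodesic_field_solution[OF c that(1)] that(2) unfolding z1_def by blast
      show "(z2 has_vector_derivative geodesic_field (z2 t)) (at t within {0..1})" if "t \<in> {0..1}" "z2 t \<in> U \<times> UNIV" for t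
        using geodesic_field_solution[OF d that(1)] that(2) unfolding z2_def by blast
      show "z1 s \<in> U \<times> UNIV" using U(1) by (simp add: z1_def)
    qed
    then show "\<exists>e>0. \<forall>t\<in>{0..1}. dist t s < e \<longrightarrow> t \<in> A" by (simp add: A_def dist_real_def)
  qed
  ultimately have "A = {} \<or> A = {0..1}"
    using connected_clopen[THEN iffD1, OF connected_Icc, rule_format, of 0 1 A] by simp
  moreover have "0 \<in> A" using 0 by (simp add: A_def z1_def z2_def)
  ultimately have "A = {0..1}" by blast
  then have "t \<in> A" using t by simp
  then have "z1 t = z2 t" by (simp add: A_def)
  then show "c t = d t" "vel c t = vel d t" by (simp_all add: z1_def z2_def)
qed

text \<open>The derivative of \<open>vel c \<bullet> vel c\<close> is twice the product of a normal
  acceleration with a tangent velocity.\<close>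

lemma geodesic_constant_speed:
  assumes M: "smooth_submanifold m M" and c: "unit_time_geodesic M c" and t: "t \<in> {0..1}"
  shows "norm (vel c t) = norm (vel c 0)"
proof -
  have "norm (vel c t \<bullet> vel c t - vel c 0 \<bullet> vel c 0) \<le> 0 * (t - 0)"
  proof (rule vector_derivative_norm_bound[where f="\<lambda>s. vel c s \<bullet> vel c s" and f'="\<lambda>s. vel c s \<bullet> vel (vel c) s + vel (vel c) s \<bullet> vel c s"])
    fix s assume "s \<in> {0..t}"
    then have s: "s \<in> {0..1}" using t by auto
    have "((\<lambda>s. vel c s \<bullet> vel c s) has_vector_derivative (vel c s \<bullet> vel (vel c) s + vel (vel c) s \<bullet> vel c s)) (at s within {0..1})"
      by (rule bounded_bilinear.has_vector_derivative[OF bounded_bilinear_inner geodesic_acc[OF c s] geodesic_acc[OF c s]])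
    then show "((\<lambda>s. vel c s \<bullet> vel c s) has_vector_derivative (vel c s \<bullet> vel (vel c) s + vel (vel c) s \<bullet> vel c s)) (at s within {0..t})"
      by (rule has_vector_derivative_within_subset) (use t in auto)
    have "vel (vel c) s \<bullet> vel c s = 0"
      by (rule orthogonal_compD[OF geodesic_acc_normal[OF c s] geodesic_vel_tangent'[OF M c s]])
    then show "norm (vel c s \<bullet> vel (vel c) s + vel (vel c) s \<bullet> vel c s) \<le> 0" by (simp add: inner_commute)
  qed (use t in auto)
  then show ?thesis by (simp add: norm_eq_sqrt_inner)
qed

lemma geodesic_rescale:
  assumes c: "unit_time_geodesic M c" and s: "s \<in> {0..1}"
  shows "unit_time_geodesic M (\<lambda>t. c (s * t))" "vel (\<lambda>t. c (s * t)) 0 = s *\<^sub>R vel c 0"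
proof -
  have in01: "s * t \<in> {0..1}" if "t \<in> {0..1}" for t using that s by (auto intro: mult_le_one)
  have chain: "vel (\<lambda>t. f (s * t)) t = s *\<^sub>R f'"
    if "(f has_vector_derivative f') (at (s * t) within {0..1})" "t \<in> {0..1}" for f :: "real \<Rightarrow> 'a" and f' t
  proof (rule vel_eqI[OF _ that(2)])
    have "((\<lambda>t. s * t) has_vector_derivative s) (at t within {0..1})"
      by (auto intro!: derivative_eq_intros simp: has_vector_derivative_def)
    moreover have "(f has_vector_derivative f') (at (s * t) within (\<lambda>t. s * t) ` {0..1})"
      by (rule has_vector_derivative_within_subset[OF that(1)]) (rule image_subsetI[OF in01])
    ultimately show "((\<lambda>t. f (s * t)) has_vector_derivative s *\<^sub>R f') (at t within {0..1})"
      using vector_diff_chain_within[of "\<lambda>t. s * t" s t "{0..1}" f f'] by (simp add: o_def)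
  qed
  have v: "vel (\<lambda>t. c (s * t)) t = s *\<^sub>R vel c (s * t)" if "t \<in> {0..1}" for t
    by (rule chain[OF geodesic_vel[OF c in01[OF that]] that])
  show "vel (\<lambda>t. c (s * t)) 0 = s *\<^sub>R vel c 0" using v[of 0] by simp
  have a: "vel (vel (\<lambda>t. c (s * t))) t = s *\<^sub>R (s *\<^sub>R vel (vel c) (s * t))" if t: "t \<in> {0..1}" for t
  proof -
    have "vel (vel (\<lambda>t. c (s * t))) t = vel (\<lambda>t. s *\<^sub>R vel c (s * t)) t"
      by (rule vel_cong[OF v t])
    also have "\<dots> = s *\<^sub>R (s *\<^sub>R vel (vel c) (s * t))"
      by (rule chain[of "\<lambda>t. s *\<^sub>R vel c t"])
         (use t bounded_linear.has_vector_derivative[OF bounded_linear_scaleR_right geodesic_acc[OF c in01[OF t]]] in auto)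
    finally show ?thesis .
  qed
  show "unit_time_geodesic M (\<lambda>t. c (s * t))"
    unfolding unit_time_geodesic_def
  proof (intro conjI ballI image_subsetI)
    show "smooth_on {0..1} (\<lambda>t. c (s * t))"
      by (rule smooth_on_compose[where g=c and f="\<lambda>t. s * t", OF smooth_on_mult[OF smooth_on_const smooth_on_id] geodesic_smooth[OF c]])
         (rule image_subsetI[OF in01])
    show "c (s * t) \<in> M" if "t \<in> {0..1}" for t by (rule geodesic_in_M[OF c in01[OF that]])
    fix t :: real assume t: "t \<in> {0..1}"
    have "vel (vel (\<lambda>t. c (s * t))) t \<in> (tangent_space M (c (s * t)))\<^sup>\<bottom>"
      unfolding a[OF t] by (intro subspace_scale subspace_orthogonal_comp geodesic_acc_normal[OF c in01[OF t]])
    then show "vector_derivative (\<lambda>u. vector_derivative (\<lambda>t. c (s * t)) (at u within {0..1})) (at t within {0..1}) \<in> (tangent_space M (c (s * t)))\<^sup>\<bottom>"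
      by (simp add: vel_def[abs_def])
  qed
qed

lemma constant_geodesic:
  assumes "p \<in> M" shows "unit_time_geodesic M (\<lambda>t. p)" "vel (\<lambda>t. p) 0 = 0"
proof -
  have v: "vel (\<lambda>t. q) t = 0" if "t \<in> {0..1}" for q :: 'a and t by (rule vel_eqI[OF _ that]) simp
  then show "vel (\<lambda>t. p) 0 = 0" by simp
  show "unit_time_geodesic M (\<lambda>t. p)"
    unfolding unit_time_geodesic_def
  proof (intro conjI ballI)
    fix t :: real assume t: "t \<in> {0..1}"
    have "vel (vel (\<lambda>t. p)) t = 0" using vel_cong[OF v t] v[OF t] by simp
    then show "vector_derivative (\<lambda>u. vector_derivative (\<lambda>t. p) (at u within {0..1})) (at t within {0..1}) \<in> (tangent_space M p)\<^sup>\<bottom>"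
      using subspace_0[OF subspace_orthogonal_comp[of "tangent_space M p"]] by (simp add: vel_def[abs_def])
  qed (use assms in \<open>auto simp: smooth_on_const\<close>)
qed

section \<open>The exponential map and the Gauss lemma\<close>

text \<open>Uniqueness of geodesics makes the definite description denote the end point of any
  geodesic with these initial data.\<close>

lemma exp_map_geodesic:
  assumes M: "smooth_submanifold m M" and c: "unit_time_geodesic M c"
  shows "exp_map M (c 0) (vel c 0) = c 1"
  unfolding exp_map_def
proof (rule the_equality)
  show "\<exists>d. unit_time_geodesic M d \<and> d 0 = c 0 \<and> initial_velocity d = vel c 0 \<and> d 1 = c 1"
    using c by (intro exI[of _ c]) (simp add: initial_velocity_vel)
  fix q assume "\<exists>d. unit_time_geodesic M d \<and> d 0 = c 0 \<and> initial_velocity d = vel c 0 \<and> d 1 = q"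
  then obtain d where d: "unit_time_geodesic M d" "d 0 = c 0" "vel d 0 = vel c 0" "d 1 = q"
    by (auto simp: initial_velocity_vel)
  show "q = c 1" using geodesic_unique(1)[OF M d(1) c d(2,3), of 1] d(4) by simp
qed

text \<open>No existence theorem for the geodesic equation is needed: where no geodesic exists, the
  definite description in the exponential map denotes one fixed point, and with \<open>v\<close> all multiples
  \<open>s v\<close> with \<open>s > 1\<close> would be mapped there, so that injectivity on a ball rules this out.\<close>

lemma geodesic_exists_if_exp_inj:
  assumes M: "smooth_submanifold m M" and p: "p \<in> M"
    and inj: "inj_on (exp_map M p) (tangent_space M p \<inter> ball 0 R)" and T: "subspace (tangent_space M p)"
    and v: "v \<in> tangent_space M p \<inter> ball 0 R"
  shows "\<exists>c. unit_time_geodesic M c \<and> c 0 = p \<and> vel c 0 = v"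
proof (rule ccontr)
  assume no: "\<not> ?thesis"
  have v0: "v \<noteq> 0" using no constant_geodesic[OF p] by blast
  have junk: "exp_map M p u = (THE q. False)" if "\<not> (\<exists>c. unit_time_geodesic M c \<and> c 0 = p \<and> vel c 0 = u)" for u
  proof -
    have "(\<lambda>q. \<exists>c. unit_time_geodesic M c \<and> c 0 = p \<and> initial_velocity c = u \<and> c 1 = q) = (\<lambda>q. False)"
      using that by (auto simp: initial_velocity_vel)
    then show ?thesis by (simp add: exp_map_def)
  qed
  \<comment> \<open>The midpoint between 1 and \<open>R / norm v\<close>: the multiple
    \<open>s v\<close> is longer than \<open>v\<close> and still in the ball.\<close>
  define s where "s = (1 + R / norm v) / 2"
  have nv: "norm v < R" "norm v > 0" using v v0 by auto
  have s: "s > 1" "s * norm v < R" using nv by (auto simp: s_def field_simps)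
  \<comment> \<open>A geodesic for \<open>s v\<close>, slowed down by the factor \<open>1/s\<close>,
    would be one for \<open>v\<close>.\<close>
  have no': "\<not> (\<exists>c. unit_time_geodesic M c \<and> c 0 = p \<and> vel c 0 = s *\<^sub>R v)"
  proof
    assume "\<exists>c. unit_time_geodesic M c \<and> c 0 = p \<and> vel c 0 = s *\<^sub>R v"
    then obtain c where c: "unit_time_geodesic M c" "c 0 = p" "vel c 0 = s *\<^sub>R v" by blast
    have "1 / s \<in> {0..1}" using s by auto
    from geodesic_rescale[OF c(1) this] have "unit_time_geodesic M (\<lambda>t. c (1 / s * t))" "vel (\<lambda>t. c (1 / s * t)) 0 = v"
      using c(3) s by auto
    then show False using no c(2) by auto
  qed
  have "s *\<^sub>R v \<in> tangent_space M p \<inter> ball 0 R" using v s T by (auto simp: subspace_scale)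
  then have "v = s *\<^sub>R v" using inj_onD[OF inj _ v] junk[OF no] junk[OF no'] by metis
  then have "(s - 1) *\<^sub>R v = 0" by (simp add: algebra_simps)
  then show False using s v0 by simp
qed

lemma vel_eqI_eventually:
  assumes "(f has_vector_derivative v) (at t within {0..1})" "\<forall>\<^sub>F s in at t within {0..1}. f s = c s" "f t = c t" "t \<in> {0..1}"
  shows "vel c t = v"
  by (rule vel_eqI[OF _ assms(4)])
     (use has_derivative_transform_eventually[OF assms(1)[unfolded has_vector_derivative_def] assms(2-4)] in \<open>simp add: has_vector_derivative_def\<close>)

locale normal_ball =
  fixes M :: "'a::euclidean_space set" and m :: nat and p :: 'a and R :: real
  assumes M: "smooth_submanifold m M" and p: "p \<in> M" and R: "0 < R"
    and diffeo: "diffeomorphism_on (tangent_space M p \<inter> ball 0 R)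
          (exp_map M p ` (tangent_space M p \<inter> ball 0 R)) (exp_map M p)"
begin

abbreviation "T \<equiv> tangent_space M p"
abbreviation "X \<equiv> T \<inter> ball 0 R"
abbreviation "e \<equiv> exp_map M p"

lemma subspace_T: "subspace T"
proof -
  obtain U r where "p \<in> U" "tube M U r" using smooth_submanifold_tube[OF M p] by blast
  then show ?thesis using tube.subspace_tangent p by blast
qed

lemma inj_e: "inj_on e X" using diffeo by (simp add: diffeomorphism_on_def bij_betw_def)
lemma smooth_e: "smooth_on X e" using diffeo by (simp add: diffeomorphism_on_def)
lemma smooth_inv_e: "smooth_on (e ` X) (the_inv_into X e)" using diffeo by (simp add: diffeomorphism_on_def)

lemma X_scale: assumes "v \<in> X" "t \<in> {0..1}" shows "t *\<^sub>R v \<in> X"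
proof -
  have "\<bar>t\<bar> * norm v \<le> norm v" by (rule mult_left_le_one_le) (use assms(2) in auto)
  then show ?thesis using assms subspace_T by (auto simp: subspace_scale)
qed

lemma zero_X: "0 \<in> X" using subspace_T R by (simp add: subspace_0)

text \<open>Slowed down by the factor \<open>t\<close>, the geodesic with velocity \<open>v\<close>
  has initial velocity \<open>t v\<close> and ends at its former point at time \<open>t\<close>; by
  definition that end is the exponential of \<open>t v\<close>.\<close>

lemma ray:
  assumes v: "v \<in> X"
  obtains c where "unit_time_geodesic M c" "c 0 = p" "vel c 0 = v" "\<And>t. t \<in> {0..1} \<Longrightarrow> c t = e (t *\<^sub>R v)"
proof -
  obtain c where c: "unit_time_geodesic M c" "c 0 = p" "vel c 0 = v"
    using geodesic_exists_if_exp_inj[OF M p inj_e subspace_T v] by blast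
  have "c t = e (t *\<^sub>R v)" if t: "t \<in> {0..1}" for t
    using exp_map_geodesic[OF M geodesic_rescale(1)[OF c(1) t]] geodesic_rescale(2)[OF c(1) t] c by simp
  with c show thesis by (rule that)
qed

lemma e_in_M: assumes "v \<in> X" shows "e v \<in> M"
proof -
  obtain c where c: "unit_time_geodesic M c" "\<And>t. t \<in> {0..1} \<Longrightarrow> c t = e (t *\<^sub>R v)" by (rule ray[OF assms]) blast
  show ?thesis using geodesic_in_M[OF c(1), of 1] c(2)[of 1] by simp
qed

lemma e_0: "e 0 = p"
  using exp_map_geodesic[OF M constant_geodesic(1)[OF p]] constant_geodesic(2)[OF p] by simp

lemma eventually_in_X:
  assumes x: "x \<in> X" and w: "w \<in> T" and G: "open G" "x \<in> G"
  shows "\<forall>\<^sub>F h in nhds 0. x + h *\<^sub>R w \<in> X \<and> x + h *\<^sub>R w \<in> G"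
proof -
  have o: "open (G \<inter> ball 0 R)" using G by auto
  have "((\<lambda>h. x + h *\<^sub>R w) \<longlongrightarrow> x + 0 *\<^sub>R w) (nhds 0)" by (intro tendsto_intros filterlim_ident)
  then have "\<forall>\<^sub>F h in nhds 0. x + h *\<^sub>R w \<in> G \<inter> ball 0 R"
    by (rule topological_tendstoD[OF _ o]) (use x G in auto)
  moreover have "x + h *\<^sub>R w \<in> T" for h using x w subspace_T by (simp add: subspace_add subspace_scale)
  ultimately show ?thesis by (auto elim: eventually_mono)
qed

text \<open>\<open>ext x G g\<close>: an ambient smooth extension of the exponential map near \<open>x\<close>.\<close>

definition ext :: "'a \<Rightarrow> 'a set \<Rightarrow> ('a \<Rightarrow> 'a) \<Rightarrow> bool" where
  "ext x G g \<longleftrightarrow> open G \<and> x \<in> G \<and> (\<forall>k. Ck_on k G g) \<and> (\<forall>y. y \<in> X \<longrightarrow> y \<in> G \<longrightarrow> g y = e y)"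

lemma ext_exists: assumes "x \<in> X" obtains G g where "ext x G g"
proof -
  obtain G g where "open G" "x \<in> G" "\<And>k. Ck_on k G g" "\<And>y. y \<in> X \<Longrightarrow> y \<in> G \<Longrightarrow> g y = e y"
    by (rule smooth_onE[OF smooth_e assms]) blast
  then have "ext x G g" by (simp add: ext_def)
  then show thesis by (rule that)
qed

context
  fixes x0 G g assumes ext: "ext x0 G g"
begin

lemma ext_open: "open G" and ext_smooth: "Ck_on k G g" and ext_eq: "y \<in> X \<Longrightarrow> y \<in> G \<Longrightarrow> g y = e y"
  using ext by (simp_all add: ext_def)

lemma ext_has_derivative: "y \<in> G \<Longrightarrow> (g has_derivative frechet_derivative g (at y)) (at y)"
  by (rule Ck_on_has_derivative[OF ext_smooth])

lemma ext_has_derivative2: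
  "y \<in> G \<Longrightarrow> ((\<lambda>z. frechet_derivative g (at z) w) has_derivative frechet_derivative (\<lambda>z. frechet_derivative g (at z) w) (at y)) (at y)"
  by (rule Ck_on_has_derivative[of 0 G]) (use ext_smooth[of "Suc (Suc 0)"] in simp)

lemma ext_linear: "y \<in> G \<Longrightarrow> linear (frechet_derivative g (at y))"
  using has_derivative_linear[OF ext_has_derivative] .

text \<open>Along a line in a direction of \<open>T\<close> the extension agrees with the
  exponential map and so runs in \<open>M\<close>; its velocity is tangent by
  \<open>B_fixes_velocity\<close>.\<close>

lemma ext_tangent:
  assumes x: "x \<in> X" "x \<in> G" and w: "w \<in> T"
  shows "frechet_derivative g (at x) w \<in> tangent_space M (e x)"
proof -
  obtain U r where U: "e x \<in> U" "tube M U r" using smooth_submanifold_tube[OF M e_in_M[OF x(1)]] by blast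
  interpret tube M U r by fact
  obtain S where S: "open S" "0 \<in> S" "\<And>h. h \<in> S \<Longrightarrow> x + h *\<^sub>R w \<in> X \<and> x + h *\<^sub>R w \<in> G"
    using eventually_in_X[OF x(1) w ext_open x(2)] unfolding eventually_nhds by blast
  have ex: "g x = e x" by (rule ext_eq[OF x])
  have "((\<lambda>h. g (x + h *\<^sub>R w)) has_vector_derivative frechet_derivative g (at x) w) (at 0 within S)"
    using has_derivative_along_line[of g "frechet_derivative g (at x)" x 0 w S] ext_has_derivative[OF x(2)] by simp
  then have "B (g (x + 0 *\<^sub>R w)) (frechet_derivative g (at x) w) = frechet_derivative g (at x) w"
  proof (rule B_fixes_velocity)
    show "(\<lambda>h. g (x + h *\<^sub>R w)) ` S \<subseteq> M"
    proof (rule image_subsetI)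
      fix h assume h: "h \<in> S"
      have "g (x + h *\<^sub>R w) = e (x + h *\<^sub>R w)" using S(3)[OF h] ext_eq by blast
      then show "g (x + h *\<^sub>R w) \<in> M" using S(3)[OF h] e_in_M by simp
    qed
    show "at 0 within S \<noteq> bot" by (simp add: at_within_open[OF S(2,1)])
  qed (use S(2) U(1) ex in simp_all)
  then show ?thesis using tangent_iff[OF e_in_M[OF x(1)] U(1)] ex by simp
qed

text \<open>In directions of \<open>T\<close> the derivative of an extension is computed from the
  exponential map alone, so different extensions agree. Along a ray the extension has to be changed,
  and this is what glues the pieces.\<close>

lemma ext_vector_derivative:
  assumes x: "x \<in> X" "x \<in> G" and w: "w \<in> T"
  shows "vector_derivative (\<lambda>h. e (x + h *\<^sub>R w)) (at 0) = frechet_derivative g (at x) w"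
proof -
  obtain S where S: "open S" "0 \<in> S" "\<And>h. h \<in> S \<Longrightarrow> x + h *\<^sub>R w \<in> X \<and> x + h *\<^sub>R w \<in> G"
    using eventually_in_X[OF x(1) w ext_open x(2)] unfolding eventually_nhds by blast
  have "((\<lambda>h. g (x + h *\<^sub>R w)) has_vector_derivative frechet_derivative g (at x) w) (at 0)"
    using has_derivative_along_line[of g "frechet_derivative g (at x)" x 0 w UNIV] ext_has_derivative[OF x(2)] by simp
  then have "((\<lambda>h. e (x + h *\<^sub>R w)) has_vector_derivative frechet_derivative g (at x) w) (at 0)"
    by (rule has_vector_derivative_transform_within_open[OF _ S(1,2)]) (rule ext_eq; use S(3) in blast)
  then show ?thesis by (rule vector_derivative_at)
qed

lemma eventually_ray_in_G:
  assumes "t0 \<in> {0..1}" "t0 *\<^sub>R x \<in> G"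
  shows "\<forall>\<^sub>F t in at t0 within {0..1}. t \<in> {0..1} \<and> t *\<^sub>R x \<in> G"
proof -
  have "((\<lambda>t. t *\<^sub>R x) \<longlongrightarrow> t0 *\<^sub>R x) (at t0 within {0..1})" by (intro tendsto_intros)
  then have "\<forall>\<^sub>F t in at t0 within {0..1}. t *\<^sub>R x \<in> G" by (rule topological_tendstoD[OF _ ext_open assms(2)])
  moreover have "\<forall>\<^sub>F t in at t0 within {0..1}. t \<in> {0..1}" by (simp add: eventually_at_filter)
  ultimately show ?thesis by eventually_elim simp
qed

lemma ext_ray_vel:
  assumes x: "x \<in> X" and c: "unit_time_geodesic M c" "\<And>t. t \<in> {0..1} \<Longrightarrow> c t = e (t *\<^sub>R x)"
    and t: "t \<in> {0..1}" "t *\<^sub>R x \<in> G"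
  shows "vel c t = frechet_derivative g (at (t *\<^sub>R x)) x"
proof (rule vel_eqI_eventually[where f="\<lambda>s. g (s *\<^sub>R x)"])
  show "((\<lambda>s. g (s *\<^sub>R x)) has_vector_derivative frechet_derivative g (at (t *\<^sub>R x)) x) (at t within {0..1})"
    using has_derivative_along_line[of g _ 0 t x "{0..1}"] ext_has_derivative[OF t(2)] by simp
  have eq: "g (s *\<^sub>R x) = c s" if "s \<in> {0..1}" "s *\<^sub>R x \<in> G" for s
    unfolding c(2)[OF that(1)] by (rule ext_eq[OF X_scale[OF x that(1)] that(2)])
  show "\<forall>\<^sub>F s in at t within {0..1}. g (s *\<^sub>R x) = c s"
    using eventually_ray_in_G[OF t] by eventually_elim (simp add: eq)
  show "g (t *\<^sub>R x) = c t" by (rule eq[OF t])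
qed (rule t(1))

lemma ext_ray_acc:
  assumes x: "x \<in> X" and c: "unit_time_geodesic M c" "\<And>t. t \<in> {0..1} \<Longrightarrow> c t = e (t *\<^sub>R x)"
    and t: "t \<in> {0..1}" "t *\<^sub>R x \<in> G"
  shows "vel (vel c) t = frechet_derivative (\<lambda>z. frechet_derivative g (at z) x) (at (t *\<^sub>R x)) x"
proof (rule vel_eqI_eventually[where f="\<lambda>s. frechet_derivative g (at (s *\<^sub>R x)) x"])
  show "((\<lambda>s. frechet_derivative g (at (s *\<^sub>R x)) x) has_vector_derivative
      frechet_derivative (\<lambda>z. frechet_derivative g (at z) x) (at (t *\<^sub>R x)) x) (at t within {0..1})"
    using has_derivative_along_line[of "\<lambda>z. frechet_derivative g (at z) x" _ 0 t x "{0..1}"] ext_has_derivative2[OF t(2)] by simp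
  show "\<forall>\<^sub>F s in at t within {0..1}. frechet_derivative g (at (s *\<^sub>R x)) x = vel c s"
    using eventually_ray_in_G[OF t] by eventually_elim (use ext_ray_vel[OF x c] in simp)
  show "frechet_derivative g (at (t *\<^sub>R x)) x = vel c t" using ext_ray_vel[OF x c t] by simp
qed (rule t(1))

lemma ext_ray_speed:
  assumes x: "x \<in> X" and t: "t \<in> {0..1}" "t *\<^sub>R x \<in> G"
  shows "norm (frechet_derivative g (at (t *\<^sub>R x)) x) = norm x"
proof -
  obtain c where c: "unit_time_geodesic M c" "c 0 = p" "vel c 0 = x" "\<And>t. t \<in> {0..1} \<Longrightarrow> c t = e (t *\<^sub>R x)"
    by (rule ray[OF x]) blast
  show ?thesis using geodesic_constant_speed[OF M c(1) t(1)] ext_ray_vel[OF x c(1,4) t] c(3) by simp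
qed

text \<open>The ray with initial velocity \<open>x + s w\<close> has constant speed, so the square
  of its speed at time \<open>t\<close> is \<open>(x + s w) \<bullet> (x + s w)\<close>.
  Differentiating at \<open>s = 0\<close> and exchanging second derivatives gives the
  identity.\<close>

lemma ext_radial_variation:
  assumes x: "x \<in> X" and w: "w \<in> T" and t: "t \<in> {0..1}" "t *\<^sub>R x \<in> G"
  shows "frechet_derivative g (at (t *\<^sub>R x)) x \<bullet>
    (t *\<^sub>R frechet_derivative (\<lambda>z. frechet_derivative g (at z) w) (at (t *\<^sub>R x)) x + frechet_derivative g (at (t *\<^sub>R x)) w) = x \<bullet> w"
proof -
  let ?y = "t *\<^sub>R x"
  let ?D = "\<lambda>z. frechet_derivative g (at z)"
  \<comment> \<open>For small \<open>s\<close> this is the velocity at time \<open>t\<close> of the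
    ray with initial velocity \<open>x + s w\<close>.\<close>
  define f where "f s = ?D (?y + s *\<^sub>R (t *\<^sub>R w)) x + s *\<^sub>R ?D (?y + s *\<^sub>R (t *\<^sub>R w)) w" for s
  define A where "A = t *\<^sub>R frechet_derivative (\<lambda>z. ?D z w) (at ?y) x + ?D ?y w"
  have f0: "f 0 = ?D ?y x" by (simp add: f_def)
  have dD: "((\<lambda>s. ?D (?y + s *\<^sub>R (t *\<^sub>R w)) u) has_vector_derivative frechet_derivative (\<lambda>z. ?D z u) (at ?y) (t *\<^sub>R w)) (at 0)" for u
    using has_derivative_along_line[of "\<lambda>z. ?D z u" _ ?y 0 "t *\<^sub>R w" UNIV] ext_has_derivative2[OF t(2)] by simp
  have "(f has_vector_derivative (frechet_derivative (\<lambda>z. ?D z x) (at ?y) (t *\<^sub>R w) +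
      (0 *\<^sub>R frechet_derivative (\<lambda>z. ?D z w) (at ?y) (t *\<^sub>R w) + 1 *\<^sub>R ?D (?y + 0 *\<^sub>R (t *\<^sub>R w)) w))) (at 0)"
    unfolding f_def
    by (rule has_vector_derivative_add[OF dD bounded_bilinear.has_vector_derivative[OF bounded_bilinear_scaleR has_vector_derivative_id dD]])
  moreover have "frechet_derivative (\<lambda>z. ?D z x) (at ?y) (t *\<^sub>R w) = t *\<^sub>R frechet_derivative (\<lambda>z. ?D z w) (at ?y) x"
    using linear_scale[OF has_derivative_linear[OF ext_has_derivative2[OF t(2)]]] Ck_on_second_derivative_commute[OF ext_open t(2) ext_smooth]
    by simp
  ultimately have fd: "(f has_vector_derivative A) (at 0)" by (simp add: A_def)
  have 1: "((\<lambda>s. f s \<bullet> f s) has_vector_derivative (f 0 \<bullet> A + A \<bullet> f 0)) (at 0)"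
    by (rule bounded_bilinear.has_vector_derivative[OF bounded_bilinear_inner fd fd])
  have ld: "((\<lambda>s. x + s *\<^sub>R w) has_vector_derivative w) (at 0)"
    using has_derivative_along_line[of "\<lambda>z. z" "\<lambda>z. z" x 0 w UNIV] by simp
  have 2: "((\<lambda>s. (x + s *\<^sub>R w) \<bullet> (x + s *\<^sub>R w)) has_vector_derivative ((x + 0 *\<^sub>R w) \<bullet> w + w \<bullet> (x + 0 *\<^sub>R w))) (at 0)"
    by (rule bounded_bilinear.has_vector_derivative[OF bounded_bilinear_inner ld ld])
  have tw: "t *\<^sub>R w \<in> T" using w subspace_T by (simp add: subspace_scale)
  have "\<forall>\<^sub>F s in nhds 0. f s \<bullet> f s = (x + s *\<^sub>R w) \<bullet> (x + s *\<^sub>R w)"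
    using eventually_in_X[OF x w open_UNIV UNIV_I] eventually_in_X[OF X_scale[OF x t(1)] tw ext_open t(2)]
  proof eventually_elim
    case (elim s)
    have eq: "?y + s *\<^sub>R (t *\<^sub>R w) = t *\<^sub>R (x + s *\<^sub>R w)" by (simp add: algebra_simps)
    have inG: "t *\<^sub>R (x + s *\<^sub>R w) \<in> G" using elim(2) unfolding eq by blast
    have "f s = ?D (t *\<^sub>R (x + s *\<^sub>R w)) (x + s *\<^sub>R w)"
      unfolding f_def eq using ext_linear[OF inG] by (simp add: linear_add linear_scale)
    then have "norm (f s) = norm (x + s *\<^sub>R w)" using ext_ray_speed[OF _ t(1) inG] elim(1) by simp
    then show ?case by (simp add: dot_square_norm)
  qed
  then obtain S where S: "open S" "0 \<in> S" "\<And>s. s \<in> S \<Longrightarrow> f s \<bullet> f s = (x + s *\<^sub>R w) \<bullet> (x + s *\<^sub>R w)"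
    unfolding eventually_nhds by blast
  have "((\<lambda>s. (x + s *\<^sub>R w) \<bullet> (x + s *\<^sub>R w)) has_vector_derivative (f 0 \<bullet> A + A \<bullet> f 0)) (at 0)"
    by (rule has_vector_derivative_transform_within_open[OF 1 S])
  from vector_derivative_unique_at[OF this 2] have "f 0 \<bullet> A = x \<bullet> w" by (simp add: inner_commute)
  then show ?thesis by (simp add: f0 A_def)
qed

end

text \<open>The quantity \<open>E x t \<bullet> (t E w t) - t (x \<bullet> w)\<close> vanishes at
  \<open>t = 0\<close> and has zero derivative: differentiating the first factor produces the normal
  acceleration of the ray, orthogonal to the tangent vector \<open>E w t\<close>, and
  differentiating the second is covered by \<open>ext_radial_variation\<close>.\<close>

lemma gauss:
  assumes x: "x \<in> X" and w: "w \<in> T" and ext: "ext x G g"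
  shows "frechet_derivative g (at x) x \<bullet> frechet_derivative g (at x) w = x \<bullet> w"
proof -
  have xT: "x \<in> T" using x by simp
  obtain c where c: "unit_time_geodesic M c" "c 0 = p" "vel c 0 = x" "\<And>t. t \<in> {0..1} \<Longrightarrow> c t = e (t *\<^sub>R x)"
    by (rule ray[OF x]) blast
  \<comment> \<open>\<open>E\<close> is expressed by the exponential map itself and hence makes
    sense along the whole ray, while a smooth extension \<open>h\<close> is chosen anew at each
    \<open>t\<close>.\<close>
  define E where "E y t = vector_derivative (\<lambda>h. e (t *\<^sub>R x + h *\<^sub>R y)) (at 0)" for y t
  define a where "a t = E x t \<bullet> (t *\<^sub>R E w t) - t *\<^sub>R (x \<bullet> w)" for t :: real
  have "norm (a 1 - a 0) \<le> 0 * (1 - 0)"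
  proof (rule vector_derivative_norm_bound[where f'="\<lambda>t. 0"])
    fix t :: real assume t: "t \<in> {0..1}"
    obtain H h where H: "ext (t *\<^sub>R x) H h" by (rule ext_exists[OF X_scale[OF x t]])
    have txH: "t *\<^sub>R x \<in> H" using H by (simp add: ext_def)
    let ?D = "\<lambda>z. frechet_derivative h (at z)"
    let ?y = "t *\<^sub>R x"
    have Eeq: "E y s = ?D (s *\<^sub>R x) y" if "y \<in> T" "s \<in> {0..1}" "s *\<^sub>R x \<in> H" for y s
      unfolding E_def by (rule ext_vector_derivative[OF H X_scale[OF x that(2)] that(3,1)])
    define S1 where "S1 = frechet_derivative (\<lambda>z. ?D z x) (at ?y) x"
    define S2 where "S2 = frechet_derivative (\<lambda>z. ?D z w) (at ?y) x"
    have dD: "((\<lambda>s. ?D (s *\<^sub>R x) u) has_vector_derivative frechet_derivative (\<lambda>z. ?D z u) (at ?y) x) (at t within {0..1})" for u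
      using has_derivative_along_line[of "\<lambda>z. ?D z u" _ 0 t x "{0..1}"] ext_has_derivative2[OF H txH] by simp
    have "((\<lambda>s. ?D (s *\<^sub>R x) x \<bullet> (s *\<^sub>R ?D (s *\<^sub>R x) w)) has_vector_derivative
       (?D ?y x \<bullet> (t *\<^sub>R S2 + 1 *\<^sub>R ?D ?y w) + S1 \<bullet> (t *\<^sub>R ?D ?y w))) (at t within {0..1})"
      unfolding S1_def S2_def
      by (rule bounded_bilinear.has_vector_derivative[OF bounded_bilinear_inner dD
           bounded_bilinear.has_vector_derivative[OF bounded_bilinear_scaleR has_vector_derivative_id dD]])
    moreover have "?D ?y x \<bullet> (t *\<^sub>R S2 + 1 *\<^sub>R ?D ?y w) = x \<bullet> w"
      using ext_radial_variation[OF H x w t txH] by (simp add: S2_def)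
    moreover have "S1 \<bullet> (t *\<^sub>R ?D ?y w) = 0"
    proof -
      have "S1 = vel (vel c) t" unfolding S1_def by (rule ext_ray_acc[OF H x c(1,4) t txH, symmetric])
      moreover have "?D ?y w \<in> tangent_space M (c t)"
        using ext_tangent[OF H X_scale[OF x t] txH w] c(4)[OF t] by simp
      ultimately have "S1 \<bullet> ?D ?y w = 0" using orthogonal_compD[OF geodesic_acc_normal[OF c(1) t]] by simp
      then show ?thesis by simp
    qed
    ultimately have 1: "((\<lambda>s. ?D (s *\<^sub>R x) x \<bullet> (s *\<^sub>R ?D (s *\<^sub>R x) w)) has_vector_derivative x \<bullet> w) (at t within {0..1})"
      by (simp only: add_0_right)
    have 2: "((\<lambda>s. s *\<^sub>R (x \<bullet> w)) has_vector_derivative x \<bullet> w) (at t within {0..1})"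
      by (auto intro!: derivative_eq_intros simp: has_vector_derivative_def)
    have 3: "((\<lambda>s. ?D (s *\<^sub>R x) x \<bullet> (s *\<^sub>R ?D (s *\<^sub>R x) w) - s *\<^sub>R (x \<bullet> w)) has_vector_derivative 0) (at t within {0..1})"
      using has_vector_derivative_diff[OF 1 2] by simp
    have aeq: "?D (s *\<^sub>R x) x \<bullet> (s *\<^sub>R ?D (s *\<^sub>R x) w) - s *\<^sub>R (x \<bullet> w) = a s" if "s \<in> {0..1}" "s *\<^sub>R x \<in> H" for s
      unfolding a_def Eeq[OF xT that] Eeq[OF w that] ..
    have ev: "\<forall>\<^sub>F s in at t within {0..1}. ?D (s *\<^sub>R x) x \<bullet> (s *\<^sub>R ?D (s *\<^sub>R x) w) - s *\<^sub>R (x \<bullet> w) = a s"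
      using eventually_ray_in_G[OF H t txH] by eventually_elim (use aeq in simp)
    show "(a has_vector_derivative 0) (at t within {0..1})"
      unfolding has_vector_derivative_def
      by (rule has_derivative_transform_eventually[OF 3[unfolded has_vector_derivative_def] ev aeq[OF t txH] t])
  qed simp_all
  then have "a 1 = 0" by (simp add: a_def)
  moreover have xG: "x \<in> G" using ext by (simp add: ext_def)
  have "E y 1 = frechet_derivative g (at x) y" if "y \<in> T" for y
    unfolding E_def using ext_vector_derivative[OF ext x xG that] by simp
  ultimately show ?thesis using xT w by (simp add: a_def)
qed

end

section \<open>Piecewise smooth paths and the geodesic distance\<close>

lemma smooth_on_interior_derivative:
  fixes \<gamma> :: "real \<Rightarrow> 'a::euclidean_space"
  assumes "smooth_on {u..v} \<gamma>" "t \<in> {u<..<v}"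
  shows "(\<gamma> has_vector_derivative vector_derivative \<gamma> (at t)) (at t)"
    and "vector_derivative \<gamma> (at t) = vector_derivative \<gamma> (at t within {u..v})"
proof -
  have uv: "u < v" "t \<in> {u..v}" using assms(2) by auto
  have at: "at t within {u..v} = at t" using assms(2) by (intro at_within_Icc_at) auto
  show "vector_derivative \<gamma> (at t) = vector_derivative \<gamma> (at t within {u..v})" by (simp add: at)
  show "(\<gamma> has_vector_derivative vector_derivative \<gamma> (at t)) (at t)"
    using smooth_on_curve_derivative(1)[OF assms(1) uv] by (simp add: at)
qed

lemma speed_integrable_piece:
  fixes \<gamma> :: "real \<Rightarrow> 'a::euclidean_space"
  assumes "smooth_on {u..v} \<gamma>" "u < v"
  shows "(\<lambda>t. norm (vector_derivative \<gamma> (at t))) integrable_on {u..v}"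
proof (rule integrable_spike[where S="{u, v}"])
  show "(\<lambda>t. norm (vector_derivative \<gamma> (at t within {u..v}))) integrable_on {u..v}"
    by (intro integrable_continuous_real continuous_on_norm smooth_on_continuous smooth_on_curve_derivative(2)[OF assms])
  show "norm (vector_derivative \<gamma> (at t)) = norm (vector_derivative \<gamma> (at t within {u..v}))" if "t \<in> {u..v} - {u, v}" for t
    using smooth_on_interior_derivative(2)[OF assms(1), of t] that by simp
qed (rule negligible_finite, simp)

text \<open>The derivative in \<open>curve_length\<close> is two-sided, so its values at break
  points and end points carry no meaning; these points form a finite set and do not affect the
  integrals.\<close>

lemma piecewise_smooth_path_ac_on:
  fixes \<gamma> :: "real \<Rightarrow> 'a::euclidean_space"
  assumes "piecewise_smooth_path \<gamma>"
  obtains S where "finite S"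
    "\<And>t. t \<in> {0<..<1} - S \<Longrightarrow> (\<gamma> has_vector_derivative vector_derivative \<gamma> (at t)) (at t)"
    "(\<lambda>t. norm (vector_derivative \<gamma> (at t))) integrable_on {0..1}"
    "ac_on 0 1 \<gamma> (\<lambda>t. vector_derivative \<gamma> (at t))"
proof -
  obtain S where S: "finite S" "\<And>a b. 0 \<le> a \<Longrightarrow> a < b \<Longrightarrow> b \<le> 1 \<Longrightarrow> {a<..<b} \<inter> S = {} \<Longrightarrow> smooth_on {a..b} \<gamma>"
    and c: "continuous_on {0..1} \<gamma>"
    using assms unfolding piecewise_smooth_path_def by blast
  have d: "(\<gamma> has_vector_derivative vector_derivative \<gamma> (at t)) (at t)" if t: "t \<in> {0<..<1} - S" for t
  proof -
    have "open ({0<..<1} - S)" using finite_imp_closed[OF S(1)] by (intro open_Diff) auto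
    then obtain e where e: "e > 0" "cball t e \<subseteq> {0<..<1} - S" using t open_contains_cball by blast
    have sub: "{t - e..t + e} \<subseteq> {0<..<1} - S" using e(2) by (simp add: cball_eq_atLeastAtMost)
    have l: "t - e \<in> {0<..<1} - S" and u: "t + e \<in> {0<..<1} - S"
      by (rule subsetD[OF sub], use e(1) in simp)+
    have "{t - e<..<t + e} \<inter> S = {}"
    proof (rule equals0I)
      fix s assume s: "s \<in> {t - e<..<t + e} \<inter> S"
      then have "s \<in> {0<..<1} - S" by (intro subsetD[OF sub]) simp
      then show False using s by blast
    qed
    then have "smooth_on {t - e..t + e} \<gamma>" using l u e(1) by (intro S(2)) simp_all
    then show ?thesis by (rule smooth_on_interior_derivative(1)) (use e(1) in simp)
  qed
  have sing: "(\<lambda>t. norm (vector_derivative \<gamma> (at t))) integrable_on {y}" for y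
    using integrable_on_refl[of "\<lambda>t. norm (vector_derivative \<gamma> (at t))" y] by simp
  \<comment> \<open>Integrability is local: near \<open>x\<close> no break point other than
    \<open>x\<close> occurs, so the path is smooth on each side of \<open>x\<close>.\<close>
  have i: "(\<lambda>t. norm (vector_derivative \<gamma> (at t))) integrable_on cbox 0 1"
  proof (rule integrable_on_little_subintervals, rule ballI)
    fix x :: real assume x: "x \<in> cbox 0 1"
    obtain r where r: "r > 0" "\<And>s. s \<in> S \<Longrightarrow> s \<noteq> x \<Longrightarrow> r \<le> dist x s" using finite_set_avoid[OF S(1)] by blast
    show "\<exists>r>0. \<forall>u v. x \<in> cbox u v \<and> cbox u v \<subseteq> ball x r \<and> cbox u v \<subseteq> cbox 0 1 \<longrightarrow>
        (\<lambda>t. norm (vector_derivative \<gamma> (at t))) integrable_on cbox u v"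
    proof (intro exI[of _ r] conjI allI impI)
      fix u v :: real assume uv: "x \<in> cbox u v \<and> cbox u v \<subseteq> ball x r \<and> cbox u v \<subseteq> cbox 0 1"
      then have ux: "u \<le> x" "x \<le> v" by auto
      have "u \<in> cbox u v" "v \<in> cbox u v" using ux by auto
      then have uv': "dist x u < r" "dist x v < r" "0 \<le> u" "v \<le> 1" using uv by (auto simp: subset_eq)
      have no: "{u<..<x} \<inter> S = {}" "{x<..<v} \<inter> S = {}"
        using r(2) uv' by (force simp: dist_real_def)+
      have "(\<lambda>t. norm (vector_derivative \<gamma> (at t))) integrable_on {u..x}"
      proof (cases "u < x")
        case True show ?thesis by (rule speed_integrable_piece[OF S(2) True]) (use True no uv' ux in auto)
      next
        case False then show ?thesis using ux sing[of x] by simp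
      qed
      moreover have "(\<lambda>t. norm (vector_derivative \<gamma> (at t))) integrable_on {x..v}"
      proof (cases "x < v")
        case True show ?thesis by (rule speed_integrable_piece[OF S(2) True]) (use True no uv' ux in auto)
      next
        case False then show ?thesis using ux sing[of x] by simp
      qed
      ultimately show "(\<lambda>t. norm (vector_derivative \<gamma> (at t))) integrable_on cbox u v"
        using Henstock_Kurzweil_Integration.integrable_combine[OF ux] by simp
    qed (rule r(1))
  qed
  have f: "((\<lambda>t. vector_derivative \<gamma> (at t)) has_integral (\<gamma> x - \<gamma> 0)) {0..x}" if "0 \<le> x" "x \<le> 1" for x
    by (rule fundamental_theorem_of_calculus_interior_strong[OF S(1) that(1)])
       (use d that in \<open>auto intro: continuous_on_subset[OF c]\<close>)
  have "ac_on 0 1 \<gamma> (\<lambda>t. vector_derivative \<gamma> (at t))"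
  proof (rule ac_onI)
    show "(\<lambda>t. vector_derivative \<gamma> (at t)) absolutely_integrable_on {0..1}"
      unfolding absolutely_integrable_on_def using f[of 1] i by auto
    show "\<gamma> x - \<gamma> 0 = integral {0..x} (\<lambda>t. vector_derivative \<gamma> (at t))" if "0 \<le> x" "x \<le> 1" for x
      using integral_unique[OF f[OF that]] by simp
  qed
  then show thesis using that[OF S(1) d] i by simp
qed

lemma curve_length_nonneg: "curve_length c \<ge> 0"
proof (cases "(\<lambda>t. norm (vector_derivative c (at t))) integrable_on {0..1}")
  case True then show ?thesis unfolding curve_length_def by (rule Henstock_Kurzweil_Integration.integral_nonneg) simp
next
  case False then show ?thesis by (simp add: curve_length_def not_integrable_integral)
qed

text \<open>Cauchy-Schwarz on the unit interval, obtained by integrating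
  \<open>(norm (h t) - L)^2 \<ge> 0\<close> with \<open>L\<close> the length.\<close>

lemma curve_length_square_le_energy:
  fixes \<gamma> :: "real \<Rightarrow> 'a::euclidean_space"
  assumes "piecewise_smooth_path \<gamma>" "ac_on 0 1 \<gamma> h" "(\<lambda>t. (norm (h t))\<^sup>2) integrable_on {0..1}"
  shows "(curve_length \<gamma>)\<^sup>2 \<le> integral {0..1} (\<lambda>t. (norm (h t))\<^sup>2)"
proof -
  have ac: "ac_on 0 1 \<gamma> (\<lambda>t. vector_derivative \<gamma> (at t))" by (rule piecewise_smooth_path_ac_on[OF assms(1)])
  obtain N where N: "negligible N" "\<And>t. t \<in> {0..1} - N \<Longrightarrow> vector_derivative \<gamma> (at t) = h t"
    using ac_on_unique[OF ac assms(2)] by blast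
  define L where "L = curve_length \<gamma>"
  have hi: "(\<lambda>t. norm (h t)) integrable_on {0..1}"
    using ac_on_absolutely_integrable[OF assms(2)] unfolding absolutely_integrable_on_def by blast
  have L: "integral {0..1} (\<lambda>t. norm (h t)) = L"
    unfolding L_def curve_length_def by (rule integral_spike[OF N(1)]) (simp add: N(2))
  have "((\<lambda>t. (norm (h t))\<^sup>2 - 2 * L * norm (h t) + L\<^sup>2) has_integral
      (integral {0..1} (\<lambda>t. (norm (h t))\<^sup>2) - 2 * L * L + (1 - 0) *\<^sub>R L\<^sup>2)) {0..1}"
    unfolding L[symmetric]
    by (intro has_integral_add has_integral_diff has_integral_mult_right integrable_integral hi assms(3))
       (use has_integral_const_real[of _ 0 1] in simp)
  moreover have "(norm (h t))\<^sup>2 - 2 * L * norm (h t) + L\<^sup>2 = (norm (h t) - L)\<^sup>2" for t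
    by (simp add: power2_diff)
  ultimately have "0 \<le> integral {0..1} (\<lambda>t. (norm (h t))\<^sup>2) - 2 * L * L + (1 - 0) *\<^sub>R L\<^sup>2"
    using has_integral_nonneg[of "\<lambda>t. (norm (h t) - L)\<^sup>2"] by simp
  then show ?thesis by (simp add: L_def power2_eq_square)
qed

lemma piecewise_smooth_path_smooth: "smooth_on {0..1} c \<Longrightarrow> piecewise_smooth_path c"
  unfolding piecewise_smooth_path_def
  by (intro conjI smooth_on_continuous exI[of _ "{}"]) (auto intro: smooth_on_subset)

lemma piecewise_smooth_path_reverse:
  fixes c :: "real \<Rightarrow> 'a::euclidean_space"
  assumes "piecewise_smooth_path c"
  shows "piecewise_smooth_path (\<lambda>t. c (1 - t))" "curve_length (\<lambda>t. c (1 - t)) = curve_length c"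
proof -
  obtain S where S: "finite S" "\<And>a b. 0 \<le> a \<Longrightarrow> a < b \<Longrightarrow> b \<le> 1 \<Longrightarrow> {a<..<b} \<inter> S = {} \<Longrightarrow> smooth_on {a..b} c"
    and c: "continuous_on {0..1} c"
    using assms unfolding piecewise_smooth_path_def by blast
  show "piecewise_smooth_path (\<lambda>t. c (1 - t))"
    unfolding piecewise_smooth_path_def
  proof (intro conjI exI[of _ "(\<lambda>t. 1 - t) ` S"] allI impI)
    show "continuous_on {0..1} (\<lambda>t. c (1 - t))"
      by (rule continuous_on_compose2[OF c]) (auto intro!: continuous_intros)
    fix a b :: real assume ab: "0 \<le> a \<and> a < b \<and> b \<le> 1 \<and> {a<..<b} \<inter> (\<lambda>t. 1 - t) ` S = {}"
    have "{1 - b<..<1 - a} \<inter> S = {}"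
    proof (rule equals0I)
      fix s assume s: "s \<in> {1 - b<..<1 - a} \<inter> S"
      then have "1 - s \<in> {a<..<b} \<inter> (\<lambda>t. 1 - t) ` S" by auto
      then show False using ab by auto
    qed
    then have "smooth_on {1 - b..1 - a} c" using ab by (intro S(2)) auto
    then show "smooth_on {a..b} (\<lambda>t. c (1 - t))"
      by (rule smooth_on_compose[where g=c and f="\<lambda>t. 1 - t", OF smooth_on_diff[OF smooth_on_const smooth_on_id]]) auto
  qed (use S(1) in simp)
  obtain S' where S': "finite S'" "\<And>t. t \<in> {0<..<1} - S' \<Longrightarrow> (c has_vector_derivative vector_derivative c (at t)) (at t)"
    "(\<lambda>t. norm (vector_derivative c (at t))) integrable_on {0..1}"
    by (rule piecewise_smooth_path_ac_on[OF assms]) blast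
  have "((\<lambda>t. norm (vector_derivative c (at t))) has_integral curve_length c) (cbox 0 1)"
    using S'(3) by (simp add: curve_length_def has_integral_iff)
  from has_integral_affinity[OF this, of "-1" 1]
  have "((\<lambda>t. norm (vector_derivative c (at (1 - t)))) has_integral curve_length c) ((\<lambda>x. 1 - x) ` {0..1})"
    by (simp add: algebra_simps)
  moreover have "(\<lambda>x::real. 1 - x) ` {0..1} = {0..1}"
  proof (intro equalityI subsetI)
    fix x :: real assume "x \<in> {0..1}"
    then have "1 - x \<in> {0..1}" "x = 1 - (1 - x)" by auto
    then show "x \<in> (\<lambda>x. 1 - x) ` {0..1}" by (rule rev_image_eqI)
  qed auto
  ultimately have 1: "((\<lambda>t. norm (vector_derivative c (at (1 - t)))) has_integral curve_length c) {0..1}" by simp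
  have "((\<lambda>t. norm (vector_derivative (\<lambda>t. c (1 - t)) (at t))) has_integral curve_length c) {0..1}"
  proof (rule has_integral_spike[OF negligible_finite _ 1])
    show "finite ({0, 1} \<union> (\<lambda>t. 1 - t) ` S')" using S'(1) by simp
    fix t :: real assume t: "t \<in> {0..1} - ({0, 1} \<union> (\<lambda>t. 1 - t) ` S')"
    have "1 - t \<notin> S'"
    proof
      assume "1 - t \<in> S'"
      then have "1 - (1 - t) \<in> (\<lambda>t. 1 - t) ` S'" by (rule imageI)
      then show False using t by simp
    qed
    then have "(c has_vector_derivative vector_derivative c (at (1 - t))) (at (1 - t))"
      using t by (intro S'(2)) auto
    moreover have "((\<lambda>t. 1 - t) has_vector_derivative - 1) (at t)"
      by (auto intro!: derivative_eq_intros simp: has_vector_derivative_def)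
    ultimately have "((\<lambda>t. c (1 - t)) has_vector_derivative - 1 *\<^sub>R vector_derivative c (at (1 - t))) (at t)"
      using vector_diff_chain_at[of "\<lambda>t. 1 - t" "-1" t c] by (simp add: o_def)
    then show "norm (vector_derivative (\<lambda>t. c (1 - t)) (at t)) = norm (vector_derivative c (at (1 - t)))"
      by (simp add: vector_derivative_at)
  qed
  then show "curve_length (\<lambda>t. c (1 - t)) = curve_length c"
    by (simp add: curve_length_def integral_unique)
qed

lemma piecewise_smooth_path_join:
  fixes c d :: "real \<Rightarrow> 'a::euclidean_space"
  assumes c: "piecewise_smooth_path c" and d: "piecewise_smooth_path d" and "c 1 = d 0"
  shows "piecewise_smooth_path (\<lambda>t. if t \<le> 1/2 then c (2 * t) else d (2 * t - 1))"
proof -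
  let ?j = "\<lambda>t. if t \<le> 1/2 then c (2 * t) else d (2 * t - 1)"
  obtain S where S: "finite S" "\<And>a b. 0 \<le> a \<Longrightarrow> a < b \<Longrightarrow> b \<le> 1 \<Longrightarrow> {a<..<b} \<inter> S = {} \<Longrightarrow> smooth_on {a..b} c"
    and cc: "continuous_on {0..1} c"
    using c unfolding piecewise_smooth_path_def by blast
  obtain S' where S': "finite S'" "\<And>a b. 0 \<le> a \<Longrightarrow> a < b \<Longrightarrow> b \<le> 1 \<Longrightarrow> {a<..<b} \<inter> S' = {} \<Longrightarrow> smooth_on {a..b} d"
    and cd: "continuous_on {0..1} d"
    using d unfolding piecewise_smooth_path_def by blast
  define Z where "Z = insert (1/2) ((\<lambda>s. s / 2) ` S \<union> (\<lambda>s. (s + 1) / 2) ` S')"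
  show ?thesis unfolding piecewise_smooth_path_def
  proof (intro conjI exI[of _ Z] allI impI)
    have "continuous_on ({0..1/2} \<union> {1/2..1}) ?j"
    proof (rule continuous_on_cases)
      show "continuous_on {0..1/2} (\<lambda>t. c (2 * t))"
        by (rule continuous_on_compose2[OF cc]) (auto intro!: continuous_intros)
      show "continuous_on {1/2..1} (\<lambda>t. d (2 * t - 1))"
        by (rule continuous_on_compose2[OF cd]) (auto intro!: continuous_intros)
      show "\<forall>t. t \<in> {0..1/2} \<and> \<not> t \<le> 1/2 \<or> t \<in> {1/2..1} \<and> t \<le> 1/2 \<longrightarrow> c (2 * t) = d (2 * t - 1)"
      proof (intro allI impI)
        fix t :: real assume "t \<in> {0..1/2} \<and> \<not> t \<le> 1/2 \<or> t \<in> {1/2..1} \<and> t \<le> 1/2"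
        then have t: "t = 1/2" by auto
        show "c (2 * t) = d (2 * t - 1)" unfolding t using assms(3) by simp
      qed
    qed simp_all
    moreover have "{0..1/2} \<union> {1/2..1} = {0..1::real}" by auto
    ultimately show "continuous_on {0..1} ?j" by simp
    show "finite Z" using S(1) S'(1) by (simp add: Z_def)
    fix a b :: real assume ab: "0 \<le> a \<and> a < b \<and> b \<le> 1 \<and> {a<..<b} \<inter> Z = {}"
    have "1/2 \<notin> {a<..<b}" using ab by (auto simp: Z_def)
    then consider "b \<le> 1/2" | "1/2 \<le> a" by force
    then show "smooth_on {a..b} ?j"
    proof cases
      case 1
      have "{2 * a<..<2 * b} \<inter> S = {}"
      proof (rule equals0I)
        fix s assume "s \<in> {2 * a<..<2 * b} \<inter> S"
        then have "s / 2 \<in> {a<..<b} \<inter> Z" by (auto simp: Z_def)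
        then show False using ab by auto
      qed
      then have "smooth_on {2 * a..2 * b} c" using ab 1 by (intro S(2)) auto
      then have "smooth_on {a..b} (\<lambda>t. c (2 * t))"
        by (rule smooth_on_compose[where g=c and f="\<lambda>t. 2 * t", OF smooth_on_mult[OF smooth_on_const smooth_on_id]]) auto
      then show ?thesis by (rule smooth_on_cong[rotated]) (use 1 in auto)
    next
      case 2
      have "{2 * a - 1<..<2 * b - 1} \<inter> S' = {}"
      proof (rule equals0I)
        fix s assume s: "s \<in> {2 * a - 1<..<2 * b - 1} \<inter> S'"
        then have "(s + 1) / 2 \<in> {a<..<b} \<inter> Z" by (auto simp: Z_def)
        then show False using ab by auto
      qed
      then have "smooth_on {2 * a - 1..2 * b - 1} d" using ab 2 by (intro S'(2)) auto
      then have "smooth_on {a..b} (\<lambda>t. d (2 * t - 1))"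
        by (rule smooth_on_compose[where g=d and f="\<lambda>t. 2 * t - 1",
              OF smooth_on_diff[OF smooth_on_mult[OF smooth_on_const smooth_on_id] smooth_on_const]]) auto
      then show ?thesis
      proof (rule smooth_on_cong[rotated])
        fix t assume "t \<in> {a..b}"
        then have t: "t \<ge> 1/2" using 2 by auto
        show "d (2 * t - 1) = ?j t"
        proof (cases "t = 1/2")
          case True show ?thesis unfolding True using assms(3) by simp
        next
          case False then show ?thesis using t by simp
        qed
      qed
    qed
  qed
qed

section \<open>Joining points by paths and the geodesic distance\<close>

definition path_in :: "'a::euclidean_space set \<Rightarrow> 'a \<Rightarrow> 'a \<Rightarrow> (real \<Rightarrow> 'a) \<Rightarrow> bool" where
  "path_in M x y c \<longleftrightarrow> piecewise_smooth_path c \<and> c ` {0..1} \<subseteq> M \<and> c 0 = x \<and> c 1 = y"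

lemma path_in_reverse: assumes "path_in M x y c" shows "path_in M y x (\<lambda>t. c (1 - t))"
proof -
  have "c (1 - t) \<in> M" if "t \<in> {0..1}" for t
    using assms that by (auto simp: path_in_def image_subset_iff)
  then show ?thesis using assms piecewise_smooth_path_reverse(1)[of c] by (auto simp: path_in_def)
qed

lemma path_in_join:
  assumes c: "path_in M x y c" and d: "path_in M y z d"
  shows "path_in M x z (\<lambda>t. if t \<le> 1/2 then c (2 * t) else d (2 * t - 1))"
proof -
  have "piecewise_smooth_path (\<lambda>t. if t \<le> 1/2 then c (2 * t) else d (2 * t - 1))"
    using assms by (intro piecewise_smooth_path_join) (simp_all add: path_in_def)
  moreover have "c (2 * t) \<in> M" if "t \<in> {0..1}" "t \<le> 1/2" for t
    using c that by (auto simp: path_in_def image_subset_iff)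
  moreover have "d (2 * t - 1) \<in> M" if "t \<in> {0..1}" "\<not> t \<le> 1/2" for t
    using d that by (auto simp: path_in_def image_subset_iff)
  ultimately show ?thesis using c d by (auto simp: path_in_def)
qed

text \<open>Being joined by a path is an equivalence relation with open classes: near
  \<open>a\<close>, the retraction of a straight segment is a smooth path in \<open>M\<close>. The
  infimum in \<open>geodesic_dist\<close> is thus taken over a nonempty set.\<close>

lemma path_in_exists:
  assumes M: "smooth_submanifold m M" and "connected M" "x \<in> M" "y \<in> M"
  shows "\<exists>c. path_in M x y c"
proof (rule connected_equivalence_relation[OF assms(2,3,4)])
  show "\<exists>c. path_in M b a c" if "\<exists>c. path_in M a b c" for a b using that path_in_reverse by blast
  show "\<exists>c. path_in M a d c" if "\<exists>c. path_in M a b c" "\<exists>c. path_in M b d c" for a b d using that path_in_join by blast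
  fix a assume a: "a \<in> M"
  obtain U r where U: "a \<in> U" "tube M U r" using smooth_submanifold_tube[OF M a] by blast
  interpret tube M U r by fact
  obtain d where d: "d > 0" "ball a d \<subseteq> U" using open_U U(1) open_contains_ball by blast
  show "\<exists>V. openin (top_of_set M) V \<and> a \<in> V \<and> (\<forall>x\<in>V. \<exists>c. path_in M a x c)"
  proof (intro exI[of _ "M \<inter> ball a d"] conjI ballI)
    show "openin (top_of_set M) (M \<inter> ball a d)" by (simp add: openin_open_Int)
    show "a \<in> M \<inter> ball a d" using a d(1) by simp
    fix x assume x: "x \<in> M \<inter> ball a d"
    have inU: "a + t *\<^sub>R (x - a) \<in> U" if "t \<in> {0..1}" for t
    proof -
      have "norm (t *\<^sub>R (x - a)) \<le> norm (x - a)" unfolding norm_scaleR by (rule mult_left_le_one_le) (use that in auto)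
      also have "\<dots> < d" using x by (simp add: dist_norm norm_minus_commute)
      finally have "a + t *\<^sub>R (x - a) \<in> ball a d" by (simp add: dist_norm)
      then show ?thesis using d(2) by blast
    qed
    have "smooth_on {0..1} (\<lambda>t. r (a + t *\<^sub>R (x - a)))"
      by (rule smooth_on_compose[where g=r and T=U and f="\<lambda>t. a + t *\<^sub>R (x - a)",
            OF smooth_on_add[OF smooth_on_const smooth_on_scaleR[OF smooth_on_id smooth_on_const]] smooth_onI[OF open_U r_smooth]])
         (rule image_subsetI[OF inU])
    then have "piecewise_smooth_path (\<lambda>t. r (a + t *\<^sub>R (x - a)))" by (rule piecewise_smooth_path_smooth)
    moreover have "x \<in> U" using x d(2) by blast
    ultimately have "path_in M a x (\<lambda>t. r (a + t *\<^sub>R (x - a)))"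
      unfolding path_in_def using r_in_M[OF inU] r_fixes[OF a U(1)] r_fixes[of x] x by (simp add: image_subset_iff)
    then show "\<exists>c. path_in M a x c" by blast
  qed
qed

lemma geodesic_dist_eq: "geodesic_dist M x y = Inf {curve_length c | c. path_in M x y c}"
  by (simp add: geodesic_dist_def path_in_def)

lemma geodesic_dist_le: "path_in M x y c \<Longrightarrow> geodesic_dist M x y \<le> curve_length c"
  unfolding geodesic_dist_eq by (rule cInf_lower) (auto intro!: bdd_belowI[of _ 0] curve_length_nonneg)

lemma geodesic_dist_greatest:
  assumes "\<exists>c. path_in M x y c" "\<And>c. path_in M x y c \<Longrightarrow> l \<le> curve_length c"
  shows "l \<le> geodesic_dist M x y"
  unfolding geodesic_dist_eq by (rule cInf_greatest) (use assms in auto)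

lemma geodesic_dist_less:
  assumes "\<exists>c. path_in M x y c" "geodesic_dist M x y < l"
  obtains c where "path_in M x y c" "curve_length c < l"
proof -
  have "{curve_length c | c. path_in M x y c} \<noteq> {}" using assms(1) by blast
  from cInf_lessD[OF this assms(2)[unfolded geodesic_dist_eq]] show thesis using that by blast
qed

text \<open>Reversing a path preserves its length. The risk measures from \<open>Y i\<close>,
  whereas the logarithm starts at \<open>F (t i)\<close>.\<close>

lemma geodesic_dist_commute: "geodesic_dist M x y = geodesic_dist M y x"
proof -
  have "\<exists>d. curve_length c = curve_length d \<and> path_in M y x d" if "path_in M x y c" for x y c
    using path_in_reverse[OF that] piecewise_smooth_path_reverse(2)[of c] that
    by (intro exI[of _ "\<lambda>t. c (1 - t)"]) (simp add: path_in_def)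
  then have "{curve_length c | c. path_in M x y c} = {curve_length c | c. path_in M y x c}" by blast
  then show ?thesis by (simp add: geodesic_dist_eq)
qed

lemma geodesic_path_in: "unit_time_geodesic M c \<Longrightarrow> path_in M (c 0) (c 1) c"
  using piecewise_smooth_path_smooth[OF geodesic_smooth] by (auto simp: path_in_def geodesic_in_M)

lemma geodesic_length:
  assumes M: "smooth_submanifold m M" and c: "unit_time_geodesic M c"
  shows "curve_length c = norm (vel c 0)"
proof -
  have "curve_length c = integral {0..1} (\<lambda>t::real. norm (vel c 0))"
    unfolding curve_length_def
  proof (rule integral_spike[where S="{0, 1::real}"])
    show "norm (vel c 0) = norm (vector_derivative c (at t))" if "t \<in> {0..1} - {0, 1}" for t
      using smooth_on_interior_derivative(2)[OF geodesic_smooth[OF c], of t] geodesic_constant_speed[OF M c, of t] that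
      by (simp add: vel_def)
  qed (rule negligible_finite, simp)
  then show ?thesis by simp
qed

section \<open>Radial geodesics minimize length\<close>

context normal_ball
begin

text \<open>Being a diffeomorphism onto the image does not by itself say that the image is open in
  \<open>M\<close>. Read in a parametrization near \<open>q\<close>, the exponential map is a
  continuous injection of an open part of \<open>T\<close> into \<open>E\<close>, and invariance of
  domain applies because \<open>dim E = m\<close> is at most \<open>dim T\<close>.\<close>

lemma open_image: "openin (top_of_set M) (e ` X)"
proof (subst openin_subopen, rule ballI)
  fix q assume "q \<in> e ` X"
  then obtain x where x: "x \<in> X" "q = e x" by blast
  have q: "q \<in> M" using e_in_M x by simp
  have "\<exists>W (E :: 'a set) V f. q \<in> W \<and> openin (top_of_set M) W \<and>
        subspace E \<and> dim E = m \<and> openin (top_of_set E) V \<and> diffeomorphism_on V W f"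
    using M q unfolding smooth_submanifold_def by (rule bspec)
  then obtain W and E V :: "'a set" and f where ch: "q \<in> W" "openin (top_of_set M) W" "subspace E" "dim E = m"
      "openin (top_of_set E) V" "diffeomorphism_on V W f"
    by (elim exE conjE)
  define h where "h = the_inv_into V f"
  have bij: "bij_betw f V W" and sf: "smooth_on V f" and sh: "smooth_on W h"
    using ch(6) by (simp_all add: diffeomorphism_on_def h_def)
  have inj: "inj_on f V" and im: "f ` V = W" using bij by (simp_all add: bij_betw_def)
  have fh: "f (h y) = y" if "y \<in> W" for y
    unfolding h_def by (rule f_the_inv_into_f[OF inj]) (simp add: im that)
  have hV: "h y \<in> V" if "y \<in> W" for y
    unfolding h_def by (rule the_inv_into_into[OF inj _ order_refl]) (simp add: im that)
  have VE: "V \<subseteq> E" using ch(5) openin_imp_subset by blast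
  define X' where "X' = X \<inter> e -` W"
  have ce: "continuous_on X e" by (rule smooth_on_continuous[OF smooth_e])
  have "openin (top_of_set X) X'"
    unfolding X'_def by (rule continuous_openin_preimage[OF ce _ ch(2)]) (use e_in_M in auto)
  moreover have "openin (top_of_set T) X" by (simp add: openin_open_Int)
  ultimately have oX': "openin (top_of_set T) X'" by (rule openin_trans)
  have X'W: "e y \<in> W" "y \<in> X" if "y \<in> X'" for y using that by (auto simp: X'_def)
  have "openin (top_of_set E) ((\<lambda>y. h (e y)) ` X')"
  proof (rule invariance_of_domain_subspaces[OF oX' subspace_T ch(3)])
    show "dim E \<le> dim T" using smooth_submanifold_tube[OF M p] ch(4) by blast
    show "continuous_on X' (\<lambda>y. h (e y))"
      by (rule continuous_on_compose2[OF smooth_on_continuous[OF sh] continuous_on_subset[OF ce]]) (auto simp: X'_def)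
    show "(\<lambda>y. h (e y)) \<in> X' \<rightarrow> E" using hV X'W VE by blast
    show "inj_on (\<lambda>y. h (e y)) X'"
    proof (rule inj_onI)
      fix y z assume yz: "y \<in> X'" "z \<in> X'" "h (e y) = h (e z)"
      then have "e y = e z" using fh X'W(1) by metis
      then show "y = z" using inj_onD[OF inj_e] X'W(2) yz by blast
    qed
  qed
  then have "openin (top_of_set W) (W \<inter> h -` ((\<lambda>y. h (e y)) ` X'))"
    by (rule continuous_openin_preimage[OF smooth_on_continuous[OF sh], rotated -1]) (use hV VE in auto)
  moreover have "W \<inter> h -` ((\<lambda>y. h (e y)) ` X') = e ` X'"
  proof (intro equalityI subsetI)
    fix y assume "y \<in> W \<inter> h -` ((\<lambda>y. h (e y)) ` X')"
    then obtain z where z: "y \<in> W" "z \<in> X'" "h y = h (e z)" by auto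
    then have "y = e z" using fh X'W(1) by metis
    then show "y \<in> e ` X'" using z(2) by blast
  qed (use X'W in auto)
  ultimately have "openin (top_of_set W) (e ` X')" by simp
  then have "openin (top_of_set M) (e ` X')" using ch(2) by (rule openin_trans)
  moreover have "q \<in> e ` X'" using x ch(1) by (auto simp: X'_def)
  moreover have "e ` X' \<subseteq> e ` X" by (auto simp: X'_def)
  ultimately show "\<exists>S. openin (top_of_set M) S \<and> q \<in> S \<and> S \<subseteq> e ` X" by blast
qed

abbreviation "l \<equiv> the_inv_into X e"

lemma l_e: "x \<in> X \<Longrightarrow> l (e x) = x" by (rule the_inv_into_f_f[OF inj_e])
lemma e_l: "y \<in> e ` X \<Longrightarrow> e (l y) = y" by (rule f_the_inv_into_f[OF inj_e])
lemma l_in_X: "y \<in> e ` X \<Longrightarrow> l y \<in> X" by (rule the_inv_into_into[OF inj_e _ order_refl])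

text \<open>Put \<open>x = l (\<gamma> t)\<close>. As \<open>\<gamma>\<close> is the exponential of
  \<open>l \<circ> \<gamma>\<close>, its velocity is \<open>D w\<close> with \<open>D\<close> the
  derivative of the exponential map at \<open>x\<close>. The Gauss lemma gives
  \<open>x \<bullet> w = D x \<bullet> v\<close> and \<open>norm (D x) = norm x\<close>. The product
  form avoids dividing by \<open>norm x\<close>, which may vanish.\<close>

lemma radial_speed:
  assumes t: "open N" "t \<in> N" and \<gamma>: "(\<gamma> has_vector_derivative v) (at t)" and N: "\<And>s. s \<in> N \<Longrightarrow> \<gamma> s \<in> e ` X"
  obtains w where "((\<lambda>s. l (\<gamma> s)) has_vector_derivative w) (at t)" "\<bar>l (\<gamma> t) \<bullet> w\<bar> \<le> norm (l (\<gamma> t)) * norm v"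
proof -
  obtain H k where H: "open H" "\<gamma> t \<in> H" "\<And>j. Ck_on j H k" "\<And>y. y \<in> e ` X \<Longrightarrow> y \<in> H \<Longrightarrow> k y = l y"
    by (rule smooth_onE[OF smooth_inv_e N[OF t(2)]]) blast
  define w where "w = frechet_derivative k (at (\<gamma> t)) v"
  have kd: "(k has_derivative frechet_derivative k (at (\<gamma> t))) (at (\<gamma> t))" by (rule Ck_on_has_derivative[OF H(3) H(2)])
  have chain: "((\<lambda>s. f (\<gamma> s)) has_vector_derivative f' v) (at t)" if "(f has_derivative f') (at (\<gamma> t))" for f :: "'a \<Rightarrow> 'a" and f'
  proof -
    have "((\<lambda>s. f (\<gamma> s)) has_derivative (\<lambda>h. f' (h *\<^sub>R v))) (at t)"
      using diff_chain_at[OF \<gamma>[unfolded has_vector_derivative_def] that] by (simp add: o_def)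
    then show ?thesis using has_derivative_linear[OF that] by (simp add: has_vector_derivative_def linear_scale)
  qed
  have "(\<gamma> \<longlongrightarrow> \<gamma> t) (nhds t)"
    using has_vector_derivative_continuous[OF \<gamma>] by (simp add: continuous_at tendsto_at_iff_tendsto_nhds)
  then have "\<forall>\<^sub>F s in nhds t. \<gamma> s \<in> H" by (rule topological_tendstoD[OF _ H(1,2)])
  moreover have "\<forall>\<^sub>F s in nhds t. s \<in> N" by (rule eventually_nhds_in_open[OF t])
  ultimately have "\<forall>\<^sub>F s in nhds t. s \<in> N \<and> \<gamma> s \<in> H" by eventually_elim simp
  then obtain N' where N': "open N'" "t \<in> N'" "\<And>s. s \<in> N' \<Longrightarrow> s \<in> N \<and> \<gamma> s \<in> H" unfolding eventually_nhds by blast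
  have ld: "((\<lambda>s. l (\<gamma> s)) has_vector_derivative w) (at t)"
    unfolding w_def by (rule has_vector_derivative_transform_within_open[OF chain[OF kd] N'(1,2)]) (use H(4) N N'(3) in auto)
  define x where "x = l (\<gamma> t)"
  have x: "x \<in> X" "e x = \<gamma> t" unfolding x_def by (rule l_in_X[OF N[OF t(2)]], rule e_l[OF N[OF t(2)]])
  \<comment> \<open>The inverse \<open>l\<close> takes values in the subspace \<open>T\<close>, so
    its composition with \<open>\<gamma>\<close> is fixed by the projection onto \<open>T\<close>,
    and so is the velocity.\<close>
  have w: "w \<in> T"
  proof -
    have lT: "closest_point T (l (\<gamma> s)) = l (\<gamma> s)" if "s \<in> N" for s
      by (rule closest_point_self) (use l_in_X[OF N[OF that]] in blast)
    have bl: "bounded_linear (closest_point T)"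
      by (rule linear_conv_bounded_linear[THEN iffD1, OF linear_closest_point_subspace[OF subspace_T]])
    have "((\<lambda>s. closest_point T (l (\<gamma> s))) has_vector_derivative closest_point T w) (at t)"
      by (rule bounded_linear.has_vector_derivative[OF bl ld])
    then have "((\<lambda>s. l (\<gamma> s)) has_vector_derivative closest_point T w) (at t)"
      by (rule has_vector_derivative_transform_within_open[OF _ t]) (rule lT)
    from vector_derivative_unique_at[OF this ld] have "w = closest_point T w" by simp
    then show ?thesis using closest_point_subspace(1)[OF subspace_T, of w] by simp
  qed
  obtain G g where G: "ext x G g" by (rule ext_exists[OF x(1)])
  have xG: "x \<in> G" and oG: "open G" using G by (simp_all add: ext_def)
  let ?D = "frechet_derivative g (at x)"
  have gd: "(g has_derivative ?D) (at x)" by (rule ext_has_derivative[OF G xG])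
  have "((\<lambda>s. g (l (\<gamma> s))) has_derivative (\<lambda>h. ?D (h *\<^sub>R w))) (at t)"
    using diff_chain_at[OF ld[unfolded has_vector_derivative_def], of g ?D] gd by (simp add: o_def x_def)
  then have 1: "((\<lambda>s. g (l (\<gamma> s))) has_vector_derivative ?D w) (at t)"
    using has_derivative_linear[OF gd] by (simp add: has_vector_derivative_def linear_scale)
  have "((\<lambda>s. l (\<gamma> s)) \<longlongrightarrow> l (\<gamma> t)) (nhds t)"
    using has_vector_derivative_continuous[OF ld] tendsto_at_iff_tendsto_nhds[of "\<lambda>s. l (\<gamma> s)" t]
    by (simp add: continuous_at)
  then have "\<forall>\<^sub>F s in nhds t. l (\<gamma> s) \<in> G" by (rule topological_tendstoD[OF _ oG]) (use xG in \<open>simp add: x_def\<close>)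
  moreover have "\<forall>\<^sub>F s in nhds t. s \<in> N" by (rule eventually_nhds_in_open[OF t])
  ultimately have "\<forall>\<^sub>F s in nhds t. s \<in> N \<and> l (\<gamma> s) \<in> G" by eventually_elim simp
  then obtain N2 where N2: "open N2" "t \<in> N2" "\<And>s. s \<in> N2 \<Longrightarrow> s \<in> N \<and> l (\<gamma> s) \<in> G" unfolding eventually_nhds by blast
  have "g (l (\<gamma> s)) = \<gamma> s" if s: "s \<in> N2" for s
  proof -
    have "g (l (\<gamma> s)) = e (l (\<gamma> s))" using N2(3)[OF s] by (intro ext_eq[OF G] l_in_X N) auto
    then show ?thesis using e_l N N2(3)[OF s] by simp
  qed
  then have "(\<gamma> has_vector_derivative ?D w) (at t)"
    by (rule has_vector_derivative_transform_within_open[OF 1 N2(1,2)])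
  then have Dw: "?D w = v" using \<gamma> vector_derivative_unique_at by blast
  have "?D x \<bullet> ?D x = x \<bullet> x" by (rule gauss[OF x(1) _ G]) (use x(1) in simp)
  then have nx: "norm (?D x) = norm x" by (simp add: norm_eq_sqrt_inner)
  have "x \<bullet> w = ?D x \<bullet> v" using gauss[OF x(1) w G] Dw by simp
  then have "\<bar>x \<bullet> w\<bar> \<le> norm x * norm v" using Cauchy_Schwarz_ineq2[of "?D x" v] nx by simp
  then show thesis using that ld by (simp add: x_def)
qed

text \<open>The radius \<open>norm (l (\<gamma> t))\<close> starts at zero and by
  \<open>radial_speed\<close> grows no faster than the arc length.\<close>

lemma radial_bound:
  assumes \<gamma>: "piecewise_smooth_path \<gamma>" "\<gamma> 0 = p" and s: "s \<in> {0..1}" and in_e: "\<And>t. t \<in> {0..s} \<Longrightarrow> \<gamma> t \<in> e ` X"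
  shows "norm (l (\<gamma> s)) \<le> curve_length \<gamma>"
proof -
  obtain S where S: "finite S" "\<And>t. t \<in> {0<..<1} - S \<Longrightarrow> (\<gamma> has_vector_derivative vector_derivative \<gamma> (at t)) (at t)"
    "(\<lambda>t. norm (vector_derivative \<gamma> (at t))) integrable_on {0..1}"
    by (rule piecewise_smooth_path_ac_on[OF \<gamma>(1)]) blast
  have ci: "(\<lambda>t. norm (vector_derivative \<gamma> (at t))) integrable_on {0..s}"
    by (rule integrable_on_subinterval[OF S(3)]) (use s in auto)
  have le_L: "integral {0..s} (\<lambda>t. norm (vector_derivative \<gamma> (at t))) \<le> curve_length \<gamma>"
    unfolding curve_length_def by (rule integral_subset_le[OF _ ci S(3)]) (use s in auto)
  have c\<gamma>: "continuous_on {0..s} \<gamma>"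
    by (rule continuous_on_subset[of "{0..1}"]) (use \<gamma>(1) s in \<open>auto simp: piecewise_smooth_path_def\<close>)
  define u where "u t = l (\<gamma> t)" for t
  have cu: "continuous_on {0..s} u" unfolding u_def
    by (rule continuous_on_compose2[OF smooth_on_continuous[OF smooth_inv_e] c\<gamma>]) (use in_e in auto)
  have "norm (u s) \<le> curve_length \<gamma> + \<epsilon>" if \<epsilon>: "\<epsilon> > 0" for \<epsilon>
  proof -
    \<comment> \<open>The norm is not differentiable at 0; this smoothed radius is, dominates the
      norm, starts at \<open>\<epsilon>\<close> and has derivative at most the speed.\<close>
    define \<phi> where "\<phi> t = sqrt (u t \<bullet> u t + \<epsilon>\<^sup>2)" for t
    have pos: "u t \<bullet> u t + \<epsilon>\<^sup>2 > 0" for t using \<epsilon> by (intro add_nonneg_pos) auto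
    have u_le: "norm (u t) \<le> \<phi> t" for t
      unfolding \<phi>_def norm_eq_sqrt_inner by (rule real_sqrt_le_mono) simp
    have "\<exists>d. (\<phi> has_vector_derivative d) (at t) \<and> d \<le> norm (vector_derivative \<gamma> (at t))" if t: "t \<in> {0<..<s} - S" for t
    proof -
      have t1: "t \<in> {0<..<1} - S" using t s by auto
      obtain w where w: "(u has_vector_derivative w) (at t)" "\<bar>u t \<bullet> w\<bar> \<le> norm (u t) * norm (vector_derivative \<gamma> (at t))"
        unfolding u_def by (rule radial_speed[of "{0<..<s}" t \<gamma> "vector_derivative \<gamma> (at t)"]) (use t S(2)[OF t1] in_e in auto)
      have "((\<lambda>t. u t \<bullet> u t) has_vector_derivative (u t \<bullet> w + w \<bullet> u t)) (at t)"
        by (rule bounded_bilinear.has_vector_derivative[OF bounded_bilinear_inner w(1) w(1)])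
      then have "((\<lambda>t. u t \<bullet> u t + \<epsilon>\<^sup>2) has_real_derivative (2 * (u t \<bullet> w))) (at t)"
        unfolding has_real_derivative_iff_has_vector_derivative
        by (intro has_vector_derivative_add_const[THEN iffD2]) (simp add: inner_commute)
      from DERIV_chain2[OF DERIV_real_sqrt[OF pos] this]
      have "(\<phi> has_real_derivative inverse (sqrt (u t \<bullet> u t + \<epsilon>\<^sup>2)) / 2 * (2 * (u t \<bullet> w))) (at t)"
        unfolding \<phi>_def .
      then have "(\<phi> has_real_derivative (u t \<bullet> w) / \<phi> t) (at t)" by (simp add: \<phi>_def field_simps)
      moreover have "(u t \<bullet> w) / \<phi> t \<le> norm (vector_derivative \<gamma> (at t))"
      proof -
        have \<phi>pos: "\<phi> t > 0" using pos by (simp add: \<phi>_def)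
        have "u t \<bullet> w \<le> norm (u t) * norm (vector_derivative \<gamma> (at t))" using w(2) by linarith
        also have "\<dots> \<le> \<phi> t * norm (vector_derivative \<gamma> (at t))" by (intro mult_right_mono u_le) simp
        finally show ?thesis using \<phi>pos by (simp add: field_simps)
      qed
      ultimately show ?thesis unfolding has_real_derivative_iff_has_vector_derivative by blast
    qed
    then obtain d where d: "\<And>t. t \<in> {0<..<s} - S \<Longrightarrow> (\<phi> has_vector_derivative d t) (at t)"
      "\<And>t. t \<in> {0<..<s} - S \<Longrightarrow> d t \<le> norm (vector_derivative \<gamma> (at t))" by metis
    define d' where "d' t = (if t \<in> {0<..<s} - S then d t else 0)" for t
    have "(d' has_integral (\<phi> s - \<phi> 0)) {0..s}"
    proof (rule fundamental_theorem_of_calculus_interior_strong[OF S(1)])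
      show "(\<phi> has_vector_derivative d' t) (at t)" if "t \<in> {0<..<s} - S" for t using d(1)[OF that] that by (simp add: d'_def)
      show "continuous_on {0..s} \<phi>" unfolding \<phi>_def by (intro continuous_intros cu)
    qed (use s in simp)
    then have "\<phi> s - \<phi> 0 \<le> integral {0..s} (\<lambda>t. norm (vector_derivative \<gamma> (at t)))"
      by (rule has_integral_le[OF _ integrable_integral[OF ci]]) (use d(2) in \<open>simp add: d'_def\<close>)
    moreover have "\<phi> 0 = \<epsilon>"
    proof -
      have "u 0 = 0" using l_e[OF zero_X] e_0 \<gamma>(2) by (simp add: u_def)
      then show ?thesis using \<epsilon> by (simp add: \<phi>_def)
    qed
    ultimately show ?thesis using le_L u_le[of s] by linarith
  qed
  then show ?thesis unfolding u_def by (rule field_le_epsilon)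
qed

text \<open>A continuation argument. As long as the path stays in the image of the ball,
  \<open>radial_bound\<close> keeps it in the compact set \<open>K\<close>, the image of the closed
  ball of radius \<open>curve_length \<gamma> < R\<close>. Since \<open>K\<close> is closed and the
  image of the open ball is open in \<open>M\<close>, the path cannot leave.\<close>

lemma short_path_stays:
  assumes \<gamma>: "path_in M p q \<gamma>" and L: "curve_length \<gamma> < R"
  shows "q \<in> e ` X" "norm (l q) \<le> curve_length \<gamma>"
proof -
  have ps: "piecewise_smooth_path \<gamma>" and \<gamma>M: "\<gamma> ` {0..1} \<subseteq> M" and \<gamma>0: "\<gamma> 0 = p" and \<gamma>1: "\<gamma> 1 = q"
    using \<gamma> by (simp_all add: path_in_def)
  have c\<gamma>: "continuous_on {0..1} \<gamma>" using ps by (simp add: piecewise_smooth_path_def)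
  define K where "K = e ` (T \<inter> cball 0 (curve_length \<gamma>))"
  have subX: "T \<inter> cball 0 (curve_length \<gamma>) \<subseteq> X" using L by auto
  have KX: "K \<subseteq> e ` X" unfolding K_def by (rule image_mono[OF subX])
  have "compact (T \<inter> cball 0 (curve_length \<gamma>))"
    using closed_subspace[OF subspace_T] by (simp add: closed_Int_compact)
  then have "compact K" unfolding K_def
    by (rule compact_continuous_image[OF continuous_on_subset[OF smooth_on_continuous[OF smooth_e] subX]])
  then have cK: "closed K" by (rule compact_imp_closed)
  have in_K: "\<gamma> s \<in> K" if "s \<in> {0..1}" "\<And>t. t \<in> {0..s} \<Longrightarrow> \<gamma> t \<in> e ` X" for s
  proof -
    have "\<gamma> s \<in> e ` X" using that by simp
    then have "l (\<gamma> s) \<in> T \<inter> cball 0 (curve_length \<gamma>)"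
      using l_in_X[of "\<gamma> s"] radial_bound[OF ps \<gamma>0 that] by simp
    then show ?thesis unfolding K_def using e_l[OF \<open>\<gamma> s \<in> e ` X\<close>] by force
  qed
  obtain O' where O': "open O'" "e ` X = M \<inter> O'" using open_image openin_open by blast
  define A where "A = {s \<in> {0..1}. \<forall>t\<in>{0..s}. \<gamma> t \<in> K}"
  define b where "b = Sup A"
  have "\<gamma> 0 \<in> K" by (rule in_K) (use \<gamma>0 e_0 zero_X in \<open>auto intro: image_eqI[of _ _ 0]\<close>)
  then have A0: "0 \<in> A" by (simp add: A_def)
  have bd: "bdd_above A" by (rule bdd_aboveI[of _ 1]) (simp add: A_def)
  have ne: "A \<noteq> {}" using A0 by blast
  have "b \<le> 1" unfolding b_def by (rule cSup_least[OF ne]) (simp add: A_def)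
  moreover have "0 \<le> b" unfolding b_def by (rule cSup_upper[OF A0 bd])
  ultimately have b01: "b \<in> {0..1}" by simp
  have below: "\<gamma> t \<in> K" if t: "t \<in> {0..<b}" for t
  proof -
    have "t < Sup A" using t by (simp add: b_def)
    from less_cSupD[OF ne this] obtain s where "s \<in> A" "t < s" by blast
    then show ?thesis using t by (simp add: A_def)
  qed
  have bK: "\<gamma> b \<in> K"
  proof (cases "b = 0")
    case True then show ?thesis using \<open>\<gamma> 0 \<in> K\<close> by simp
  next
    case False
    then have "b > 0" using b01 by simp
    have "(\<gamma> \<longlongrightarrow> \<gamma> b) (at b within {0..1})" using c\<gamma> b01 by (simp add: continuous_on_def)
    then have "(\<gamma> \<longlongrightarrow> \<gamma> b) (at b within {0..<b})" by (rule tendsto_within_subset) (use b01 in auto)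
    moreover have "at b within {0..<b} \<noteq> bot" using \<open>b > 0\<close> by (simp add: trivial_limit_within islimpt_Ico)
    moreover have "\<forall>\<^sub>F t in at b within {0..<b}. \<gamma> t \<in> K" using below by (auto simp: eventually_at_filter)
    ultimately show ?thesis using Lim_in_closed_set[OF cK, of \<gamma>] by metis
  qed
  have "b = 1"
  proof (rule ccontr)
    assume "b \<noteq> 1"
    then have b1: "b < 1" using b01 by simp
    have "(\<gamma> \<longlongrightarrow> \<gamma> b) (at b within {0..1})" using c\<gamma> b01 by (simp add: continuous_on_def)
    moreover have "\<gamma> b \<in> O'" using bK KX O'(2) by blast
    ultimately have "\<forall>\<^sub>F t in at b within {0..1}. \<gamma> t \<in> O'" by (rule topological_tendstoD[OF _ O'(1)])
    then obtain d where d: "d > 0" "\<And>t. t \<in> {0..1} \<Longrightarrow> t \<noteq> b \<Longrightarrow> dist t b < d \<Longrightarrow> \<gamma> t \<in> O'"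
      unfolding eventually_at by blast
    define s where "s = min 1 (b + d/2)"
    have s: "s \<in> {0..1}" "b < s" "s < b + d" using b01 b1 d(1) by (auto simp: s_def)
    have inX: "\<gamma> t \<in> e ` X" if t: "t \<in> {0..s}" for t
    proof (cases "t \<le> b")
      case True
      then have "t = b \<or> t \<in> {0..<b}" using t by auto
      then show ?thesis using below bK KX by blast
    next
      case False
      then have "\<gamma> t \<in> O'" using t s by (intro d(2)) (auto simp: dist_real_def)
      moreover have "\<gamma> t \<in> M" using \<gamma>M t s(1) by auto
      ultimately show ?thesis unfolding O'(2) by blast
    qed
    have "\<gamma> t \<in> K" if t: "t \<in> {0..s}" for t
      by (rule in_K) (use t s(1) inX in auto)
    then have "s \<in> A" using s(1) by (simp add: A_def)
    then have "s \<le> b" unfolding b_def by (rule cSup_upper[OF _ bd])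
    then show False using s(2) by simp
  qed
  have all: "\<gamma> t \<in> e ` X" if "t \<in> {0..1}" for t
  proof (rule subsetD[OF KX], cases "t = 1")
    case True then show "\<gamma> t \<in> K" using bK \<open>b = 1\<close> by simp
  next
    case False then show "\<gamma> t \<in> K" using below[of t] that \<open>b = 1\<close> by simp
  qed
  show "q \<in> e ` X" using all[of 1] \<gamma>1 by simp
  show "norm (l q) \<le> curve_length \<gamma>" using radial_bound[OF ps \<gamma>0, of 1] all \<gamma>1 by simp
qed

end

lemma log_map_geodesic:
  fixes M :: "'a::euclidean_space set"
  assumes M: "smooth_submanifold m M" and con: "connected M" and p: "p \<in> M" and q: "q \<in> M"
    and d: "ereal (geodesic_dist M p q) < injectivity_radius M"
  obtains c where "unit_time_geodesic M c" "c 0 = p" "c 1 = q" "log_map M p q = vel c 0"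
    "geodesic_dist M p q = norm (vel c 0)"
proof -
  note ex = path_in_exists[OF M con p q]
  have "injectivity_radius M \<le> (SUP r\<in>{r. 0 < r \<and>
        diffeomorphism_on (tangent_space M p \<inter> ball 0 r)
          (exp_map M p ` (tangent_space M p \<inter> ball 0 r)) (exp_map M p)}. ereal r)"
    unfolding injectivity_radius_def by (rule INF_lower[OF p])
  with d have "ereal (geodesic_dist M p q) < (SUP r\<in>{r. 0 < r \<and>
        diffeomorphism_on (tangent_space M p \<inter> ball 0 r)
          (exp_map M p ` (tangent_space M p \<inter> ball 0 r)) (exp_map M p)}. ereal r)" by (rule less_le_trans)
  then obtain R where Rf: "0 < R" "diffeomorphism_on (tangent_space M p \<inter> ball 0 R)
          (exp_map M p ` (tangent_space M p \<inter> ball 0 R)) (exp_map M p)" "geodesic_dist M p q < R"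
    unfolding less_SUP_iff by auto
  interpret normal_ball M m p R by unfold_locales (use M p Rf in auto)
  obtain \<gamma> where \<gamma>: "path_in M p q \<gamma>" "curve_length \<gamma> < R" by (rule geodesic_dist_less[OF ex Rf(3)])
  note qe = short_path_stays(1)[OF \<gamma>]
  have le: "norm (l q) \<le> geodesic_dist M p q"
  proof (rule geodesic_dist_greatest[OF ex])
    fix \<gamma>' assume \<gamma>': "path_in M p q \<gamma>'"
    show "norm (l q) \<le> curve_length \<gamma>'"
    proof (cases "curve_length \<gamma>' < R")
      case True then show ?thesis by (rule short_path_stays(2)[OF \<gamma>'])
    next
      case False then show ?thesis using l_in_X[OF qe] by simp
    qed
  qed
  obtain c where c: "unit_time_geodesic M c" "c 0 = p" "vel c 0 = l q" "\<And>t. t \<in> {0..1} \<Longrightarrow> c t = e (t *\<^sub>R l q)"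
    by (rule ray[OF l_in_X[OF qe]]) blast
  have c1: "c 1 = q" using c(4)[of 1] e_l[OF qe] by simp
  have len: "curve_length c = norm (l q)" using geodesic_length[OF M c(1)] c(3) by simp
  have eq: "geodesic_dist M p q = norm (l q)"
    using le geodesic_dist_le[OF geodesic_path_in[OF c(1)]] len c(2) c1 by simp
  have "log_map M p q = vel c 0" unfolding log_map_def
  proof (rule the_equality)
    show "\<exists>d. unit_time_geodesic M d \<and> d 0 = p \<and> d 1 = q \<and> curve_length d = geodesic_dist M p q \<and> initial_velocity d = vel c 0"
      using c c1 len eq by (intro exI[of _ c]) (simp add: initial_velocity_vel)
    fix v assume "\<exists>d. unit_time_geodesic M d \<and> d 0 = p \<and> d 1 = q \<and> curve_length d = geodesic_dist M p q \<and> initial_velocity d = v"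
    then obtain d where d: "unit_time_geodesic M d" "d 0 = p" "d 1 = q" "curve_length d = geodesic_dist M p q" "vel d 0 = v"
      by (auto simp: initial_velocity_vel)
    have "v \<in> X"
      using geodesic_vel_tangent'[OF M d(1), of 0] geodesic_length[OF M d(1)] d Rf(3) by simp
    moreover have "e v = q" using exp_map_geodesic[OF M d(1)] d by simp
    ultimately show "v = vel c 0" using l_e c(3) by auto
  qed
  then show thesis using that[OF c(1,2) c1] eq c(3) by simp
qed

section \<open>First variation of the squared distance\<close>

text \<open>Only an upper bound is needed, so it suffices to move the initial point of one minimising
  geodesic, by a variation supported near that point.\<close>

lemma (in tube) dist_square_upper:
  assumes M: "smooth_submanifold m M" and c: "unit_time_geodesic M c" and cU: "c 0 \<in> U" and w: "w \<in> tangent_space M (c 0)"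
  shows "\<exists>e0>0. \<exists>C\<ge>0. \<forall>e. \<bar>e\<bar> \<le> e0 \<longrightarrow>
    (geodesic_dist M (r (c 0 + e *\<^sub>R w)) (c 1))\<^sup>2 \<le> (norm (vel c 0))\<^sup>2 - 2 * e * (vel c 0 \<bullet> w) + C * e\<^sup>2"
proof -
  have c01: "(0::real) \<in> {0..1}" by simp
  have "(c \<longlongrightarrow> c 0) (at 0 within {0..1})" using geodesic_continuous(1)[OF c] by (simp add: continuous_on_def)
  then have "\<forall>\<^sub>F t in at 0 within {0..1}. c t \<in> U" by (rule topological_tendstoD[OF _ open_U cU])
  then obtain d where d: "d > 0" "\<And>t. t \<in> {0..1} \<Longrightarrow> t \<noteq> 0 \<Longrightarrow> dist t 0 < d \<Longrightarrow> c t \<in> U"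
    unfolding eventually_at by blast
  \<comment> \<open>The variation lives on \<open>[0, \<delta>]\<close>: short enough for
    \<open>c\<close> to remain in the tube, and below 1 so that the end point \<open>c 1\<close>
    stays fixed.\<close>
  define \<delta> where "\<delta> = min (d/2) (1/2)"
  have \<delta>: "0 < \<delta>" "\<delta> < 1" "\<delta> < d" using d(1) by (auto simp: \<delta>_def)
  have I: "t \<in> {0..1}" if "t \<in> {0..\<delta>}" for t using that \<delta> by auto
  have cU': "c t \<in> U" if "t \<in> {0..\<delta>}" for t
  proof (cases "t = 0")
    case True then show ?thesis using cU by simp
  next
    case False then show ?thesis using d(2)[OF I[OF that]] that \<delta> by (simp add: dist_real_def)
  qed
  have rc: "r (c t) = c t" if "t \<in> {0..\<delta>}" for t by (rule r_fixes[OF geodesic_in_M[OF c I[OF that]] cU'[OF that]])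
  \<comment> \<open>A field along \<open>c\<close> that starts at \<open>w\<close> and fades to 0 at
    \<open>\<delta>\<close>; projecting keeps it tangent at every time.\<close>
  define \<psi> where "\<psi> t = (1 - (1/\<delta>) * t) *\<^sub>R P (c t) w" for t
  have cs: "smooth_on {0..\<delta>} c" by (rule smooth_on_subset[OF geodesic_smooth[OF c]]) (use I in blast)
  have \<psi>s: "smooth_on {0..\<delta>} \<psi>" unfolding \<psi>_def
  proof (rule smooth_on_scaleR)
    show "smooth_on {0..\<delta>} (\<lambda>t. 1 - (1/\<delta>) * t)"
      by (rule smooth_on_diff[OF smooth_on_const smooth_on_mult[OF smooth_on_const smooth_on_id]])
    show "smooth_on {0..\<delta>} (\<lambda>t. P (c t) w)"
      by (rule smooth_on_compose[where g="\<lambda>x. P x w" and f=c, OF cs smooth_onI[OF open_U P_smooth]])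
         (rule image_subsetI[OF cU'])
  qed
  define \<eta> where "\<eta> t = vector_derivative \<psi> (at t within {0..\<delta>})" for t
  note \<psi>d = smooth_on_curve_derivative[OF \<psi>s \<delta>(1), folded \<eta>_def]
  have c\<eta>: "continuous_on {0..\<delta>} \<eta>" using smooth_on_continuous[OF \<psi>d(2)] by (simp add: \<eta>_def[abs_def])
  have ac\<psi>: "ac_on 0 \<delta> \<psi> \<eta>" by (rule ac_on_C1[OF _ \<psi>d(1) c\<eta>]) (use \<delta> in auto)
  have acc1: "ac_on 0 1 c (vel c)" by (rule ac_on_C1[OF _ geodesic_vel[OF c] geodesic_continuous(2)[OF c]]) auto
  have acc: "ac_on 0 \<delta> c (vel c)" by (rule ac_on_subinterval[OF acc1]) (use \<delta> in auto)
  have acv: "ac_on 0 \<delta> (vel c) (vel (vel c))"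
    by (rule ac_on_subinterval[OF ac_on_C1[OF zero_le_one geodesic_acc[OF c] geodesic_continuous(3)[OF c]]]) (use \<delta> in auto)
  have vi: "(\<lambda>t. (norm (vel c t))\<^sup>2) integrable_on {x..y}" if "0 \<le> x" "y \<le> 1" for x y
    by (intro integrable_continuous_real continuous_on_power continuous_on_norm continuous_on_subset[OF geodesic_continuous(2)[OF c]])
       (use that in auto)
  have \<psi>T: "\<psi> t \<in> tangent_space M (c t)" if "t \<in> {0..\<delta>}" for t
    unfolding \<psi>_def using P_tangent[OF cU'[OF that], of w] rc[OF that] subspace_tangent[OF geodesic_in_M[OF c I[OF that]] cU'[OF that]]
    by (simp add: subspace_scale)
  have \<psi>0: "\<psi> 0 = w" using P_id[OF cU, of w] w rc[of 0] \<delta>(1) by (simp add: \<psi>_def)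
  have \<psi>\<delta>: "\<psi> \<delta> = 0" using \<delta>(1) by (simp add: \<psi>_def)
  have tan: "frechet_derivative r (at (c t)) (\<psi> t) = \<psi> t" if "t \<in> {0..\<delta>}" for t
    using \<psi>T[OF that] tangent_iff[OF geodesic_in_M[OF c I[OF that]] cU'[OF that]] by (simp add: B_def)
  have \<eta>i: "(\<lambda>t. (norm (\<eta> t))\<^sup>2) integrable_on {0..\<delta>}"
    by (intro integrable_continuous_real continuous_on_power continuous_on_norm c\<eta>)
  have \<delta>0: "0 \<le> \<delta>" using \<delta>(1) by simp
  have "\<exists>e0>0. \<exists>C\<ge>0. \<forall>e. \<bar>e\<bar> \<le> e0 \<longrightarrow> (\<forall>t\<in>{0..\<delta>}. c t + e *\<^sub>R \<psi> t \<in> U) \<and>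
    (\<exists>h. ac_on 0 \<delta> (\<lambda>t. r (c t + e *\<^sub>R \<psi> t)) h \<and> (\<lambda>t. (norm (h t))\<^sup>2) integrable_on {0..\<delta>} \<and>
       integral {0..\<delta>} (\<lambda>t. (norm (h t))\<^sup>2) \<le> integral {0..\<delta>} (\<lambda>t. (norm (vel c t))\<^sup>2)
         + 2 * e * integral {0..\<delta>} (\<lambda>t. vel c t \<bullet> \<eta> t) + C * e\<^sup>2)"
    by (rule energy_variation[OF open_U r_smooth \<delta>0 acc vi[OF order_refl less_imp_le[OF \<delta>(2)]] ac\<psi> \<eta>i])
       (rule cU' rc tan; assumption)+
  then obtain e0 C where e0: "e0 > 0" "C \<ge> 0" and var: "\<forall>e. \<bar>e\<bar> \<le> e0 \<longrightarrow> (\<forall>t\<in>{0..\<delta>}. c t + e *\<^sub>R \<psi> t \<in> U) \<and>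
    (\<exists>h. ac_on 0 \<delta> (\<lambda>t. r (c t + e *\<^sub>R \<psi> t)) h \<and> (\<lambda>t. (norm (h t))\<^sup>2) integrable_on {0..\<delta>} \<and>
       integral {0..\<delta>} (\<lambda>t. (norm (h t))\<^sup>2) \<le> integral {0..\<delta>} (\<lambda>t. (norm (vel c t))\<^sup>2)
         + 2 * e * integral {0..\<delta>} (\<lambda>t. vel c t \<bullet> \<eta> t) + C * e\<^sup>2)"
    by (elim exE conjE)
  \<comment> \<open>Integration by parts: the acceleration of a geodesic is normal and
    \<open>\<psi>\<close> is tangent, so only the boundary term at 0 is left.\<close>
  have first: "integral {0..\<delta>} (\<lambda>t. vel c t \<bullet> \<eta> t) = - (vel c 0 \<bullet> w)"
  proof -
    have "ac_on 0 \<delta> (\<lambda>t. vel c t \<bullet> \<psi> t) (\<lambda>t. vel c t \<bullet> \<eta> t + vel (vel c) t \<bullet> \<psi> t)"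
      by (rule ac_on_bilinear[OF bounded_bilinear_inner acv ac\<psi> \<delta>0])
    then have "ac_on 0 \<delta> (\<lambda>t. vel c t \<bullet> \<psi> t) (\<lambda>t. vel c t \<bullet> \<eta> t)"
      by (rule ac_on_cong[OF _ _ negligible_empty])
         (simp_all add: orthogonal_compD[OF geodesic_acc_normal[OF c I] \<psi>T])
    from ac_on_increment[OF this order_refl \<delta>0 order_refl] show ?thesis by (simp add: \<psi>0 \<psi>\<delta>)
  qed
  have full: "integral {0..\<delta>} (\<lambda>t. (norm (vel c t))\<^sup>2) + integral {\<delta>..1} (\<lambda>t. (norm (vel c t))\<^sup>2) = (norm (vel c 0))\<^sup>2"
  proof -
    have "integral {0..\<delta>} (\<lambda>t. (norm (vel c t))\<^sup>2) + integral {\<delta>..1} (\<lambda>t. (norm (vel c t))\<^sup>2) = integral {0..1} (\<lambda>t. (norm (vel c t))\<^sup>2)"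
      by (rule Henstock_Kurzweil_Integration.integral_combine) (use \<delta> vi in auto)
    also have "\<dots> = integral {0..1} (\<lambda>t::real. (norm (vel c 0))\<^sup>2)"
      by (rule Henstock_Kurzweil_Integration.integral_cong) (rule arg_cong[OF geodesic_constant_speed[OF M c]])
    finally show ?thesis by simp
  qed
  show ?thesis
  proof (rule exI[of _ e0], intro exI[of _ C] conjI allI impI e0)
    fix e assume e: "\<bar>e\<bar> \<le> e0"
    from mp[OF spec[OF var] e] obtain h where inU': "\<forall>t\<in>{0..\<delta>}. c t + e *\<^sub>R \<psi> t \<in> U"
      and h: "ac_on 0 \<delta> (\<lambda>t. r (c t + e *\<^sub>R \<psi> t)) h" "(\<lambda>t. (norm (h t))\<^sup>2) integrable_on {0..\<delta>}"
       "integral {0..\<delta>} (\<lambda>t. (norm (h t))\<^sup>2) \<le> integral {0..\<delta>} (\<lambda>t. (norm (vel c t))\<^sup>2)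
         + 2 * e * integral {0..\<delta>} (\<lambda>t. vel c t \<bullet> \<eta> t) + C * e\<^sup>2" by (elim exE conjE)
    have inU: "c t + e *\<^sub>R \<psi> t \<in> U" if "t \<in> {0..\<delta>}" for t using inU' that by blast
    \<comment> \<open>The bent piece followed by the unchanged rest of the geodesic. They match at
      \<open>\<delta>\<close> because \<open>\<psi> \<delta> = 0\<close>, and
      \<open>\<delta>\<close> is the only break point.\<close>
    define \<gamma> where "\<gamma> t = (if t \<le> \<delta> then r (c t + e *\<^sub>R \<psi> t) else c t)" for t
    define H where "H t = (if t \<le> \<delta> then h t else vel c t)" for t
    have \<gamma>c: "\<gamma> t = c t" if "t \<ge> \<delta>" for t
      using that rc[of \<delta>] \<delta>0 by (cases "t = \<delta>") (simp_all add: \<gamma>_def \<psi>\<delta>)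
    have ac1: "ac_on 0 \<delta> \<gamma> H"
      by (rule ac_on_cong[OF h(1) _ negligible_empty]) (simp_all add: \<gamma>_def H_def)
    have ac2: "ac_on \<delta> 1 \<gamma> H"
    proof (rule ac_on_cong[OF ac_on_subinterval[OF acc1 \<delta>0 less_imp_le[OF \<delta>(2)] order_refl] _ negligible_sing[of \<delta>]])
      show "\<gamma> t = c t" if "t \<in> {\<delta>..1}" for t using that by (intro \<gamma>c) simp
      show "H t = vel c t" if "t \<in> {\<delta>..1} - {\<delta>}" for t using that by (simp add: H_def)
    qed
    have ac: "ac_on 0 1 \<gamma> H" by (rule ac_on_combine[OF ac1 ac2 \<delta>0 less_imp_le[OF \<delta>(2)]])
    have s1: "smooth_on {0..\<delta>} \<gamma>"
    proof (rule smooth_on_cong[rotated])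
      show "smooth_on {0..\<delta>} (\<lambda>t. r (c t + e *\<^sub>R \<psi> t))"
        by (rule smooth_on_compose[where g=r and f="\<lambda>t. c t + e *\<^sub>R \<psi> t",
              OF smooth_on_add[OF cs smooth_on_scaleR[OF smooth_on_const \<psi>s]] smooth_onI[OF open_U r_smooth]])
           (rule image_subsetI[OF inU])
    qed (simp add: \<gamma>_def)
    have s2: "smooth_on {\<delta>..1} \<gamma>"
    proof (rule smooth_on_cong[rotated])
      show "smooth_on {\<delta>..1} c" by (rule smooth_on_subset[OF geodesic_smooth[OF c]]) (use \<delta>0 in auto)
    qed (simp add: \<gamma>c)
    have ps: "piecewise_smooth_path \<gamma>"
      unfolding piecewise_smooth_path_def
    proof (intro conjI exI[of _ "{\<delta>}"] allI impI)
      show "continuous_on {0..1} \<gamma>" by (rule ac_on_continuous[OF ac])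
      fix a b assume ab: "0 \<le> a \<and> a < b \<and> b \<le> 1 \<and> {a<..<b} \<inter> {\<delta>} = {}"
      then consider "b \<le> \<delta>" | "\<delta> \<le> a" by force
      then show "smooth_on {a..b} \<gamma>"
      proof cases
        case 1 show ?thesis by (rule smooth_on_subset[OF s1]) (use 1 ab in auto)
      next
        case 2 show ?thesis by (rule smooth_on_subset[OF s2]) (use 2 ab in auto)
      qed
    qed simp
    have path: "path_in M (r (c 0 + e *\<^sub>R w)) (c 1) \<gamma>"
      unfolding path_in_def
    proof (intro conjI ps image_subsetI)
      fix t :: real assume t: "t \<in> {0..1}"
      show "\<gamma> t \<in> M"
      proof (cases "t \<le> \<delta>")
        case True then show ?thesis using r_in_M[OF inU[of t]] t by (simp add: \<gamma>_def)
      next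
        case False then show ?thesis using geodesic_in_M[OF c t] by (simp add: \<gamma>_def)
      qed
    next
      show "\<gamma> 0 = r (c 0 + e *\<^sub>R w)" using \<delta>0 by (simp add: \<gamma>_def \<psi>0)
      show "\<gamma> 1 = c 1" using \<delta>(2) by (simp add: \<gamma>_def)
    qed
    have Hi1: "((\<lambda>t. (norm (H t))\<^sup>2) has_integral integral {0..\<delta>} (\<lambda>t. (norm (h t))\<^sup>2)) {0..\<delta>}"
      by (rule has_integral_spike[OF negligible_empty _ integrable_integral[OF h(2)]]) (simp add: H_def)
    have Hi2: "((\<lambda>t. (norm (H t))\<^sup>2) has_integral integral {\<delta>..1} (\<lambda>t. (norm (vel c t))\<^sup>2)) {\<delta>..1}"
      by (rule has_integral_spike[OF negligible_sing[of \<delta>] _ integrable_integral[OF vi[OF \<delta>0 order_refl]]]) (simp add: H_def)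
    note Hi = has_integral_combine[OF \<delta>0 less_imp_le[OF \<delta>(2)] Hi1 Hi2]
    \<comment> \<open>The squared distance is at most the squared length, and this at most the
      energy; the energy of the unvaried geodesic is the squared norm of its initial
      velocity.\<close>
    have "(geodesic_dist M (r (c 0 + e *\<^sub>R w)) (c 1))\<^sup>2 \<le> (curve_length \<gamma>)\<^sup>2"
    proof (rule power_mono[OF geodesic_dist_le[OF path]])
      show "0 \<le> geodesic_dist M (r (c 0 + e *\<^sub>R w)) (c 1)"
        by (rule geodesic_dist_greatest) (use path curve_length_nonneg in blast)+
    qed
    also have "\<dots> \<le> integral {0..1} (\<lambda>t. (norm (H t))\<^sup>2)"
      by (rule curve_length_square_le_energy[OF ps ac has_integral_integrable[OF Hi]])
    also have "\<dots> = integral {0..\<delta>} (\<lambda>t. (norm (h t))\<^sup>2) + integral {\<delta>..1} (\<lambda>t. (norm (vel c t))\<^sup>2)"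
      by (rule integral_unique[OF Hi])
    also have "\<dots> \<le> (norm (vel c 0))\<^sup>2 - 2 * e * (vel c 0 \<bullet> w) + C * e\<^sup>2"
      using h(3) full unfolding first by simp
    finally show "(geodesic_dist M (r (c 0 + e *\<^sub>R w)) (c 1))\<^sup>2 \<le> (norm (vel c 0))\<^sup>2 - 2 * e * (vel c 0 \<bullet> w) + C * e\<^sup>2" .
  qed
qed

section \<open>The Euler--Lagrange equation\<close>

lemma linear_coefficient_zero:
  fixes X C e0 :: real
  assumes "e0 > 0" "C \<ge> 0" and le: "\<And>e. \<bar>e\<bar> \<le> e0 \<Longrightarrow> 0 \<le> e * X + C * e\<^sup>2"
  shows "X = 0"
proof (rule ccontr)
  assume X: "X \<noteq> 0"
  \<comment> \<open>For this \<open>e\<close> the quadratic term is less than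
    \<open>\<bar>X\<bar> e\<close>; a step of size \<open>e\<close> against the sign of
    \<open>X\<close> makes the expression negative.\<close>
  define e where "e = min e0 (\<bar>X\<bar> / (2 * (C + 1)))"
  have e: "e > 0" "e \<le> e0" "e \<le> \<bar>X\<bar> / (2 * (C + 1))" using assms X by (auto simp: e_def)
  have "e * (2 * (C + 1)) \<le> \<bar>X\<bar>" using e(3) assms(2) by (simp add: pos_le_divide_eq)
  then have "C * e < \<bar>X\<bar>" using e(1) assms(2) X by (simp add: algebra_simps)
  then have lt: "C * e * e < \<bar>X\<bar> * e" using e(1) by (intro mult_strict_right_mono)
  have "0 \<le> (- sgn X * e) * X + C * (- sgn X * e)\<^sup>2" by (rule le) (use e X in \<open>auto simp: abs_mult sgn_if\<close>)
  also have "\<dots> = - (\<bar>X\<bar> * e) + C * e * e" using X by (auto simp: sgn_if abs_if power2_eq_square)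
  finally show False using lt by simp
qed

lemma test_functions_outside: "\<phi> \<in> test_functions V \<Longrightarrow> x \<notin> V \<Longrightarrow> \<phi> x = 0"
  unfolding test_functions_def by blast

lemma absolutely_integrable_zero_extend:
  fixes f :: "real \<Rightarrow> 'a::euclidean_space"
  assumes "S \<subseteq> S'" "\<And>x. x \<in> S' - S \<Longrightarrow> f x = 0"
  shows "f absolutely_integrable_on S' \<longleftrightarrow> f absolutely_integrable_on S" "integral S' f = integral S f"
proof -
  have "(\<lambda>x. if x \<in> S' then f x else 0) = (\<lambda>x. if x \<in> S then f x else 0)" by (intro ext) (use assms in auto)
  then show "f absolutely_integrable_on S' \<longleftrightarrow> f absolutely_integrable_on S" "integral S' f = integral S f"
    using absolutely_integrable_restrict_UNIV[of S' f] absolutely_integrable_restrict_UNIV[of S f]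
      integral_restrict_UNIV[of S' f] integral_restrict_UNIV[of S f] by simp_all
qed

lemma continuous_on_Icc_bounded:
  fixes f :: "real \<Rightarrow> 'a::real_normed_vector"
  assumes "continuous_on {a..b} f"
  obtains K where "K > 0" "\<And>s. s \<in> {a..b} \<Longrightarrow> norm (f s) \<le> K"
proof -
  have "bounded (f ` {a..b})" by (rule compact_imp_bounded[OF compact_continuous_image[OF assms compact_Icc]])
  then show thesis unfolding bounded_pos using that by auto
qed

text \<open>The equation for a test function supported where one tube suffices. The zeros of
  \<open>\<phi>\<close> at \<open>a\<close> and \<open>b\<close> let the varied piece of
  \<open>F\<close> be joined continuously to the unvaried rest, so the competitor is again an H^1
  map into \<open>M\<close>.\<close>

lemma euler_lagrange_local:
  fixes M :: "'a::euclidean_space set" and F :: "real \<Rightarrow> 'a" and t :: "nat \<Rightarrow> real"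
  defines "g \<equiv> weak_deriv F"
  defines "A \<equiv> \<lambda>s. second_fundamental_form M (F s) (weak_deriv F s) (weak_deriv F s)"
  assumes M: "smooth_submanifold m M" and con: "connected M" and n: "1 \<le> n" and lam: "0 < lam"
    and t01: "\<And>i. i \<in> {1..n} \<Longrightarrow> t i \<in> {0..1}" and YM: "\<And>i. i \<in> {1..n} \<Longrightarrow> Y i \<in> M"
    and min: "is_arg_min (\<lambda>G. empirical_risk M n t Y G + lam * J1 G) (\<lambda>G. G \<in> H1_maps M) F"
    and inj: "\<And>i. i \<in> {1..n} \<Longrightarrow> ereal (geodesic_dist M (F (t i)) (Y i)) < injectivity_radius M"
    and tube: "tube M U r" and ab: "0 \<le> a" "a \<le> b" "b \<le> 1" and FU: "\<And>s. s \<in> {a..b} \<Longrightarrow> F s \<in> U"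
    and \<phi>: "\<phi> \<in> test_functions ({0<..<1} \<inter> {a..b})" and \<phi>ab: "\<phi> a = 0" "\<phi> b = 0"
  shows "(\<lambda>s. \<phi> s *\<^sub>R A s) absolutely_integrable_on {0..1}"
    and "integral {0..1} (\<lambda>s. \<phi> s *\<^sub>R A s) - integral {0..1} (\<lambda>s. deriv \<phi> s *\<^sub>R g s)
      = - (1 / (real n * lam)) *\<^sub>R (\<Sum>i=1..n. \<phi> (t i) *\<^sub>R log_map M (F (t i)) (Y i))"
proof -
  interpret tube M U r by (rule tube)
  have FH: "F \<in> H1_maps M" using min by (simp add: is_arg_min_def)
  have FM: "F s \<in> M" if "s \<in> {0..1}" for s using FH that by (simp add: H1_maps_def)
  have FI: "F \<in> H1_I" using FH by (simp add: H1_maps_def)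
  have acF1: "ac_on 0 1 F g" and gi1: "(\<lambda>s. (norm (g s))\<^sup>2) integrable_on {0..1}"
    unfolding g_def by (rule H1_I_ac_on[OF FI])+
  have sub: "s \<in> {0..1}" if "s \<in> {a..b}" for s using that ab by auto
  have rF: "r (F s) = F s" if "s \<in> {a..b}" for s by (rule r_fixes[OF FM[OF sub[OF that]] FU[OF that]])
  have acF: "ac_on a b F g" by (rule ac_on_subinterval[OF acF1 ab])
  have gi: "(\<lambda>s. (norm (g s))\<^sup>2) integrable_on {x..y}" if "0 \<le> x" "y \<le> 1" for x y
    by (rule integrable_on_subinterval[OF gi1]) (use that in auto)
  note gab = gi[OF ab(1,3)]
  note ga = ac_on_absolutely_integrable[OF acF]
  have cF: "continuous_on {a..b} F" by (rule ac_on_continuous[OF acF])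
  \<comment> \<open>The velocity of an H^1 curve in \<open>M\<close> is tangent almost everywhere,
    by differentiating \<open>r(F) = F\<close>.\<close>
  have tang: "\<exists>N. negligible N \<and> (\<forall>s\<in>{a..b} - N. g s \<in> tangent_space M (F s))"
  proof -
    have cB: "continuous_on U (\<lambda>x. B x v)" for v using r_smooth[of "Suc 0"] by (simp add: B_def)
    have "ac_on a b (\<lambda>s. r (F s)) (\<lambda>s. B (F s) (g s))"
      by (rule ac_on_chain[OF acF ab(2) open_U FU r_has_derivative cB])
    then have ac_r: "ac_on a b F (\<lambda>s. B (F s) (g s))"
      by (rule ac_on_cong[OF _ _ negligible_empty]) (simp_all add: rF)
    obtain N where N: "negligible N" "\<And>s. s \<in> {a..b} - N \<Longrightarrow> g s = B (F s) (g s)" by (rule ac_on_unique[OF acF ac_r]) blast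
    have "g s \<in> tangent_space M (F s)" if s: "s \<in> {a..b} - N" for s
    proof -
      have sab: "s \<in> {a..b}" using s by simp
      show ?thesis unfolding tangent_iff[OF FM[OF sub[OF sab]] FU[OF sab]] by (rule N(2)[OF s, symmetric])
    qed
    with N(1) show ?thesis by blast
  qed
  then obtain N where N: "negligible N" "\<And>s. s \<in> {a..b} - N \<Longrightarrow> g s \<in> tangent_space M (F s)" by blast
  \<comment> \<open>Off \<open>N\<close> this is minus the second fundamental form. On
    \<open>N\<close> the vector \<open>g s\<close> may fail to be tangent, and the value of
    \<open>A s\<close> carries no information.\<close>
  define Q where "Q s = P' (F s) (g s) (g s)" for s
  have AQ: "A s = - Q s" if "s \<in> {a..b} - N" for s
  proof -
    have s: "s \<in> {a..b}" using that by simp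
    show ?thesis unfolding A_def Q_def g_def[symmetric]
      by (rule second_fundamental_form_eq[OF FM[OF sub[OF s]] FU[OF s] N(2)[OF that] N(2)[OF that]])
  qed
  have cP': "continuous_on {a..b} (\<lambda>s. P' (F s) e d)" for e d
    by (rule continuous_on_compose2[OF P'_continuous cF]) (use FU in blast)
  have acP: "ac_on a b (\<lambda>s. P (F s) e) (\<lambda>s. P' (F s) e (g s))" for e
    by (rule ac_on_chain[OF acF ab(2) open_U FU P_has_derivative P'_continuous])
  \<comment> \<open>\<open>Q\<close> is quadratic in \<open>g\<close>, so square integrability of
    \<open>g\<close> yields only integrability of \<open>Q\<close>; in coordinates it is a sum of
    continuous coefficients times products of components of \<open>g\<close>.\<close>
  have Qi: "Q absolutely_integrable_on {a..b}"
  proof -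
    have gg: "(\<lambda>s. (g s \<bullet> b') * (g s \<bullet> d)) absolutely_integrable_on {a..b}" if bd: "b' \<in> Basis" "d \<in> Basis" for b' d
    proof (rule measurable_bounded_by_integrable_imp_absolutely_integrable[OF _ _ gab])
      have [measurable]: "g \<in> borel_measurable (lebesgue_on {a..b})"
        by (rule absolutely_integrable_imp_borel_measurable[OF ga]) simp
      show "(\<lambda>s. (g s \<bullet> b') * (g s \<bullet> d)) \<in> borel_measurable (lebesgue_on {a..b})" by measurable
      show "norm ((g s \<bullet> b') * (g s \<bullet> d)) \<le> (norm (g s))\<^sup>2" for s
        unfolding norm_mult power2_eq_square by (intro mult_mono) (auto simp: Basis_le_norm bd)
    qed simp
    have "(\<lambda>s. \<Sum>b'\<in>Basis. \<Sum>d\<in>Basis. ((g s \<bullet> b') * (g s \<bullet> d)) *\<^sub>R P' (F s) b' d) absolutely_integrable_on {a..b}"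
      by (intro absolutely_integrable_sum finite_Basis absolutely_integrable_mult_continuous[OF bounded_bilinear_scaleR cP' gg])
    then show ?thesis
    proof (rule absolutely_integrable_spike[OF _ negligible_empty])
      fix s assume "s \<in> {a..b} - {}"
      then have s: "F s \<in> U" using FU by simp
      have "Q s = (\<Sum>b'\<in>Basis. (g s \<bullet> b') *\<^sub>R P' (F s) b' (g s))" unfolding Q_def by (rule P'_expand[OF s])
      also have "\<dots> = (\<Sum>b'\<in>Basis. (g s \<bullet> b') *\<^sub>R (\<Sum>d\<in>Basis. (g s \<bullet> d) *\<^sub>R P' (F s) b' d))"
        using linear_basis_expand[OF has_derivative_linear[OF P_has_derivative[OF s]], of _ "g s"] by simp
      finally show "Q s = (\<Sum>b'\<in>Basis. \<Sum>d\<in>Basis. ((g s \<bullet> b') * (g s \<bullet> d)) *\<^sub>R P' (F s) b' d)"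
        by (simp add: scaleR_sum_right)
    qed
  qed
  have c\<phi>: "continuous_on S \<phi>" and c\<phi>': "continuous_on S (deriv \<phi>)" for S
    by (rule test_functions_continuous[OF \<phi>], rule test_functions_continuous[OF test_functions_deriv[OF \<phi>]])
  have out: "\<phi> s = 0" "deriv \<phi> s = 0" if "s \<notin> {a..b}" for s
    using test_functions_outside[OF \<phi>, of s] test_functions_outside[OF test_functions_deriv[OF \<phi>], of s] that by auto
  have sub': "{a..b} \<subseteq> {0..1}" using ab by auto
  have "(\<lambda>s. \<phi> s *\<^sub>R (- Q s)) absolutely_integrable_on {a..b}"
    using absolutely_integrable_continuous_mult[OF bounded_bilinear_scaleR continuous_on_minus[OF c\<phi>] Qi] by simp
  then have \<phi>A: "(\<lambda>s. \<phi> s *\<^sub>R A s) absolutely_integrable_on {a..b}"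
    by (rule absolutely_integrable_spike[OF _ N(1)]) (simp add: AQ)
  note extA = absolutely_integrable_zero_extend[OF sub', of "\<lambda>s. \<phi> s *\<^sub>R A s"]
  show "(\<lambda>s. \<phi> s *\<^sub>R A s) absolutely_integrable_on {0..1}"
    by (subst extA(1)) (use out(1) \<phi>A in auto)
  have iA: "integral {0..1} (\<lambda>s. \<phi> s *\<^sub>R A s) = integral {a..b} (\<lambda>s. \<phi> s *\<^sub>R A s)"
    by (rule extA(2)) (use out(1) in auto)
  have ig: "integral {0..1} (\<lambda>s. deriv \<phi> s *\<^sub>R g s) = integral {a..b} (\<lambda>s. deriv \<phi> s *\<^sub>R g s)"
    by (rule absolutely_integrable_zero_extend(2)[OF sub']) (use out(2) in auto)
  have \<phi>g: "(\<lambda>s. deriv \<phi> s *\<^sub>R g s) absolutely_integrable_on {a..b}"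
    by (rule absolutely_integrable_continuous_mult[OF bounded_bilinear_scaleR c\<phi>' ga])
  define V where "V = integral {0..1} (\<lambda>s. \<phi> s *\<^sub>R A s) - integral {0..1} (\<lambda>s. deriv \<phi> s *\<^sub>R g s)"
  \<comment> \<open>The left side is the coefficient of \<open>\<epsilon>\<close> in the upper bound
    for the objective along the competitors built from \<open>e\<close>; minimality forces it to
    vanish.\<close>
  have key: "(1 / real n) * (\<Sum>i=1..n. - 2 * (\<phi> (t i) * (log_map M (F (t i)) (Y i) \<bullet> e))) + 2 * lam * (- (V \<bullet> e)) = 0" for e
  proof -
    define \<psi> where "\<psi> s = \<phi> s *\<^sub>R P (F s) e" for s
    define \<eta> where "\<eta> s = \<phi> s *\<^sub>R P' (F s) e (g s) + deriv \<phi> s *\<^sub>R P (F s) e" for s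
    have ac\<psi>: "ac_on a b \<psi> \<eta>"
      unfolding \<psi>_def \<eta>_def by (rule ac_on_bilinear[OF bounded_bilinear_scaleR ac_on_test_function[OF \<phi> ab(2)] acP ab(2)])
    have \<psi>T: "\<psi> s \<in> tangent_space M (F s)" if s: "s \<in> {a..b}" for s
      unfolding \<psi>_def using P_tangent[OF FU[OF s], of e] rF[OF s] subspace_tangent[OF FM[OF sub[OF s]] FU[OF s]]
      by (simp add: subspace_scale)
    have tan: "frechet_derivative r (at (F s)) (\<psi> s) = \<psi> s" if s: "s \<in> {a..b}" for s
      using \<psi>T[OF s] unfolding tangent_iff[OF FM[OF sub[OF s]] FU[OF s]] B_def .
    \<comment> \<open>\<open>\<eta>\<close> is dominated by a constant plus a multiple of
      \<open>norm (g s)\<close>, because the derivative of \<open>P\<close> is bounded on the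
      compact image of \<open>[a,b]\<close> under \<open>F\<close>.\<close>
    have \<eta>i: "(\<lambda>s. (norm (\<eta> s))\<^sup>2) integrable_on {a..b}"
    proof -
      obtain K1 where K1: "K1 > 0" "\<And>s. s \<in> {a..b} \<Longrightarrow> norm (\<phi> s) \<le> K1" by (rule continuous_on_Icc_bounded[OF c\<phi>]) blast
      have "continuous_on {a..b} (\<lambda>s. deriv \<phi> s *\<^sub>R P (F s) e)"
        by (intro continuous_on_scaleR c\<phi>' ac_on_continuous[OF acP])
      then obtain K2 where K2: "K2 > 0" "\<And>s. s \<in> {a..b} \<Longrightarrow> norm (deriv \<phi> s *\<^sub>R P (F s) e) \<le> K2"
        by (rule continuous_on_Icc_bounded) blast
      have "compact (F ` {a..b})" "F ` {a..b} \<subseteq> U" using cF FU by (auto intro: compact_continuous_image)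
      then obtain C where C: "C \<ge> 0" "\<And>x v. x \<in> F ` {a..b} \<Longrightarrow> norm (frechet_derivative (\<lambda>x. P x e) (at x) v) \<le> C * norm v"
        by (rule Ck_on_derivative_bounded[OF P_smooth[of "Suc 0" e]]) blast
      have le: "norm (\<eta> s) \<le> K1 * C * norm (g s) + K2" if s: "s \<in> {a..b}" for s
      proof -
        have "norm (\<phi> s *\<^sub>R P' (F s) e (g s)) \<le> K1 * (C * norm (g s))"
          unfolding norm_scaleR P'_def using K1(2)[OF s] C(2)[OF imageI[OF s]] K1(1) by (intro mult_mono) auto
        then show ?thesis unfolding \<eta>_def using K2(2)[OF s] norm_triangle_ineq[of "\<phi> s *\<^sub>R P' (F s) e (g s)" "deriv \<phi> s *\<^sub>R P (F s) e"]
          by simp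
      qed
      show ?thesis
      proof (rule measurable_bounded_by_integrable_imp_integrable[where g="\<lambda>s. 2 * (K1 * C)\<^sup>2 * (norm (g s))\<^sup>2 + 2 * K2\<^sup>2"])
        have [measurable]: "\<eta> \<in> borel_measurable (lebesgue_on {a..b})"
          by (rule absolutely_integrable_imp_borel_measurable[OF ac_on_absolutely_integrable[OF ac\<psi>]]) simp
        show "(\<lambda>s. (norm (\<eta> s))\<^sup>2) \<in> borel_measurable (lebesgue_on {a..b})" by measurable
        show "(\<lambda>s. 2 * (K1 * C)\<^sup>2 * (norm (g s))\<^sup>2 + 2 * K2\<^sup>2) integrable_on {a..b}"
          by (intro Henstock_Kurzweil_Integration.integrable_add integrable_on_mult_right gab) (simp add: integrable_const_ivl)
        fix s assume s: "s \<in> {a..b}"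
        have "(norm (\<eta> s))\<^sup>2 \<le> (K1 * C * norm (g s) + K2)\<^sup>2" by (rule power_mono[OF le[OF s]]) simp
        also have "\<dots> \<le> 2 * (K1 * C * norm (g s))\<^sup>2 + 2 * K2\<^sup>2"
          using zero_le_power2[of "K1 * C * norm (g s) - K2"] by (simp add: power2_sum power2_diff)
        finally show "norm ((norm (\<eta> s))\<^sup>2) \<le> 2 * (K1 * C)\<^sup>2 * (norm (g s))\<^sup>2 + 2 * K2\<^sup>2" by (simp add: power_mult_distrib)
      qed simp
    qed
    have "\<exists>e0>0. \<exists>C\<ge>0. \<forall>\<epsilon>. \<bar>\<epsilon>\<bar> \<le> e0 \<longrightarrow> (\<forall>s\<in>{a..b}. F s + \<epsilon> *\<^sub>R \<psi> s \<in> U) \<and>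
      (\<exists>h. ac_on a b (\<lambda>s. r (F s + \<epsilon> *\<^sub>R \<psi> s)) h \<and> (\<lambda>s. (norm (h s))\<^sup>2) integrable_on {a..b} \<and>
       integral {a..b} (\<lambda>s. (norm (h s))\<^sup>2) \<le> integral {a..b} (\<lambda>s. (norm (g s))\<^sup>2)
         + 2 * \<epsilon> * integral {a..b} (\<lambda>s. g s \<bullet> \<eta> s) + C * \<epsilon>\<^sup>2)"
      by (rule energy_variation[OF open_U r_smooth ab(2) acF gab ac\<psi> \<eta>i]) (rule FU rF tan; assumption)+
    then obtain e0 C where e0: "e0 > 0" "C \<ge> 0" and var: "\<forall>\<epsilon>. \<bar>\<epsilon>\<bar> \<le> e0 \<longrightarrow> (\<forall>s\<in>{a..b}. F s + \<epsilon> *\<^sub>R \<psi> s \<in> U) \<and>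
      (\<exists>h. ac_on a b (\<lambda>s. r (F s + \<epsilon> *\<^sub>R \<psi> s)) h \<and> (\<lambda>s. (norm (h s))\<^sup>2) integrable_on {a..b} \<and>
       integral {a..b} (\<lambda>s. (norm (h s))\<^sup>2) \<le> integral {a..b} (\<lambda>s. (norm (g s))\<^sup>2)
         + 2 * \<epsilon> * integral {a..b} (\<lambda>s. g s \<bullet> \<eta> s) + C * \<epsilon>\<^sup>2)"
      by (elim exE conjE)
    define I where "I = integral {a..b} (\<lambda>s. g s \<bullet> \<eta> s)"
    define x where "x i = \<phi> (t i) * (log_map M (F (t i)) (Y i) \<bullet> e)" for i
    define G where "G \<epsilon> s = (if s \<in> {a..b} then r (F s + \<epsilon> *\<^sub>R \<psi> s) else F s)" for \<epsilon> s
    define \<rho> where "\<rho> i f = (geodesic_dist M (Y i) f)\<^sup>2" for i f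
    \<comment> \<open>\<open>fst q\<close> is the range of admissible \<open>\<epsilon>\<close> and
      \<open>snd q\<close> the quadratic constant of the i-th observation, paired so that both can
      be chosen as functions of \<open>i\<close> at once. If \<open>t i\<close> lies outside
      \<open>[a,b]\<close>, the competitor equals \<open>F\<close> there and \<open>x i = 0\<close>,
      so \<open>(1, 0)\<close> serves.\<close>
    have "\<forall>i\<in>{1..n}. \<exists>q. fst q > 0 \<and> snd q \<ge> 0 \<and> (\<forall>\<epsilon>. \<bar>\<epsilon>\<bar> \<le> fst q \<longrightarrow> \<rho> i (G \<epsilon> (t i)) \<le> \<rho> i (F (t i)) - 2 * \<epsilon> * x i + snd q * \<epsilon>\<^sup>2)"
    proof
      fix i assume i: "i \<in> {1..n}"
      show "\<exists>q. fst q > 0 \<and> snd q \<ge> 0 \<and> (\<forall>\<epsilon>. \<bar>\<epsilon>\<bar> \<le> fst q \<longrightarrow> \<rho> i (G \<epsilon> (t i)) \<le> \<rho> i (F (t i)) - 2 * \<epsilon> * x i + snd q * \<epsilon>\<^sup>2)"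
      proof (cases "t i \<in> {a..b}")
        case True
        obtain c where c: "unit_time_geodesic M c" "c 0 = F (t i)" "c 1 = Y i" "log_map M (F (t i)) (Y i) = vel c 0"
          "geodesic_dist M (F (t i)) (Y i) = norm (vel c 0)"
          by (rule log_map_geodesic[OF M con FM[OF t01[OF i]] YM[OF i] inj[OF i]]) blast
        have cU: "c 0 \<in> U" using FU[OF True] c(2) by simp
        have w: "\<psi> (t i) \<in> tangent_space M (c 0)" using \<psi>T[OF True] c(2) by simp
        from dist_square_upper[OF M c(1) cU w]
        obtain e1 C1 where e1: "e1 > 0" "C1 \<ge> 0" "\<forall>\<epsilon>. \<bar>\<epsilon>\<bar> \<le> e1 \<longrightarrow>
            (geodesic_dist M (r (c 0 + \<epsilon> *\<^sub>R \<psi> (t i))) (c 1))\<^sup>2 \<le> (norm (vel c 0))\<^sup>2 - 2 * \<epsilon> * (vel c 0 \<bullet> \<psi> (t i)) + C1 * \<epsilon>\<^sup>2"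
          by (elim exE conjE)
        \<comment> \<open>The logarithm is tangent, so replacing \<open>e\<close> by its projection
          does not change the product with it.\<close>
        have "vel c 0 \<in> tangent_space M (c 0)" by (rule geodesic_vel_tangent[OF c(1) _ cU]) simp
        then have "P (F (t i)) (vel c 0) = vel c 0" using P_id[OF FU[OF True], of "vel c 0"] rF[OF True] c(2) by simp
        then have "vel c 0 \<bullet> \<psi> (t i) = x i"
          using P_symmetric[OF FU[OF True], of "vel c 0" e] by (simp add: x_def \<psi>_def c(4))
        then have "\<rho> i (G \<epsilon> (t i)) \<le> \<rho> i (F (t i)) - 2 * \<epsilon> * x i + C1 * \<epsilon>\<^sup>2" if "\<bar>\<epsilon>\<bar> \<le> e1" for \<epsilon>
          using e1(3) that True c(2,3,5) geodesic_dist_commute[of M "Y i"] by (simp add: \<rho>_def G_def)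
        then show ?thesis using e1(1,2) by (intro exI[of _ "(e1, C1)"]) simp
      next
        case False
        then show ?thesis by (intro exI[of _ "(1, 0)"]) (simp add: x_def G_def out(1) del: atLeastAtMost_iff)
      qed
    qed
    then obtain q where q: "\<forall>i\<in>{1..n}. fst (q i) > 0 \<and> snd (q i) \<ge> 0 \<and>
        (\<forall>\<epsilon>. \<bar>\<epsilon>\<bar> \<le> fst (q i) \<longrightarrow> \<rho> i (G \<epsilon> (t i)) \<le> \<rho> i (F (t i)) - 2 * \<epsilon> * x i + snd (q i) * \<epsilon>\<^sup>2)"
      by (rule bchoice[THEN exE])
    \<comment> \<open>A range of \<open>\<epsilon>\<close> valid for the energy and for all finitely
      many observations at once.\<close>
    define E where "E = Min (insert e0 ((\<lambda>i. fst (q i)) ` {1..n}))"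
    have E: "E > 0" "E \<le> e0" "\<And>i. i \<in> {1..n} \<Longrightarrow> E \<le> fst (q i)"
    proof -
      show "E > 0" unfolding E_def by (subst Min_gr_iff) (use e0 q in \<open>auto simp del: atLeastAtMost_iff\<close>)
      show "E \<le> e0" unfolding E_def by (rule Min_le) auto
      show "E \<le> fst (q i)" if "i \<in> {1..n}" for i unfolding E_def by (rule Min_le) (use that in auto)
    qed
    define X where "X = (1 / real n) * (\<Sum>i=1..n. - 2 * x i) + 2 * lam * I"
    define C' where "C' = (1 / real n) * (\<Sum>i=1..n. snd (q i)) + lam * C"
    have C': "C' \<ge> 0" unfolding C'_def using q e0 lam by (intro add_nonneg_nonneg mult_nonneg_nonneg sum_nonneg) auto
    have "X = 0"
    proof (rule linear_coefficient_zero[OF E(1) C'])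
      fix \<epsilon> assume \<epsilon>: "\<bar>\<epsilon>\<bar> \<le> E"
      have \<epsilon>0: "\<bar>\<epsilon>\<bar> \<le> e0" using \<epsilon> E(2) by simp
      from mp[OF spec[OF var] \<epsilon>0] obtain h where inU: "\<forall>s\<in>{a..b}. F s + \<epsilon> *\<^sub>R \<psi> s \<in> U"
        and h: "ac_on a b (\<lambda>s. r (F s + \<epsilon> *\<^sub>R \<psi> s)) h" "(\<lambda>s. (norm (h s))\<^sup>2) integrable_on {a..b}"
          "integral {a..b} (\<lambda>s. (norm (h s))\<^sup>2) \<le> integral {a..b} (\<lambda>s. (norm (g s))\<^sup>2)
            + 2 * \<epsilon> * integral {a..b} (\<lambda>s. g s \<bullet> \<eta> s) + C * \<epsilon>\<^sup>2"
        by (elim exE conjE)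
      define H where "H s = (if s \<in> {a..b} then h s else g s)" for s
      have Gab: "G \<epsilon> a = F a" "G \<epsilon> b = F b" using rF ab by (simp_all add: G_def \<psi>_def \<phi>ab)
      have ac1: "ac_on 0 a (G \<epsilon>) H"
        by (rule ac_on_cong[OF ac_on_subinterval[OF acF1 order_refl ab(1)] _ negligible_sing[of a]])
           (use ab Gab in \<open>auto simp: H_def G_def\<close>)
      have ac2: "ac_on a b (G \<epsilon>) H"
        by (rule ac_on_cong[OF h(1) _ negligible_empty]) (simp_all add: G_def H_def)
      have ac3: "ac_on b 1 (G \<epsilon>) H"
        by (rule ac_on_cong[OF ac_on_subinterval[OF acF1 _ ab(3) order_refl] _ negligible_sing[of b]])
           (use ab Gab in \<open>auto simp: H_def G_def\<close>)
      have acG: "ac_on 0 1 (G \<epsilon>) H"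
        using ac_on_combine[OF ac_on_combine[OF ac1 ac2 ab(1,2)] ac3] ab by simp
      have gint: "((\<lambda>s. (norm (g s))\<^sup>2) has_integral integral {y..z} (\<lambda>s. (norm (g s))\<^sup>2)) {y..z}" if "0 \<le> y" "z \<le> 1" for y z
        by (rule integrable_integral[OF gi[OF that]])
      have b0: "0 \<le> b" using ab by simp
      have a1: "a \<le> 1" using ab by simp
      have H1: "((\<lambda>s. (norm (H s))\<^sup>2) has_integral integral {0..a} (\<lambda>s. (norm (g s))\<^sup>2)) {0..a}"
        by (rule has_integral_spike[OF negligible_sing[of a] _ gint[OF order_refl a1]]) (use ab in \<open>auto simp: H_def\<close>)
      have H2: "((\<lambda>s. (norm (H s))\<^sup>2) has_integral integral {a..b} (\<lambda>s. (norm (h s))\<^sup>2)) {a..b}"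
        by (rule has_integral_spike[OF negligible_empty _ integrable_integral[OF h(2)]]) (simp add: H_def)
      have H3: "((\<lambda>s. (norm (H s))\<^sup>2) has_integral integral {b..1} (\<lambda>s. (norm (g s))\<^sup>2)) {b..1}"
        by (rule has_integral_spike[OF negligible_sing[of b] _ gint[OF b0 order_refl]]) (use ab in \<open>auto simp: H_def\<close>)
      note Hint = has_integral_combine[OF b0 ab(3) has_integral_combine[OF ab(1,2) H1 H2] H3]
      note gint' = has_integral_combine[OF b0 ab(3) has_integral_combine[OF ab(1,2) gint[OF order_refl a1] gint[OF ab(1,3)]] gint[OF b0 order_refl]]
      have JG: "J1 (G \<epsilon>) \<le> J1 F + 2 * \<epsilon> * I + C * \<epsilon>\<^sup>2"
        unfolding J1_eq[OF acG has_integral_integrable[OF Hint]] J1_eq[OF acF1 gi1] integral_unique[OF Hint] integral_unique[OF gint']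
        using h(3) by (simp add: I_def)
      have GM: "G \<epsilon> \<in> H1_maps M"
        unfolding H1_maps_def
      proof (intro CollectI conjI ballI)
        show "G \<epsilon> \<in> H1_I" by (rule ac_on_imp_H1_I[OF acG has_integral_integrable[OF Hint]])
        fix s :: real assume s: "s \<in> {0..1}"
        show "G \<epsilon> s \<in> M"
        proof (cases "s \<in> {a..b}")
          case True then show ?thesis using r_in_M inU by (simp add: G_def)
        next
          case False show ?thesis unfolding G_def if_not_P[OF False] by (rule FM[OF s])
        qed
      qed
      have opt: "empirical_risk M n t Y F + lam * J1 F \<le> empirical_risk M n t Y (G \<epsilon>) + lam * J1 (G \<epsilon>)"
        using min GM unfolding is_arg_min_def by (meson not_le)
      have risk: "empirical_risk M n t Y (G \<epsilon>) \<le> (1 / real n) * (\<Sum>i=1..n. \<rho> i (F (t i)) - 2 * \<epsilon> * x i + snd (q i) * \<epsilon>\<^sup>2)"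
        unfolding empirical_risk_def \<rho>_def[symmetric]
      proof (intro mult_left_mono sum_mono)
        fix i assume i: "i \<in> {1..n}"
        then have "\<bar>\<epsilon>\<bar> \<le> fst (q i)" using \<epsilon> E(3)[OF i] by simp
        then show "\<rho> i (G \<epsilon> (t i)) \<le> \<rho> i (F (t i)) - 2 * \<epsilon> * x i + snd (q i) * \<epsilon>\<^sup>2" using q i by blast
      qed simp
      have "(\<Sum>i=1..n. \<rho> i (F (t i)) - 2 * \<epsilon> * x i + snd (q i) * \<epsilon>\<^sup>2) =
         (\<Sum>i=1..n. \<rho> i (F (t i))) + \<epsilon> * (\<Sum>i=1..n. - 2 * x i) + \<epsilon>\<^sup>2 * (\<Sum>i=1..n. snd (q i))"
        by (simp add: sum.distrib sum_subtractf sum_distrib_left sum_negf mult.assoc mult.commute mult.left_commute)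
      then have "(1 / real n) * (\<Sum>i=1..n. \<rho> i (F (t i)) - 2 * \<epsilon> * x i + snd (q i) * \<epsilon>\<^sup>2) = empirical_risk M n t Y F
         + \<epsilon> * ((1 / real n) * (\<Sum>i=1..n. - 2 * x i)) + \<epsilon>\<^sup>2 * ((1 / real n) * (\<Sum>i=1..n. snd (q i)))"
        by (simp only: empirical_risk_def \<rho>_def distrib_left mult.left_commute)
      moreover have "lam * J1 (G \<epsilon>) \<le> lam * (J1 F + 2 * \<epsilon> * I + C * \<epsilon>\<^sup>2)" using JG lam by (intro mult_left_mono) auto
      ultimately have "0 \<le> \<epsilon> * ((1 / real n) * (\<Sum>i=1..n. - 2 * x i)) + \<epsilon>\<^sup>2 * ((1 / real n) * (\<Sum>i=1..n. snd (q i)))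
          + lam * (2 * \<epsilon> * I + C * \<epsilon>\<^sup>2)"
        using opt risk by (simp only: distrib_left)
      also have "\<dots> = \<epsilon> * X + C' * \<epsilon>\<^sup>2" by (simp only: X_def C'_def distrib_left distrib_right mult_ac)
      finally show "0 \<le> \<epsilon> * X + C' * \<epsilon>\<^sup>2" .
    qed
    \<comment> \<open>Tangency of \<open>g\<close> removes the projection in the term with
      \<open>deriv \<phi>\<close>, and symmetry of \<open>P'\<close> turns the other term into
      \<open>- (A s \<bullet> e)\<close>.\<close>
    moreover have "I = - (V \<bullet> e)"
    proof -
      have "I = integral {a..b} (\<lambda>s. (deriv \<phi> s *\<^sub>R g s - \<phi> s *\<^sub>R A s) \<bullet> e)"
        unfolding I_def
      proof (rule integral_spike[OF N(1)])
        fix s assume s: "s \<in> {a..b} - N"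
        then have U: "F s \<in> U" and s': "s \<in> {a..b}" using FU by auto
        have "g s \<bullet> P' (F s) e (g s) = Q s \<bullet> e" unfolding Q_def by (rule P'_symmetric[OF U, symmetric])
        then have 1: "g s \<bullet> P' (F s) e (g s) = - (A s \<bullet> e)" using AQ[OF s] by simp
        have "P (F s) (g s) = g s" by (rule P_id[OF U]) (simp add: rF[OF s'] N(2)[OF s])
        then have 2: "g s \<bullet> P (F s) e = g s \<bullet> e" using P_symmetric[OF U, of "g s" e] by simp
        show "(deriv \<phi> s *\<^sub>R g s - \<phi> s *\<^sub>R A s) \<bullet> e = g s \<bullet> \<eta> s"
          by (simp add: \<eta>_def inner_add_right inner_diff_left 1 2)
      qed
      also have "\<dots> = (integral {a..b} (\<lambda>s. deriv \<phi> s *\<^sub>R g s) - integral {a..b} (\<lambda>s. \<phi> s *\<^sub>R A s)) \<bullet> e"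
      proof -
        have i1: "(\<lambda>s. deriv \<phi> s *\<^sub>R g s) integrable_on {a..b}" and i2: "(\<lambda>s. \<phi> s *\<^sub>R A s) integrable_on {a..b}"
          using \<phi>g \<phi>A by (simp_all add: set_lebesgue_integral_eq_integral(1))
        have "integral {a..b} ((\<lambda>v. v \<bullet> e) \<circ> (\<lambda>s. deriv \<phi> s *\<^sub>R g s - \<phi> s *\<^sub>R A s)) = integral {a..b} (\<lambda>s. deriv \<phi> s *\<^sub>R g s - \<phi> s *\<^sub>R A s) \<bullet> e"
          by (rule integral_linear[OF Henstock_Kurzweil_Integration.integrable_diff[OF i1 i2] bounded_linear_inner_left])
        then show ?thesis using Henstock_Kurzweil_Integration.integral_diff[OF i1 i2] by (simp add: o_def)
      qed
      finally show ?thesis by (simp add: V_def iA ig inner_diff_left)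
    qed
    ultimately show ?thesis by (simp add: X_def x_def)
  qed
  show "V = - (1 / (real n * lam)) *\<^sub>R (\<Sum>i=1..n. \<phi> (t i) *\<^sub>R log_map M (F (t i)) (Y i))"
  proof (rule vector_eq_rdot[THEN iffD1], rule allI)
    fix e
    define S where "S = (\<Sum>i=1..n. \<phi> (t i) *\<^sub>R log_map M (F (t i)) (Y i)) \<bullet> e"
    have "(\<Sum>i=1..n. - 2 * (\<phi> (t i) * (log_map M (F (t i)) (Y i) \<bullet> e))) = - 2 * S"
      by (simp add: S_def inner_sum_left sum_distrib_left)
    with key[of e] have "(1 / real n) * (- 2 * S) + 2 * lam * (- (V \<bullet> e)) = 0" by simp
    then have "V \<bullet> e = - (1 / (real n * lam)) * S" using n lam by (simp add: field_simps)
    then show "V \<bullet> e = (- (1 / (real n * lam)) *\<^sub>R (\<Sum>i=1..n. \<phi> (t i) *\<^sub>R log_map M (F (t i)) (Y i))) \<bullet> e"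
      by (simp add: S_def)
  qed
qed

text \<open>Telescoping differences of a smooth step function form a partition of unity on \<open>[0,1]\<close>.\<close>

definition hat :: "nat \<Rightarrow> nat \<Rightarrow> real \<Rightarrow> real" where
  "hat N j x = step (real N * x + (1 - real j)) - step (real N * x + (- real j))"

lemma smooth_on_hat: "smooth_on S (hat N j)"
  unfolding hat_def by (intro smooth_on_diff smooth_on_step_affine)

text \<open>The remaining interval has width \<open>2 / N\<close>, the length up to which
  \<open>tube_subdivision\<close> provides a single tube.\<close>

lemma hat_eq_0: "real N * x \<le> real j - 1 \<or> real j + 1 \<le> real N * x \<Longrightarrow> hat N j x = 0"
  by (auto simp: hat_def step_eq_0 step_eq_1)

text \<open>The sum telescopes. On \<open>[0,1]\<close> the first step is 1 and the last one 0, the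
  latter because \<open>j\<close> runs up to \<open>N\<close> inclusive.\<close>

lemma sum_hat:
  assumes "x \<in> {0..1}" shows "(\<Sum>j\<le>N. hat N j x) = 1"
proof -
  have "(\<Sum>j\<le>K. hat N j x) = step (real N * x + 1) - step (real N * x - real K)" for K
    by (induction K) (simp_all add: hat_def algebra_simps)
  moreover have "real N * x \<le> real N" using assms by (simp add: mult_left_le)
  ultimately show ?thesis using assms by (simp add: step_eq_0 step_eq_1)
qed

text \<open>A Lebesgue number for the cover of the compact image of \<open>F\<close> by tube
  domains, combined with uniform continuity of \<open>F\<close>.\<close>

lemma tube_subdivision:
  fixes M :: "'a::euclidean_space set" and F :: "real \<Rightarrow> 'a"
  assumes M: "smooth_submanifold m M" and F: "continuous_on {0..1} F" "\<And>s. s \<in> {0..1} \<Longrightarrow> F s \<in> M"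
  obtains N where "N > 0"
    "\<And>a b. 0 \<le> a \<Longrightarrow> a \<le> b \<Longrightarrow> b \<le> 1 \<Longrightarrow> b - a \<le> 2 / real N \<Longrightarrow> \<exists>U r. tube M U r \<and> F ` {a..b} \<subseteq> U"
proof -
  define \<U> where "\<U> = {U. \<exists>r. tube M U r}"
  have cF: "compact (F ` {0..1})" by (rule compact_continuous_image[OF F(1) compact_Icc])
  have "F ` {0..1} \<subseteq> \<Union>\<U>"
  proof
    fix p assume "p \<in> F ` {0..1}"
    then have p: "p \<in> M" using F(2) by blast
    obtain U r where "p \<in> U" "tube M U r" by (rule smooth_submanifold_tube[OF M p]) blast
    then show "p \<in> \<Union>\<U>" unfolding \<U>_def by blast
  qed
  moreover have "open U" if "U \<in> \<U>" for U
    using that tube.open_U unfolding \<U>_def by blast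
  ultimately obtain \<delta> where \<delta>: "\<delta> > 0" "\<forall>p\<in>F ` {0..1}. \<exists>U\<in>\<U>. ball p \<delta> \<subseteq> U"
    using Heine_Borel_lemma[OF cF, of \<U>] by metis
  have "uniformly_continuous_on {0..1} F" by (rule compact_uniformly_continuous[OF F(1) compact_Icc])
  then obtain \<eta> where \<eta>: "\<eta> > 0" "\<forall>x\<in>{0..1}. \<forall>x'\<in>{0..1}. dist x' x < \<eta> \<longrightarrow> dist (F x') (F x) < \<delta>"
    unfolding uniformly_continuous_on_def using \<delta>(1) by blast
  obtain N :: nat where N: "2 / \<eta> < real N" using reals_Archimedean2 by blast
  have "0 < 2 / \<eta>" using \<eta> by simp
  then have N0: "0 < real N" using N by linarith
  have N2: "2 / real N < \<eta>" using N N0 \<eta>(1) by (simp add: field_simps)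
  show thesis
  proof (rule that[of N])
    show "N > 0" using N0 by simp
    fix a b assume ab: "0 \<le> a" "a \<le> b" "b \<le> (1::real)" "b - a \<le> 2 / real N"
    have a01: "a \<in> {0..1}" using ab by simp
    obtain U where U: "U \<in> \<U>" "ball (F a) \<delta> \<subseteq> U" using \<delta>(2) a01 by blast
    have "F s \<in> ball (F a) \<delta>" if s: "s \<in> {a..b}" for s
    proof -
      have "s \<in> {0..1}" "dist s a < \<eta>" using s ab N2 by (auto simp: dist_real_def)
      then have "dist (F s) (F a) < \<delta>" using \<eta>(2) a01 by blast
      then show ?thesis by (simp add: dist_commute)
    qed
    then show "\<exists>U r. tube M U r \<and> F ` {a..b} \<subseteq> U" using U unfolding \<U>_def by blast
  qed
qed

text \<open>One derivative is carried out as the weak derivative of \<open>F\<close>, the other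
  stays on the test function; hence the sign.\<close>

lemma second_distr_deriv:
  assumes F: "F \<in> H1_I" and \<phi>: "\<phi> \<in> test_functions {0<..<1}"
  shows "distr_deriv (distr_deriv (regular_distr F)) \<phi> = - integral {0..1} (\<lambda>s. deriv \<phi> s *\<^sub>R weak_deriv F s)"
proof -
  have "distr_deriv (regular_distr F) (deriv \<phi>) = regular_distr (weak_deriv F) (deriv \<phi>)"
    using H1_I_ac_on(3)[OF F] test_functions_deriv[OF \<phi>] unfolding has_weak_deriv_def distr_eq_on_I_def by blast
  also have "\<dots> = integral {0..1} (\<lambda>s. deriv \<phi> s *\<^sub>R weak_deriv F s)"
    by (rule regular_distr_eq_integral[OF ac_on_absolutely_integrable[OF H1_I_ac_on(1)[OF F]]
          test_functions_continuous[OF test_functions_deriv[OF \<phi>]]])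
  finally show ?thesis by (simp add: distr_deriv_def)
qed

theorem theorem5p1:
  fixes M :: "'a::euclidean_space set" and m n :: nat and lam :: real
    and t :: "nat \<Rightarrow> real" and Y :: "nat \<Rightarrow> 'a" and F :: "real \<Rightarrow> 'a"
  assumes "smooth_submanifold m M" and "compact M" and "connected M"
    and "1 \<le> n" and "0 < lam"
    and "\<And>i. i \<in> {1..n} \<Longrightarrow> t i \<in> {0..1}"
    and "\<And>i. i \<in> {1..n} \<Longrightarrow> Y i \<in> M"
    and "is_arg_min (\<lambda>G. empirical_risk M n t Y G + lam * J1 G) (\<lambda>G. G \<in> H1_maps M) F"
    and "\<And>i. i \<in> {1..n} \<Longrightarrow> ereal (geodesic_dist M (F (t i)) (Y i)) < injectivity_radius M"
  shows "distr_eq_on_I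
    (\<lambda>\<phi>. distr_deriv (distr_deriv (regular_distr F)) \<phi>
        + regular_distr (\<lambda>s. second_fundamental_form M (F s) (weak_deriv F s) (weak_deriv F s)) \<phi>)
    (\<lambda>\<phi>. - (1 / (real n * lam)) *\<^sub>R (\<Sum>i=1..n. dirac (t i) \<phi> *\<^sub>R log_map M (F (t i)) (Y i)))"
  unfolding distr_eq_on_I_def
proof
  fix \<phi> assume \<phi>: "\<phi> \<in> test_functions {0<..<1::real}"
  define A where "A s = second_fundamental_form M (F s) (weak_deriv F s) (weak_deriv F s)" for s
  define g where "g = weak_deriv F"
  define L where "L i = log_map M (F (t i)) (Y i)" for i
  have "F \<in> H1_maps M" using assms(8) by (simp add: is_arg_min_def)
  then have FI: "F \<in> H1_I" and FM: "\<And>s. s \<in> {0..1} \<Longrightarrow> F s \<in> M" by (simp_all add: H1_maps_def)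
  have acF: "ac_on 0 1 F g" unfolding g_def by (rule H1_I_ac_on(1)[OF FI])
  obtain N where N: "N > 0" "\<And>a b. 0 \<le> a \<Longrightarrow> a \<le> b \<Longrightarrow> b \<le> 1 \<Longrightarrow> b - a \<le> 2 / real N \<Longrightarrow> \<exists>U r. tube M U r \<and> F ` {a..b} \<subseteq> U"
    by (rule tube_subdivision[OF assms(1) ac_on_continuous[OF acF] FM]) blast+
  define \<phi>j where "\<phi>j j x = \<phi> x * hat N j x" for j x
  have local: "\<phi>j j \<in> test_functions {0<..<1} \<and> (\<lambda>s. \<phi>j j s *\<^sub>R A s) absolutely_integrable_on {0..1} \<and>
      integral {0..1} (\<lambda>s. \<phi>j j s *\<^sub>R A s) - integral {0..1} (\<lambda>s. deriv (\<phi>j j) s *\<^sub>R g s)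
        = - (1 / (real n * lam)) *\<^sub>R (\<Sum>i=1..n. \<phi>j j (t i) *\<^sub>R L i)" if j: "j \<le> N" for j
  proof -
    \<comment> \<open>The support of \<open>hat N j\<close> is clipped to \<open>[0,1]\<close>, as
      the outermost functions \<open>j = 0\<close> and \<open>j = N\<close> reach beyond.\<close>
    define a where "a = max 0 ((real j - 1) / real N)"
    define b where "b = min 1 ((real j + 1) / real N)"
    have N0: "real N > 0" and jN: "real j \<le> real N" using N(1) j by simp_all
    have le: "(real j - 1) / real N \<le> 1" "0 \<le> (real j + 1) / real N" "(real j - 1) / real N \<le> (real j + 1) / real N"
      using N0 jN by (simp_all add: divide_right_mono)
    have ab: "0 \<le> a" "a \<le> b" "b \<le> 1" unfolding a_def b_def using le by auto
    have len: "b - a \<le> 2 / real N"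
    proof -
      have "b - a \<le> (real j + 1) / real N - (real j - 1) / real N" by (simp add: a_def b_def)
      then show ?thesis by (simp add: diff_divide_distrib[symmetric])
    qed
    obtain U r where U: "tube M U r" "F ` {a..b} \<subseteq> U" using N(2)[OF ab len] by blast
    have FU: "F s \<in> U" if "s \<in> {a..b}" for s using U(2) that by blast
    define I where "I = {(real j - 1) / real N..(real j + 1) / real N}"
    have hat0: "hat N j x = 0" if "x \<le> (real j - 1) / real N \<or> (real j + 1) / real N \<le> x" for x
      by (rule hat_eq_0) (use that N0 in \<open>simp add: pos_le_divide_eq pos_divide_le_eq mult.commute\<close>)
    have "\<phi>j j \<in> test_functions ({0<..<1} \<inter> I)"
      unfolding \<phi>j_def by (rule test_functions_mult[OF \<phi> smooth_on_hat]) (auto simp: I_def intro: hat0)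
    moreover have "{0<..<1} \<inter> I \<subseteq> {0<..<1} \<inter> {a..b}" by (auto simp: I_def a_def b_def)
    ultimately have \<phi>j: "\<phi>j j \<in> test_functions ({0<..<1} \<inter> {a..b})" unfolding test_functions_def by blast
    have \<phi>01: "\<phi> 0 = 0" "\<phi> 1 = 0" by (rule test_functions_outside[OF \<phi>]; simp)+
    \<comment> \<open>At a clipped end point \<open>\<phi>\<close> vanishes, at an unclipped one the
      hat function does.\<close>
    have z: "\<phi>j j a = 0" "\<phi>j j b = 0"
      using \<phi>01 hat0[of a] hat0[of b] by (auto simp: \<phi>j_def a_def b_def max_def min_def)
    have "\<phi>j j \<in> test_functions {0<..<1}" using \<phi>j unfolding test_functions_def by blast
    with euler_lagrange_local[OF assms(1,3,4,5) assms(6,7) assms(8,9) U(1) ab FU \<phi>j z]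
    show ?thesis unfolding A_def g_def L_def by blast
  qed
  \<comment> \<open>The identity holds on the whole line although \<open>sum_hat\<close> covers only
    \<open>[0,1]\<close>, since \<open>\<phi>\<close> is zero outside; so it can be differentiated
    term by term.\<close>
  have sum\<phi>: "\<phi> = (\<lambda>s. \<Sum>j\<le>N. \<phi>j j s)"
  proof
    fix s
    show "\<phi> s = (\<Sum>j\<le>N. \<phi>j j s)"
    proof (cases "s \<in> {0..1}")
      case True then show ?thesis by (simp add: \<phi>j_def sum_distrib_left[symmetric] sum_hat del: atLeastAtMost_iff)
    next
      case False
      then have "\<phi> s = 0" by (intro test_functions_outside[OF \<phi>]) auto
      then show ?thesis by (simp add: \<phi>j_def)
    qed
  qed
  have d\<phi>: "deriv \<phi> s = (\<Sum>j\<le>N. deriv (\<phi>j j) s)" for s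
  proof (rule DERIV_imp_deriv)
    have "((\<lambda>s. \<Sum>j\<le>N. \<phi>j j s) has_real_derivative (\<Sum>j\<le>N. deriv (\<phi>j j) s)) (at s)"
      by (intro DERIV_sum test_functions_has_derivative[of _ "{0<..<1}"]) (use local in simp)
    then show "(\<phi> has_real_derivative (\<Sum>j\<le>N. deriv (\<phi>j j) s)) (at s)" unfolding sum\<phi>[symmetric] .
  qed
  have Ai: "(\<lambda>s. \<phi> s *\<^sub>R A s) absolutely_integrable_on {0..1}"
    by (subst sum\<phi>, unfold scaleR_sum_left, intro absolutely_integrable_sum) (use local in simp_all)
  have iA: "integral {0..1} (\<lambda>s. \<phi> s *\<^sub>R A s) = (\<Sum>j\<le>N. integral {0..1} (\<lambda>s. \<phi>j j s *\<^sub>R A s))"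
    by (subst sum\<phi>, unfold scaleR_sum_left, intro integral_sum) (use local set_lebesgue_integral_eq_integral(1) in auto)
  have gi: "(\<lambda>s. deriv (\<phi>j j) s *\<^sub>R g s) integrable_on {0..1}" if j: "j \<le> N" for j
  proof -
    have "\<phi>j j \<in> test_functions {0<..<1}" using local[OF j] by blast
    from absolutely_integrable_continuous_mult[OF bounded_bilinear_scaleR
        test_functions_continuous[OF test_functions_deriv[OF this]] ac_on_absolutely_integrable[OF acF]]
    show ?thesis by (rule set_lebesgue_integral_eq_integral(1))
  qed
  have ig: "integral {0..1} (\<lambda>s. deriv \<phi> s *\<^sub>R g s) = (\<Sum>j\<le>N. integral {0..1} (\<lambda>s. deriv (\<phi>j j) s *\<^sub>R g s))"
    unfolding d\<phi> scaleR_sum_left by (rule integral_sum) (simp_all add: gi)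
  \<comment> \<open>Every term is linear in the test function, so the localized equations add
    up.\<close>
  have "distr_deriv (distr_deriv (regular_distr F)) \<phi> + regular_distr A \<phi>
      = integral {0..1} (\<lambda>s. \<phi> s *\<^sub>R A s) - integral {0..1} (\<lambda>s. deriv \<phi> s *\<^sub>R g s)"
    unfolding second_distr_deriv[OF FI \<phi>] regular_distr_def lebesgue_integral_Icc[OF Ai] g_def by simp
  also have "\<dots> = (\<Sum>j\<le>N. - (1 / (real n * lam)) *\<^sub>R (\<Sum>i=1..n. \<phi>j j (t i) *\<^sub>R L i))"
    unfolding iA ig sum_subtractf[symmetric] by (rule sum.cong) (use local in simp_all)
  also have "\<dots> = - (1 / (real n * lam)) *\<^sub>R (\<Sum>i=1..n. \<Sum>j\<le>N. \<phi>j j (t i) *\<^sub>R L i)"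
    unfolding scaleR_sum_right[symmetric] by (subst sum.swap) (rule refl)
  also have "(\<Sum>i=1..n. \<Sum>j\<le>N. \<phi>j j (t i) *\<^sub>R L i) = (\<Sum>i=1..n. dirac (t i) \<phi> *\<^sub>R L i)"
    unfolding scaleR_sum_left[symmetric] dirac_def by (simp only: fun_cong[OF sum\<phi>, symmetric])
  finally show "distr_deriv (distr_deriv (regular_distr F)) \<phi>
        + regular_distr (\<lambda>s. second_fundamental_form M (F s) (weak_deriv F s) (weak_deriv F s)) \<phi>
      = - (1 / (real n * lam)) *\<^sub>R (\<Sum>i=1..n. dirac (t i) \<phi> *\<^sub>R log_map M (F (t i)) (Y i))"
    unfolding A_def L_def .
qed

end
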